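(* Let $n\geq3$. Then the class $\mathcal S_n$ is of resolvent type. Namely, there is a constant $C$ such that for every $V\in\mathcal S_n$, every $z\in\mathbb C\setminus\mathbb R$ and every $f\in L^2(|V|^{-1})$, $$\|(-\Delta-z)^{-1}f\|_{L^2(|V|)}\leq C\,[V]_{\mathcal S_n}\,\|f\|_{L^2(|V|^{-1})},$$ where $C$ is independent of $z\in\mathbb C\setminus\mathbb R$ (and of $V$ and $f$).
   Context: For a nonnegative function $w$ on $\mathbb R^n$, $\|f\|_{L^2(w)}^2=\int_{\mathbb R^n}|f|^2w\,dx$. Conventions $1/0=\infty$, $0\cdot\infty=0$, so functions in $L^2(|V|^{-1})$ vanish a.e. where $V=0$. For $f$ not in $L^2$, $(-\Delta-z)^{-1}f$ is understood by extension by continuity from the dense subspace $L^2\cap L^2(|V|^{-1})$ of $L^2(|V|^{-1})$. Kerman–Sawyer class: for $0<\alpha<n$, a (locally integrable) function $W$ on $\mathbb R^n$ is in $\mathcal{KS}_\alpha$ if $$\|W\|_{\mathcal{KS}_\alpha}:=\sup_Q\Big(\int_Q|W(x)|dx\Big)^{-1}\int_Q\int_Q\frac{|W(x)W(y)|}{|x-y|^{n-\alpha}}dxdy<\infty,$$ the sup being over all dyadic cubes $Q$ in $\mathbb R^n$ (cubes with $\int_Q|W|=0$ are disregarded). For $n\ge3$, a function $V:\mathbb R^n\to\mathbb C$ is in the class $\mathcal S_n$ if $|V|^{\frac{n-1}2}\in\mathcal{KS}_{n-1}$, and $[V]_{\mathcal S_n}:=\big\||V|^{\frac{n-1}2}\big\|_{\mathcal{KS}_{n-1}}^{\frac2{n-1}}$.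 *)

theory Defs
  imports "HOL-Analysis.Analysis"
begin

section \<open>Weighted \<open>L\<^sup>2\<close> spaces\<close>

text \<open>
  Weights are \<open>ennreal\<close>-valued so that \<open>1 / \<bar>V\<bar>\<close> takes the value \<open>\<infinity>\<close> where \<open>V = 0\<close>. In
  \<open>ennreal\<close> we have \<open>inverse 0 = \<infinity>\<close> and \<open>0 * \<infinity> = 0\<close>, so members of
  \<open>L2 (inv_abs_weight V)\<close> vanish almost everywhere on the zero set of \<open>V\<close>. Elements of \<open>L2 w\<close>
  are functions, not classes modulo null sets.
\<close>

definition L2_sq :: "(real^'n \<Rightarrow> ennreal) \<Rightarrow> (real^'n \<Rightarrow> complex) \<Rightarrow> ennreal" where
  "L2_sq w f = (\<integral>\<^sup>+ x. ennreal ((cmod (f x))\<^sup>2) * w x \<partial>lebesgue)"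

definition L2 :: "(real^'n \<Rightarrow> ennreal) \<Rightarrow> (real^'n \<Rightarrow> complex) set" where
  "L2 w = {f. f \<in> borel_measurable lebesgue \<and> L2_sq w f < \<infinity>}"

text \<open>As \<open>enn2real \<infinity> = 0\<close>, this is the norm only for functions in \<open>L2 w\<close>.\<close>

definition L2_norm :: "(real^'n \<Rightarrow> ennreal) \<Rightarrow> (real^'n \<Rightarrow> complex) \<Rightarrow> real" where
  "L2_norm w f = sqrt (enn2real (L2_sq w f))"

definition abs_weight :: "(real^'n \<Rightarrow> complex) \<Rightarrow> real^'n \<Rightarrow> ennreal" where
  "abs_weight V x = ennreal (cmod (V x))"

definition inv_abs_weight :: "(real^'n \<Rightarrow> complex) \<Rightarrow> real^'n \<Rightarrow> ennreal" where
  "inv_abs_weight V x = inverse (ennreal (cmod (V x)))"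

section \<open>The class of potentials\<close>

definition dyadic_cube :: "int \<Rightarrow> int^'n \<Rightarrow> (real^'n) set" where
  "dyadic_cube k m =
     {x. \<forall>i. of_int (m $ i) * 2 powi k \<le> x $ i \<and> x $ i < (of_int (m $ i) + 1) * 2 powi k}"

definition dyadic_cubes :: "(real^'n) set set" where
  "dyadic_cubes = {dyadic_cube k m | k m. True}"

text \<open>The quotients are formed in \<open>ennreal\<close>, so the kernel is \<open>\<infinity>\<close> on the diagonal.\<close>

definition KS_norm :: "real \<Rightarrow> (real^'n \<Rightarrow> real) \<Rightarrow> ennreal" where
  "KS_norm \<alpha> W =
     (SUP Q \<in> {Q \<in> dyadic_cubes. (\<integral>\<^sup>+ x\<in>Q. ennreal \<bar>W x\<bar> \<partial>lebesgue) \<noteq> 0}.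
        (\<integral>\<^sup>+ x\<in>Q. (\<integral>\<^sup>+ y\<in>Q. ennreal \<bar>W x * W y\<bar> /
             ennreal (dist x y powr (real CARD('n) - \<alpha>)) \<partial>lebesgue) \<partial>lebesgue)
        / (\<integral>\<^sup>+ x\<in>Q. ennreal \<bar>W x\<bar> \<partial>lebesgue))"

definition KS_class :: "real \<Rightarrow> (real^'n \<Rightarrow> real) set" where
  "KS_class \<alpha> =
     {W. (\<forall>K. compact K \<longrightarrow> set_integrable lebesgue K W) \<and> KS_norm \<alpha> W < \<infinity>}"

definition abs_power :: "(real^'n \<Rightarrow> complex) \<Rightarrow> real^'n \<Rightarrow> real" where
  "abs_power V x = cmod (V x) powr ((real CARD('n) - 1) / 2)"

definition S_class :: "(real^'n \<Rightarrow> complex) set" where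
  "S_class = {V. V \<in> borel_measurable lebesgue \<and>
                 abs_power V \<in> KS_class (real CARD('n) - 1)}"

definition S_norm :: "(real^'n \<Rightarrow> complex) \<Rightarrow> real" where
  "S_norm V =
     enn2real (KS_norm (real CARD('n) - 1) (abs_power V)) powr (2 / (real CARD('n) - 1))"

section \<open>The resolvent of the Laplacian\<close>

definition partial_deriv :: "'n \<Rightarrow> (real^'n \<Rightarrow> complex) \<Rightarrow> real^'n \<Rightarrow> complex" where
  "partial_deriv i \<phi> x = frechet_derivative \<phi> (at x) (axis i 1)"

fun Ck :: "nat \<Rightarrow> (real^'n \<Rightarrow> complex) \<Rightarrow> bool" where
  "Ck 0 \<phi> = continuous_on UNIV \<phi>"
| "Ck (Suc k) \<phi> = (\<phi> differentiable_on UNIV \<and> (\<forall>i. Ck k (partial_deriv i \<phi>)))"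

definition test_function :: "(real^'n \<Rightarrow> complex) \<Rightarrow> bool" where
  "test_function \<phi> \<longleftrightarrow> (\<forall>k. Ck k \<phi>) \<and> compact (closure {x. \<phi> x \<noteq> 0})"

definition laplacian :: "(real^'n \<Rightarrow> complex) \<Rightarrow> real^'n \<Rightarrow> complex" where
  "laplacian \<phi> x = (\<Sum>i\<in>UNIV. partial_deriv i (partial_deriv i \<phi>) x)"

definition has_distr_laplacian :: "(real^'n \<Rightarrow> complex) \<Rightarrow> (real^'n \<Rightarrow> complex) \<Rightarrow> bool" where
  "has_distr_laplacian u g \<longleftrightarrow>
     (\<forall>\<phi>. test_function \<phi> \<longrightarrow>
        (LINT x|lebesgue. u x * laplacian \<phi> x) = (LINT x|lebesgue. g x * \<phi> x))"

text \<open>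
  On \<open>L\<^sup>2\<close>, \<open>- \<Delta>\<close> is the self-adjoint operator that acts as the distributional Laplacian on the
  domain of all \<open>u \<in> L\<^sup>2\<close> whose distributional Laplacian is in \<open>L\<^sup>2\<close>. For \<open>f \<in> L\<^sup>2\<close> and \<open>z\<close>
  not real, \<open>(- \<Delta> - z)\<^sup>-\<^sup>1 f\<close> is thus the solution \<open>u \<in> L\<^sup>2\<close>, unique up to null sets, of
  \<open>- \<Delta> u - z u = f\<close> (then \<open>\<Delta> u = - (f + z u)\<close> is automatically in \<open>L\<^sup>2\<close>); \<open>resolvent\<close>
  picks a representative.
\<close>

definition resolvent :: "complex \<Rightarrow> (real^'n \<Rightarrow> complex) \<Rightarrow> real^'n \<Rightarrow> complex" where
  "resolvent z f =
     (SOME u. u \<in> L2 (\<lambda>_. 1) \<and> has_distr_laplacian u (\<lambda>x. - (f x + z * u x)))"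

definition approximates ::
  "(real^'n \<Rightarrow> complex) \<Rightarrow> (nat \<Rightarrow> real^'n \<Rightarrow> complex) \<Rightarrow> (real^'n \<Rightarrow> complex) \<Rightarrow> bool" where
  "approximates V g f \<longleftrightarrow>
     (\<forall>k. g k \<in> L2 (\<lambda>_. 1) \<inter> L2 (inv_abs_weight V)) \<and>
     (\<lambda>k. L2_norm (inv_abs_weight V) (\<lambda>x. g k x - f x)) \<longlonglongrightarrow> 0"

text \<open>
  \<open>resolvent_limit V z f u\<close>: extension by continuity of the resolvent, as a map from
  \<open>L\<^sup>2(1 / \<bar>V\<bar>)\<close> to \<open>L\<^sup>2(\<bar>V\<bar>)\<close>, from the dense subspace \<open>L\<^sup>2 \<inter> L\<^sup>2(1 / \<bar>V\<bar>)\<close> is possible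
  at \<open>f\<close> and has the value \<open>u\<close> there.
\<close>

definition resolvent_limit ::
  "(real^'n \<Rightarrow> complex) \<Rightarrow> complex \<Rightarrow> (real^'n \<Rightarrow> complex) \<Rightarrow> (real^'n \<Rightarrow> complex) \<Rightarrow> bool" where
  "resolvent_limit V z f u \<longleftrightarrow>
     u \<in> L2 (abs_weight V) \<and>
     (\<exists>g. approximates V g f) \<and>
     (\<forall>g. approximates V g f \<longrightarrow>
        (\<forall>k. resolvent z (g k) \<in> L2 (abs_weight V)) \<and>
        (\<lambda>k. L2_norm (abs_weight V) (\<lambda>x. resolvent z (g k) x - u x)) \<longlonglongrightarrow> 0)"

definition extended_resolvent ::
  "(real^'n \<Rightarrow> complex) \<Rightarrow> complex \<Rightarrow> (real^'n \<Rightarrow> complex) \<Rightarrow> real^'n \<Rightarrow> complex" where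
  "extended_resolvent V z f =
     (if f \<in> L2 (\<lambda>_. 1) then resolvent z f else (SOME u. resolvent_limit V z f u))"

end

theory Submission
  imports Defs "HOL-Complex_Analysis.Complex_Analysis" "HOL-Probability.Probability"
begin

text \<open>
 Write \<open>z = - K\<^sup>2\<close> with \<open>Re K > 0\<close> and \<open>b = (n - 1) / 2\<close>. The resolvent is the value at \<open>s = 1\<close> of
 the analytic family of powers \<open>- s\<close> of \<open>- \<Delta> + K\<^sup>2\<close>, to which Stein interpolation is applied. On
 \<open>Re s = 0\<close> the powers are bounded on \<open>L\<^sup>2\<close>, by Plancherel. On \<open>Re s = b\<close> they have kernels dominated
 by a constant times \<open>1 / \<bar>x - y\<bar>\<close>, uniformly in \<open>K\<close>; this kernel is bounded between the weighted spaces
 with weight \<open>W = \<bar>V\<bar>\<close> to the power \<open>b\<close> because the Kerman--Sawyer condition, by a Carleson embedding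
 proved with a Bellman function, controls the dyadic model of \<open>1 / \<bar>x - y\<bar>\<close>. Interpolation at
 \<open>s = 1\<close> gives the weight \<open>\<bar>V\<bar>\<close>. In order to have a finite sum of entire functions of \<open>s\<close>, the root of
 \<open>\<bar>V\<bar>\<close> is rounded down to a power of 2. The distributional resolvent is identified with a convolution
 operator by uniqueness: for a solution \<open>u\<close> of the homogeneous equation, the pairing \<open>U(\<tau>)\<close> with the
 heat kernel satisfies \<open>U' = K\<^sup>2 U\<close> for \<open>Re \<tau> > 0\<close> and is bounded along \<open>\<tau> = t / K\<close>, hence vanishes.
\<close>

text \<open>The exponent b = (n - 1) / 2 is critical. For Re s = b the kernel of the power - s has
  singularity |x|^(2 b - n) = |x|^(- 1), and its tail, purely oscillating as Re K tends to 0, has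
  size |K|^(n / 2 - b - 1 / 2) |x|^(b - (n + 1) / 2), again |x|^(- 1) without a power of |K|. For
  smaller real parts the tail carries a positive power of |K|, so size alone gives no uniform bound;
  the resolvent, at s = 1, is such a case when n > 3, hence the interpolation. The class enters with
  the same kernel, since n - \<alpha> = 1 for \<alpha> = n - 1, and with the weight |V|^b; the
  fraction 1 / b of the strip turns its norm into the power 2 / (n - 1) that defines [V]. Operators
  are handled through pairings: a convolution with f, paired with g, is the integral of the kernel
  against the correlation of f and g, so every identity concerns one scalar integral. Formulas in K
  or in complex time are computed for positive reals and continued. Imaginary powers cost
  exponential growth in Im s, which a Gaussian factor equal to 1 at s = 1 absorbs.\<close>

unbundle no fps_syntax

lemmas LBINT_cong = Bochner_Integration.integral_cong

abbreviation lborel2 :: "('a::euclidean_space \<times> 'b::euclidean_space) measure"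
 where "lborel2 \<equiv> lborel \<Otimes>\<^sub>M lborel"

abbreviation nn_lborel :: "('a::euclidean_space \<Rightarrow> ennreal) \<Rightarrow> ennreal" (binder "NN " 10)
 where "nn_lborel \<equiv> nn_integral lborel"

section \<open>Integrals depending on a parameter\<close>

lemma tendsto_parametric_integral:
 fixes f :: "'a::metric_space \<Rightarrow> 'x \<Rightarrow> 'b::{banach, second_countable_topology}"
 assumes meas: "\<And>s. s \<in> A \<Longrightarrow> f s \<in> borel_measurable M"
  and cont: "\<And>x. x \<in> space M \<Longrightarrow> continuous_on A (\<lambda>s. f s x)"
  and g: "integrable M g" "r > 0"
  and dom: "\<And>s x. s \<in> A \<Longrightarrow> dist s a \<le> r \<Longrightarrow> x \<in> space M \<Longrightarrow> norm (f s x) \<le> g x"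
  and u: "\<And>n. u n \<in> A" "a \<in> A" "u \<longlonglongrightarrow> a"
 shows "(\<lambda>n. \<integral>x. f (u n) x \<partial>M) \<longlonglongrightarrow> (\<integral>x. f a x \<partial>M)"
proof -
 \<comment> \<open>The domination holds only near \<open>a\<close>, so the first \<open>N\<close>
   terms are dropped before dominated convergence is applied.\<close>
 from u(3) g(2) obtain N where N: "\<And>n. n \<ge> N \<Longrightarrow> dist (u n) a < r"
  by (metis LIMSEQ_def)
 have "(\<lambda>n. \<integral>x. f (u (n + N)) x \<partial>M) \<longlonglongrightarrow> (\<integral>x. f a x \<partial>M)"
 proof (rule integral_dominated_convergence[where w = g])
  show "AE x in M. (\<lambda>n. f (u (n + N)) x) \<longlonglongrightarrow> f a x"
  proof (rule AE_I2)
   fix x assume "x \<in> space M"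
   from continuous_on_tendsto_compose[OF cont[OF this] u(3,2)] u(1)
   have "(\<lambda>n. f (u n) x) \<longlonglongrightarrow> f a x" by simp
   then show "(\<lambda>n. f (u (n + N)) x) \<longlonglongrightarrow> f a x" by (rule LIMSEQ_ignore_initial_segment)
  qed
  show "AE x in M. norm (f (u (n + N)) x) \<le> g x" for n
   using u(1) N[of "n + N"] by (intro AE_I2 dom) auto
 qed (use u meas g in auto)
 then show ?thesis by (rule LIMSEQ_offset)
qed

lemma continuous_on_parametric_integral:
 fixes f :: "'a::metric_space \<Rightarrow> 'x \<Rightarrow> 'b::{banach, second_countable_topology}"
 assumes meas: "\<And>s. s \<in> A \<Longrightarrow> f s \<in> borel_measurable M"
  and cont: "\<And>x. x \<in> space M \<Longrightarrow> continuous_on A (\<lambda>s. f s x)"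
  and dom: "\<And>a. a \<in> A \<Longrightarrow> \<exists>r>0. \<exists>g. integrable M g \<and>
   (\<forall>s\<in>A. dist s a \<le> r \<longrightarrow> (\<forall>x\<in>space M. norm (f s x) \<le> g x))"
 shows "continuous_on A (\<lambda>s. \<integral>x. f s x \<partial>M)"
proof (rule continuous_on_sequentiallyI)
 fix u a assume u: "\<forall>n. u n \<in> A" "a \<in> A" "u \<longlonglongrightarrow> a"
 from dom[OF u(2)] obtain r g where "r > 0" "integrable M g"
  and "\<forall>s\<in>A. dist s a \<le> r \<longrightarrow> (\<forall>x\<in>space M. norm (f s x) \<le> g x)" by blast
 then show "(\<lambda>n. \<integral>x. f (u n) x \<partial>M) \<longlonglongrightarrow> (\<integral>x. f a x \<partial>M)"
  using u by (intro tendsto_parametric_integral[where A = A and g = g and r = r] meas cont) auto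
qed

text \<open>A bound on \<open>f\<close> itself suffices: Cauchy's inequality on discs of radius
  \<open>r / 2\<close> bounds the derivative by \<open>2 * g x / r\<close> on the half disc, hence
  also the difference quotients, and dominated convergence applies to them.\<close>

lemma has_field_derivative_parametric_integral:
 fixes f :: "complex \<Rightarrow> 'x \<Rightarrow> complex"
 assumes r: "r > 0"
  and meas: "\<And>s. s \<in> cball a r \<Longrightarrow> f s \<in> borel_measurable M"
  and hol: "\<And>x. x \<in> space M \<Longrightarrow> (\<lambda>s. f s x) holomorphic_on cball a r"
  and g: "integrable M g"
  and dom: "\<And>s x. s \<in> cball a r \<Longrightarrow> x \<in> space M \<Longrightarrow> norm (f s x) \<le> g x"
 shows "((\<lambda>s. \<integral>x. f s x \<partial>M) has_field_derivative (\<integral>x. deriv (\<lambda>s. f s x) a \<partial>M)) (at a)"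
  and "integrable M (\<lambda>x. deriv (\<lambda>s. f s x) a)"
proof -
 have int: "integrable M (f s)" if "s \<in> cball a r" for s
  by (rule Bochner_Integration.integrable_bound[OF g meas[OF that]]) (use dom[OF that] in \<open>auto intro!: AE_I2 order_trans[OF _ abs_ge_self]\<close>)
 have quot: "norm ((f (a + h) x - f a x) / h) \<le> 2 * g x / r"
  if h: "norm h < r / 2" and x: "x \<in> space M" for h x
 proof -
  have d: "norm (deriv (\<lambda>s. f s x) w) \<le> 2 * g x / r" if w: "w \<in> ball a (r/2)" for w
  proof -
   have sub: "cball w (r/2) \<subseteq> cball a r"
   proof
    fix y assume "y \<in> cball w (r/2)"
    then have "dist a y \<le> dist a w + dist w y" "dist w y \<le> r / 2" by (auto intro: dist_triangle)
    with w show "y \<in> cball a r" by auto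
   qed
   have "norm ((deriv ^^ 1) (\<lambda>s. f s x) w) \<le> fact 1 * g x / (r/2) ^ 1"
   proof (rule Cauchy_inequality)
    show "(\<lambda>s. f s x) holomorphic_on ball w (r / 2)"
     using hol[OF x] sub by (meson ball_subset_cball holomorphic_on_subset order_trans)
    show "continuous_on (cball w (r / 2)) (\<lambda>s. f s x)"
     using hol[OF x] sub by (meson holomorphic_on_imp_continuous_on holomorphic_on_subset)
    show "norm (f y x) \<le> g x" if "norm (w - y) = r / 2" for y
     using sub that by (intro dom x) (auto simp: subset_iff dist_norm)
   qed (use r in auto)
   then show ?thesis by (simp add: mult.commute)
  qed
  have "norm (f (a + h) x - f a x) \<le> (2 * g x / r) * norm ((a + h) - a)"
  proof (rule field_differentiable_bound[of "ball a (r/2)" _ "deriv (\<lambda>s. f s x)"])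
   fix w assume w: "w \<in> ball a (r/2)"
   have "(\<lambda>s. f s x) holomorphic_on ball a r"
    using hol[OF x] by (meson ball_subset_cball holomorphic_on_subset)
   moreover have "w \<in> ball a r" using w r by auto
   ultimately have "((\<lambda>s. f s x) has_field_derivative deriv (\<lambda>s. f s x) w) (at w)"
    by (intro holomorphic_derivI) auto
   then show "((\<lambda>s. f s x) has_field_derivative deriv (\<lambda>s. f s x) w) (at w within ball a (r/2))"
    by (rule has_field_derivative_at_within)
  qed (use d r h in \<open>auto simp: dist_norm\<close>)
  then have "norm (f (a + h) x - f a x) \<le> (2 * g x / r) * norm h" by simp
  moreover have "0 \<le> g x" by (rule order_trans[OF norm_ge_zero dom[of a x]]) (use x r in auto)
  then have "0 \<le> 2 * g x / r" using r by simp
  ultimately show ?thesis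
   by (cases "h = 0") (auto simp: norm_divide divide_simps)
 qed
 have lim: "(\<lambda>h. (f (a + h) x - f a x) / h) \<midarrow>0\<rightarrow> deriv (\<lambda>s. f s x) a" if x: "x \<in> space M" for x
 proof -
  have "(\<lambda>s. f s x) holomorphic_on ball a r"
   using hol[OF x] by (meson ball_subset_cball holomorphic_on_subset)
  then have "((\<lambda>s. f s x) has_field_derivative deriv (\<lambda>s. f s x) a) (at a)"
   using r by (intro holomorphic_derivI[of _ "ball a r"]) auto
  then show ?thesis by (simp add: DERIV_def)
 qed
 have key: "integrable M (\<lambda>x. deriv (\<lambda>s. f s x) a) \<and>
  (\<lambda>k. \<integral>x. (f (a + S k) x - f a x) / S k \<partial>M) \<longlonglongrightarrow> (\<integral>x. deriv (\<lambda>s. f s x) a \<partial>M)"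
  if S: "\<And>k. S k \<noteq> 0" "S \<longlonglongrightarrow> 0" "\<And>k. norm (S k) < r / 2" for S :: "nat \<Rightarrow> complex"
 proof -
  have in_cball: "a + S k \<in> cball a r" "a \<in> cball a r" for k
  proof -
   have "norm (S k) \<le> r" using S(3)[of k] r by linarith
   then show "a + S k \<in> cball a r" "a \<in> cball a r" using r by (auto simp: dist_norm)
  qed
  have l: "(\<lambda>k. (f (a + S k) x - f a x) / S k) \<longlonglongrightarrow> deriv (\<lambda>s. f s x) a" if "x \<in> space M" for x
   using lim[OF that] S(1,2) unfolding LIMSEQ_SEQ_conv[symmetric] by blast
  have m: "(\<lambda>x. (f (a + S k) x - f a x) / S k) \<in> borel_measurable M" for k
   using meas[OF in_cball(1)[of k]] meas[OF in_cball(2)] by measurable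
  have m2: "(\<lambda>x. deriv (\<lambda>s. f s x) a) \<in> borel_measurable M"
   by (rule borel_measurable_LIMSEQ_metric[OF m l])
  have gi: "integrable M (\<lambda>x. 2 * g x / r)" using g by simp
  have l': "AE x in M. (\<lambda>k. (f (a + S k) x - f a x) / S k) \<longlonglongrightarrow> deriv (\<lambda>s. f s x) a"
   using l by (intro AE_I2)
  have b': "AE x in M. norm ((f (a + S k) x - f a x) / S k) \<le> 2 * g x / r" for k
  proof (rule AE_I2)
   fix x assume "x \<in> space M"
   from quot[OF S(3)[of k] this] show "norm ((f (a + S k) x - f a x) / S k) \<le> 2 * g x / r" .
  qed
  show ?thesis
   using integrable_dominated_convergence[OF m2 m gi l' b'] integral_dominated_convergence[OF m2 m gi l' b'] by simp
 qed
 \<comment> \<open>Any null sequence of nonzero increments would serve; a concrete one is chosen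
   because integrability of the derivative is itself obtained along such a sequence.\<close>
 define S where "S k = complex_of_real (r / 4 * inverse (real (Suc k)))" for k
 have "(\<lambda>k. S k) \<longlonglongrightarrow> of_real (r / 4 * 0)" unfolding S_def
  by (intro tendsto_intros LIMSEQ_inverse_real_of_nat)
 moreover have "S k \<noteq> 0" for k using r by (simp add: S_def del: of_nat_Suc)
 moreover have "norm (S k) < r / 2" for k
 proof -
  have "inverse (real (Suc k)) \<le> 1" by (simp add: field_simps)
  then have "r / 4 * inverse (real (Suc k)) \<le> r / 4" using r by simp
  then show ?thesis unfolding S_def norm_of_real using r by simp
 qed
 ultimately have "integrable M (\<lambda>x. deriv (\<lambda>s. f s x) a)"
  using key[of S] by simp
 then show "integrable M (\<lambda>x. deriv (\<lambda>s. f s x) a)" .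
 have "(\<lambda>h. ((\<integral>x. f (a + h) x \<partial>M) - (\<integral>x. f a x \<partial>M)) / h) \<midarrow>0\<rightarrow> (\<integral>x. deriv (\<lambda>s. f s x) a \<partial>M)"
  unfolding LIMSEQ_SEQ_conv[symmetric]
 proof (intro allI impI)
  fix S :: "nat \<Rightarrow> complex" assume S: "(\<forall>n. S n \<noteq> 0) \<and> S \<longlonglongrightarrow> 0"
  then obtain N where N: "\<And>k. k \<ge> N \<Longrightarrow> norm (S k) < r / 2"
   using r LIMSEQ_D[of S 0 "r/2"] by auto
  have "(\<lambda>k. \<integral>x. (f (a + S (k + N)) x - f a x) / S (k + N) \<partial>M) \<longlonglongrightarrow> (\<integral>x. deriv (\<lambda>s. f s x) a \<partial>M)"
   using key[of "\<lambda>k. S (k + N)"] S N by (auto intro: LIMSEQ_ignore_initial_segment)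
  moreover have "(\<integral>x. (f (a + S (k + N)) x - f a x) / S (k + N) \<partial>M) =
    ((\<integral>x. f (a + S (k + N)) x \<partial>M) - (\<integral>x. f a x \<partial>M)) / S (k + N)" for k
  proof -
   have "a + S (k + N) \<in> cball a r" "a \<in> cball a r"
   proof -
    have "norm (S (k + N)) \<le> r" using N[of "k+N"] r by simp
    then show "a + S (k + N) \<in> cball a r" "a \<in> cball a r" using r by (auto simp: dist_norm)
   qed
   then show ?thesis using int by simp
  qed
  ultimately have "(\<lambda>k. ((\<integral>x. f (a + S (k + N)) x \<partial>M) - (\<integral>x. f a x \<partial>M)) / S (k + N)) \<longlonglongrightarrow> (\<integral>x. deriv (\<lambda>s. f s x) a \<partial>M)"
   by (simp only:)
  then show "(\<lambda>k. ((\<integral>x. f (a + S k) x \<partial>M) - (\<integral>x. f a x \<partial>M)) / S k) \<longlonglongrightarrow> (\<integral>x. deriv (\<lambda>s. f s x) a \<partial>M)"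
   by (rule LIMSEQ_offset)
 qed
 then show "((\<lambda>s. \<integral>x. f s x \<partial>M) has_field_derivative (\<integral>x. deriv (\<lambda>s. f s x) a \<partial>M)) (at a)"
  by (simp add: DERIV_def)
qed

lemma holomorphic_on_parametric_integral:
 fixes f :: "complex \<Rightarrow> 'x \<Rightarrow> complex"
 assumes A: "open A"
  and meas: "\<And>s. s \<in> A \<Longrightarrow> f s \<in> borel_measurable M"
  and hol: "\<And>x. x \<in> space M \<Longrightarrow> (\<lambda>s. f s x) holomorphic_on A"
  and dom: "\<And>a. a \<in> A \<Longrightarrow> \<exists>r>0. \<exists>g. integrable M g \<and>
   (\<forall>s\<in>A. dist s a \<le> r \<longrightarrow> (\<forall>x\<in>space M. norm (f s x) \<le> g x))"
 shows "(\<lambda>s. \<integral>x. f s x \<partial>M) holomorphic_on A"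
proof -
 have "(\<lambda>s. \<integral>x. f s x \<partial>M) field_differentiable at a" if a: "a \<in> A" for a
 proof -
  from dom[OF a] obtain r g where r: "r > 0" "integrable M g"
   and b: "\<forall>s\<in>A. dist s a \<le> r \<longrightarrow> (\<forall>x\<in>space M. norm (f s x) \<le> g x)" by blast
  from A a obtain e where e: "e > 0" "cball a e \<subseteq> A" by (meson open_contains_cball)
  have sub: "cball a (min e r) \<subseteq> A" using e by auto
  have "((\<lambda>s. \<integral>x. f s x \<partial>M) has_field_derivative (\<integral>x. deriv (\<lambda>s. f s x) a \<partial>M)) (at a)"
  proof (rule has_field_derivative_parametric_integral(1)[where r = "min e r" and g = g])
   show "norm (f s x) \<le> g x" if "s \<in> cball a (min e r)" "x \<in> space M" for s x
    using b that sub by (auto simp: dist_commute subset_iff)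
   show "(\<lambda>s. f s x) holomorphic_on cball a (min e r)" if "x \<in> space M" for x
    using hol[OF that] sub by (rule holomorphic_on_subset)
  qed (use r e sub meas in auto)
  then show ?thesis by (auto simp: field_differentiable_def)
 qed
 then show ?thesis by (auto simp: holomorphic_on_def intro: field_differentiable_at_within)
qed

text \<open>Hadamard's argument for a function that decays at both ends of the strip. Dividing by
  \<open>exp (L z)\<close>, where \<open>Re (L z)\<close> interpolates \<open>ln M0\<close> and
  \<open>ln M1\<close> linearly, makes the bound 1 on both vertical lines. The decay, later supplied
  by a Gaussian factor, lets the maximum principle on a single rectangle do.\<close>

lemma three_lines_bound:
 fixes F :: "complex \<Rightarrow> complex"
 assumes b: "b > 0"
  and hol: "F holomorphic_on {z. 0 < Re z \<and> Re z < b}"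
  and cont: "continuous_on {z. 0 \<le> Re z \<and> Re z \<le> b} F"
  and decay: "\<And>e. e > 0 \<Longrightarrow> \<exists>R. \<forall>z. 0 \<le> Re z \<and> Re z \<le> b \<and> \<bar>Im z\<bar> \<ge> R \<longrightarrow> norm (F z) \<le> e"
  and M: "M0 > 0" "M1 > 0"
  and bd0: "\<And>z. Re z = 0 \<Longrightarrow> norm (F z) \<le> M0"
  and bd1: "\<And>z. Re z = b \<Longrightarrow> norm (F z) \<le> M1"
  and th: "0 \<le> \<theta>" "\<theta> \<le> 1"
 shows "norm (F (of_real (\<theta> * b))) \<le> M0 powr (1 - \<theta>) * M1 powr \<theta>"
proof -
 define L where "L = (\<lambda>z::complex. (1 - z / of_real b) * of_real (ln M0) + z / of_real b * of_real (ln M1))"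
 define H where "H = (\<lambda>z. F z * exp (- L z))"
 have ReL: "Re (L z) = (1 - Re z / b) * ln M0 + Re z / b * ln M1" for z
  using b by (simp add: L_def Re_divide_of_real)
 have nH: "norm (H z) = norm (F z) * exp (- ((1 - Re z / b) * ln M0 + Re z / b * ln M1))" for z
  by (simp add: H_def norm_mult ReL)
 \<comment> \<open>\<open>B\<close> bounds the modulus of \<open>exp (- L z)\<close> on the closed
   strip; the rectangle is taken so high that \<open>F\<close> is at most \<open>1 / B\<close> on
   its horizontal sides.\<close>
 define B where "B = max (1 / M0) (1 / M1)"
 have B: "B > 0" using M by (auto simp: B_def less_max_iff_disj)
 have fac: "exp (- ((1 - x / b) * ln M0 + x / b * ln M1)) \<le> B" if "0 \<le> x" "x \<le> b" for x
 proof -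
  have x: "0 \<le> x / b" "x / b \<le> 1" using that b by auto
  have "- ln M0 = ln (1 / M0)" "- ln M1 = ln (1 / M1)" using M by (simp_all add: ln_div)
  then have "- ln M0 \<le> ln B" "- ln M1 \<le> ln B" using M B by (simp_all add: B_def)
  then have "(1 - x/b) * (- ln M0) + x / b * (- ln M1) \<le> (1 - x/b) * ln B + x / b * ln B"
   using x by (intro add_mono mult_left_mono) auto
  also have "\<dots> = ln B" by (simp add: algebra_simps)
  finally have "exp (- ((1 - x / b) * ln M0 + x / b * ln M1)) \<le> exp (ln B)" by simp
  then show ?thesis using B by simp
 qed
 obtain R0 where R0: "\<And>z. 0 \<le> Re z \<Longrightarrow> Re z \<le> b \<Longrightarrow> \<bar>Im z\<bar> \<ge> R0 \<Longrightarrow> norm (F z) \<le> 1 / B"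
  using decay[of "1 / B"] B by auto
 define R where "R = max R0 1"
 define S where "S = cbox (Complex 0 (- R)) (Complex b R)"
 have S: "z \<in> S \<longleftrightarrow> 0 \<le> Re z \<and> Re z \<le> b \<and> \<bar>Im z\<bar> \<le> R" for z
  by (auto simp: S_def in_cbox_complex_iff)
 have "norm (H (of_real (\<theta> * b))) \<le> 1"
 proof (rule maximum_modulus_frontier[where S = S and f = H])
  have "interior S \<subseteq> {z. 0 < Re z \<and> Re z < b}"
   by (auto simp: S_def interior_cbox in_box_complex_iff)
  then show "H holomorphic_on interior S"
   unfolding H_def L_def using b
   by (intro holomorphic_intros holomorphic_on_subset[OF hol]) auto
  have "S \<subseteq> {z. 0 \<le> Re z \<and> Re z \<le> b}" by (auto simp: S)
  then show "continuous_on (closure S) H"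
   unfolding H_def L_def using b
   by (auto simp: S_def intro!: continuous_intros continuous_on_subset[OF cont])
  show "bounded S" by (simp add: S_def)
  show "of_real (\<theta> * b) \<in> S" using th b by (auto simp: S R_def mult_left_le_one_le)
  fix z assume "z \<in> frontier S"
  then have z: "z \<in> S" "z \<notin> box (Complex 0 (- R)) (Complex b R)"
   by (auto simp: frontier_def S_def interior_cbox)
  then have "Re z = 0 \<or> Re z = b \<or> \<bar>Im z\<bar> = R" unfolding S by (auto simp: in_box_complex_iff)
  then show "norm (H z) \<le> 1"
  proof (elim disjE)
   assume "Re z = 0" with bd0[OF this] M show ?thesis by (simp add: nH exp_minus field_simps)
  next
   assume "Re z = b" with bd1[OF this] M b show ?thesis by (simp add: nH exp_minus field_simps)
  next
   assume "\<bar>Im z\<bar> = R"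
   with z(1) have "norm (F z) \<le> 1 / B" by (intro R0) (auto simp: S R_def)
   with fac[of "Re z"] z(1) have "norm (H z) \<le> 1 / B * B"
    using B unfolding nH S by (intro mult_mono) auto
   with B show ?thesis by simp
  qed
 qed
 then have "norm (F (of_real (\<theta> * b))) * exp (- ((1 - \<theta>) * ln M0 + \<theta> * ln M1)) \<le> 1"
  using b unfolding nH by simp
 then have "norm (F (of_real (\<theta> * b))) / exp ((1 - \<theta>) * ln M0 + \<theta> * ln M1) \<le> 1"
  by (simp only: exp_minus divide_inverse)
 then have "norm (F (of_real (\<theta> * b))) \<le> exp ((1 - \<theta>) * ln M0 + \<theta> * ln M1)"
  by (simp only: pos_divide_le_eq[OF exp_gt_zero] mult_1)
 then show ?thesis using M by (simp add: powr_def exp_add)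
qed

section \<open>Translation invariance and Young's inequality\<close>

lemma lborel_distr_affine_unit:
 fixes c :: real and t :: "'a::euclidean_space"
 assumes "\<bar>c\<bar> = 1"
 shows "distr lborel borel (\<lambda>x. t + c *\<^sub>R x) = (lborel :: 'a measure)"
 using lborel_affine[of c t] assms by (cases "c = 0") (auto simp: density_1)

lemma nn_integral_shift:
 fixes f :: "'a::euclidean_space \<Rightarrow> ennreal"
 assumes [measurable]: "f \<in> borel_measurable borel"
 shows "(NN y. f (t - y)) = (NN y. f y)"
  and "(NN y. f (y - t)) = (NN y. f y)"
proof -
 have "(\<integral>\<^sup>+y. f y \<partial>distr lborel borel (\<lambda>x. t + (-1) *\<^sub>R x)) = (NN y. f (t - y))"
  by (subst nn_integral_distr) auto
 then show "(NN y. f (t - y)) = (NN y. f y)"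
  by (subst (asm) lborel_distr_affine_unit) auto
 have "(\<integral>\<^sup>+y. f y \<partial>distr lborel borel (\<lambda>x. - t + 1 *\<^sub>R x)) = (NN y. f (y - t))"
  by (subst nn_integral_distr) auto
 then show "(NN y. f (y - t)) = (NN y. f y)"
  by (subst (asm) lborel_distr_affine_unit) auto
qed

lemma integral_shift:
 fixes f :: "'a::euclidean_space \<Rightarrow> 'b::{banach, second_countable_topology}"
 assumes [measurable]: "f \<in> borel_measurable borel"
 shows "(LBINT y. f (t - y)) = (LBINT y. f y)"
  and "(LBINT y. f (y - t)) = (LBINT y. f y)"
  and "integrable lborel (\<lambda>y. f (t - y)) \<longleftrightarrow> integrable lborel f"
  and "integrable lborel (\<lambda>y. f (y - t)) \<longleftrightarrow> integrable lborel f"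
proof -
 have "(\<integral>y. f y \<partial>distr lborel borel (\<lambda>x. t + (-1) *\<^sub>R x)) = (LBINT y. f (t - y))"
  by (subst integral_distr) auto
 then show "(LBINT y. f (t - y)) = (LBINT y. f y)"
  by (subst (asm) lborel_distr_affine_unit) auto
 have "(\<integral>y. f y \<partial>distr lborel borel (\<lambda>x. - t + 1 *\<^sub>R x)) = (LBINT y. f (y - t))"
  by (subst integral_distr) auto
 then show "(LBINT y. f (y - t)) = (LBINT y. f y)"
  by (subst (asm) lborel_distr_affine_unit) auto
 have "integrable (distr lborel borel (\<lambda>x. t + (-1) *\<^sub>R x)) f \<longleftrightarrow> integrable lborel (\<lambda>y. f (t - y))"
  by (subst integrable_distr_eq) auto
 then show "integrable lborel (\<lambda>y. f (t - y)) \<longleftrightarrow> integrable lborel f"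
  by (subst (asm) lborel_distr_affine_unit) auto
 have "integrable (distr lborel borel (\<lambda>x. - t + 1 *\<^sub>R x)) f \<longleftrightarrow> integrable lborel (\<lambda>y. f (y - t))"
  by (subst integrable_distr_eq) auto
 then show "integrable lborel (\<lambda>y. f (y - t)) \<longleftrightarrow> integrable lborel f"
  by (subst (asm) lborel_distr_affine_unit) auto
qed

lemma norm_integral_le_nn_integral:
 fixes f :: "'a \<Rightarrow> 'b::{banach, second_countable_topology}"
 shows "ennreal (norm (\<integral>x. f x \<partial>M)) \<le> (\<integral>\<^sup>+x. norm (f x) \<partial>M)"
 by (cases "integrable M f") (auto simp: integral_norm_bound_ennreal not_integrable_integral_eq)

text \<open>Cauchy--Schwarz for the product \<open>1 * f\<close> in the measure with density
  \<open>K (x - y)\<close>, then Tonelli.\<close>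

lemma young_L1_L2:
 fixes K f :: "'a::euclidean_space \<Rightarrow> ennreal"
 assumes [measurable]: "K \<in> borel_measurable borel" "f \<in> borel_measurable borel"
 shows "(NN x. (NN y. K (x - y) * f y)^2)
  \<le> (NN x. K x)^2 * (NN x. (f x)^2)"
proof -
 have sq: "(NN y. K (x - y) * f y)^2 \<le> (NN x. K x) * (NN y. K (x - y) * (f y)^2)" for x
 proof -
  define k where "k = (\<lambda>y. K (x - y))"
  have [measurable]: "k \<in> borel_measurable borel" unfolding k_def by measurable
  have "(NN y. k y * f y) = (\<integral>\<^sup>+y. f y \<partial>density lborel k)"
   by (simp add: nn_integral_density)
  also have "\<dots>^2 = (\<integral>\<^sup>+y. 1 * f y \<partial>density lborel k)^2" by simp
  also have "\<dots> \<le> (\<integral>\<^sup>+y. 1 ^ 2 \<partial>density lborel k) * (\<integral>\<^sup>+y. (f y) ^ 2 \<partial>density lborel k)"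
   by (rule Cauchy_Schwarz_nn_integral) auto
  also have "\<dots> = (NN y. k y) * (NN y. k y * (f y)^2)"
   by (subst (1 2) nn_integral_density) auto
  also have "(NN y. k y) = (NN x. K x)"
   unfolding k_def by (rule nn_integral_shift) auto
  finally show ?thesis by (simp add: k_def)
 qed
 have "(NN x. (NN y. K (x - y) * f y)^2)
  \<le> (NN x. (NN x. K x) * (NN y. K (x - y) * (f y)^2))"
  by (intro nn_integral_mono sq)
 also have "\<dots> = (NN x. K x) * (NN x. (NN y. K (x - y) * (f y)^2))"
  by (rule nn_integral_cmult) measurable
 also have "(NN x. (NN y. K (x - y) * (f y)^2)) = (NN y. (NN x. K (x - y) * (f y)^2))"
  by (rule lborel_pair.Fubini') measurable
 also have "\<dots> = (NN y. (NN x. K x) * (f y)^2)"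
  by (intro nn_integral_cong) (simp add: nn_integral_multc nn_integral_shift)
 also have "\<dots> = (NN x. K x) * (NN x. (f x)^2)"
  by (simp add: nn_integral_cmult)
 finally show ?thesis by (simp add: power2_eq_square mult_ac)
qed

subsection \<open>Square integrable functions\<close>

text \<open>Borel measurability is asked for, although the result concerns Lebesgue measurable
  functions: it makes \<open>f (x - y)\<close> jointly measurable, as Tonelli and Fubini on the
  product require. The passage to Borel versions takes place near the end.\<close>

definition sq_integrable :: "('a::euclidean_space \<Rightarrow> complex) \<Rightarrow> bool" where
 "sq_integrable f \<longleftrightarrow> f \<in> borel_measurable borel \<and> integrable lborel (\<lambda>x. (norm (f x))^2)"

definition norm2 :: "('a::euclidean_space \<Rightarrow> complex) \<Rightarrow> real" where
 "norm2 f = sqrt (LBINT x. (norm (f x))^2)"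

lemma norm2_nonneg [simp]: "0 \<le> norm2 f"
 by (simp add: norm2_def)

lemma norm2_sq: "(norm2 f)^2 = (LBINT x. (norm (f x))^2)"
 by (simp add: norm2_def)

lemma sq_integrable_iff_nn:
 "sq_integrable f \<longleftrightarrow> f \<in> borel_measurable borel \<and> (NN x. ennreal ((norm (f x))^2)) < \<infinity>"
 unfolding sq_integrable_def by (auto simp: integrable_iff_bounded)

lemma nn_integral_sq_integrable:
 "sq_integrable f \<Longrightarrow> (NN x. ennreal ((norm (f x))^2)) = ennreal ((norm2 f)^2)"
 unfolding sq_integrable_def norm2_sq by (subst nn_integral_eq_integral) auto

lemma norm2_leI:
 assumes "(NN x. ennreal ((norm (f x))^2)) \<le> ennreal (c^2)" "f \<in> borel_measurable borel" "0 \<le> c"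
 shows "sq_integrable f" "norm2 f \<le> c"
proof -
 show 1: "sq_integrable f" unfolding sq_integrable_iff_nn using assms by (auto intro: le_less_trans)
 have "(norm2 f)^2 \<le> c^2" using assms(1) by (simp add: nn_integral_sq_integrable[OF 1])
 then show "norm2 f \<le> c" using assms(3) by (rule power2_le_imp_le)
qed

lemma sq_integrable_mult:
 fixes f g :: "'a::euclidean_space \<Rightarrow> complex"
 assumes f: "sq_integrable f" and g: "sq_integrable g"
 shows "integrable lborel (\<lambda>x. f x * g x)"
  and "(LBINT x. norm (f x * g x)) \<le> norm2 f * norm2 g"
  and "norm (LBINT x. f x * g x) \<le> norm2 f * norm2 g"
proof -
 have [measurable]: "f \<in> borel_measurable borel" "g \<in> borel_measurable borel"
  using f g by (simp_all add: sq_integrable_def)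
 have "norm (f x * g x) \<le> (norm (f x))^2 + (norm (g x))^2" for x
 proof -
  have "2 * (norm (f x) * norm (g x)) \<le> (norm (f x))^2 + (norm (g x))^2"
   using sum_squares_bound[of "norm (f x)" "norm (g x)"] by simp
  moreover have "0 \<le> norm (f x) * norm (g x)" by simp
  ultimately show ?thesis unfolding norm_mult by linarith
 qed
 then show i: "integrable lborel (\<lambda>x. f x * g x)"
 proof (intro Bochner_Integration.integrable_bound[where f = "\<lambda>x. (norm (f x))^2 + (norm (g x))^2" and g = "\<lambda>x. f x * g x"] AE_I2)
  show "integrable lborel (\<lambda>x. (norm (f x))^2 + (norm (g x))^2)"
   using f g by (simp add: sq_integrable_def)
 qed auto
 have "ennreal ((LBINT x. norm (f x * g x))^2) = (NN x. ennreal (norm (f x * g x)))^2"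
  using i by (subst nn_integral_eq_integral) (auto simp: ennreal_power intro!: integrable_norm)
 also have "\<dots> = (NN x. ennreal (norm (f x)) * ennreal (norm (g x)))^2"
  by (simp add: norm_mult ennreal_mult)
 also have "\<dots> \<le> (NN x. (ennreal (norm (f x)))^2) * (NN x. (ennreal (norm (g x)))^2)"
  by (rule Cauchy_Schwarz_nn_integral) auto
 also have "\<dots> = ennreal ((norm2 f * norm2 g)^2)"
  using f g by (simp add: ennreal_power nn_integral_sq_integrable power_mult_distrib ennreal_mult)
 finally have "(LBINT x. norm (f x * g x))^2 \<le> (norm2 f * norm2 g)^2" by simp
 then show n: "(LBINT x. norm (f x * g x)) \<le> norm2 f * norm2 g"
  by (rule power2_le_imp_le) simp
 show "norm (LBINT x. f x * g x) \<le> norm2 f * norm2 g"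
  using integral_norm_bound[of lborel "\<lambda>x. f x * g x"] n by linarith
qed

lemma sq_integrable_shift:
 assumes [measurable]: "sq_integrable f"
 shows "sq_integrable (\<lambda>x. f (t - x))" "sq_integrable (\<lambda>x. f (x - t))"
  "norm2 (\<lambda>x. f (t - x)) = norm2 f" "norm2 (\<lambda>x. f (x - t)) = norm2 f"
proof -
 have [measurable]: "f \<in> borel_measurable borel" using assms by (simp add: sq_integrable_def)
 have "(\<lambda>x. f (t - x)) \<in> borel_measurable borel" "(\<lambda>x. f (x - t)) \<in> borel_measurable borel" by measurable
 then show "sq_integrable (\<lambda>x. f (t - x))" "sq_integrable (\<lambda>x. f (x - t))"
  "norm2 (\<lambda>x. f (t - x)) = norm2 f" "norm2 (\<lambda>x. f (x - t)) = norm2 f"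
  using assms integral_shift[of "\<lambda>x. (norm (f x))^2" t] by (simp_all add: sq_integrable_def norm2_def)
qed

lemma measurable_cnj [measurable]: "cnj \<in> borel_measurable borel"
 by (intro borel_measurable_continuous_onI continuous_intros)

lemma sq_integrable_cnj:
 "sq_integrable f \<Longrightarrow> sq_integrable (\<lambda>x. cnj (f x))" "norm2 (\<lambda>x. cnj (f x)) = norm2 f"
 by (auto simp: sq_integrable_def norm2_def)

lemma sq_integrable_cmult:
 "sq_integrable f \<Longrightarrow> sq_integrable (\<lambda>x. c * f x)" "norm2 (\<lambda>x. c * f x) = norm c * norm2 f"
 by (auto simp: sq_integrable_def norm2_def norm_mult power_mult_distrib real_sqrt_mult)

lemma sq_integrable_add:
 assumes f: "sq_integrable f" and g: "sq_integrable g"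
 shows "sq_integrable (\<lambda>x. f x + g x)" "norm2 (\<lambda>x. f x + g x) \<le> norm2 f + norm2 g"
proof -
 have [measurable]: "f \<in> borel_measurable borel" "g \<in> borel_measurable borel"
  using f g by (simp_all add: sq_integrable_def)
 have b: "(norm (f x + g x))^2 \<le> (norm (f x))^2 + 2 * norm (f x * g x) + (norm (g x))^2" for x
 proof -
  have "(norm (f x + g x))^2 \<le> (norm (f x) + norm (g x))^2" by (intro power_mono norm_triangle_ineq) auto
  then show ?thesis by (simp add: power2_sum norm_mult mult_ac)
 qed
 have i: "integrable lborel (\<lambda>x. (norm (f x))^2 + 2 * norm (f x * g x) + (norm (g x))^2)"
  using f g sq_integrable_mult(1)[OF f g]
  by (intro Bochner_Integration.integrable_add integrable_mult_right integrable_norm) (auto simp: sq_integrable_def)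
 have s: "integrable lborel (\<lambda>x. (norm (f x + g x))^2)"
  by (rule Bochner_Integration.integrable_bound[OF i]) (use b in \<open>auto intro!: AE_I2 order_trans[OF _ abs_ge_self]\<close>)
 then show "sq_integrable (\<lambda>x. f x + g x)" unfolding sq_integrable_def by simp
 have "(norm2 (\<lambda>x. f x + g x))^2 \<le> (LBINT x. (norm (f x))^2 + 2 * norm (f x * g x) + (norm (g x))^2)"
  unfolding norm2_sq by (intro integral_mono s i b)
 also have "\<dots> = (norm2 f)^2 + 2 * (LBINT x. norm (f x * g x)) + (norm2 g)^2"
 proof -
  have "integrable lborel (\<lambda>x. (norm (f x))^2)" "integrable lborel (\<lambda>x. (norm (g x))^2)" "integrable lborel (\<lambda>x. norm (f x * g x))"
   using f g sq_integrable_mult(1)[OF f g] by (auto simp: sq_integrable_def)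
  then show ?thesis unfolding norm2_sq by simp
 qed
 also have "\<dots> \<le> (norm2 f + norm2 g)^2"
  using sq_integrable_mult(2)[OF f g] by (simp add: power2_sum)
 finally show "norm2 (\<lambda>x. f x + g x) \<le> norm2 f + norm2 g" by (rule power2_le_imp_le) simp
qed

lemma sq_integrable_diff:
 assumes f: "sq_integrable f" and g: "sq_integrable g"
 shows "sq_integrable (\<lambda>x. f x - g x)"
 using sq_integrable_add(1)[OF f sq_integrable_cmult(1)[OF g, of "- 1"]] by simp

subsection \<open>Convolution and correlation\<close>

definition conv :: "('a::euclidean_space \<Rightarrow> complex) \<Rightarrow> ('a \<Rightarrow> complex) \<Rightarrow> 'a \<Rightarrow> complex" where
 "conv K f x = (LBINT y. K (x - y) * f y)"

text \<open>Bilinear, without conjugate. By \<open>conv_pairing\<close> the pairing of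
  \<open>conv K f\<close> with \<open>g\<close> depends on \<open>f\<close> and \<open>g\<close>
  only through \<open>corr f g\<close>, so operator identities and bounds become statements about
  integrals against this function.\<close>

definition corr :: "('a::euclidean_space \<Rightarrow> complex) \<Rightarrow> ('a \<Rightarrow> complex) \<Rightarrow> 'a \<Rightarrow> complex" where
 "corr f g w = (LBINT x. f (x - w) * g x)"

lemma measurable_conv [measurable]:
 assumes [measurable]: "K \<in> borel_measurable borel" "f \<in> borel_measurable borel"
 shows "conv K f \<in> borel_measurable borel"
 unfolding conv_def by measurable

lemma measurable_corr [measurable]:
 assumes [measurable]: "g \<in> borel_measurable borel" "f \<in> borel_measurable borel"
 shows "corr f g \<in> borel_measurable borel"
 unfolding corr_def by measurable

lemma norm_corr_le:
 assumes "sq_integrable f" "sq_integrable g"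
 shows "norm (corr f g w) \<le> norm2 f * norm2 g"
 using sq_integrable_mult(3)[OF sq_integrable_shift(2)[OF assms(1)] assms(2)]
 by (simp add: corr_def sq_integrable_shift[OF assms(1)])

text \<open>\<open>conv\<close> takes the default value 0 where its integral diverges. The third
  part confines that to a null set, and is what makes \<open>conv\<close> additive in
  \<open>f\<close> almost everywhere.\<close>

lemma conv_sq_integrable:
 fixes K f :: "'a::euclidean_space \<Rightarrow> complex"
 assumes K: "integrable lborel K" and f: "sq_integrable f"
 shows "sq_integrable (conv K f)" "norm2 (conv K f) \<le> (LBINT x. norm (K x)) * norm2 f"
  "AE x in lborel. integrable lborel (\<lambda>y. K (x - y) * f y)"
proof -
 have [measurable]: "K \<in> borel_measurable borel" "f \<in> borel_measurable borel"
  using borel_measurable_integrable[OF K] f by (auto simp: sq_integrable_def)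
 let ?I = "\<lambda>x. \<integral>\<^sup>+y. ennreal (norm (K (x - y))) * ennreal (norm (f y)) \<partial>lborel"
 have Y: "(NN x. (?I x)^2) \<le> ennreal (((LBINT x. norm (K x)) * norm2 f)^2)"
 proof -
  have "(NN x. (?I x)^2) \<le> (NN x. norm (K x))^2 * (NN x. (ennreal (norm (f x)))^2)"
   by (rule young_L1_L2) auto
  also have "\<dots> = ennreal (((LBINT x. norm (K x)) * norm2 f)^2)"
   using K f by (simp add: nn_integral_eq_integral integrable_norm ennreal_power nn_integral_sq_integrable
     power_mult_distrib ennreal_mult)
  finally show ?thesis .
 qed
 have "(NN x. ennreal ((norm (conv K f x))^2)) \<le> (NN x. (?I x)^2)"
 proof (intro nn_integral_mono)
  fix x
  have "ennreal (norm (conv K f x)) \<le> ?I x"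
   unfolding conv_def using norm_integral_le_nn_integral[of lborel "\<lambda>y. K (x - y) * f y"]
   by (simp add: norm_mult ennreal_mult)
  then have "(ennreal (norm (conv K f x)))^2 \<le> (?I x)^2" by (intro power_mono) auto
  then show "ennreal ((norm (conv K f x))^2) \<le> (?I x)^2" by (simp add: ennreal_power)
 qed
 with Y have "(NN x. ennreal ((norm (conv K f x))^2)) \<le> ennreal (((LBINT x. norm (K x)) * norm2 f)^2)"
  by (rule order_trans[rotated])
 from norm2_leI[OF this] show "sq_integrable (conv K f)" "norm2 (conv K f) \<le> (LBINT x. norm (K x)) * norm2 f"
  by auto
 have "(NN x. (?I x)^2) \<noteq> \<infinity>" using Y by (auto simp: top_unique)
 then have "AE x in lborel. (?I x)^2 \<noteq> \<infinity>" by (intro nn_integral_PInf_AE) auto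
 then show "AE x in lborel. integrable lborel (\<lambda>y. K (x - y) * f y)"
 proof (eventually_elim)
  fix x assume "(?I x)^2 \<noteq> \<infinity>"
  then have "?I x < \<infinity>" by (metis ennreal_mult_eq_top_iff ennreal_zero_less_top infinity_ennreal_def less_top not_gr_zero power2_eq_square)
  then show "integrable lborel (\<lambda>y. K (x - y) * f y)"
   unfolding integrable_iff_bounded by (auto simp: norm_mult ennreal_mult)
 qed
qed

text \<open>Fubini after the substitution \<open>y = x - w\<close>. For fixed \<open>w\<close> the
  integral over \<open>x\<close> is bounded by \<open>norm2 f * norm2 g\<close>, so integrability of
  \<open>K\<close> gives absolute convergence.\<close>

lemma conv_pairing:
 fixes K f g :: "'a::euclidean_space \<Rightarrow> complex"
 assumes K: "integrable lborel K" and f: "sq_integrable f" and g: "sq_integrable g"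
 shows "(LBINT x. conv K f x * g x) = (LBINT w. K w * corr f g w)"
proof -
 have [measurable]: "K \<in> borel_measurable borel" "f \<in> borel_measurable borel" "g \<in> borel_measurable borel"
  using borel_measurable_integrable[OF K] f g by (auto simp: sq_integrable_def)
 let ?h = "\<lambda>w x. K w * (f (x - w) * g x)"
 have sh: "(LBINT y. K (x - y) * f y) = (LBINT w. K w * f (x - w))" for x
  using integral_shift(1)[of "\<lambda>w. K w * f (x - w)" x] by simp
 have int: "integrable lborel2 (\<lambda>(w, x). ?h w x)"
  unfolding integrable_iff_bounded
 proof
  have "(\<integral>\<^sup>+p. ennreal (norm (case p of (w, x) \<Rightarrow> ?h w x)) \<partial>lborel2)
   = (NN w. (NN x. ennreal (norm (?h w x))))"
   by (subst lborel.nn_integral_fst[symmetric]) auto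
  also have "\<dots> \<le> (NN w. ennreal (norm (K w)) * ennreal (norm2 f * norm2 g))"
  proof (intro nn_integral_mono)
   fix w
   have "(NN x. ennreal (norm (?h w x))) = ennreal (norm (K w)) * (NN x. ennreal (norm (f (x - w) * g x)))"
    by (subst nn_integral_cmult[symmetric]) (auto simp: norm_mult ennreal_mult)
   also have "(NN x. ennreal (norm (f (x - w) * g x))) \<le> ennreal (norm2 f * norm2 g)"
    using sq_integrable_mult[OF sq_integrable_shift(2)[OF f] g, of w]
    by (subst nn_integral_eq_integral) (auto intro!: integrable_norm ennreal_leI simp: sq_integrable_shift[OF f])
   finally show "(NN x. ennreal (norm (?h w x))) \<le> ennreal (norm (K w)) * ennreal (norm2 f * norm2 g)"
    by (simp add: mult_left_mono)
  qed
  also have "\<dots> < \<infinity>"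
   using K by (subst nn_integral_multc) (auto simp: integrable_iff_bounded ennreal_mult_less_top)
  finally show "(\<integral>\<^sup>+p. ennreal (norm (case p of (w, x) \<Rightarrow> ?h w x)) \<partial>lborel2) < \<infinity>" .
 qed measurable
 have "(LBINT x. conv K f x * g x) = (LBINT x. (LBINT w. ?h w x))"
 proof (rule integral_cong_AE)
  show "AE x in lborel. conv K f x * g x = (LBINT w. ?h w x)"
  proof (rule AE_I2)
   fix x
   have "conv K f x * g x = (LBINT w. K w * f (x - w)) * g x" unfolding conv_def sh ..
   also have "\<dots> = (LBINT w. (K w * f (x - w)) * g x)" by simp
   finally show "conv K f x * g x = (LBINT w. ?h w x)" by (simp add: mult.assoc)
  qed
 qed measurable
 also have "\<dots> = (LBINT w. (LBINT x. ?h w x))"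
  by (rule lborel_pair.Fubini_integral[OF int])
 also have "\<dots> = (LBINT w. K w * corr f g w)"
  by (simp add: corr_def)
 finally show ?thesis .
qed

lemma integrable_corr:
 fixes f g :: "'a::euclidean_space \<Rightarrow> complex"
 assumes f: "integrable lborel f" and g: "integrable lborel g"
 shows "integrable lborel (corr f g)" "integrable lborel2 (\<lambda>(w, x). f (x - w) * g x)"
proof -
 have [measurable]: "f \<in> borel_measurable borel" "g \<in> borel_measurable borel"
  using borel_measurable_integrable[OF f] borel_measurable_integrable[OF g] by auto
 show int: "integrable lborel2 (\<lambda>(w, x). f (x - w) * g x)"
  unfolding integrable_iff_bounded
 proof
  have "(\<integral>\<^sup>+p. ennreal (norm (case p of (w, x) \<Rightarrow> f (x - w) * g x)) \<partial>lborel2)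
   = (NN x. (NN w. ennreal (norm (f (x - w))) * ennreal (norm (g x))))"
   by (subst lborel_pair.nn_integral_snd[symmetric]) (auto simp: norm_mult ennreal_mult)
  also have "\<dots> = (NN x. (NN w. ennreal (norm (f w))) * ennreal (norm (g x)))"
   by (intro nn_integral_cong) (simp add: nn_integral_multc nn_integral_shift(1)[where f = "\<lambda>w. ennreal (norm (f w))"])
  also have "\<dots> < \<infinity>"
   using f g by (subst nn_integral_cmult) (auto simp: integrable_iff_bounded ennreal_mult_less_top)
  finally show "(\<integral>\<^sup>+p. ennreal (norm (case p of (w, x) \<Rightarrow> f (x - w) * g x)) \<partial>lborel2) < \<infinity>" .
 qed measurable
 show "integrable lborel (corr f g)"
  using lborel_pair.integrable_fst'[OF int] by (simp add: corr_def[abs_def])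
qed

subsection \<open>The Fourier transform of integrable functions\<close>

definition fourier :: "('a::euclidean_space \<Rightarrow> complex) \<Rightarrow> 'a \<Rightarrow> complex" where
 "fourier f y = (LBINT x. f x * cis (- (y \<bullet> x)))"

lemma measurable_cis [measurable]: "cis \<in> borel_measurable borel"
 by (intro borel_measurable_continuous_onI continuous_intros)

lemma measurable_fourier [measurable]:
 assumes [measurable]: "f \<in> borel_measurable borel"
 shows "fourier f \<in> borel_measurable borel"
 unfolding fourier_def by measurable

lemma integrable_mult_cis:
 fixes f :: "'a::euclidean_space \<Rightarrow> complex"
 assumes f: "integrable lborel f"
 shows "integrable lborel (\<lambda>x. f x * cis (h \<bullet> x))"
proof -
 have [measurable]: "f \<in> borel_measurable borel" using borel_measurable_integrable[OF f] by simp
 show ?thesis by (rule Bochner_Integration.integrable_bound[OF f]) (auto simp: norm_mult)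
qed

lemma norm_fourier_le:
 assumes f: "integrable lborel f"
 shows "norm (fourier f y) \<le> (LBINT x. norm (f x))"
proof -
 have "norm (fourier f y) \<le> (LBINT x. norm (f x * cis (- (y \<bullet> x))))"
  unfolding fourier_def by (rule integral_norm_bound)
 then show ?thesis by (simp add: norm_mult)
qed

text \<open>The argument \<open>- p\<close> on \<open>f\<close> comes from the absence of a
  conjugate in \<open>corr\<close>; when \<open>g\<close> is the conjugate of \<open>f\<close> the
  product is a squared modulus.\<close>

lemma fourier_corr:
 fixes f g :: "'a::euclidean_space \<Rightarrow> complex"
 assumes f: "integrable lborel f" and g: "integrable lborel g"
 shows "fourier (corr f g) p = fourier g p * fourier f (- p)"
proof -
 have [measurable]: "f \<in> borel_measurable borel" "g \<in> borel_measurable borel"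
  using borel_measurable_integrable[OF f] borel_measurable_integrable[OF g] by auto
 let ?h = "\<lambda>w x. f (x - w) * g x * cis (- (p \<bullet> w))"
 have int: "integrable lborel2 (\<lambda>(w, x). ?h w x)"
  by (rule Bochner_Integration.integrable_bound[OF integrable_corr(2)[OF f g]]) (auto simp: norm_mult)
 have "fourier (corr f g) p = (LBINT w. (LBINT x. ?h w x))"
  unfolding fourier_def corr_def by simp
 also have "\<dots> = (LBINT x. (LBINT w. ?h w x))"
  by (rule lborel_pair.Fubini_integral[OF int, symmetric])
 also have "\<dots> = (LBINT x. (g x * cis (- (p \<bullet> x))) * fourier f (- p))"
 proof (intro LBINT_cong refl)
  fix x
  have "(LBINT w. ?h w x) = (LBINT y. ?h (x - y) x)"
   using integral_shift(1)[of "\<lambda>w. ?h w x" x] by simp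
  also have "\<dots> = (LBINT y. (g x * cis (- (p \<bullet> x))) * (f y * cis (- (- p \<bullet> y))))"
   by (intro LBINT_cong refl) (simp add: inner_diff_right cis_mult mult_ac)
  also have "\<dots> = (g x * cis (- (p \<bullet> x))) * fourier f (- p)"
   unfolding fourier_def by (rule integral_mult_right_zero)
  finally show "(LBINT w. ?h w x) = (g x * cis (- (p \<bullet> x))) * fourier f (- p)" .
 qed
 also have "\<dots> = fourier g p * fourier f (- p)" unfolding fourier_def by simp
 finally show ?thesis .
qed

lemma fourier_cnj: "fourier (\<lambda>x. cnj (f x)) y = cnj (fourier f (- y))"
proof -
 have "cnj (fourier f (- y)) = (LBINT x. cnj (f x * cis (- (- y \<bullet> x))))"
  unfolding fourier_def by (rule Bochner_Integration.integral_cnj[symmetric])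
 also have "\<dots> = fourier (\<lambda>x. cnj (f x)) y"
  unfolding fourier_def by (simp add: cis_cnj)
 finally show ?thesis ..
qed

text \<open>The identity theorem in the form in which formulas are continued here: a computation for
  positive real parameters, where real substitutions are available, extends to the half plane once
  both sides are holomorphic.\<close>

lemma holomorphic_right_half_plane_eqI:
 assumes f: "f holomorphic_on {z. 0 < Re z}" and g: "g holomorphic_on {z. 0 < Re z}"
  and eq: "\<And>t::real. 0 < t \<Longrightarrow> f (of_real t) = g (of_real t)"
  and z: "0 < Re z"
 shows "f z = g z"
proof -
 have "f z - g z = 0"
 proof (rule analytic_continuation[where f = "\<lambda>z. f z - g z" and S = "{z. 0 < Re z}" and U = "complex_of_real ` {0<..}" and \<xi> = 1])
  show "(\<lambda>z. f z - g z) holomorphic_on {z. 0 < Re z}" by (intro holomorphic_intros f g)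
  show "open {z. 0 < Re z}" by (rule open_halfspace_Re_gt)
  show "connected {z. 0 < Re z}" by (intro convex_connected convex_halfspace_Re_gt)
  show "1 islimpt complex_of_real ` {0<..}"
   unfolding islimpt_approachable
  proof (intro allI impI)
   fix e :: real assume "e > 0"
   then show "\<exists>x'\<in>complex_of_real ` {0<..}. x' \<noteq> 1 \<and> dist x' 1 < e"
   proof (intro bexI conjI)
    show "complex_of_real (1 + e / 2) \<in> complex_of_real ` {0<..}" using \<open>e > 0\<close> by (intro imageI) simp
   qed (use \<open>e > 0\<close> in \<open>auto simp: dist_norm norm_divide\<close>)
  qed
 qed (use eq z in auto)
 then show ?thesis by simp
qed

subsection \<open>Gaussians\<close>

text \<open>The one-dimensional heat kernel at complex time \<open>t\<close>. The principal root is
  analytic for \<open>Re t > 0\<close>, and taking \<open>heat\<close> as a product of such factors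
  avoids a choice of branch for the power n / 2 of \<open>t\<close>.\<close>

definition gauss1 :: "complex \<Rightarrow> real \<Rightarrow> complex" where
 "gauss1 t s = exp (- of_real (s^2) / (4 * t)) / csqrt (4 * of_real pi * t)"

definition heat :: "complex \<Rightarrow> real^'n \<Rightarrow> complex" where
 "heat t x = (\<Prod>i\<in>UNIV. gauss1 t (x $ i))"

lemma gaussian_real_integral:
 fixes c :: real
 assumes "c > 0"
 shows "integrable lborel (\<lambda>s. exp (- c * s^2))" "(LBINT s. exp (- c * s^2)) = sqrt (pi / c)"
proof -
 define \<sigma> where "\<sigma> = 1 / sqrt (2 * c)"
 have \<sigma>: "\<sigma> > 0" "\<sigma>^2 = 1 / (2 * c)" using assms by (simp_all add: \<sigma>_def power_divide)
 have e: "exp (- c * s^2) = sqrt (pi / c) * normal_density 0 \<sigma> s" for s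
 proof -
  have "2 * pi * \<sigma>^2 = pi / c" "s^2 / (2 * \<sigma>^2) = c * s^2" unfolding \<sigma>(2) using assms by simp_all
  then have "normal_density 0 \<sigma> s = 1 / sqrt (pi / c) * exp (- (c * s^2))" by (simp add: normal_density_def)
  then show ?thesis using assms by simp
 qed
 show "integrable lborel (\<lambda>s. exp (- c * s^2))" unfolding e using \<sigma> by simp
 show "(LBINT s. exp (- c * s^2)) = sqrt (pi / c)" unfolding e using \<sigma> by simp
qed

lemma gaussian_fourier_1d_real:
 fixes t w :: real
 assumes "t > 0"
 shows "(LBINT s. exp (- of_real t * of_real (s^2)) * cis (w * s)) = 2 * of_real pi * gauss1 (of_real t) w"
proof -
 \<comment> \<open>Rescaling by \<open>c\<close> turns the Gaussian into a multiple of the standard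
   normal density, whose characteristic function is known.\<close>
 define c where "c = 1 / sqrt (2 * t)"
 have c: "c > 0" "c^2 = 1 / (2 * t)" using assms by (simp_all add: c_def power_divide)
 have "(LBINT s. exp (- of_real t * of_real (s^2)) * cis (w * s))
  = \<bar>c\<bar> *\<^sub>R (LBINT s. exp (- of_real t * of_real ((0 + c * s)^2)) * cis (w * (0 + c * s)))"
  using c by (subst lborel_integral_real_affine[where c = c and t = 0]) auto
 also have "(LBINT s. exp (- of_real t * of_real ((0 + c * s)^2)) * cis (w * (0 + c * s)))
  = (LBINT s. of_real (sqrt (2 * pi)) * (std_normal_density s *\<^sub>R iexp ((w * c) * s)))"
 proof (intro LBINT_cong refl)
  fix s
  have "- of_real t * of_real ((0 + c * s)^2) = complex_of_real (- s\<^sup>2 / 2)"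
  proof -
   have "- t * (0 + c * s)^2 = - s\<^sup>2 / 2" using assms c by (simp add: power_mult_distrib)
   then show ?thesis by (metis of_real_minus of_real_mult)
  qed
  then have ee: "exp (- of_real t * of_real ((0 + c * s)^2)) = complex_of_real (exp (- s\<^sup>2 / 2))"
   by (simp only: exp_of_real)
  have dd: "exp (- s\<^sup>2 / 2) = sqrt (2 * pi) * std_normal_density s" by (simp add: std_normal_density_def)
  show "exp (- of_real t * of_real ((0 + c * s)^2)) * cis (w * (0 + c * s)) = of_real (sqrt (2 * pi)) * (std_normal_density s *\<^sub>R iexp ((w * c) * s))"
   unfolding ee dd by (simp add: cis_conv_exp scaleR_conv_of_real mult_ac)
 qed
 also have "\<dots> = of_real (sqrt (2 * pi)) * char std_normal_distribution (w * c)"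
  unfolding integral_mult_right_zero char_def by (subst integral_density) (auto simp: normal_density_nonneg)
 also have "char std_normal_distribution (w * c) = complex_of_real (exp (- (w^2) / (4 * t)))"
  using c by (simp add: char_std_normal_distribution power_mult_distrib)
 finally have F: "(LBINT s. exp (- of_real t * of_real (s^2)) * cis (w * s))
   = \<bar>c\<bar> *\<^sub>R (of_real (sqrt (2 * pi)) * complex_of_real (exp (- (w^2) / (4 * t))))" .
 show ?thesis
 proof -
  have 1: "csqrt (4 * of_real pi * of_real t) = of_real (2 * sqrt pi * sqrt t)"
  proof -
   have "csqrt (4 * of_real pi * of_real t) = csqrt (of_real (4 * pi * t))" by simp
   also have "\<dots> = of_real (sqrt (4 * pi * t))" using assms by (subst csqrt_of_real_nonneg) auto
   finally show ?thesis by (simp add: real_sqrt_mult)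
  qed
  have 2: "gauss1 (of_real t) w = of_real (exp (- (w^2) / (4 * t)) / (2 * sqrt pi * sqrt t))"
   unfolding gauss1_def 1 by (simp add: exp_of_real[symmetric])
  have "c * (sqrt (2 * pi) * exp (- (w^2) / (4 * t))) = 2 * pi * (exp (- (w^2) / (4 * t)) / (2 * sqrt pi * sqrt t))"
  proof -
   have "pi / sqrt pi = sqrt pi" by (simp add: real_div_sqrt)
   moreover have "2 * pi * (E / (2 * sqrt pi * sqrt t)) = (pi / sqrt pi) / sqrt t * E" for E by simp
   ultimately have e: "2 * pi * (E / (2 * sqrt pi * sqrt t)) = sqrt pi / sqrt t * E" for E by (simp only:)
   show ?thesis unfolding e using assms by (simp add: c_def real_sqrt_mult)
  qed
  then have "complex_of_real c * (of_real (sqrt (2 * pi)) * of_real (exp (- (w^2) / (4 * t)))) = 2 * of_real pi * gauss1 (of_real t) w"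
   unfolding 2 by (metis of_real_mult of_real_numeral)
  then show ?thesis unfolding F using \<open>c > 0\<close> by (simp add: scaleR_conv_of_real)
 qed
qed

lemma cmod_exp_gauss: "norm (exp (- t * of_real (s^2))) = exp (- Re t * s^2)"
 by simp

text \<open>Continuation of the real case in \<open>T\<close>; near \<open>a\<close> the integrand
  is dominated by the Gaussian with exponent \<open>Re a / 2\<close>.\<close>

lemma gaussian_fourier_1d:
 fixes T :: complex and w :: real
 assumes "Re T > 0"
 shows "(LBINT s. exp (- T * of_real (s^2)) * cis (w * s)) = 2 * of_real pi * gauss1 T w"
proof (rule holomorphic_right_half_plane_eqI[where f = "\<lambda>T. \<integral>s. exp (- T * of_real (s^2)) * cis (w * s) \<partial>lborel"])
 show "(\<lambda>T. \<integral>s. exp (- T * of_real (s^2)) * cis (w * s) \<partial>lborel) holomorphic_on {z. 0 < Re z}"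
 proof (rule holomorphic_on_parametric_integral)
  fix a :: complex assume a: "a \<in> {z. 0 < Re z}"
  have "norm (exp (- Z * of_real (s^2)) * cis (w * s)) \<le> exp (- (Re a / 2) * s^2)"
   if "dist Z a \<le> Re a / 2" for Z s
  proof -
   have "\<bar>Re Z - Re a\<bar> \<le> Re a / 2"
    using that abs_Re_le_cmod[of "Z - a"] by (simp add: dist_norm)
   then have "Re a / 2 \<le> Re Z" by linarith
   then have "(Re a / 2) * s^2 \<le> Re Z * s^2" by (intro mult_right_mono) auto
   then show ?thesis by (simp only: norm_mult cmod_exp_gauss norm_cis) simp
  qed
  then show "\<exists>r>0. \<exists>g. integrable lborel g \<and>
    (\<forall>Z\<in>{z. 0 < Re z}. dist Z a \<le> r \<longrightarrow> (\<forall>x\<in>space lborel. cmod (exp (- Z * of_real (x^2)) * cis (w * x)) \<le> g x))"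
   using a gaussian_real_integral(1)[of "Re a / 2"] by (intro exI[of _ "Re a / 2"] conjI exI[of _ "\<lambda>s. exp (- (Re a / 2) * s^2)"]) auto
 qed (auto intro!: holomorphic_intros open_halfspace_Re_gt)
 show "(\<lambda>T. 2 * of_real pi * gauss1 T w) holomorphic_on {z. 0 < Re z}"
  unfolding gauss1_def
  by (intro holomorphic_intros) (auto simp: complex_nonpos_Reals_iff mult_le_0_iff not_le)
 show "(LBINT s. exp (- of_real t * of_real (s^2)) * cis (w * s)) = 2 * of_real pi * gauss1 (of_real t) w" if "0 < t" for t :: real
  by (rule gaussian_fourier_1d_real[OF that])
qed (use assms in auto)

lemma prod_Basis_vec:
 fixes g :: "real^'n \<Rightarrow> 'b::comm_monoid_mult"
 shows "(\<Prod>b\<in>Basis. g b) = (\<Prod>i\<in>UNIV. g (axis i 1))"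
proof -
 have "(Basis :: (real^'n) set) = range (\<lambda>i. axis i 1)" by (auto simp: Basis_vec_def)
 moreover have "inj (\<lambda>i. axis i (1::real) :: real^'n)" by (auto simp: inj_on_def axis_eq_axis)
 then have "prod g (range (\<lambda>i. axis i 1)) = (\<Prod>i\<in>UNIV. g (axis i 1))"
  by (subst prod.reindex) auto
 ultimately show ?thesis by (simp only:)
qed

lemma integral_prod_components:
 fixes h :: "'n::finite \<Rightarrow> real \<Rightarrow> complex"
 assumes h: "\<And>i. integrable lborel (h i)"
 shows "integrable lborel (\<lambda>x::real^'n. \<Prod>i\<in>UNIV. h i (x $ i))"
  and "(\<integral>x. (\<Prod>i\<in>UNIV. h i (x $ i)) \<partial>(lborel :: (real^'n) measure)) = (\<Prod>i\<in>UNIV. \<integral>s. h i s \<partial>lborel)"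
proof -
 interpret P: product_sigma_finite "\<lambda>b::real^'n. lborel :: real measure" by standard
 \<comment> \<open>Lebesgue measure is the image of a product measure indexed by basis vectors, not
   by coordinates; \<open>k\<close> reindexes \<open>h\<close> accordingly.\<close>
 define k where "k b = h (THE i. b = axis i (1::real))" for b :: "real^'n"
 have k: "k (axis i 1) = h i" for i by (simp add: k_def axis_eq_axis)
 have hm[measurable]: "h i \<in> borel_measurable borel" for i using borel_measurable_integrable[OF h[of i]] by simp
 have ki: "integrable lborel (k b)" for b unfolding k_def by (rule h)
 have km[measurable]: "k b \<in> borel_measurable borel" for b using borel_measurable_integrable[OF ki[of b]] by simp
 have e: "(\<Prod>i\<in>UNIV. h i (x $ i)) = (\<Prod>b\<in>Basis. k b (x \<bullet> b))" for x :: "real^'n"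
  by (simp add: prod_Basis_vec k inner_axis)
 let ?T = "\<lambda>f. \<Sum>b\<in>Basis. f b *\<^sub>R (b::real^'n)"
 have eT: "(\<Prod>b\<in>Basis. k b (?T f \<bullet> b)) = (\<Prod>b\<in>Basis. k b (f b))" for f
  by (intro prod.cong) auto
 have Tm: "?T \<in> (\<Pi>\<^sub>M b\<in>Basis. lborel) \<rightarrow>\<^sub>M borel" by measurable
 have Pm: "(\<lambda>x::real^'n. \<Prod>b\<in>Basis. k b (x \<bullet> b)) \<in> borel_measurable borel" by measurable
 have "integrable (\<Pi>\<^sub>M b\<in>Basis. lborel) (\<lambda>f. \<Prod>b\<in>Basis. k b (f b))"
  by (rule P.product_integrable_prod) (auto intro: ki)
 then show "integrable lborel (\<lambda>x::real^'n. \<Prod>i\<in>UNIV. h i (x $ i))"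
  unfolding e lborel_eq[where 'a = "real^'n"] integrable_distr_eq[OF Tm Pm] eT .
 have "(\<integral>x. (\<Prod>i\<in>UNIV. h i (x $ i)) \<partial>(lborel :: (real^'n) measure)) = (\<integral>f. (\<Prod>b\<in>Basis. k b (f b)) \<partial>(\<Pi>\<^sub>M b\<in>Basis. lborel))"
  unfolding e lborel_eq[where 'a = "real^'n"] integral_distr[OF Tm Pm] eT ..
 also have "\<dots> = (\<Prod>b\<in>Basis. \<integral>s. k b s \<partial>lborel)"
  by (rule P.product_integral_prod) (auto intro: ki)
 also have "\<dots> = (\<Prod>i\<in>UNIV. \<integral>s. h i s \<partial>lborel)" by (simp add: prod_Basis_vec k)
 finally show "(\<integral>x. (\<Prod>i\<in>UNIV. h i (x $ i)) \<partial>(lborel :: (real^'n) measure)) = (\<Prod>i\<in>UNIV. \<integral>s. h i s \<partial>lborel)" .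
qed

lemma csqrt_measurable [measurable]: "csqrt \<in> borel_measurable borel"
proof -
 have "(\<lambda>z. if z = 0 then 0 else exp (Ln z / 2)) \<in> borel_measurable borel" by measurable
 also have "(\<lambda>z. if z = 0 then 0 else exp (Ln z / 2)) = csqrt"
  by (auto simp: fun_eq_iff csqrt_exp_Ln)
 finally show ?thesis .
qed

lemma exp_gauss_integrable:
 assumes "Re t > 0"
 shows "integrable lborel (\<lambda>s. exp (- t * of_real (s^2)) * cis (w * s))"
 by (rule Bochner_Integration.integrable_bound[OF gaussian_real_integral(1)[OF assms]])
  (auto simp: norm_mult)

lemma norm_sq_vec: "(norm (x :: real^'n))^2 = (\<Sum>i\<in>UNIV. (x $ i)^2)"
 by (simp add: norm_vec_def L2_set_def sum_nonneg)

lemma exp_gauss_prod: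
 "exp (- t * of_real ((norm y)^2)) * cis (w \<bullet> y) = (\<Prod>i\<in>UNIV. exp (- t * of_real ((y $ i)^2)) * cis (w $ i * y $ i))"
 for y w :: "real^'n"
proof -
 have "cis (w \<bullet> y) = (\<Prod>i\<in>UNIV. cis (w $ i * y $ i))"
  by (simp add: inner_vec_def cis_conv_exp exp_sum sum_distrib_left)
 moreover have "exp (- t * of_real ((norm y)^2)) = (\<Prod>i\<in>UNIV. exp (- t * of_real ((y $ i)^2)))"
  unfolding norm_sq_vec of_real_sum sum_distrib_left by (rule exp_sum) simp
 ultimately show ?thesis by (simp add: prod.distrib)
qed

lemma gaussian_fourier:
 fixes w :: "real^'n"
 assumes "Re t > 0"
 shows "(LBINT y. exp (- t * of_real ((norm y)^2)) * cis (w \<bullet> y)) = of_real ((2 * pi) ^ CARD('n)) * heat t w"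
  and "integrable lborel (\<lambda>y::real^'n. exp (- t * of_real ((norm y)^2)) * cis (w \<bullet> y))"
proof -
 have i: "integrable lborel (\<lambda>s. exp (- t * of_real (s^2)) * cis (w $ i * s))" for i
  by (rule exp_gauss_integrable[OF assms])
 show "integrable lborel (\<lambda>y::real^'n. exp (- t * of_real ((norm y)^2)) * cis (w \<bullet> y))"
  unfolding exp_gauss_prod by (rule integral_prod_components(1)[OF i])
 show "(LBINT y. exp (- t * of_real ((norm y)^2)) * cis (w \<bullet> y)) = of_real ((2 * pi) ^ CARD('n)) * heat t w"
  unfolding exp_gauss_prod integral_prod_components(2)[OF i] gaussian_fourier_1d[OF assms] heat_def
  by (simp add: prod.distrib)
qed

lemma norm_gauss1:
 assumes "Re t > 0"
 shows "norm (gauss1 t s) = exp (- (Re t / (4 * (norm t)^2)) * s^2) / (2 * sqrt pi * sqrt (norm t))"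
proof -
 have "Re (- of_real (s^2) / (4 * t)) = - (Re t / (4 * (norm t)^2)) * s^2"
 proof -
  have "- of_real (s^2) / (4 * t) = of_real (- s\<^sup>2 / 4) * inverse t" using assms by (auto simp: field_simps)
  then have "Re (- of_real (s^2) / (4 * t)) = (- s\<^sup>2 / 4) * Re (inverse t)" by (simp only: Re_complex_of_real Im_complex_of_real times_complex.sel)
  also have "Re (inverse t) = Re t / (norm t)^2" by (simp add: cmod_power2)
  finally show ?thesis by simp
 qed
 moreover have "norm (csqrt (4 * of_real pi * t)) = 2 * sqrt pi * sqrt (norm t)"
  by (simp add: norm_mult real_sqrt_mult)
 ultimately show ?thesis by (simp add: gauss1_def norm_divide)
qed

lemma gauss1_measurable [measurable]: "gauss1 t \<in> borel_measurable borel"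
 unfolding gauss1_def by measurable

lemma heat_measurable [measurable]: "heat t \<in> borel_measurable borel"
 unfolding heat_def by measurable

lemma gauss1_integrable:
 assumes "Re t > 0"
 shows "integrable lborel (gauss1 t)" "(LBINT s. norm (gauss1 t s)) = sqrt (norm t / Re t)"
proof -
 define a where "a = Re t / (4 * (norm t)^2)"
 have n: "norm t > 0" using assms by auto
 have a: "a > 0" using assms n by (simp add: a_def)
 have i: "integrable lborel (\<lambda>s. exp (- a * s^2) / (2 * sqrt pi * sqrt (norm t)))"
  using gaussian_real_integral(1)[OF a] by simp
 show "integrable lborel (gauss1 t)"
  by (rule Bochner_Integration.integrable_bound[OF i]) (auto simp: norm_gauss1[OF assms] a_def)
 have "(LBINT s. norm (gauss1 t s)) = (LBINT s. exp (- a * s^2)) / (2 * sqrt pi * sqrt (norm t))"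
  unfolding norm_gauss1[OF assms] a_def[symmetric] by (rule integral_divide_zero)
 also have "\<dots> = sqrt (pi / a) / (2 * sqrt pi * sqrt (norm t))" unfolding gaussian_real_integral(2)[OF a] ..
 also have "\<dots> = sqrt (norm t / Re t)"
 proof -
  have "pi / a = pi * (4 * (norm t)^2 / Re t)" by (simp add: a_def)
  then have "sqrt (pi / a) = sqrt pi * (2 * norm t / sqrt (Re t))"
   using n by (simp only: real_sqrt_mult real_sqrt_divide) simp
  moreover have "norm t = sqrt (norm t) * sqrt (norm t)" using n by simp
  ultimately have "sqrt (pi / a) / (2 * sqrt pi * sqrt (norm t)) = (sqrt pi * (2 * (sqrt (norm t) * sqrt (norm t)) / sqrt (Re t))) / (2 * sqrt pi * sqrt (norm t))"
   by metis
  also have "\<dots> = sqrt (norm t) / sqrt (Re t)" using n assms by (simp add: field_simps)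
  finally show ?thesis by (simp add: real_sqrt_divide)
 qed
 finally show "(LBINT s. norm (gauss1 t s)) = sqrt (norm t / Re t)" .
qed

lemma heat_integrable:
 assumes "Re t > 0"
 shows "integrable lborel (heat t :: real^'n \<Rightarrow> complex)"
  "(LBINT x. norm (heat t (x::real^'n))) = sqrt (norm t / Re t) ^ CARD('n)"
proof -
 show "integrable lborel (heat t :: real^'n \<Rightarrow> complex)"
  unfolding heat_def by (rule integral_prod_components(1)[OF gauss1_integrable(1)[OF assms]])
 have i: "integrable lborel (\<lambda>s. complex_of_real (norm (gauss1 t s)))"
  using gauss1_integrable(1)[OF assms] by (intro integrable_of_real integrable_norm)
 have "complex_of_real (LBINT x. norm (heat t (x::real^'n))) = (LBINT x. complex_of_real (norm (heat t (x::real^'n))))"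
  by simp
 also have "\<dots> = (LBINT x. (\<Prod>i\<in>UNIV. complex_of_real (norm (gauss1 t ((x::real^'n) $ i)))))"
  by (simp add: heat_def prod_norm[symmetric])
 also have "\<dots> = complex_of_real (sqrt (norm t / Re t) ^ CARD('n))"
  unfolding integral_prod_components(2)[OF i] integral_complex_of_real gauss1_integrable(2)[OF assms] by simp
 finally show "(LBINT x. norm (heat t (x::real^'n))) = sqrt (norm t / Re t) ^ CARD('n)"
  by (simp only: of_real_eq_iff)
qed

text \<open>Parseval against a Gaussian: \<open>gaussian_fourier\<close> represents
  \<open>heat t\<close> as a Fourier integral, and Fubini moves the transform to \<open>C\<close>.
  Bessel's inequality, inversion at the origin and both kernel formulas rest on this
  identity.\<close>

lemma heat_pairing:
 fixes C :: "real^'n \<Rightarrow> complex"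
 assumes t: "Re t > 0" and C: "integrable lborel C"
 shows "of_real ((2 * pi) ^ CARD('n)) * (LBINT w. heat t w * C w) = (LBINT y. exp (- t * of_real ((norm y)^2)) * fourier C y)"
proof -
 have [measurable]: "C \<in> borel_measurable borel" using borel_measurable_integrable[OF C] by simp
 let ?h = "\<lambda>w y. (exp (- t * of_real ((norm y)^2)) * cis (w \<bullet> y)) * C w"
 have g: "integrable lborel (\<lambda>y::real^'n. exp (- t * of_real ((norm y)^2)))"
  using gaussian_fourier(2)[OF t, of 0] by simp
 have int: "integrable lborel2 (\<lambda>(w, y). ?h w y)"
  unfolding integrable_iff_bounded
 proof
  have "(\<integral>\<^sup>+p. ennreal (norm (case p of (w, y) \<Rightarrow> ?h w y)) \<partial>lborel2)
   = (NN w. (NN y. ennreal (norm (exp (- t * of_real ((norm (y::real^'n))^2)))) * ennreal (norm (C w))))"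
   by (subst lborel.nn_integral_fst[symmetric]) (auto simp: norm_mult ennreal_mult)
  also have "\<dots> = (NN y. ennreal (norm (exp (- t * of_real ((norm (y::real^'n))^2))))) * (NN w. ennreal (norm (C w)))"
   by (subst nn_integral_multc, measurable)+ (subst nn_integral_cmult, auto)
  also have "\<dots> < \<infinity>"
   using C g by (auto simp: integrable_iff_bounded ennreal_mult_less_top)
  finally show "(\<integral>\<^sup>+p. ennreal (norm (case p of (w, y) \<Rightarrow> ?h w y)) \<partial>lborel2) < \<infinity>" .
 qed measurable
 have "of_real ((2 * pi) ^ CARD('n)) * (LBINT w. heat t w * C w) = (LBINT w. (of_real ((2 * pi) ^ CARD('n)) * heat t w) * C w)"
  unfolding mult.assoc by (rule integral_mult_right_zero[symmetric])
 also have "\<dots> = (LBINT w. (LBINT y. ?h w y))"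
  unfolding gaussian_fourier(1)[OF t, symmetric] by simp
 also have "\<dots> = (LBINT y. (LBINT w. ?h w y))"
  by (rule lborel_pair.Fubini_integral[OF int, symmetric])
 also have "\<dots> = (LBINT y. exp (- t * of_real ((norm (0 - y))^2)) * fourier C (0 - y))"
 proof (intro LBINT_cong refl)
  fix y :: "real^'n"
  have "?h w y = exp (- t * of_real ((norm (0 - y))^2)) * (C w * cis (- ((0 - y) \<bullet> w)))" for w
   by (simp add: inner_commute)
  then show "(LBINT w. ?h w y) = exp (- t * of_real ((norm (0 - y))^2)) * fourier C (0 - y)"
   unfolding fourier_def by (simp only: integral_mult_right_zero)
 qed
 also have "\<dots> = (LBINT y. exp (- t * of_real ((norm y)^2)) * fourier C y)"
  by (rule integral_shift(1)[of "\<lambda>y. exp (- t * of_real ((norm y)^2)) * fourier C y" 0]) measurable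
 finally show ?thesis .
qed

text \<open>The upper bound in Plancherel. The transform of the autocorrelation \<open>C\<close> is
  the reflected squared modulus of the transform of \<open>f\<close>, \<open>C\<close> is bounded by
  the square of \<open>norm2 f\<close>, and at real time the heat kernel has L1 norm 1. So
  \<open>heat_pairing\<close> bounds the Gaussian means of that squared modulus, and Fatou removes
  the Gaussian.\<close>

lemma bessel_inequality:
 fixes f :: "real^'n \<Rightarrow> complex"
 assumes f1: "integrable lborel f" and f2: "sq_integrable f"
 shows "sq_integrable (fourier f)" "norm2 (fourier f) \<le> sqrt ((2 * pi) ^ CARD('n)) * norm2 f"
proof -
 have [measurable]: "f \<in> borel_measurable borel" using f2 by (simp add: sq_integrable_def)
 define C where "C = corr f (\<lambda>x. cnj (f x))"
 have fc: "integrable lborel (\<lambda>x. cnj (f x))" using f1 by simp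
 have C: "integrable lborel C" unfolding C_def by (rule integrable_corr(1)[OF f1 fc])
 have FC: "fourier C y = of_real ((norm (fourier f (- y)))^2)" for y
  unfolding C_def fourier_corr[OF f1 fc] fourier_cnj by (simp only: complex_norm_square mult.commute)
 have bd: "norm (C w) \<le> (norm2 f)^2" for w
  using norm_corr_le[OF f2 sq_integrable_cnj(1)[OF f2], of w] by (simp add: C_def sq_integrable_cnj(2) power2_eq_square)
 define B where "B = (2 * pi) ^ CARD('n) * (norm2 f)^2"
 have B0: "0 \<le> B" by (simp add: B_def)
 have le: "(NN y. ennreal (exp (- (1 / real (Suc k)) * (norm y)^2) * (norm (fourier f (- y)))^2)) \<le> ennreal B" for k
 proof -
  define t where "t = 1 / real (Suc k)"
  have t: "t > 0" by (simp add: t_def)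
  have tr: "Re (complex_of_real t) > 0" using t by simp
  define I where "I = (LBINT y. exp (- t * (norm y)^2) * (norm (fourier f (- y)))^2)"
  have "integrable lborel (\<lambda>y::real^'n. exp (- of_real t * of_real ((norm y)^2)) :: complex)"
   using gaussian_fourier(2)[OF tr, of 0] by simp
  then have "integrable lborel (\<lambda>y::real^'n. norm (exp (- of_real t * of_real ((norm y)^2)) :: complex))" by (rule integrable_norm)
  then have i0: "integrable lborel (\<lambda>y::real^'n. exp (- t * (norm y)^2))" by simp
  define M where "M = (LBINT x. norm (f x))"
  have i: "integrable lborel (\<lambda>y::real^'n. exp (- t * (norm y)^2) * (norm (fourier f (- y)))^2)"
  proof (rule Bochner_Integration.integrable_bound)
   show "integrable lborel (\<lambda>y::real^'n. exp (- t * (norm y)^2) * M^2)" using i0 by simp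
   show "AE y in lborel. norm (exp (- t * (norm y)^2) * (norm (fourier f (- y)))^2) \<le> norm (exp (- t * (norm y)^2) * M^2)"
    using norm_fourier_le[OF f1] by (intro AE_I2) (auto simp: abs_mult M_def intro!: mult_left_mono power_mono)
  qed measurable
  have "complex_of_real I = (LBINT y. exp (- of_real t * of_real ((norm y)^2)) * fourier C y)"
   unfolding I_def FC integral_complex_of_real[symmetric] by (simp add: exp_of_real[symmetric])
  also have "\<dots> = of_real ((2 * pi) ^ CARD('n)) * (LBINT w. heat (of_real t) w * C w)"
   by (rule heat_pairing[OF tr C, symmetric])
  finally have "norm (complex_of_real I) = norm (of_real ((2 * pi) ^ CARD('n)) * (LBINT w. heat (of_real t) w * C w))"
   by simp
  also have "\<dots> = (2 * pi) ^ CARD('n) * norm (LBINT w. heat (of_real t) w * C w)"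
   by (simp add: norm_mult norm_power)
  also have "\<dots> \<le> (2 * pi) ^ CARD('n) * (LBINT w. norm (heat (of_real t) (w::real^'n)) * (norm2 f)^2)"
  proof (intro mult_left_mono)
   have "norm (LBINT w. heat (of_real t) w * C w) \<le> (LBINT w. norm (heat (of_real t) w * C w))" by (rule integral_norm_bound)
   also have "\<dots> \<le> (LBINT w. norm (heat (of_real t) (w::real^'n)) * (norm2 f)^2)"
   proof (rule integral_mono)
    show j: "integrable lborel (\<lambda>w. norm (heat (of_real t) (w::real^'n)) * (norm2 f)^2)"
     using heat_integrable(1)[OF tr] by (intro integrable_mult_left integrable_norm)
    have Cm[measurable]: "C \<in> borel_measurable borel" using borel_measurable_integrable[OF C] by simp
    show "integrable lborel (\<lambda>w. norm (heat (of_real t) w * C w))"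
     by (rule Bochner_Integration.integrable_bound[OF j]) (auto simp: norm_mult intro!: mult_left_mono bd)
   qed (auto simp: norm_mult intro!: mult_left_mono bd)
   finally show "norm (LBINT w. heat (of_real t) w * C w) \<le> (LBINT w. norm (heat (of_real t) (w::real^'n)) * (norm2 f)^2)" .
  qed simp
  also have "\<dots> = B" using t by (simp add: heat_integrable(2)[OF tr] B_def)
  finally have "I \<le> B" by simp
  moreover have "(NN y. ennreal (exp (- t * (norm y)^2) * (norm (fourier f (- y)))^2)) = ennreal I"
   unfolding I_def by (rule nn_integral_eq_integral[OF i]) auto
  ultimately show ?thesis unfolding t_def by (simp add: ennreal_leI)
 qed
 have "(NN y. ennreal ((norm (fourier f (0 - y)))^2))
  \<le> (NN y. liminf (\<lambda>k. ennreal (exp (- (1 / real (Suc k)) * (norm y)^2) * (norm (fourier f (- y)))^2)))"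
 proof (rule nn_integral_mono)
  fix y :: "real^'n"
  have "(\<lambda>k. ennreal (exp (- (1 / real (Suc k)) * (norm y)^2) * (norm (fourier f (- y)))^2)) \<longlonglongrightarrow> ennreal (exp (- 0 * (norm y)^2) * (norm (fourier f (- y)))^2)"
   using LIMSEQ_inverse_real_of_nat by (intro tendsto_intros) (simp_all add: inverse_eq_divide)
  from lim_imp_Liminf[OF _ this] show "ennreal ((norm (fourier f (0 - y)))^2) \<le> liminf (\<lambda>k. ennreal (exp (- (1 / real (Suc k)) * (norm y)^2) * (norm (fourier f (- y)))^2))"
   by simp
 qed
 also have "\<dots> \<le> liminf (\<lambda>k. \<integral>\<^sup>+y. ennreal (exp (- (1 / real (Suc k)) * (norm y)^2) * (norm (fourier f (- y)))^2) \<partial>lborel)"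
  by (rule nn_integral_liminf) measurable
 also have "\<dots> \<le> ennreal B"
  by (rule order_trans[OF Liminf_mono[OF always_eventually[OF allI[OF le]]]]) (simp add: Liminf_const)
 also have "(NN y. ennreal ((norm (fourier f (0 - y)))^2)) = (NN y. ennreal ((norm (fourier f y))^2))"
  by (rule nn_integral_shift(1)) measurable
 also have "B = (sqrt ((2 * pi) ^ CARD('n)) * norm2 f)^2" by (simp add: B_def power_mult_distrib)
 finally have *: "(NN y. ennreal ((norm (fourier f y))^2)) \<le> ennreal ((sqrt ((2 * pi) ^ CARD('n)) * norm2 f)^2)" .
 show "sq_integrable (fourier f)" "norm2 (fourier f) \<le> sqrt ((2 * pi) ^ CARD('n)) * norm2 f"
  by (rule norm2_leI[OF *]; simp)+
qed

subsection \<open>A dyadic Carleson embedding\<close>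

text \<open>A tree of height \<open>j\<close> with root \<open>q\<close>: \<open>p\<close> maps a
  node to its parent one level up. The value adds \<open>b i * (v i q')^2\<close> over all
  descendants \<open>q'\<close> of \<open>q\<close>, itself included, at the levels \<open>i\<close>
  from 1 to \<open>j\<close>; level 0 carries no term.\<close>

primrec tree_sum :: "('q \<Rightarrow> 'q) \<Rightarrow> (nat \<Rightarrow> real) \<Rightarrow> (nat \<Rightarrow> 'q \<Rightarrow> real) \<Rightarrow> nat \<Rightarrow> 'q \<Rightarrow> real" where
 "tree_sum p b v 0 q = 0"
| "tree_sum p b v (Suc j) q = b (Suc j) * (v (Suc j) q)^2 + (\<Sum>q'\<in>p -` {q}. tree_sum p b v j q')"

lemma tree_sum_nonneg: "(\<And>j. 0 \<le> b j) \<Longrightarrow> 0 \<le> tree_sum p b v j q"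
 by (induction j arbitrary: q) (auto intro!: add_nonneg_nonneg sum_nonneg)

text \<open>Joint convexity and homogeneity of m^2 / v. As division by 0 gives 0, the second
  assumption excludes the terms that would have to be infinite.\<close>

lemma sum_sq_div_ge:
 fixes m v :: "'a \<Rightarrow> real"
 assumes "\<And>c. c \<in> S \<Longrightarrow> 0 \<le> v c" "\<And>c. c \<in> S \<Longrightarrow> v c = 0 \<Longrightarrow> m c = 0"
 shows "(\<Sum>c\<in>S. m c)^2 / (\<Sum>c\<in>S. v c) \<le> (\<Sum>c\<in>S. (m c)^2 / v c)"
proof (cases "(\<Sum>c\<in>S. v c) > 0")
 case True
 have "(\<Sum>c\<in>S. m c) = (\<Sum>c\<in>S. (m c / sqrt (v c)) * sqrt (v c))"
  using assms by (intro sum.cong) auto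
 then have "(\<Sum>c\<in>S. m c)^2 \<le> (\<Sum>c\<in>S. (m c / sqrt (v c))^2) * (\<Sum>c\<in>S. (sqrt (v c))^2)"
  by (simp only: Cauchy_Schwarz_ineq_sum)
 also have "\<dots> = (\<Sum>c\<in>S. (m c)^2 / v c) * (\<Sum>c\<in>S. v c)"
  using assms by (intro arg_cong2[where f = "(*)"] sum.cong) (auto simp: power_divide)
 finally show ?thesis using True by (simp add: pos_divide_le_eq)
next
 case False
 moreover have "(\<Sum>c\<in>S. v c) \<ge> 0" using assms by (intro sum_nonneg)
 ultimately have "(\<Sum>c\<in>S. v c) = 0" by simp
 then show ?thesis using assms by (auto intro!: sum_nonneg)
qed

text \<open>The summand \<open>4 * D\<^sup>2 * m\<^sup>2 / (D * w + A)\<close> is the Bellman function of the problem.\<close>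

lemma carleson_bellman:
 fixes w m F :: "nat \<Rightarrow> 'q \<Rightarrow> real" and b :: "nat \<Rightarrow> real"
 assumes D: "D > 0" and b: "\<And>j. 0 \<le> b j"
  and w0: "\<And>j q. 0 \<le> w j q" and F0: "\<And>j q. 0 \<le> F j q"
  and wS: "\<And>j q. w (Suc j) q = (\<Sum>q'\<in>p -` {q}. w j q')"
  and mS: "\<And>j q. m (Suc j) q = (\<Sum>q'\<in>p -` {q}. m j q')"
  and FS: "\<And>j q. F (Suc j) q = (\<Sum>q'\<in>p -` {q}. F j q')"
  and CS: "\<And>j q. (m j q)^2 \<le> F j q * w j q"
  and test: "\<And>j q. tree_sum p b w j q \<le> D * w j q"
 shows "tree_sum p b m j q + 4 * D^2 * (m j q)^2 / (D * w j q + tree_sum p b w j q) \<le> 4 * D * F j q"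
proof (induction j arbitrary: q)
 case 0
 show ?case
 proof (cases "w 0 q = 0")
  case True
  then have "m 0 q = 0" using CS[of 0 q] by simp
  then show ?thesis using D F0[of 0 q] by simp
 next
  case False
  then have "w 0 q > 0" using w0[of 0 q] by simp
  then show ?thesis using CS[of 0 q] D by (simp add: field_simps power2_eq_square)
 qed
next
 case (Suc j)
 let ?S = "p -` {q}" and ?A = "tree_sum p b w"
 define B where "B = (\<Sum>c\<in>?S. D * w j c + ?A j c)"
 define W where "W = w (Suc j) q"
 define M where "M = m (Suc j) q"
 define \<beta> where "\<beta> = b (Suc j)"
 have A0: "0 \<le> ?A j c" for c by (rule tree_sum_nonneg[OF b])
 have B: "D * W + ?A (Suc j) q = B + \<beta> * W^2"
  by (simp add: W_def B_def \<beta>_def wS sum.distrib sum_distrib_left)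
 \<comment> \<open>From children to parent: convexity of the Bellman function, before the parent's
   own term \<open>\<beta> * W^2\<close> enters its denominator.\<close>
 have "M^2 / B \<le> (\<Sum>c\<in>?S. (m j c)^2 / (D * w j c + ?A j c))"
  unfolding M_def mS B_def
 proof (rule sum_sq_div_ge)
  fix c
  show "0 \<le> D * w j c + ?A j c" using D w0 A0 by simp
  assume "D * w j c + ?A j c = 0"
  then have "w j c = 0" using D w0[of j c] A0[of c] by (simp add: add_nonneg_eq_0_iff)
  then show "m j c = 0" using CS[of j c] by simp
 qed
 then have "4 * D^2 * (M^2 / B) \<le> 4 * D^2 * (\<Sum>c\<in>?S. (m j c)^2 / (D * w j c + ?A j c))"
  by (intro mult_left_mono) auto
 also have "\<dots> = (\<Sum>c\<in>?S. 4 * D^2 * (m j c)^2 / (D * w j c + ?A j c))"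
  by (simp add: sum_distrib_left)
 finally have 1: "4 * D^2 * M^2 / B \<le> (\<Sum>c\<in>?S. 4 * D^2 * (m j c)^2 / (D * w j c + ?A j c))" by simp
 have "(\<Sum>c\<in>?S. tree_sum p b m j c) + (\<Sum>c\<in>?S. 4 * D^2 * (m j c)^2 / (D * w j c + ?A j c)) \<le> (\<Sum>c\<in>?S. 4 * D * F j c)"
  unfolding sum.distrib[symmetric] by (intro sum_mono Suc)
 with 1 have 2: "(\<Sum>c\<in>?S. tree_sum p b m j c) + 4 * D^2 * M^2 / B \<le> 4 * D * F (Suc j) q"
  by (simp add: FS sum_distrib_left)
 \<comment> \<open>Raising the denominator from \<open>B\<close> to \<open>B + \<beta> * W^2\<close>
   lowers the Bellman function by
   \<open>4 * D^2 * M^2 * \<beta> * W^2 / (B * (B + \<beta> * W^2))\<close>. The testing condition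
   keeps both factors of this denominator below \<open>2 * D * W\<close>, so the drop pays for the
   new term \<open>\<beta> * M^2\<close>; this is the origin of the factor 4.\<close>
 have 3: "\<beta> * M^2 + 4 * D^2 * M^2 / (B + \<beta> * W^2) \<le> 4 * D^2 * M^2 / B"
 proof (cases "M = 0")
  case False
  have "W > 0" using False CS[of "Suc j" q] w0[of "Suc j" q] by (cases "W = 0") (auto simp: M_def W_def)
  have "B \<ge> D * W" using A0 by (simp add: B_def W_def wS sum.distrib sum_distrib_left[symmetric] sum_nonneg)
  moreover have "D * W > 0" using D \<open>W > 0\<close> by simp
  ultimately have "B > 0" by linarith
  have \<beta>: "0 \<le> \<beta>" using b by (simp add: \<beta>_def)
  have le: "B + \<beta> * W^2 \<le> 2 * D * W" using test[of "Suc j" q] B by (simp add: W_def)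
  have "B * (B + \<beta> * W^2) \<le> (2 * D * W) * (2 * D * W)"
  proof (intro mult_mono le)
   have "0 \<le> \<beta> * W^2" using \<beta> by simp
   then show "B \<le> 2 * D * W" "0 \<le> B + \<beta> * W^2" "0 \<le> 2 * D * W" using le \<open>B > 0\<close> by linarith+
  qed
  then have "\<beta> * M^2 * (B * (B + \<beta> * W^2)) \<le> \<beta> * M^2 * ((2 * D * W) * (2 * D * W))"
   using \<beta> by (intro mult_left_mono) auto
  moreover have "B + \<beta> * W^2 > 0" using \<beta> \<open>B > 0\<close> by (simp add: add_pos_nonneg)
  ultimately show ?thesis using \<open>B > 0\<close>
   by (simp add: field_simps power2_eq_square)
 qed simp
 have T: "tree_sum p b m (Suc j) q = \<beta> * M^2 + (\<Sum>c\<in>?S. tree_sum p b m j c)"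
  by (simp add: \<beta>_def M_def)
 show ?case unfolding T M_def[symmetric] W_def[symmetric] B using 2 3 by linarith
qed

subsection \<open>Dyadic cubes\<close>

text \<open>A cube of side 2^k is handled by its integer index, so that all scales share one index
  type and nesting is the map \<open>parent_index\<close>. Integer division rounds down, which is
  right for negative indices too.\<close>

definition cube_index :: "int \<Rightarrow> real^'n \<Rightarrow> int^'n" where
 "cube_index k x = (\<chi> i. \<lfloor>x $ i / 2 powi k\<rfloor>)"

definition parent_index :: "int^'n \<Rightarrow> int^'n" where
 "parent_index m = (\<chi> i. m $ i div 2)"

lemma mem_dyadic_cube: "x \<in> dyadic_cube k m \<longleftrightarrow> cube_index k x = m"
 by (auto simp: dyadic_cube_def cube_index_def vec_eq_iff floor_eq_iff field_simps)

lemma parent_cube_index: "parent_index (cube_index k x) = cube_index (k + 1) x"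
proof -
 have "\<lfloor>a / 2 powi k\<rfloor> div 2 = \<lfloor>a / 2 powi (k + 1)\<rfloor>" for a :: real
  using floor_divide_real_eq_div[of 2 "a / 2 powi k"] by (simp add: power_int_add)
 then show ?thesis by (simp add: parent_index_def cube_index_def vec_eq_iff)
qed

lemma borel_dyadic_cube [measurable]: "dyadic_cube k (m :: int^'n) \<in> sets borel"
proof -
 have "dyadic_cube k m = (\<Inter>i. {x \<in> space borel. of_int (m $ i) * 2 powi k \<le> x $ i \<and> x $ i < (of_int (m $ i) + 1) * 2 powi k})"
  by (auto simp: dyadic_cube_def)
 also have "\<dots> \<in> sets borel" by (intro sets.finite_INT) measurable
 finally show ?thesis .
qed

lemma measurable_cube_index [measurable]: "cube_index k \<in> borel \<rightarrow>\<^sub>M count_space (UNIV :: (int^'n::finite) set)"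
proof (subst measurable_count_space_eq_countable[OF countableI_type], intro conjI ballI)
 fix m :: "int^'n"
 have "cube_index k -` {m} \<inter> space borel = dyadic_cube k m" by (auto simp: mem_dyadic_cube)
 then show "cube_index k -` {m} \<inter> space borel \<in> sets borel" by simp
qed auto

lemma finite_parent_vimage: "finite (parent_index -` {m :: int^'n})"
proof (rule finite_subset)
 show "parent_index -` {m} \<subseteq> vec_lambda ` (PiE UNIV (\<lambda>i. {2 * m $ i .. 2 * m $ i + 1}))"
 proof
  fix m' assume "m' \<in> parent_index -` {m}"
  then have "($) m' \<in> PiE UNIV (\<lambda>i. {2 * m $ i .. 2 * m $ i + 1})"
   by (auto simp: parent_index_def)
  then show "m' \<in> vec_lambda ` (PiE UNIV (\<lambda>i. {2 * m $ i .. 2 * m $ i + 1}))"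
   by (metis imageI vec_nth_inverse)
 qed
qed (intro finite_imageI finite_PiE; simp)

lemma nn_integral_cube_partition:
 fixes \<phi> :: "real^'n \<Rightarrow> ennreal"
 assumes [measurable]: "\<phi> \<in> borel_measurable borel"
 shows "(NN x. \<phi> x) = (\<integral>\<^sup>+m. (NN x. \<phi> x * indicator (dyadic_cube k m) x) \<partial>count_space UNIV)"
proof -
 have "\<phi> x = (\<integral>\<^sup>+m. \<phi> x * indicator (dyadic_cube k m) x \<partial>count_space UNIV)" for x
 proof -
  have "(\<integral>\<^sup>+m. \<phi> x * indicator (dyadic_cube k m) x \<partial>count_space UNIV) = (\<Sum>m\<in>{cube_index k x}. \<phi> x * indicator (dyadic_cube k m) x)"
   by (rule nn_integral_count_space') (auto simp: mem_dyadic_cube indicator_def)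
  then show ?thesis by (simp add: mem_dyadic_cube)
 qed
 then have "(NN x. \<phi> x) = (NN x. (\<integral>\<^sup>+m. \<phi> x * indicator (dyadic_cube k m) x \<partial>count_space UNIV))"
  by simp
 also have "\<dots> = (\<integral>\<^sup>+m. (NN x. \<phi> x * indicator (dyadic_cube k m) x) \<partial>count_space UNIV)"
  by (rule nn_integral_count_space_nn_integral) auto
 finally show ?thesis .
qed

lemma nn_integral_parent_vimage:
 fixes h :: "int^'n \<Rightarrow> ennreal"
 shows "(\<integral>\<^sup>+m. (\<Sum>m'\<in>parent_index -` {m}. h m') \<partial>count_space UNIV) = (\<integral>\<^sup>+m. h m \<partial>count_space UNIV)"
proof -
 have "(\<integral>\<^sup>+m. (\<Sum>m'\<in>parent_index -` {m}. h m') \<partial>count_space UNIV)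
   = (\<integral>\<^sup>+m. (\<integral>\<^sup>+m'. h m' * indicator {parent_index m'} m \<partial>count_space UNIV) \<partial>count_space UNIV)"
 proof (rule nn_integral_cong)
  fix m :: "int^'n"
  have "(\<integral>\<^sup>+m'. h m' * indicator {parent_index m'} m \<partial>count_space UNIV) = (\<Sum>m'\<in>parent_index -` {m}. h m' * indicator {parent_index m'} m)"
   by (rule nn_integral_count_space') (auto simp: finite_parent_vimage indicator_def)
  also have "\<dots> = (\<Sum>m'\<in>parent_index -` {m}. h m')" by (intro sum.cong) auto
  finally show "(\<Sum>m'\<in>parent_index -` {m}. h m') = (\<integral>\<^sup>+m'. h m' * indicator {parent_index m'} m \<partial>count_space UNIV)" by simp
 qed
 also have "\<dots> = (\<integral>\<^sup>+m'. (\<integral>\<^sup>+m. h m' * indicator {parent_index m'} m \<partial>count_space UNIV) \<partial>count_space UNIV)"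
  by (rule nn_integral_count_space_nn_integral) auto
 also have "\<dots> = (\<integral>\<^sup>+m. h m \<partial>count_space UNIV)"
  by (intro nn_integral_cong) (simp add: nn_integral_cmult_indicator)
 finally show ?thesis .
qed

lemma indicator_dyadic_cube_Suc:
 fixes x :: "real^'n"
 shows "indicator (dyadic_cube (k + 1) m) x = (\<Sum>m'\<in>parent_index -` {m}. indicator (dyadic_cube k m') x :: 'a::semiring_1)"
proof (cases "x \<in> dyadic_cube (k + 1) m")
 case True
 then have "cube_index k x \<in> parent_index -` {m}" by (simp add: mem_dyadic_cube parent_cube_index)
 then have "(\<Sum>m'\<in>parent_index -` {m}. indicator (dyadic_cube k m') x :: 'a) = (\<Sum>m'\<in>{cube_index k x}. indicator (dyadic_cube k m') x)"
  by (intro sum.mono_neutral_right finite_parent_vimage) (auto simp: mem_dyadic_cube indicator_def)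
 with True show ?thesis by (simp add: mem_dyadic_cube)
next
 case False
 then have "(\<Sum>m'\<in>parent_index -` {m}. indicator (dyadic_cube k m') x :: 'a) = 0"
  by (intro sum.neutral) (auto simp: mem_dyadic_cube parent_cube_index[symmetric] indicator_def)
 with False show ?thesis by simp
qed

lemma nn_integral_cube_children:
 fixes \<phi> :: "real^'n \<Rightarrow> ennreal"
 assumes [measurable]: "\<phi> \<in> borel_measurable borel"
 shows "(NN x. \<phi> x * indicator (dyadic_cube (k + 1) m) x)
  = (\<Sum>m'\<in>parent_index -` {m}. \<integral>\<^sup>+x. \<phi> x * indicator (dyadic_cube k m') x \<partial>lborel)"
 by (simp add: indicator_dyadic_cube_Suc sum_distrib_left nn_integral_sum)

section \<open>The distance of two points and the dyadic scales\<close>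

lemma dist_dyadic_cube_le:
 fixes x y :: "real^'n"
 assumes "cube_index k x = cube_index k y"
 shows "dist x y \<le> real CARD('n) * 2 powi k"
proof -
 have "\<bar>(x - y) $ i\<bar> \<le> 2 powi k" for i
 proof -
  have "x \<in> dyadic_cube k (cube_index k x)" "y \<in> dyadic_cube k (cube_index k x)"
   using assms by (auto simp: mem_dyadic_cube)
  then show ?thesis by (auto simp: dyadic_cube_def abs_le_iff algebra_simps) (smt (verit))+
 qed
 then have "(\<Sum>i\<in>UNIV. \<bar>(x - y) $ i\<bar>) \<le> (\<Sum>i\<in>(UNIV::'n set). 2 powi k)" by (intro sum_mono)
 then show ?thesis using norm_le_l1_cart[of "x - y"] by (simp add: dist_norm)
qed

lemma cube_index_adjacent:
 fixes x y :: "real^'n"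
 assumes "dist x y \<le> 2 powi k"
 shows "\<bar>cube_index k x $ i - cube_index k y $ i\<bar> \<le> 1"
proof -
 have "\<bar>(x - y) $ i\<bar> \<le> 2 powi k" using component_le_norm_cart[of "x - y" i] assms by (simp add: dist_norm)
 then have "\<bar>x $ i - y $ i\<bar> / 2 powi k \<le> 1" by (simp add: divide_le_eq)
 moreover have "\<bar>x $ i - y $ i\<bar> / 2 powi k = \<bar>x $ i / 2 powi k - y $ i / 2 powi k\<bar>"
  by (simp add: diff_divide_distrib[symmetric])
 ultimately have "\<bar>x $ i / 2 powi k - y $ i / 2 powi k\<bar> \<le> 1" by simp
 then show ?thesis unfolding cube_index_def by (simp add: abs_le_iff) linarith
qed

text \<open>The cubes of level \<open>J\<close> are the roots of a forest, since no single growing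
  dyadic cube exhausts the space; summing over the roots turns the trees into a sum over
  levels.\<close>

lemma tree_sum_total:
 fixes v :: "nat \<Rightarrow> int^'n \<Rightarrow> real"
 assumes b: "\<And>j. 0 \<le> b j"
 shows "(\<integral>\<^sup>+m. ennreal (tree_sum parent_index b v J m) \<partial>count_space UNIV)
  = (\<Sum>j=1..J. ennreal (b j) * (\<integral>\<^sup>+m. ennreal ((v j m)^2) \<partial>count_space UNIV))"
proof (induction J)
 case (Suc J)
 have "ennreal (tree_sum parent_index b v (Suc J) m) = ennreal (b (Suc J)) * ennreal ((v (Suc J) m)^2)
   + (\<Sum>m'\<in>parent_index -` {m}. ennreal (tree_sum parent_index b v J m'))" for m
  using b by (simp add: tree_sum_nonneg sum_nonneg ennreal_plus ennreal_mult sum_ennreal)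
 then have "(\<integral>\<^sup>+m. ennreal (tree_sum parent_index b v (Suc J) m) \<partial>count_space UNIV)
   = ennreal (b (Suc J)) * (\<integral>\<^sup>+m. ennreal ((v (Suc J) m)^2) \<partial>count_space UNIV)
    + (\<integral>\<^sup>+m. ennreal (tree_sum parent_index b v J m) \<partial>count_space UNIV)"
  by (simp add: nn_integral_add nn_integral_cmult nn_integral_parent_vimage)
 with Suc show ?case by (simp add: add.commute)
qed simp

text \<open>The left side is a dyadic model of the kernel 1 / |x - y|. Only cubes containing both
  points count; the smallest of them has side at least |x - y| / n, and the larger ones form a
  geometric series.\<close>

lemma scale_kernel_le:
 fixes x y :: "real^'n"
 assumes "x \<noteq> y"
 shows "(\<Sum>i=1..j. 1 / 2 powi (k0 + int i) * of_bool (cube_index (k0 + int i) x = cube_index (k0 + int i) y))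
  \<le> 2 * real CARD('n) / dist x y"
proof -
 let ?s = "\<lambda>j. \<Sum>i=1..j. 1 / (2::real) powi (k0 + int i) * of_bool (cube_index (k0 + int i) x = cube_index (k0 + int i) y)"
 have d: "dist x y > 0" using assms by simp
 \<comment> \<open>The spare last term makes the induction work: the term at the next scale is half
   of it, so adding that term uses up one half and leaves the other as the new spare.\<close>
 have "?s j = 0 \<or> ?s j + 1 / 2 powi (k0 + int j) \<le> 2 * real CARD('n) / dist x y"
 proof (induction j)
  case (Suc j)
  have half: "1 / 2 powi (k0 + int j) = (2::real) * (1 / 2 powi (k0 + int (Suc j)))"
   by (simp add: power_int_add add.assoc[symmetric])
  show ?case
  proof (cases "cube_index (k0 + int (Suc j)) x = cube_index (k0 + int (Suc j)) y")
   case True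
   have "dist x y \<le> real CARD('n) * 2 powi (k0 + int (Suc j))" by (rule dist_dyadic_cube_le[OF True])
   then have "2 * (1 / 2 powi (k0 + int (Suc j))) \<le> 2 * real CARD('n) / dist x y"
    using d by (simp add: field_simps del: of_nat_Suc)
   moreover have "?s (Suc j) = ?s j + 1 / 2 powi (k0 + int (Suc j))" using True by simp
   ultimately show ?thesis using Suc half by auto
  next
   case False
   then have "?s (Suc j) = ?s j" by simp
   moreover have "0 < 1 / (2::real) powi (k0 + int (Suc j))" by simp
   ultimately show ?thesis using Suc half by linarith
  qed
 qed simp
 moreover have "0 < 1 / (2::real) powi (k0 + int j)" "0 \<le> 2 * real CARD('n) / dist x y" by auto
 ultimately show ?thesis by linarith
qed

text \<open>The one scale with 2^(k - 1) < r \<le> 2^k already gives 1 / r \<le> 2 / 2^k; the other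
  terms are nonnegative.\<close>

lemma inverse_dist_le_dyadic:
 fixes r :: real
 assumes "2 powi k0 < r" "r \<le> 2 powi (k0 + int J)"
 shows "1 / r \<le> (\<Sum>j=1..J. 2 * (1 / 2 powi (k0 + int j)) * of_bool (r \<le> 2 powi (k0 + int j)))"
 using assms(2)
proof (induction J)
 case 0 with assms(1) show ?case by simp
next
 case (Suc J)
 have p: "(0::real) < 2 powi k" for k by simp
 then have r: "r > 0" using assms(1) p[of k0] by linarith
 show ?case
 proof (cases "r \<le> 2 powi (k0 + int J)")
  case True
  with Suc.IH show ?thesis by (simp add: add_increasing2)
 next
  case False
  have "1 / r \<le> 1 / 2 powi (k0 + int J)" using False by (intro divide_left_mono) (auto simp: r)
  also have "\<dots> = 2 * (1 / 2 powi (k0 + int (Suc J)))" by (simp add: power_int_add add.assoc[symmetric])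
  finally have "1 / r \<le> 2 * (1 / 2 powi (k0 + int (Suc J)))" .
  moreover have "0 \<le> (\<Sum>j=1..J. 2 * (1 / (2::real) powi (k0 + int j)) * of_bool (r \<le> 2 powi (k0 + int j)))"
   by (intro sum_nonneg) auto
  ultimately show ?thesis using Suc.prems by simp
 qed
qed

text \<open>Squares of masses expand into double integrals, so the tree sum is at most the integral
  over Q x Q of the dyadic kernel, which \<open>scale_kernel_le\<close> bounds by a multiple of 1 /
  |x - y|. Thus the continuous Kerman--Sawyer condition implies the discrete testing condition of
  \<open>carleson_bellman\<close>.\<close>

lemma dyadic_testing_tree:
 fixes W :: "real^'n \<Rightarrow> real" and k0 :: int
 assumes [measurable]: "W \<in> borel_measurable borel" and W0: "\<And>x. 0 \<le> W x"
  and fin: "\<And>k m. (\<integral>\<^sup>+x\<in>dyadic_cube k m. ennreal (W x) \<partial>lborel) < \<infinity>"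
  and test: "\<And>k m. (\<integral>\<^sup>+x\<in>dyadic_cube k m. (\<integral>\<^sup>+y\<in>dyadic_cube k m. ennreal (W x * W y) / ennreal (dist x y) \<partial>lborel) \<partial>lborel)
    \<le> ennreal D * (\<integral>\<^sup>+x\<in>dyadic_cube k m. ennreal (W x) \<partial>lborel)"
  and D: "0 \<le> D"
 defines "w \<equiv> \<lambda>j q. enn2real (\<integral>\<^sup>+x\<in>dyadic_cube (k0 + int j) q. ennreal (W x) \<partial>lborel)"
 shows "tree_sum parent_index (\<lambda>j. 1 / 2 powi (k0 + int j)) w j q \<le> 2 * real CARD('n) * D * w j q"
proof -
 let ?b = "\<lambda>j. 1 / (2::real) powi (k0 + int j)"
 define K where "K j x y = (\<Sum>i=1..j. ?b i * of_bool (cube_index (k0 + int i) x = cube_index (k0 + int i) y))" for j and x y :: "real^'n"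
 have [measurable]: "(\<lambda>p. K j (fst p) (snd p)) \<in> borel_measurable lborel2"
  "(\<lambda>y. K j x y) \<in> borel_measurable borel" for j x
  unfolding K_def by measurable
 have K0: "0 \<le> K j x y" for j x y unfolding K_def by (intro sum_nonneg) auto
 define I where "I j k q = (NN x. (NN y. ennreal (W x * W y * K j x y) * (indicator (dyadic_cube k q) x * indicator (dyadic_cube k q) y)))" for j k q
 have w: "ennreal (w j q) = (\<integral>\<^sup>+x\<in>dyadic_cube (k0 + int j) q. ennreal (W x) \<partial>lborel)" for j q
  using fin by (simp add: w_def)
 have w0: "0 \<le> w j q" for j q by (simp add: w_def)
 have 1: "ennreal (tree_sum parent_index ?b w j q) \<le> I j (k0 + int j) q" for j q
 proof (induction j arbitrary: q)
  case (Suc j)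
  let ?k = "k0 + int j"
  let ?Q = "dyadic_cube (?k + 1) q"
  have k: "k0 + int (Suc j) = ?k + 1" by simp
  have "ennreal (tree_sum parent_index ?b w (Suc j) q)
   = ennreal (?b (Suc j)) * (ennreal (w (Suc j) q) * ennreal (w (Suc j) q)) + (\<Sum>m'\<in>parent_index -` {q}. ennreal (tree_sum parent_index ?b w j m'))"
  proof -
   have b0: "0 \<le> ?b i" for i by simp
   have "tree_sum parent_index ?b w (Suc j) q = ?b (Suc j) * (w (Suc j) q * w (Suc j) q) + (\<Sum>m'\<in>parent_index -` {q}. tree_sum parent_index ?b w j m')"
    by (simp only: tree_sum.simps power2_eq_square)
   also have "ennreal \<dots> = ennreal (?b (Suc j) * (w (Suc j) q * w (Suc j) q)) + ennreal (\<Sum>m'\<in>parent_index -` {q}. tree_sum parent_index ?b w j m')"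
    using b0 w0 by (intro ennreal_plus mult_nonneg_nonneg sum_nonneg tree_sum_nonneg)
   also have "ennreal (\<Sum>m'\<in>parent_index -` {q}. tree_sum parent_index ?b w j m') = (\<Sum>m'\<in>parent_index -` {q}. ennreal (tree_sum parent_index ?b w j m'))"
    using b0 by (intro sum_ennreal[symmetric] tree_sum_nonneg)
   also have "ennreal (?b (Suc j) * (w (Suc j) q * w (Suc j) q)) = ennreal (?b (Suc j)) * (ennreal (w (Suc j) q) * ennreal (w (Suc j) q))"
    using b0 w0 by (simp only: ennreal_mult mult_nonneg_nonneg)
   finally show ?thesis .
  qed
  also have "\<dots> \<le> ennreal (?b (Suc j)) * (ennreal (w (Suc j) q) * ennreal (w (Suc j) q)) + (\<Sum>m'\<in>parent_index -` {q}. I j ?k m')"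
   by (intro add_left_mono sum_mono Suc)
  also have "ennreal (?b (Suc j)) * (ennreal (w (Suc j) q) * ennreal (w (Suc j) q))
   = (NN x. (NN y. ennreal (W x * W y * ?b (Suc j)) * (indicator ?Q x * indicator ?Q y)))"
  proof -
   have e: "ennreal (W x * W y * ?b (Suc j)) * (indicator ?Q x * indicator ?Q y)
    = ennreal (?b (Suc j)) * (ennreal (W x) * indicator ?Q x) * (ennreal (W y) * indicator ?Q y)" for x y
    using W0[of x] W0[of y] by (simp only: ennreal_mult mult_nonneg_nonneg zero_le_divide_1_iff zero_le_power_int zero_le_numeral mult_ac)
   let ?w = "\<integral>\<^sup>+y\<in>?Q. ennreal (W y) \<partial>lborel"
   have "(NN x. (NN y. ennreal (W x * W y * ?b (Suc j)) * (indicator ?Q x * indicator ?Q y)))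
    = (NN x. ennreal (?b (Suc j)) * (ennreal (W x) * indicator ?Q x) * ?w)"
    unfolding e by (intro nn_integral_cong nn_integral_cmult) measurable
   also have "\<dots> = (NN x. ennreal (?b (Suc j)) * (ennreal (W x) * indicator ?Q x)) * ?w"
    by (rule nn_integral_multc) measurable
   also have "(NN x. ennreal (?b (Suc j)) * (ennreal (W x) * indicator ?Q x)) = ennreal (?b (Suc j)) * ?w"
    by (rule nn_integral_cmult) measurable
   finally show ?thesis unfolding w k by (simp only: mult.assoc)
  qed
  also have "(\<Sum>m'\<in>parent_index -` {q}. I j ?k m')
   = (NN x. (NN y. ennreal (W x * W y * K j x y) * (\<Sum>m'\<in>parent_index -` {q}. indicator (dyadic_cube ?k m') x * indicator (dyadic_cube ?k m') y)))"
   unfolding I_def sum_distrib_left by (simp add: nn_integral_sum)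
  also have "\<dots> \<le> (NN x. (NN y. ennreal (W x * W y * K j x y) * (indicator ?Q x * indicator ?Q y)))"
  proof (intro nn_integral_mono mult_left_mono)
   fix x y :: "real^'n"
   show "(\<Sum>m'\<in>parent_index -` {q}. indicator (dyadic_cube ?k m') x * indicator (dyadic_cube ?k m') y) \<le> indicator ?Q x * (indicator ?Q y :: ennreal)"
    unfolding indicator_dyadic_cube_Suc sum_distrib_right
    by (intro sum_mono mult_left_mono member_le_sum finite_parent_vimage) auto
  qed simp
  also have "(NN x. (NN y. ennreal (W x * W y * ?b (Suc j)) * (indicator ?Q x * indicator ?Q y))) + \<dots>
   = (NN x. (NN y. (ennreal (W x * W y * ?b (Suc j)) + ennreal (W x * W y * K j x y)) * (indicator ?Q x * indicator ?Q y)))"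
   by (simp add: nn_integral_add[symmetric] distrib_right)
  also have "\<dots> = I (Suc j) (k0 + int (Suc j)) q"
   unfolding I_def
  proof (intro nn_integral_cong)
   fix x y :: "real^'n"
   have "K (Suc j) x y = ?b (Suc j) + K j x y" if "x \<in> ?Q" "y \<in> ?Q"
    using that unfolding K_def k[symmetric] by (simp add: mem_dyadic_cube)
   then show "(ennreal (W x * W y * ?b (Suc j)) + ennreal (W x * W y * K j x y)) * (indicator ?Q x * indicator ?Q y)
    = ennreal (W x * W y * K (Suc j) x y) * (indicator (dyadic_cube (k0 + int (Suc j)) q) x * indicator (dyadic_cube (k0 + int (Suc j)) q) y)"
    unfolding k using W0[of x] W0[of y] K0[of j x y]
    by (auto simp: indicator_def distrib_left ennreal_plus[symmetric] simp del: ennreal_plus)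
  qed
  finally show ?case by (simp add: add_left_mono)
 qed simp
 have 2: "ennreal (W x * W y * K j x y) \<le> ennreal (2 * real CARD('n)) * (ennreal (W x * W y) / ennreal (dist x y))" for j x y
 \<comment> \<open>On the diagonal the quotient, formed in \<open>ennreal\<close>, is infinite
   unless \<open>W y = 0\<close>, and in the latter case both sides vanish.\<close>
 proof (cases "x = y")
  case True
  then show ?thesis by (cases "W y = 0") (auto simp: divide_ennreal_def ennreal_mult_top ennreal_mult_eq_top_iff top_unique)
 next
  case False
  have "W x * W y * K j x y \<le> W x * W y * (2 * real CARD('n) / dist x y)"
   unfolding K_def using W0 by (intro mult_left_mono scale_kernel_le False) auto
  then have "ennreal (W x * W y * K j x y) \<le> ennreal (2 * real CARD('n) * (W x * W y / dist x y))"
   by (intro ennreal_leI) (simp add: mult_ac)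
  also have "\<dots> = ennreal (2 * real CARD('n)) * (ennreal (W x * W y) / ennreal (dist x y))"
  proof -
   have "ennreal (W x * W y) / ennreal (dist x y) = ennreal (W x * W y / dist x y)"
    using False W0 by (intro divide_ennreal) auto
   then show ?thesis using W0 by (simp only: ennreal_mult[symmetric] divide_nonneg_nonneg mult_nonneg_nonneg zero_le_dist of_nat_0_le_iff zero_le_numeral)
  qed
  finally show ?thesis .
 qed
 have "ennreal (tree_sum parent_index ?b w j q) \<le> I j (k0 + int j) q" by (rule 1)
 also have "\<dots> \<le> (NN x. (NN y. ennreal (2 * real CARD('n)) * (ennreal (W x * W y) / ennreal (dist x y)) *
   (indicator (dyadic_cube (k0 + int j) q) x * indicator (dyadic_cube (k0 + int j) q) y)))"
  unfolding I_def by (intro nn_integral_mono mult_right_mono 2) auto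
 also have "\<dots> = ennreal (2 * real CARD('n)) * (\<integral>\<^sup>+x\<in>dyadic_cube (k0 + int j) q. (\<integral>\<^sup>+y\<in>dyadic_cube (k0 + int j) q. ennreal (W x * W y) / ennreal (dist x y) \<partial>lborel) \<partial>lborel)"
 proof -
  have e: "ennreal (2 * real CARD('n)) * (ennreal (W x * W y) / ennreal (dist x y)) *
   (indicator (dyadic_cube (k0 + int j) q) x * indicator (dyadic_cube (k0 + int j) q) y)
   = ennreal (2 * real CARD('n)) * ((ennreal (W x * W y) / ennreal (dist x y) * indicator (dyadic_cube (k0 + int j) q) y) * indicator (dyadic_cube (k0 + int j) q) x)" for x y
   by (simp only: mult_ac)
  show ?thesis unfolding e by (simp add: nn_integral_cmult nn_integral_multc)
 qed
 also have "\<dots> \<le> ennreal (2 * real CARD('n)) * (ennreal D * ennreal (w j q))"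
  unfolding w by (intro mult_left_mono test) auto
 also have "\<dots> = ennreal (2 * real CARD('n) * D * w j q)"
  using D w0 by (simp add: ennreal_mult mult.assoc)
 finally show ?thesis using D w0 by (subst (asm) ennreal_le_iff) auto
qed

text \<open>Equal to 3^n: the offsets from a cube to itself and to its neighbours.\<close>

definition neighbour_count :: "'n::finite itself \<Rightarrow> nat" where
 "neighbour_count _ = card {m :: int^'n. \<forall>i. \<bar>m $ i\<bar> \<le> 1}"

text \<open>Points at distance at most 2^k lie in equal or adjacent cubes of side 2^k. Bounding the
  product of two cube masses by the sum of their squares and counting neighbours brings adjacent
  pairs back to single cubes, so one dyadic grid does the work of several shifted ones.\<close>

lemma nn_integral_near_diagonal:
 fixes h :: "real^'n \<Rightarrow> ennreal"
 assumes [measurable]: "h \<in> borel_measurable borel"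
 shows "(NN x. (NN y. h x * h y * of_bool (dist x y \<le> 2 powi k)))
  \<le> 2 * of_nat (neighbour_count TYPE('n)) * (\<integral>\<^sup>+m. (\<integral>\<^sup>+x\<in>dyadic_cube k m. h x \<partial>lborel)^2 \<partial>count_space UNIV)"
proof -
 define adj where "adj m m' = (of_bool (\<forall>i. \<bar>m $ i - m' $ i\<bar> \<le> 1) :: ennreal)" for m m' :: "int^'n"
 define H where "H m = (\<integral>\<^sup>+x\<in>dyadic_cube k m. h x \<partial>lborel)" for m
 let ?c = "count_space (UNIV :: (int^'n) set)"
 have [measurable]: "(\<lambda>y. adj m (cube_index k y)) \<in> borel_measurable borel" for m
  by (rule measurable_compose[OF measurable_cube_index]) simp
 have finN: "finite {m :: int^'n. \<forall>i. \<bar>m $ i\<bar> \<le> 1}"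
 proof (rule finite_subset)
  show "{m :: int^'n. \<forall>i. \<bar>m $ i\<bar> \<le> 1} \<subseteq> vec_lambda ` (PiE UNIV (\<lambda>i. {-1..1}))"
  proof
   fix m' :: "int^'n" assume "m' \<in> {m :: int^'n. \<forall>i. \<bar>m $ i\<bar> \<le> 1}"
   then have "($) m' \<in> PiE UNIV (\<lambda>i. {-1..1})" by (auto simp: abs_le_iff)
   then show "m' \<in> vec_lambda ` (PiE UNIV (\<lambda>i. {-1..1}))" by (metis imageI vec_nth_inverse)
  qed
 qed (intro finite_imageI finite_PiE; simp)
 have cnt: "(\<integral>\<^sup>+m'. adj m m' \<partial>?c) = of_nat (neighbour_count TYPE('n))" for m
 proof -
  have "bij_betw (\<lambda>s. m - s) {m :: int^'n. \<forall>i. \<bar>m $ i\<bar> \<le> 1} {m'. \<forall>i. \<bar>m $ i - m' $ i\<bar> \<le> 1}"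
   by (rule bij_betwI[where g = "\<lambda>s. m - s"]) auto
  then have c: "card {m'. \<forall>i. \<bar>m $ i - m' $ i\<bar> \<le> 1} = neighbour_count TYPE('n)"
   and f: "finite {m'. \<forall>i. \<bar>m $ i - m' $ i\<bar> \<le> 1}"
   using finN by (auto simp: neighbour_count_def bij_betw_same_card bij_betw_finite)
  have "(\<integral>\<^sup>+m'. adj m m' \<partial>?c) = (\<integral>\<^sup>+m'. indicator {m'. \<forall>i. \<bar>m $ i - m' $ i\<bar> \<le> 1} m' \<partial>?c)"
   by (intro nn_integral_cong) (auto simp: adj_def indicator_def)
  also have "\<dots> = of_nat (card {m'. \<forall>i. \<bar>m $ i - m' $ i\<bar> \<le> 1})"
   using f by (simp add: emeasure_count_space_finite)
  finally show ?thesis using c by simp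
 qed
 have sym: "adj m m' = adj m' m" for m m' by (simp add: adj_def abs_minus_commute)
 have "(NN x. (NN y. h x * h y * of_bool (dist x y \<le> 2 powi k)))
  \<le> (NN x. (NN y. h x * (h y * adj (cube_index k x) (cube_index k y))))"
  by (intro nn_integral_mono) (auto simp: adj_def mult.assoc intro!: mult_left_mono dest: cube_index_adjacent)
 also have "\<dots> = (NN x. h x * (NN y. h y * adj (cube_index k x) (cube_index k y)))"
  by (intro nn_integral_cong nn_integral_cmult) measurable
 also have "\<dots> = (NN x. h x * (\<integral>\<^sup>+m'. adj (cube_index k x) m' * H m' \<partial>?c))"
 proof (intro nn_integral_cong arg_cong2[where f = "(*)"] refl)
  fix x
  have "(NN y. h y * adj (cube_index k x) (cube_index k y))
   = (\<integral>\<^sup>+m'. (NN y. h y * adj (cube_index k x) (cube_index k y) * indicator (dyadic_cube k m') y) \<partial>?c)"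
   by (rule nn_integral_cube_partition) measurable
  also have "\<dots> = (\<integral>\<^sup>+m'. adj (cube_index k x) m' * H m' \<partial>?c)"
  proof (rule nn_integral_cong)
   fix m'
   have "(NN y. h y * adj (cube_index k x) (cube_index k y) * indicator (dyadic_cube k m') y)
    = (NN y. adj (cube_index k x) m' * (h y * indicator (dyadic_cube k m') y))"
    by (intro nn_integral_cong) (auto simp: indicator_def mem_dyadic_cube mult_ac)
   then show "(NN y. h y * adj (cube_index k x) (cube_index k y) * indicator (dyadic_cube k m') y) = adj (cube_index k x) m' * H m'"
    unfolding H_def by (simp add: nn_integral_cmult)
  qed
  finally show "(NN y. h y * adj (cube_index k x) (cube_index k y)) = (\<integral>\<^sup>+m'. adj (cube_index k x) m' * H m' \<partial>?c)" .
 qed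
 also have "\<dots> = (\<integral>\<^sup>+m. H m * (\<integral>\<^sup>+m'. adj m m' * H m' \<partial>?c) \<partial>?c)"
 proof -
  define G where "G m = (\<integral>\<^sup>+m'. adj m m' * H m' \<partial>?c)" for m
  have [measurable]: "(\<lambda>x. G (cube_index k x)) \<in> borel_measurable borel"
   by (rule measurable_compose[OF measurable_cube_index]) simp
  have "(NN x. h x * G (cube_index k x)) = (\<integral>\<^sup>+m. (NN x. h x * G (cube_index k x) * indicator (dyadic_cube k m) x) \<partial>?c)"
   by (rule nn_integral_cube_partition) measurable
  also have "\<dots> = (\<integral>\<^sup>+m. H m * G m \<partial>?c)"
  proof (rule nn_integral_cong)
   fix m
   have "(NN x. h x * G (cube_index k x) * indicator (dyadic_cube k m) x) = (NN x. (h x * indicator (dyadic_cube k m) x) * G m)"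
    by (intro nn_integral_cong) (auto simp: indicator_def mem_dyadic_cube mult_ac)
   then show "(NN x. h x * G (cube_index k x) * indicator (dyadic_cube k m) x) = H m * G m"
    unfolding H_def by (simp add: nn_integral_multc)
  qed
  finally show ?thesis by (simp add: G_def)
 qed
 also have "\<dots> = (\<integral>\<^sup>+m. (\<integral>\<^sup>+m'. adj m m' * (H m * H m') \<partial>?c) \<partial>?c)"
  by (simp add: nn_integral_cmult[symmetric] mult_ac)
 also have "\<dots> \<le> (\<integral>\<^sup>+m. (\<integral>\<^sup>+m'. adj m m' * (H m)^2 + adj m m' * (H m')^2 \<partial>?c) \<partial>?c)"
 proof (intro nn_integral_mono)
  fix m m'
  have "H m * H m' \<le> (H m)^2 + (H m')^2"
  proof (cases "H m \<le> H m'")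
   case True
   then have "H m * H m' \<le> H m' * H m'" by (intro mult_right_mono) auto
   then show ?thesis by (simp add: power2_eq_square add_increasing)
  next
   case False
   then have "H m * H m' \<le> H m * H m" by (intro mult_left_mono) auto
   then show ?thesis by (simp add: power2_eq_square add_increasing2)
  qed
  then show "adj m m' * (H m * H m') \<le> adj m m' * (H m)^2 + adj m m' * (H m')^2"
   unfolding distrib_left[symmetric] by (rule mult_left_mono) simp
 qed
 also have "\<dots> = (\<integral>\<^sup>+m. (\<integral>\<^sup>+m'. adj m m' * (H m)^2 \<partial>?c) \<partial>?c) + (\<integral>\<^sup>+m. (\<integral>\<^sup>+m'. adj m m' * (H m')^2 \<partial>?c) \<partial>?c)"
  by (simp add: nn_integral_add)
 also have "(\<integral>\<^sup>+m. (\<integral>\<^sup>+m'. adj m m' * (H m')^2 \<partial>?c) \<partial>?c) = (\<integral>\<^sup>+m'. (\<integral>\<^sup>+m. adj m m' * (H m')^2 \<partial>?c) \<partial>?c)"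
  by (rule nn_integral_count_space_nn_integral) auto
 also have "\<dots> = (\<integral>\<^sup>+m. (\<integral>\<^sup>+m'. adj m m' * (H m)^2 \<partial>?c) \<partial>?c)"
  by (subst (2) sym) simp
 also have "(\<integral>\<^sup>+m. (\<integral>\<^sup>+m'. adj m m' * (H m)^2 \<partial>?c) \<partial>?c) = of_nat (neighbour_count TYPE('n)) * (\<integral>\<^sup>+m. (H m)^2 \<partial>?c)"
  by (simp add: nn_integral_multc cnt nn_integral_cmult)
 finally show ?thesis by (simp add: H_def mult_2 distrib_right)
qed

text \<open>Cauchy--Schwarz on each cube, with h = f sqrt W, is the hypothesis of the Carleson
  embedding, and \<open>dyadic_testing_tree\<close> is its testing condition. Trees being finite,
  distances are first confined between two scales. The 32 is 2 from
  \<open>inverse_dist_le_dyadic\<close>, 2 from \<open>nn_integral_near_diagonal\<close>, 4 from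
  \<open>carleson_bellman\<close> and 2 from \<open>scale_kernel_le\<close>.\<close>

lemma kerman_sawyer_bound:
 fixes W f :: "real^'n \<Rightarrow> real"
 assumes W [measurable]: "W \<in> borel_measurable borel" and W0: "\<And>x. 0 \<le> W x"
  and fin: "\<And>k m. (\<integral>\<^sup>+x\<in>dyadic_cube k m. ennreal (W x) \<partial>lborel) < \<infinity>"
  and test: "\<And>k m. (\<integral>\<^sup>+x\<in>dyadic_cube k m. (\<integral>\<^sup>+y\<in>dyadic_cube k m. ennreal (W x * W y) / ennreal (dist x y) \<partial>lborel) \<partial>lborel)
    \<le> ennreal D * (\<integral>\<^sup>+x\<in>dyadic_cube k m. ennreal (W x) \<partial>lborel)"
  and D: "0 < D"
  and f [measurable]: "f \<in> borel_measurable borel" and f0: "\<And>x. 0 \<le> f x"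
  and finf: "(NN x. ennreal ((f x)^2)) < \<infinity>"
 shows "(NN x. (NN y. ennreal ((f x * sqrt (W x)) * (f y * sqrt (W y)) / dist x y)))
  \<le> ennreal (32 * real (neighbour_count TYPE('n)) * real CARD('n) * D) * (NN x. ennreal ((f x)^2))"
proof -
 define h where "h x = f x * sqrt (W x)" for x
 have [measurable]: "h \<in> borel_measurable borel" unfolding h_def by measurable
 have h0: "0 \<le> h x" for x using f0 W0 by (simp add: h_def)
 define N where "N = real (neighbour_count TYPE('n))"
 define D' where "D' = 2 * real CARD('n) * D"
 have D': "D' > 0" using D by (simp add: D'_def)
 define H where "H k m = (\<integral>\<^sup>+x\<in>dyadic_cube k m. ennreal (h x) \<partial>lborel)" for k m
 define F2 where "F2 = (NN x. ennreal ((f x)^2))"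
 have F2c: "(\<integral>\<^sup>+x\<in>dyadic_cube k m. ennreal ((f x)^2) \<partial>lborel) < \<infinity>" for k m
  by (rule le_less_trans[OF nn_integral_mono finf]) (auto simp: indicator_def)
 have CS: "(H k m)^2 \<le> (\<integral>\<^sup>+x\<in>dyadic_cube k m. ennreal ((f x)^2) \<partial>lborel) * (\<integral>\<^sup>+x\<in>dyadic_cube k m. ennreal (W x) \<partial>lborel)" for k m
 proof -
  let ?i = "indicator (dyadic_cube k m) :: real^'n \<Rightarrow> ennreal"
  have "H k m = (NN x. (ennreal (f x) * ?i x) * (ennreal (sqrt (W x)) * ?i x))"
   unfolding H_def h_def using f0 W0 by (intro nn_integral_cong) (auto simp: indicator_def ennreal_mult)
  then have "(H k m)^2 \<le> (NN x. (ennreal (f x) * ?i x)^2) * (NN x. (ennreal (sqrt (W x)) * ?i x)^2)"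
   by (simp only:) (rule Cauchy_Schwarz_nn_integral; measurable)
  also have "(NN x. (ennreal (f x) * ?i x)^2) = (\<integral>\<^sup>+x\<in>dyadic_cube k m. ennreal ((f x)^2) \<partial>lborel)"
   using f0 by (intro nn_integral_cong) (auto simp: indicator_def ennreal_power)
  also have "(NN x. (ennreal (sqrt (W x)) * ?i x)^2) = (\<integral>\<^sup>+x\<in>dyadic_cube k m. ennreal (W x) \<partial>lborel)"
   using W0 by (intro nn_integral_cong) (auto simp: indicator_def ennreal_power)
  finally show ?thesis .
 qed
 have Hfin: "H k m < \<infinity>" for k m
 proof -
  have "(H k m)^2 < \<infinity>"
   using CS[of k m] F2c[of k m] fin[of k m] by (auto simp: ennreal_mult_less_top intro: le_less_trans)
  then show ?thesis by (auto simp: power2_eq_square ennreal_mult_less_top top_unique less_top)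
 qed
 have trunc: "(NN x. (NN y. ennreal (h x * h y / dist x y) * of_bool (2 powi k0 < dist x y \<and> dist x y \<le> 2 powi (k0 + int J))))
   \<le> ennreal (16 * N * D') * F2" for k0 :: int and J
 proof -
  let ?b = "\<lambda>j. 1 / (2::real) powi (k0 + int j)"
  define w where "w j q = enn2real (\<integral>\<^sup>+x\<in>dyadic_cube (k0 + int j) q. ennreal (W x) \<partial>lborel)" for j q
  define v where "v j q = enn2real (H (k0 + int j) q)" for j q
  define F where "F j q = enn2real (\<integral>\<^sup>+x\<in>dyadic_cube (k0 + int j) q. ennreal ((f x)^2) \<partial>lborel)" for j q
  have Fe: "ennreal (F j q) = (\<integral>\<^sup>+x\<in>dyadic_cube (k0 + int j) q. ennreal ((f x)^2) \<partial>lborel)" for j q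
   using F2c by (simp add: F_def)
  have We: "ennreal (w j q) = (\<integral>\<^sup>+x\<in>dyadic_cube (k0 + int j) q. ennreal (W x) \<partial>lborel)" for j q
   using fin by (simp add: w_def)
  have Ve: "ennreal (v j q) = H (k0 + int j) q" for j q
   using Hfin by (simp add: v_def)
  have nn: "0 \<le> w j q" "0 \<le> v j q" "0 \<le> F j q" for j q by (auto simp: w_def v_def F_def)
  have kS: "k0 + int (Suc j) = (k0 + int j) + 1" for j by simp
  have add: "u (Suc j) q = (\<Sum>q'\<in>parent_index -` {q}. u j q')"
   if "\<And>j q. ennreal (u j q) = (NN x. \<phi> x * indicator (dyadic_cube (k0 + int j) q) x)"
    "\<phi> \<in> borel_measurable borel" "\<And>j q. 0 \<le> u j q" for u \<phi> j q
  proof -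
   have "ennreal (u (Suc j) q) = (\<Sum>q'\<in>parent_index -` {q}. ennreal (u j q'))"
    unfolding that(1) kS by (rule nn_integral_cube_children[OF that(2)])
   also have "\<dots> = ennreal (\<Sum>q'\<in>parent_index -` {q}. u j q')" using that(3) by (intro sum_ennreal)
   finally show ?thesis using that(3) by (simp add: sum_nonneg)
  qed
  have car: "tree_sum parent_index ?b v J q + 4 * D'^2 * (v J q)^2 / (D' * w J q + tree_sum parent_index ?b w J q) \<le> 4 * D' * F J q" for q
  proof (rule carleson_bellman[OF D'])
   show "w (Suc j) q = (\<Sum>q'\<in>parent_index -` {q}. w j q')" for j q by (rule add[OF We]) (use nn in auto)
   show "v (Suc j) q = (\<Sum>q'\<in>parent_index -` {q}. v j q')" for j q by (rule add[OF Ve[unfolded H_def]]) (use nn in auto)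
   show "F (Suc j) q = (\<Sum>q'\<in>parent_index -` {q}. F j q')" for j q by (rule add[OF Fe]) (use nn in auto)
   show "(v j q)^2 \<le> F j q * w j q" for j q
   proof -
    have "ennreal ((v j q)^2) \<le> ennreal (F j q * w j q)"
     using CS[of "k0 + int j" q] nn by (simp add: ennreal_mult Fe We Ve ennreal_power[symmetric])
    then show ?thesis using nn by (subst (asm) ennreal_le_iff) auto
   qed
   show "tree_sum parent_index ?b w j q \<le> D' * w j q" for j q
    unfolding D'_def w_def using D by (intro dyadic_testing_tree W W0 fin test) auto
  qed (use nn in auto)
  have car': "tree_sum parent_index ?b v J q \<le> 4 * D' * F J q" for q
  proof -
   have "0 \<le> 4 * D'^2 * (v J q)^2 / (D' * w J q + tree_sum parent_index ?b w J q)"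
    using D' nn by (intro divide_nonneg_nonneg add_nonneg_nonneg mult_nonneg_nonneg tree_sum_nonneg) auto
   with car[of q] show ?thesis by linarith
  qed
  have "(NN x. (NN y. ennreal (h x * h y / dist x y) * of_bool (2 powi k0 < dist x y \<and> dist x y \<le> 2 powi (k0 + int J))))
   \<le> (NN x. (NN y. (\<Sum>j=1..J. ennreal (2 * ?b j) * (ennreal (h x) * ennreal (h y) * of_bool (dist x y \<le> 2 powi (k0 + int j))))))"
  proof (intro nn_integral_mono)
   fix x y :: "real^'n"
   show "ennreal (h x * h y / dist x y) * of_bool (2 powi k0 < dist x y \<and> dist x y \<le> 2 powi (k0 + int J))
    \<le> (\<Sum>j=1..J. ennreal (2 * ?b j) * (ennreal (h x) * ennreal (h y) * of_bool (dist x y \<le> 2 powi (k0 + int j))))"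
   proof (cases "2 powi k0 < dist x y \<and> dist x y \<le> 2 powi (k0 + int J)")
    case True
    have "h x * h y / dist x y = h x * h y * (1 / dist x y)" by simp
    also have "\<dots> \<le> h x * h y * (\<Sum>j=1..J. 2 * ?b j * of_bool (dist x y \<le> 2 powi (k0 + int j)))"
     using True h0 by (intro mult_left_mono inverse_dist_le_dyadic) auto
    also have "\<dots> = (\<Sum>j=1..J. 2 * ?b j * (h x * h y * of_bool (dist x y \<le> 2 powi (k0 + int j))))"
     unfolding sum_distrib_left by (simp add: mult_ac)
    finally have "ennreal (h x * h y / dist x y) \<le> ennreal (\<Sum>j=1..J. 2 * ?b j * (h x * h y * of_bool (dist x y \<le> 2 powi (k0 + int j))))"
     by (rule ennreal_leI)
    also have "\<dots> = (\<Sum>j=1..J. ennreal (2 * ?b j * (h x * h y * of_bool (dist x y \<le> 2 powi (k0 + int j)))))"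
     using h0 by (intro sum_ennreal[symmetric]) auto
    also have "\<dots> = (\<Sum>j=1..J. ennreal (2 * ?b j) * (ennreal (h x) * ennreal (h y) * of_bool (dist x y \<le> 2 powi (k0 + int j))))"
    proof (intro sum.cong refl)
     fix j
     have "0 \<le> 2 * ?b j" by simp
     then show "ennreal (2 * ?b j * (h x * h y * of_bool (dist x y \<le> 2 powi (k0 + int j))))
      = ennreal (2 * ?b j) * (ennreal (h x) * ennreal (h y) * of_bool (dist x y \<le> 2 powi (k0 + int j)))"
      using h0[of x] h0[of y] by (cases "dist x y \<le> 2 powi (k0 + int j)") (simp_all only: ennreal_mult mult_nonneg_nonneg of_bool_eq mult_1_right mult_zero_right ennreal_0)
    qed
    finally show ?thesis using True by simp
   qed auto
  qed
  also have "\<dots> = (\<Sum>j=1..J. ennreal (2 * ?b j) * (NN x. (NN y. ennreal (h x) * ennreal (h y) * of_bool (dist x y \<le> 2 powi (k0 + int j)))))"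
  proof -
   have "(NN y. (\<Sum>j=1..J. ennreal (2 * ?b j) * (ennreal (h x) * ennreal (h y) * of_bool (dist x y \<le> 2 powi (k0 + int j)))))
    = (\<Sum>j=1..J. ennreal (2 * ?b j) * (NN y. ennreal (h x) * ennreal (h y) * of_bool (dist x y \<le> 2 powi (k0 + int j))))" for x
    by (subst nn_integral_sum) (auto intro!: sum.cong nn_integral_cmult)
   then show ?thesis
    by (simp only:) (subst nn_integral_sum; auto intro!: sum.cong nn_integral_cmult)
  qed
  also have "\<dots> \<le> (\<Sum>j=1..J. ennreal (2 * ?b j) * (2 * of_nat (neighbour_count TYPE('n)) * (\<integral>\<^sup>+m. (H (k0 + int j) m)^2 \<partial>count_space UNIV)))"
   unfolding H_def by (intro sum_mono mult_left_mono nn_integral_near_diagonal) auto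
  also have "\<dots> = (\<Sum>j=1..J. ennreal (4 * N) * (ennreal (?b j) * (\<integral>\<^sup>+m. ennreal ((v j m)^2) \<partial>count_space UNIV)))"
  proof (intro sum.cong refl)
   fix j
   have "ennreal ((v j m)^2) = (H (k0 + int j) m)^2" for m
    by (simp add: Ve[symmetric] ennreal_power nn)
   moreover have "ennreal (2 * ?b j) = 2 * ennreal (?b j)" by (subst ennreal_mult) auto
   moreover have "ennreal (4 * N) = 4 * of_nat (neighbour_count TYPE('n))"
    unfolding N_def by (subst ennreal_mult) (auto simp: ennreal_of_nat_eq_real_of_nat)
   ultimately show "ennreal (2 * ?b j) * (2 * of_nat (neighbour_count TYPE('n)) * (\<integral>\<^sup>+m. (H (k0 + int j) m)^2 \<partial>count_space UNIV))
    = ennreal (4 * N) * (ennreal (?b j) * (\<integral>\<^sup>+m. ennreal ((v j m)^2) \<partial>count_space UNIV))"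
    by (simp only: mult_ac) (simp only: mult.assoc[symmetric], simp add: mult_ac)
  qed
  also have "\<dots> = ennreal (4 * N) * (\<integral>\<^sup>+m. ennreal (tree_sum parent_index ?b v J m) \<partial>count_space UNIV)"
   by (subst tree_sum_total) (auto simp: sum_distrib_left)
  also have "\<dots> \<le> ennreal (4 * N) * (\<integral>\<^sup>+m. ennreal (4 * D') * ennreal (F J m) \<partial>count_space UNIV)"
  proof (intro mult_left_mono nn_integral_mono)
   show "ennreal (tree_sum parent_index ?b v J m) \<le> ennreal (4 * D') * ennreal (F J m)" for m
    using car'[of m] D' nn by (simp only: ennreal_mult[symmetric] ennreal_leI mult_nonneg_nonneg zero_le_numeral less_imp_le)
  qed simp
  also have "\<dots> = ennreal (4 * N) * (ennreal (4 * D') * F2)"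
   unfolding Fe F2_def by (simp add: nn_integral_cmult nn_integral_cube_partition[symmetric])
  also have "\<dots> = ennreal (16 * N * D') * F2"
  proof -
   have "0 \<le> 4 * N" "0 \<le> 4 * D'" using D' by (auto simp: N_def)
   then have "ennreal (4 * N) * ennreal (4 * D') = ennreal ((4 * N) * (4 * D'))" by (simp only: ennreal_mult)
   then show ?thesis by (simp only: mult.assoc[symmetric]) simp
  qed
  finally show ?thesis .
 qed
 \<comment> \<open>Distances between 2^(- i) and 2^i, written so as to match \<open>trunc\<close>
   with \<open>k0 = - i\<close> and \<open>J = 2 * i\<close>; these pairs increase to everything off
   the diagonal.\<close>
 define \<phi> where "\<phi> i p = ennreal (h (fst p) * h (snd p) / dist (fst p) (snd p)) *
   of_bool (2 powi (- int i) < dist (fst p) (snd p) \<and> dist (fst p) (snd p) \<le> 2 powi (- int i + int (2 * i)))" for i and p :: "(real^'n) \<times> (real^'n)"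
 have mono2: "(2::real) powi a \<le> 2 powi b" if "a \<le> b" for a b :: int
  using that by (intro power_int_increasing) auto
 have meas[measurable]: "\<phi> i \<in> borel_measurable lborel2" for i unfolding \<phi>_def by measurable
 have inc: "incseq \<phi>"
 proof (intro incseq_SucI le_funI)
  fix i and p :: "(real^'n) \<times> (real^'n)"
  have "(2::real) powi (- int (Suc i)) \<le> 2 powi (- int i)" "(2::real) powi (- int i + int (2 * i)) \<le> 2 powi (- int (Suc i) + int (2 * Suc i))"
   by (intro mono2; simp)+
  then have "2 powi (- int i) < dist (fst p) (snd p) \<and> dist (fst p) (snd p) \<le> 2 powi (- int i + int (2 * i)) \<Longrightarrow>
   2 powi (- int (Suc i)) < dist (fst p) (snd p) \<and> dist (fst p) (snd p) \<le> 2 powi (- int (Suc i) + int (2 * Suc i))"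
   by linarith
  then show "\<phi> i p \<le> \<phi> (Suc i) p" unfolding \<phi>_def by (intro mult_left_mono) auto
 qed
 have "(NN x. (NN y. ennreal (h x * h y / dist x y))) = (\<integral>\<^sup>+p. ennreal (h (fst p) * h (snd p) / dist (fst p) (snd p)) \<partial>lborel2)"
  by (subst lborel.nn_integral_fst[symmetric]) auto
 also have "\<dots> \<le> (\<integral>\<^sup>+p. (SUP i. \<phi> i p) \<partial>lborel2)"
 proof (intro nn_integral_mono)
  fix p :: "(real^'n) \<times> (real^'n)"
  let ?r = "dist (fst p) (snd p)"
  show "ennreal (h (fst p) * h (snd p) / ?r) \<le> (SUP i. \<phi> i p)"
  proof (cases "?r = 0")
   case False
   then have r: "?r > 0" by simp
   obtain i1 :: nat where i1: "?r < 2 ^ i1" using real_arch_pow[of 2 ?r] by auto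
   obtain i2 :: nat where i2: "1 / ?r < 2 ^ i2" using real_arch_pow[of 2 "1 / ?r"] by auto
   define i where "i = max i1 i2"
   have "(2::real) ^ i1 \<le> 2 ^ i" "(2::real) ^ i2 \<le> 2 ^ i" by (auto simp: i_def intro!: power_increasing)
   then have "?r \<le> 2 ^ i" "1 / ?r < 2 ^ i" using i1 i2 by linarith+
   then have "2 powi (- int i) < ?r \<and> ?r \<le> 2 powi (- int i + int (2 * i))"
    using r by (simp add: power_int_minus field_simps)
   then have "ennreal (h (fst p) * h (snd p) / ?r) = \<phi> i p" by (simp add: \<phi>_def)
   also have "\<dots> \<le> (SUP i. \<phi> i p)" by (rule SUP_upper) simp
   finally show ?thesis .
  qed simp
 qed
 also have "\<dots> = (SUP i. (\<integral>\<^sup>+p. \<phi> i p \<partial>lborel2))"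
  by (rule nn_integral_monotone_convergence_SUP[OF inc meas])
 also have "\<dots> \<le> ennreal (16 * N * D') * F2"
 proof (rule SUP_least)
  fix i
  show "(\<integral>\<^sup>+p. \<phi> i p \<partial>lborel2) \<le> ennreal (16 * N * D') * F2"
   using trunc[of "- int i" "2 * i"] by (subst lborel.nn_integral_fst[symmetric]) (auto simp: \<phi>_def)
 qed
 also have "16 * N * D' = 32 * real (neighbour_count TYPE('n)) * real CARD('n) * D"
  by (simp add: N_def D'_def)
 finally show ?thesis by (simp add: h_def F2_def)
qed

subsection \<open>Complex powers of the shifted Laplacian\<close>

text \<open>The symbol of \<open>- \<Delta> + K\<^sup>2\<close> to the power \<open>- s\<close>, as a function of \<open>\<rho> = \<bar>\<xi>\<bar>\<^sup>2\<close>.\<close>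

definition power_symbol :: "complex \<Rightarrow> complex \<Rightarrow> real \<Rightarrow> complex" where
 "power_symbol K s \<rho> = exp (- s * Ln (of_real \<rho> + K^2))"

text \<open>Keeps the principal logarithm in \<open>power_symbol\<close> analytic in
  \<open>K\<close>: a real \<open>K^2\<close> with \<open>Re K > 0\<close> forces \<open>K\<close>
  to be real, and then the value is positive.\<close>

lemma shifted_square_notin_nonpos:
 assumes "Re K > 0" "\<rho> \<ge> 0"
 shows "of_real \<rho> + K^2 \<notin> \<real>\<^sub>\<le>\<^sub>0"
proof
 assume *: "of_real \<rho> + K^2 \<in> \<real>\<^sub>\<le>\<^sub>0"
 then have "Im (K^2) = 0" by (simp add: complex_nonpos_Reals_iff)
 then have "Im K = 0" using assms by (simp add: power2_eq_square)
 then have "Re (of_real \<rho> + K^2) = \<rho> + (Re K)^2" by (simp add: power2_eq_square)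
 moreover have "(Re K)^2 > 0" using assms by simp
 moreover have "Re (of_real \<rho> + K^2) \<le> 0" using * by (simp only: complex_nonpos_Reals_iff)
 ultimately show False using assms by linarith
qed

text \<open>Factor into \<open>a + \<i> * K\<close> and \<open>a - \<i> * K\<close> with
  \<open>a\<close> real: both imaginary parts are \<open>Re K\<close> up to sign.\<close>

lemma norm_shifted_square_ge:
 assumes "Re K > 0" "\<rho> \<ge> 0"
 shows "(Re K)^2 \<le> norm (of_real \<rho> + K^2)"
proof -
 define a where "a = complex_of_real (sqrt \<rho>)"
 have "of_real \<rho> + K^2 = (a + \<i> * K) * (a - \<i> * K)"
 proof -
  have "a * a = of_real \<rho>" unfolding a_def of_real_mult[symmetric] using assms by simp
  then show ?thesis by (simp add: algebra_simps power2_eq_square) 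
 qed
 then have n: "norm (of_real \<rho> + K^2) = norm (a + \<i> * K) * norm (a - \<i> * K)" by (simp add: norm_mult)
 have "Re K \<le> norm (a + \<i> * K)" "Re K \<le> norm (a - \<i> * K)"
  using abs_Im_le_cmod[of "a + \<i> * K"] abs_Im_le_cmod[of "a - \<i> * K"] assms by (auto simp: a_def)
 then have "Re K * Re K \<le> norm (a + \<i> * K) * norm (a - \<i> * K)"
  using assms by (intro mult_mono) auto
 then show ?thesis unfolding n by (simp add: power2_eq_square)
qed

text \<open>The argument of the base costs \<open>exp (pi * \<bar>Im s\<bar>)\<close>. The bound is
  stated for any positive \<open>c \<le> Re K\<close>, so that it holds locally uniformly in
  \<open>K\<close>.\<close>

lemma norm_power_symbol_le:
 assumes "Re K > 0" "\<rho> \<ge> 0" "0 < c" "c \<le> Re K" "0 \<le> Re s"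
 shows "norm (power_symbol K s \<rho>) \<le> (c^2) powr (- Re s) * exp (pi * \<bar>Im s\<bar>)"
proof -
 define A where "A = of_real \<rho> + K^2"
 have c: "c^2 \<le> norm A"
 proof -
  have "c^2 \<le> (Re K)^2" using assms by (intro power_mono) auto
  then show ?thesis using norm_shifted_square_ge[OF assms(1,2)] by (simp add: A_def)
 qed
 have c2: "c^2 > 0" using assms by simp
 have A: "A \<noteq> 0" using c c2 by auto
 have "Re (- s * Ln A) = - Re s * ln (norm A) + Im s * Im (Ln A)" using A by simp
 also have "\<dots> \<le> - Re s * ln (c^2) + pi * \<bar>Im s\<bar>"
 proof (intro add_mono)
  have "ln (c^2) \<le> ln (norm A)" using c c2 by (subst ln_le_cancel_iff) auto
  then show "- Re s * ln (norm A) \<le> - Re s * ln (c^2)"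
   using mult_left_mono[of "ln (c^2)" "ln (norm A)" "Re s"] assms by simp
  have "\<bar>Im (Ln A)\<bar> \<le> pi" using mpi_less_Im_Ln[OF A] Im_Ln_le_pi[OF A] by (simp add: abs_le_iff)
  then have "\<bar>Im s\<bar> * \<bar>Im (Ln A)\<bar> \<le> \<bar>Im s\<bar> * pi" by (intro mult_left_mono) auto
  then show "Im s * Im (Ln A) \<le> pi * \<bar>Im s\<bar>"
   using abs_ge_self[of "Im s * Im (Ln A)"] by (simp add: abs_mult mult.commute)
 qed
 finally have "Re (- s * Ln A) \<le> - Re s * ln (c^2) + pi * \<bar>Im s\<bar>" .
 then have "exp (Re (- s * Ln A)) \<le> exp (- Re s * ln (c^2) + pi * \<bar>Im s\<bar>)" by simp
 then show ?thesis
  using c2 by (simp only: power_symbol_def A_def norm_exp_eq_Re exp_add powr_def) (simp add: assms)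
qed

lemma power_symbol_measurable [measurable]: "(\<lambda>\<rho>. power_symbol K s \<rho>) \<in> borel_measurable borel"
 unfolding power_symbol_def by measurable

section \<open>The kernel on the line Re s = (n - 1) / 2\<close>

lemma complex_Gamma_scaled:
 assumes s: "Re s > 0" and A: "A > (0::real)"
 shows "integrable lborel (\<lambda>t. indicator {0<..} t *\<^sub>R (exp ((s - 1) * of_real (ln t)) * of_real (exp (- A * t))))" (is "integrable lborel ?f")
  and "(LBINT t. indicator {0<..} t *\<^sub>R (exp ((s - 1) * of_real (ln t)) * of_real (exp (- A * t)))) = Gamma s * exp (- s * of_real (ln A))"
proof -
 define g where "g t = indicator {0<..} t *\<^sub>R (exp ((s - 1) * of_real (ln t)) * complex_of_real (exp (- t)))" for t :: real
 have gm[measurable]: "g \<in> borel_measurable borel" unfolding g_def by measurable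
 have ge: "g = (\<lambda>t. indicator {0<..} t *\<^sub>R (of_real t powr (s - 1) / of_real (exp t)))"
  by (auto simp: fun_eq_iff g_def indicator_def powr_def Ln_of_real exp_minus field_simps)
 have "set_integrable lebesgue {0<..} (\<lambda>t. of_real t powr (s - 1) / complex_of_real (exp t))"
  by (rule absolutely_integrable_Gamma_integral'[OF s])
 note si = this
 then have gi': "integrable lebesgue g" unfolding ge set_integrable_def .
 then have gi: "integrable lborel g" by (simp add: integrable_completion)
 have "(LBINT t. g t) = (\<integral>t. g t \<partial>lebesgue)" by (simp add: integral_completion)
 also have "\<dots> = integral {0<..} (\<lambda>t. of_real t powr (s - 1) / complex_of_real (exp t))"
  using set_lebesgue_integral_eq_integral(2)[OF si] unfolding ge set_lebesgue_integral_def .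
 also have "\<dots> = Gamma s" using Gamma_integral_complex'[OF s] by (rule integral_unique)
 finally have gI: "(LBINT t. g t) = Gamma s" .
 have e: "?f t = exp (- (s - 1) * of_real (ln A)) * g (0 + A * t)" for t
 proof (cases "t > 0")
  case True
  then have "exp ((s - 1) * of_real (ln (A * t))) = exp ((s - 1) * of_real (ln A)) * exp ((s - 1) * of_real (ln t))"
   using A by (simp add: ln_mult distrib_left exp_add[symmetric])
  moreover have "exp (- (s - 1) * of_real (ln A)) * exp ((s - 1) * of_real (ln A)) = 1"
  proof -
   have "exp (- (s - 1) * of_real (ln A)) * exp ((s - 1) * of_real (ln A)) = exp (- (s - 1) * of_real (ln A) + (s - 1) * of_real (ln A))"
    by (rule exp_add[symmetric])
   also have "- (s - 1) * of_real (ln A) + (s - 1) * of_real (ln A) = 0" by (simp only: mult_minus_left left_minus)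
   finally show ?thesis by (simp only: exp_zero)
  qed
  ultimately show ?thesis using A True by (simp add: g_def mult.assoc[symmetric])
 qed (use A in \<open>auto simp: g_def zero_less_mult_iff\<close>)
 have "integrable lborel (\<lambda>t. g (0 + A * t))" using A by (intro lborel_integrable_real_affine gi) auto
 then show "integrable lborel ?f" unfolding e by (intro integrable_mult_right)
 have "Gamma s = of_real A * (LBINT t. g (0 + A * t))"
  using A gI lborel_integral_real_affine[of A g 0] by (simp add: scaleR_conv_of_real)
 then have "(LBINT t. g (0 + A * t)) = Gamma s / of_real A" using A by simp
 moreover have "exp (- (s - 1) * of_real (ln A)) / of_real A = exp (- s * of_real (ln A))"
 proof -
  have "exp (- (s - 1) * of_real (ln A)) = exp (- s * of_real (ln A)) * exp (of_real (ln A))"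
   by (simp add: exp_add[symmetric] algebra_simps)
  moreover have "exp (complex_of_real (ln A)) = of_real A" using A by (simp add: exp_of_real)
  ultimately show ?thesis using A by simp
 qed
 ultimately show "(LBINT t. ?f t) = Gamma s * exp (- s * of_real (ln A))"
  unfolding e integral_mult_right_zero by (metis mult.commute times_divide_eq_left)
qed

text \<open>
 The kernel of \<open>- \<Delta> + K\<^sup>2\<close> to the power \<open>- (n - 1) / 2 - \<i> * s\<close>, up to a constant factor. The
 integral representation comes from the heat kernel by completing the square in the exponent,
 \<open>t * K\<^sup>2 + r\<^sup>2 / (4 * t) = q\<^sup>2 + K * r\<close> with \<open>q = r / (2 * sqrt t) - K * sqrt t\<close>; unlike the
 heat kernel representation it converges uniformly up to imaginary \<open>K\<close>.
\<close>

definition line_kernel :: "complex \<Rightarrow> real \<Rightarrow> real \<Rightarrow> complex" where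
 "line_kernel K s r = 2 / of_real r * exp (- K * of_real r) *
  (LBINT q. (of_real q + csqrt (of_real (q^2) + 2 * K * of_real r)) / csqrt (of_real (q^2) + 2 * K * of_real r) *
     exp (\<i> * of_real s * (2 * of_real (ln r) - 2 * Ln (of_real q + csqrt (of_real (q^2) + 2 * K * of_real r)))) *
     of_real (exp (- q\<^sup>2)))"

text \<open>With y = r / sqrt t the substitution for \<open>q\<close> reads y^2 - 2 q y - 2 K r = 0,
  and \<open>q + d\<close> is its root in the right half plane, because (Re d)^2 \<ge> Re (d^2) >
  q^2. So neither the square root nor the logarithm in \<open>line_kernel\<close> meets its
  cut.\<close>

lemma line_kernel_root:
 fixes K :: complex and q r :: real
 assumes "Re K > 0" "r > 0"
 defines "d \<equiv> csqrt (of_real (q^2) + 2 * K * of_real r)"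
 shows "\<bar>q\<bar> < Re d" "Re (of_real q + d) > 0" "d \<noteq> 0" "norm ((of_real q + d) / d) \<le> 2"
  "of_real (q^2) + 2 * K * of_real r \<notin> \<real>\<^sub>\<le>\<^sub>0"
proof -
 let ?v = "of_real (q^2) + 2 * K * of_real r"
 have v: "Re ?v > q^2" using assms by simp
 have "(Re d)^2 - (Im d)^2 = Re (d^2)" by (simp add: power2_eq_square)
 also have "\<dots> = Re ?v" by (simp add: d_def)
 finally have 1: "(Re d)^2 > q^2" using v zero_le_power2[of "Im d"] by linarith
 have 2: "Re d \<ge> 0" using Re_csqrt[of ?v] by (simp add: d_def)
 from 1 2 show 3: "\<bar>q\<bar> < Re d" by (metis abs_of_nonneg power2_abs power2_less_imp_less)
 then show "Re (of_real q + d) > 0" "d \<noteq> 0" by auto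
 have "norm (of_real q + d) \<le> \<bar>q\<bar> + norm d" using norm_triangle_ineq[of "of_real q" d] by simp
 also have "\<dots> \<le> 2 * norm d" using 3 complex_Re_le_cmod[of d] by linarith
 finally show "norm ((of_real q + d) / d) \<le> 2" using \<open>d \<noteq> 0\<close> by (simp add: norm_divide divide_le_eq)
 have "q^2 \<ge> 0" by simp
 then have "Re ?v > 0" using v by linarith
 then show "?v \<notin> \<real>\<^sub>\<le>\<^sub>0" by (simp only: complex_nonpos_Reals_iff not_le) simp
qed

definition line_integrand :: "complex \<Rightarrow> real \<Rightarrow> real \<Rightarrow> real \<Rightarrow> complex" where
 "line_integrand K s r q = (of_real q + csqrt (of_real (q^2) + 2 * K * of_real r)) / csqrt (of_real (q^2) + 2 * K * of_real r) *
     exp (\<i> * of_real s * (2 * of_real (ln r) - 2 * Ln (of_real q + csqrt (of_real (q^2) + 2 * K * of_real r)))) *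
     of_real (exp (- q\<^sup>2))"

lemma line_kernel_eq: "line_kernel K s r = 2 / of_real r * exp (- K * of_real r) * (LBINT q. line_integrand K s r q)"
 by (simp add: line_kernel_def line_integrand_def)

lemma line_integrand_measurable [measurable]:
 "(\<lambda>p. line_integrand K s (fst p) (snd p)) \<in> borel_measurable (borel \<Otimes>\<^sub>M lborel)"
 "line_integrand K s r \<in> borel_measurable borel"
 unfolding line_integrand_def by measurable

lemma line_kernel_measurable [measurable]: "line_kernel K s \<in> borel_measurable borel"
proof -
 have "(\<lambda>r. \<integral>q. line_integrand K s r q \<partial>lborel) \<in> borel_measurable borel"
  using lborel.borel_measurable_lebesgue_integral[of "\<lambda>r q. line_integrand K s r q" borel]
  by (simp add: case_prod_beta')
 then show ?thesis unfolding line_kernel_eq[abs_def] by measurable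
qed

text \<open>Neither \<open>K\<close> nor \<open>r\<close> is left in the bound: the quotient is at
  most 2, and an imaginary power costs only the exponential of an argument. This is the source of
  the uniformity in the spectral parameter.\<close>

lemma norm_line_integrand_le:
 assumes "Re K > 0" "r > 0"
 shows "norm (line_integrand K s r q) \<le> 2 * exp (2 * pi * \<bar>s\<bar>) * exp (- q\<^sup>2)"
proof -
 define d where "d = csqrt (of_real (q^2) + 2 * K * of_real r)"
 define y where "y = of_real q + d"
 note R = line_kernel_root[OF assms, of q, folded d_def, folded y_def]
 have y: "y \<noteq> 0" using R(2) by auto
 have "norm (exp (\<i> * of_real s * (2 * of_real (ln r) - 2 * Ln y))) = exp (2 * s * Im (Ln y))"
  by simp
 also have "\<dots> \<le> exp (2 * pi * \<bar>s\<bar>)"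
 proof -
  have "\<bar>Im (Ln y)\<bar> \<le> pi" using mpi_less_Im_Ln[OF y] Im_Ln_le_pi[OF y] by (simp add: abs_le_iff)
  then have "\<bar>s\<bar> * \<bar>Im (Ln y)\<bar> \<le> \<bar>s\<bar> * pi" by (intro mult_left_mono) auto
  then have "s * Im (Ln y) \<le> pi * \<bar>s\<bar>" using abs_ge_self[of "s * Im (Ln y)"] by (simp add: abs_mult mult.commute)
  then show ?thesis by simp
 qed
 finally have e: "norm (exp (\<i> * of_real s * (2 * of_real (ln r) - 2 * Ln y))) \<le> exp (2 * pi * \<bar>s\<bar>)" .
 have "norm (line_integrand K s r q) = norm (y / d) * norm (exp (\<i> * of_real s * (2 * of_real (ln r) - 2 * Ln y))) * exp (- q\<^sup>2)"
  unfolding line_integrand_def d_def[symmetric] y_def[symmetric] by (simp only: norm_mult norm_of_real) simp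
 also have "\<dots> \<le> 2 * exp (2 * pi * \<bar>s\<bar>) * exp (- q\<^sup>2)"
  using R(4) e by (intro mult_right_mono mult_mono) auto
 finally show ?thesis .
qed

lemma line_integrand_integrable:
 assumes "Re K > 0" "r > 0"
 shows "integrable lborel (line_integrand K s r)"
  "(LBINT q. norm (line_integrand K s r q)) \<le> 2 * exp (2 * pi * \<bar>s\<bar>) * sqrt pi"
proof -
 have g: "integrable lborel (\<lambda>q::real. 2 * exp (2 * pi * \<bar>s\<bar>) * exp (- q\<^sup>2))"
  using gaussian_real_integral(1)[of 1] by simp
 show i: "integrable lborel (line_integrand K s r)"
  by (rule Bochner_Integration.integrable_bound[OF g]) (use norm_line_integrand_le[OF assms] in auto)
 have "(LBINT q. norm (line_integrand K s r q)) \<le> (LBINT q. 2 * exp (2 * pi * \<bar>s\<bar>) * exp (- q\<^sup>2))"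
  by (intro integral_mono integrable_norm i g norm_line_integrand_le assms)
 also have "\<dots> = 2 * exp (2 * pi * \<bar>s\<bar>) * sqrt pi"
  using gaussian_real_integral(2)[of 1] by simp
 finally show "(LBINT q. norm (line_integrand K s r q)) \<le> 2 * exp (2 * pi * \<bar>s\<bar>) * sqrt pi" .
qed

lemma norm_line_kernel_le:
 assumes "Re K > 0" "r \<ge> 0"
 shows "norm (line_kernel K s r) \<le> 4 * sqrt pi * exp (2 * pi * \<bar>s\<bar>) / r"
proof (cases "r = 0")
 case False
 then have r: "r > 0" using assms by simp
 have "norm (LBINT q. line_integrand K s r q) \<le> 2 * exp (2 * pi * \<bar>s\<bar>) * sqrt pi"
  using integral_norm_bound[of lborel "line_integrand K s r"] line_integrand_integrable(2)[OF assms(1) r, of s] by linarith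
 moreover have "norm (exp (- K * of_real r)) \<le> 1" using assms by simp
 ultimately have "norm (exp (- K * of_real r)) * norm (LBINT q. line_integrand K s r q) \<le> 1 * (2 * exp (2 * pi * \<bar>s\<bar>) * sqrt pi)"
  by (intro mult_mono) auto
 then have "2 / r * (norm (exp (- K * of_real r)) * norm (LBINT q. line_integrand K s r q)) \<le> 2 / r * (2 * exp (2 * pi * \<bar>s\<bar>) * sqrt pi)"
  using r by (intro mult_left_mono) auto
 then show ?thesis using r by (simp add: line_kernel_eq norm_mult norm_divide mult_ac)
qed (simp add: line_kernel_eq)

lemma line_kernel_holomorphic:
 assumes "r \<ge> 0"
 shows "(\<lambda>K. line_kernel K s r) holomorphic_on {z. 0 < Re z}"
proof (cases "r = 0")
 case False
 then have r: "r > 0" using assms by simp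
 have "(\<lambda>K. \<integral>q. line_integrand K s r q \<partial>lborel) holomorphic_on {z. 0 < Re z}"
 proof (rule holomorphic_on_parametric_integral)
  fix q :: real
  show "(\<lambda>K. line_integrand K s r q) holomorphic_on {z. 0 < Re z}"
   unfolding line_integrand_def
  proof -
   have "of_real (q^2) + 2 * K * of_real r \<notin> \<real>\<^sub>\<le>\<^sub>0"
    "csqrt (of_real (q^2) + 2 * K * of_real r) \<noteq> 0"
    "of_real q + csqrt (of_real (q^2) + 2 * K * of_real r) \<notin> \<real>\<^sub>\<le>\<^sub>0" if "K \<in> {z. 0 < Re z}" for K
    using line_kernel_root[OF _ r, of K q] that by (auto simp: complex_nonpos_Reals_iff simp del: of_real_power)
   then show "(\<lambda>K. (of_real q + csqrt (of_real (q^2) + 2 * K * of_real r)) / csqrt (of_real (q^2) + 2 * K * of_real r) *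
     exp (\<i> * of_real s * (2 * of_real (ln r) - 2 * Ln (of_real q + csqrt (of_real (q^2) + 2 * K * of_real r)))) *
     of_real (exp (- q\<^sup>2))) holomorphic_on {z. 0 < Re z}"
    by (intro holomorphic_intros)
  qed
 next
  fix a :: complex assume a: "a \<in> {z. 0 < Re z}"
  show "\<exists>\<epsilon>>0. \<exists>g. integrable lborel g \<and>
   (\<forall>w\<in>{z. 0 < Re z}. dist w a \<le> \<epsilon> \<longrightarrow> (\<forall>x\<in>space lborel. cmod (line_integrand w s r x) \<le> g x))"
   using gaussian_real_integral(1)[of 1] norm_line_integrand_le[OF _ r]
   by (intro exI[of _ 1] conjI exI[of _ "\<lambda>q. 2 * exp (2 * pi * \<bar>s\<bar>) * exp (- q\<^sup>2)"]) auto
 qed (auto simp: open_halfspace_Re_gt)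
 then show ?thesis unfolding line_kernel_eq using r by (intro holomorphic_intros) auto
qed (simp add: line_kernel_eq)

text \<open>For real \<open>k\<close> the substitution is a genuine change of variables,
  \<open>t = g q\<close> with derivative \<open>h q\<close>. The exponent - 3 / 2 is Re Z - 1 - n /
  2 for Re Z = (n - 1) / 2, so the dimension drops out of the kernel.\<close>

lemma line_kernel_heat:
 fixes k r s :: real
 assumes k: "k > 0" and r: "r > 0"
 defines "F \<equiv> \<lambda>t. indicator {0<..} t *\<^sub>R (exp ((- 3 / 2 + \<i> * of_real s) * of_real (ln t)) * complex_of_real (exp (- (t * k^2) - r^2 / (4 * t))))"
 shows "integrable lborel F" "(LBINT t. F t) = line_kernel (of_real k) s r"
proof -
 define f where "f t = exp ((- 3 / 2 + \<i> * of_real s) * of_real (ln t)) * complex_of_real (exp (- (t * k^2) - r^2 / (4 * t)))" for t :: real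
 define d where "d q = sqrt (q^2 + 2 * k * r)" for q
 define y where "y q = q + d q" for q
 define g where "g q = r^2 / (y q)^2" for q
 define h where "h q = - 2 * r^2 / ((y q)^2 * d q)" for q
 have kr: "k * r > 0" using k r by simp
 have d2: "(d q)^2 = q^2 + 2 * k * r" for q using kr by (simp add: d_def add_nonneg_nonneg less_imp_le)
 have dq: "\<bar>q\<bar> < d q" for q
 proof -
  have "sqrt (q^2) < d q" unfolding d_def using kr by (intro real_sqrt_less_mono) simp
  then show ?thesis by simp
 qed
 have d0: "d q > 0" for q using dq[of q] by simp
 have y0: "y q > 0" for q using dq[of q] by (simp add: y_def)
 have g0: "g q > 0" for q using y0[of q] r by (simp add: g_def)
 have y2: "(y q)^2 = 2 * q * y q + 2 * k * r" for q
  using d2[of q] by (simp add: y_def power2_eq_square algebra_simps)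
 have bk: "q = y q / 2 - k * r / y q" for q
 proof -
  have "y q * y q = 2 * q * y q + 2 * k * r" using y2[of q] by (simp add: power2_eq_square)
  then show ?thesis using y0[of q] by (simp add: field_simps)
 qed
 have der: "(g has_field_derivative h q) (at q within UNIV)" for q
 proof -
  have p: "q^2 + 2 * k * r > 0" using kr by (simp add: add_nonneg_pos)
  have "(d has_field_derivative (q / d q)) (at q)"
   unfolding d_def using p by (auto intro!: derivative_eq_intros simp: field_simps)
  then have "(y has_field_derivative (1 + q / d q)) (at q)"
   unfolding y_def by (auto intro!: derivative_eq_intros)
  also have "1 + q / d q = y q / d q" using d0[of q] by (simp add: y_def field_simps)
  finally have "(g has_field_derivative (0 * (y q)^2 - r^2 * (2 * y q * (y q / d q))) / ((y q)^2 * (y q)^2)) (at q)"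
   unfolding g_def using y0[of q] by (auto intro!: derivative_eq_intros)
  also have "(0 * (y q)^2 - r^2 * (2 * y q * (y q / d q))) / ((y q)^2 * (y q)^2) = h q"
   using y0[of q] d0[of q] by (simp add: h_def field_simps power2_eq_square)
  finally show ?thesis by simp
 qed
 have inj: "inj_on g UNIV"
 proof (rule inj_onI)
  fix a b assume "g a = g b"
  then have "(y a)^2 = (y b)^2" using r y0[of a] y0[of b] by (simp add: g_def field_simps)
  then have "y a = y b" using y0[of a] y0[of b] by (simp add: power2_eq_iff_nonneg)
  then show "a = b" using bk[of a] bk[of b] by simp
 qed
 have img: "g ` UNIV = {0<..}"
 proof (intro equalityI subsetI)
  fix t :: real assume t: "t \<in> {0<..}"
  \<comment> \<open>The preimage of \<open>t\<close>; for it \<open>q^2 + 2 * k * r\<close> is the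
    square of \<open>r / (2 * sqrt t) + k * sqrt t\<close>.\<close>
  define q where "q = r / (2 * sqrt t) - k * sqrt t"
  have st: "sqrt t > 0" using t by simp
  have "q^2 + 2 * k * r = (r / (2 * sqrt t) + k * sqrt t)^2"
   using st by (simp add: q_def power2_eq_square field_simps)
  then have "d q = r / (2 * sqrt t) + k * sqrt t" unfolding d_def using st k r by simp
  then have "y q = r / sqrt t" by (simp add: y_def q_def field_simps)
  then have "g q = t" using t r by (simp add: g_def power_divide)
  then show "t \<in> range g" by (metis rangeI)
 qed (use g0 in auto)
 have key: "\<bar>h q\<bar> *\<^sub>R f (g q) = 2 / of_real r * exp (- of_real k * of_real r) * line_integrand (of_real k) s r q" for q
 proof -
  have cs: "csqrt (of_real (q^2) + 2 * of_real k * of_real r) = of_real (d q)"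
  proof -
   have "csqrt (of_real (q^2) + 2 * of_real k * of_real r) = csqrt (of_real (q^2 + 2 * k * r))" by simp
   also have "\<dots> = of_real (d q)" unfolding d_def using kr by (subst csqrt_of_real_nonneg) (auto simp: add_nonneg_nonneg)
   finally show ?thesis .
  qed
  have ln_y: "Ln (of_real q + of_real (d q)) = of_real (ln (y q))"
   using y0[of q] by (simp add: y_def Ln_of_real flip: of_real_add)
  have LI: "line_integrand (of_real k) s r q = of_real (y q / d q) * exp (\<i> * of_real s * of_real (ln (g q))) * of_real (exp (- q\<^sup>2))"
  proof -
   have "ln (g q) = 2 * ln r - 2 * ln (y q)" using r y0[of q] by (simp add: g_def ln_div ln_realpow)
   then have "complex_of_real (ln (g q)) = 2 * of_real (ln r) - 2 * of_real (ln (y q))" by simp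
   then show ?thesis unfolding line_integrand_def cs ln_y by (simp add: y_def)
  qed
  have ex: "g q * k^2 + r^2 / (4 * g q) = q^2 + k * r"
  proof -
   have "g q * k^2 + r^2 / (4 * g q) = (y q / 2 - k * r / y q)^2 + k * r"
    using y0[of q] r by (simp add: g_def power2_eq_square field_simps)
   then show ?thesis using bk[of q] by simp
  qed
  have p: "exp ((- 3 / 2 + \<i> * of_real s) * of_real (ln (g q))) = of_real ((y q / r) ^ 3) * exp (\<i> * of_real s * of_real (ln (g q)))"
  proof -
   have "ln (g q) = 2 * ln r - 2 * ln (y q)" "ln (y q / r) = ln (y q) - ln r"
    using r y0[of q] by (simp_all add: g_def ln_div ln_realpow)
   then have "- 3 / 2 * ln (g q) = 3 * ln (y q / r)" by linarith
   then have "exp (- 3 / 2 * ln (g q)) = (y q / r) ^ 3" using r y0[of q] by (simp add: exp_of_nat_mult[of 3, simplified])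
   then have "exp (complex_of_real (- 3 / 2 * ln (g q))) = of_real ((y q / r) ^ 3)" by (simp only: exp_of_real)
   moreover have "(- 3 / 2 + \<i> * of_real s) * of_real (ln (g q)) = complex_of_real (- 3 / 2 * ln (g q)) + \<i> * of_real s * of_real (ln (g q))"
    by (simp add: algebra_simps)
   ultimately show ?thesis by (simp only: exp_add)
  qed
  have E: "exp (- (g q * k^2) - r^2 / (4 * g q)) = exp (- (k * r)) * exp (- q\<^sup>2)"
  proof -
   have "- (g q * k^2) - r^2 / (4 * g q) = - (k * r) + - q\<^sup>2" using ex by linarith
   then show ?thesis by (simp only: exp_add)
  qed
  have H: "\<bar>h q\<bar> * (y q / r) ^ 3 = 2 / r * (y q / d q)"
   using y0[of q] d0[of q] r by (simp add: h_def abs_mult field_simps power2_eq_square power3_eq_cube)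
  have "\<bar>h q\<bar> *\<^sub>R f (g q) = of_real (\<bar>h q\<bar> * (y q / r) ^ 3) * exp (\<i> * of_real s * of_real (ln (g q))) * of_real (exp (- (k * r)) * exp (- q\<^sup>2))"
   unfolding f_def p E scaleR_conv_of_real by (simp only: of_real_mult mult_ac)
  also have "\<dots> = of_real (2 / r) * of_real (exp (- (k * r))) * line_integrand (of_real k) s r q"
   unfolding H LI by (simp only: of_real_mult mult_ac)
  also have "complex_of_real (exp (- (k * r))) = exp (- of_real k * of_real r)" by (simp add: exp_of_real[symmetric])
  finally show ?thesis by simp
 qed
 have kk: "Re (complex_of_real k) > 0" using k by simp
 have Li: "integrable lborel (\<lambda>q. \<bar>h q\<bar> *\<^sub>R f (g q))"
  unfolding key using line_integrand_integrable(1)[OF kk r] by simp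
 have LI: "(LBINT q. \<bar>h q\<bar> *\<^sub>R f (g q)) = line_kernel (of_real k) s r"
  unfolding key line_kernel_eq by simp
 have hm: "(\<lambda>q. \<bar>h q\<bar> *\<^sub>R f (g q)) \<in> borel_measurable lborel" using Li by (rule borel_measurable_integrable)
 have Ls: "(\<lambda>q. \<bar>h q\<bar> *\<^sub>R f (g q)) absolutely_integrable_on UNIV"
  using Li hm by (simp add: set_integrable_def integrable_completion)
 have "integral UNIV (\<lambda>q. \<bar>h q\<bar> *\<^sub>R f (g q)) = line_kernel (of_real k) s r"
  using set_lebesgue_integral_eq_integral(2)[OF Ls] LI hm by (simp add: set_lebesgue_integral_def integral_completion)
 with Ls have fs: "f absolutely_integrable_on g ` UNIV \<and> integral (g ` UNIV) f = line_kernel (of_real k) s r"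
  by (subst has_absolute_integral_change_of_variables_real[symmetric, where h = h]) (use der inj in auto)
 have FF: "F = (\<lambda>t. indicator {0<..} t *\<^sub>R f t)" by (simp add: F_def f_def)
 have Fm[measurable]: "F \<in> borel_measurable borel" unfolding F_def by measurable
 have "integrable lebesgue F" using fs unfolding img FF set_integrable_def by simp
 then show "integrable lborel F" by (simp add: integrable_completion)
 have "(LBINT t. F t) = (\<integral>t. F t \<partial>lebesgue)" by (simp add: integral_completion)
 also have "\<dots> = line_kernel (of_real k) s r"
  using set_lebesgue_integral_eq_integral(2)[of "{0<..}" f] fs unfolding img FF set_lebesgue_integral_def by simp
 finally show "(LBINT t. F t) = line_kernel (of_real k) s r" .
qed

lemma integrable_pair_mult:
 fixes f :: "'a::euclidean_space \<Rightarrow> complex" and g :: "'b::euclidean_space \<Rightarrow> complex"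
 assumes f: "integrable lborel f" and g: "integrable lborel g"
 shows "integrable lborel2 (\<lambda>(x, y). f x * g y)"
 unfolding integrable_iff_bounded
proof
 have [measurable]: "f \<in> borel_measurable borel" "g \<in> borel_measurable borel"
  using borel_measurable_integrable[OF f] borel_measurable_integrable[OF g] by auto
 show "(\<lambda>(x, y). f x * g y) \<in> borel_measurable lborel2" by measurable
 have "(\<integral>\<^sup>+p. ennreal (norm (case p of (x, y) \<Rightarrow> f x * g y)) \<partial>lborel2)
  = (NN x. (NN y. ennreal (norm (f x)) * ennreal (norm (g y))))"
  by (subst lborel.nn_integral_fst[symmetric]) (auto simp: norm_mult ennreal_mult)
 also have "\<dots> = (NN x. ennreal (norm (f x)) * (NN y. ennreal (norm (g y))))"
  by (intro nn_integral_cong nn_integral_cmult) measurable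
 also have "\<dots> = (NN x. ennreal (norm (f x))) * (NN y. ennreal (norm (g y)))"
  by (rule nn_integral_multc) measurable
 also have "\<dots> < \<infinity>"
  using f g by (auto simp: integrable_iff_bounded ennreal_mult_less_top)
 finally show "(\<integral>\<^sup>+p. ennreal (norm (case p of (x, y) \<Rightarrow> f x * g y)) \<partial>lborel2) < \<infinity>" .
qed

lemma heat_real:
 fixes w :: "real^'n"
 assumes "t > 0"
 shows "heat (of_real t) w = of_real (exp (- (norm w)\<^sup>2 / (4 * t)) / ((2 * sqrt pi) ^ CARD('n) * sqrt t ^ CARD('n)))"
proof -
 have "gauss1 (of_real t) s = of_real (exp (- s\<^sup>2 / (4 * t)) / (2 * sqrt pi * sqrt t))" for s
 proof -
  have "csqrt (4 * of_real pi * of_real t) = csqrt (of_real (4 * pi * t))" by simp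
  also have "\<dots> = of_real (sqrt (4 * pi * t))" using assms by (subst csqrt_of_real_nonneg) auto
  finally have "csqrt (4 * of_real pi * of_real t) = of_real (2 * sqrt pi * sqrt t)" by (simp add: real_sqrt_mult)
  then show ?thesis unfolding gauss1_def by (simp add: exp_of_real[symmetric])
 qed
 then have "heat (of_real t) w = of_real (\<Prod>i\<in>UNIV. exp (- (w $ i)\<^sup>2 / (4 * t)) / (2 * sqrt pi * sqrt t))"
  unfolding heat_def by simp
 also have "(\<Prod>i\<in>UNIV. exp (- (w $ i)\<^sup>2 / (4 * t)) / (2 * sqrt pi * sqrt t)) = (\<Prod>i\<in>UNIV. exp (- (w $ i)\<^sup>2 / (4 * t))) / (2 * sqrt pi * sqrt t) ^ CARD('n)"
  by (simp add: prod_dividef)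
 also have "(\<Prod>i\<in>UNIV. exp (- (w $ i)\<^sup>2 / (4 * t))) = exp (- (norm w)\<^sup>2 / (4 * t))"
  by (simp add: exp_sum[symmetric] norm_sq_vec sum_negf sum_divide_distrib[symmetric])
 finally show ?thesis by (simp add: power_mult_distrib)
qed

text \<open>Euler's integral writes Gamma times the symbol as a superposition of Gaussians in
  \<open>y\<close>; \<open>heat_pairing\<close> takes each of them to a heat kernel, and
  \<open>line_kernel_heat\<close> carries out the integral over time. The constant is (2 pi)^n / (2
  sqrt pi)^n = (sqrt pi)^n.\<close>

lemma line_identity_real:
 fixes C :: "real^'n \<Rightarrow> complex" and k :: real
 assumes n: "CARD('n) \<ge> 2" and k: "k > 0" and Z: "Re Z = (real CARD('n) - 1) / 2"
  and C: "integrable lborel C" and FC: "integrable lborel (fourier C)"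
  and Cr: "integrable lborel (\<lambda>w. C w / of_real (norm w))"
 shows "Gamma Z * (LBINT y. power_symbol (of_real k) Z ((norm y)^2) * fourier C y)
  = of_real (sqrt pi ^ CARD('n)) * (LBINT w. line_kernel (of_real k) (Im Z) (norm w) * C w)"
proof -
 define s where "s = Im Z"
 have Z0: "Re Z > 0" using n Z by simp
 have [measurable]: "C \<in> borel_measurable borel" "fourier C \<in> borel_measurable borel"
  using borel_measurable_integrable[OF C] by auto
 define e where "e t = exp ((Z - 1) * of_real (ln t))" for t :: real
 have [measurable]: "e \<in> borel_measurable borel" unfolding e_def by measurable
 define H1 where "H1 y t = (indicator {0<..} t *\<^sub>R (e t * of_real (exp (- ((norm y)^2 + k^2) * t)))) * fourier C y" for y :: "real^'n" and t :: real
 have [measurable]: "(\<lambda>p. H1 (fst p) (snd p)) \<in> borel_measurable lborel2"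
  unfolding H1_def by measurable
 have i1: "integrable lborel2 (\<lambda>(y, t). H1 y t)"
 proof (rule Bochner_Integration.integrable_bound)
  show "integrable lborel2 (\<lambda>(y, t). fourier C y * (indicator {0<..} t *\<^sub>R (e t * of_real (exp (- k\<^sup>2 * t)))))"
   unfolding e_def using k by (intro integrable_pair_mult FC complex_Gamma_scaled(1)[OF Z0]) auto
  show "AE p in lborel \<Otimes>\<^sub>M lborel. norm (case p of (y, t) \<Rightarrow> H1 y t) \<le> norm (case p of (y, t) \<Rightarrow> fourier C y * (indicator {0<..} t *\<^sub>R (e t * of_real (exp (- k\<^sup>2 * t)))))"
  proof (intro AE_I2)
   fix p :: "(real^'n) \<times> real"
   obtain y t where p: "p = (y, t)" by force
   show "norm (case p of (y, t) \<Rightarrow> H1 y t) \<le> norm (case p of (y, t) \<Rightarrow> fourier C y * (indicator {0<..} t *\<^sub>R (e t * of_real (exp (- k\<^sup>2 * t)))))"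
   proof (cases "t > 0")
    case True
    then have "exp (- ((norm y)^2 + k^2) * t) \<le> exp (- k\<^sup>2 * t)" by (simp add: algebra_simps)
    then have "norm (fourier C y) * (norm (e t) * exp (- ((norm y)^2 + k^2) * t)) \<le> norm (fourier C y) * (norm (e t) * exp (- k\<^sup>2 * t))"
     by (intro mult_left_mono) auto
    then show ?thesis using True by (simp add: p H1_def norm_mult mult_ac)
   qed (simp add: p H1_def)
  qed
 qed (simp add: case_prod_beta')
 have "Gamma Z * (LBINT y. power_symbol (of_real k) Z ((norm y)^2) * fourier C y)
  = (LBINT y. (LBINT t. H1 y t))"
 proof -
  have "(LBINT t. H1 y t) = Gamma Z * (power_symbol (of_real k) Z ((norm y)^2) * fourier C y)" for y
  proof -
   have A: "(norm y)^2 + k^2 > 0" using k by (simp add: add_nonneg_pos)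
   have "Ln (of_real ((norm y)^2) + (of_real k)^2) = of_real (ln ((norm y)^2 + k^2))"
    using Ln_of_real[OF A] by simp
   then have "power_symbol (of_real k) Z ((norm y)^2) = exp (- Z * of_real (ln ((norm y)^2 + k^2)))"
    unfolding power_symbol_def by (simp only:)
   then show ?thesis
    unfolding H1_def integral_mult_left_zero e_def complex_Gamma_scaled(2)[OF Z0 A] by (simp only: mult.assoc)
  qed
  then show ?thesis by simp
 qed
 also have "\<dots> = (LBINT t. (LBINT y. H1 y t))"
  by (rule lborel_pair.Fubini_integral[OF i1, symmetric])
 also have "\<dots> = (LBINT t. (LBINT w. (indicator {0<..} t *\<^sub>R (e t * of_real (exp (- k\<^sup>2 * t)))) * (of_real ((2 * pi) ^ CARD('n)) * (heat (of_real t) w * C w))))"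
 proof (rule LBINT_cong[OF refl])
  fix t :: real
  show "(LBINT y. H1 y t) = (LBINT w. (indicator {0<..} t *\<^sub>R (e t * of_real (exp (- k\<^sup>2 * t)))) * (of_real ((2 * pi) ^ CARD('n)) * (heat (of_real t) w * C w)))"
  proof (cases "t > 0")
   case True
   then have tr: "Re (complex_of_real t) > 0" by simp
   have "H1 y t = (e t * of_real (exp (- k\<^sup>2 * t))) * (exp (- of_real t * of_real ((norm y)^2)) * fourier C y)" for y
   proof -
    have "- ((norm y)^2 + k^2) * t = - k\<^sup>2 * t + (- t * (norm y)^2)" by (simp add: algebra_simps)
    then have "complex_of_real (exp (- ((norm y)^2 + k^2) * t)) = of_real (exp (- k\<^sup>2 * t)) * of_real (exp (- t * (norm y)^2))"
     by (simp only: exp_add of_real_mult)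
    moreover have "complex_of_real (exp (- t * (norm y)^2)) = exp (- of_real t * of_real ((norm y)^2))"
     by (simp add: exp_of_real[symmetric])
    ultimately show ?thesis using True by (simp only: H1_def) (simp add: mult_ac)
   qed
   then show ?thesis using True
    by (simp only: integral_mult_right_zero heat_pairing[OF tr C]) simp
  qed (simp add: H1_def)
 qed
 also have "\<dots> = (LBINT w. of_real (sqrt pi ^ CARD('n)) * (line_kernel (of_real k) (Im Z) (norm w) * C w))"
 proof -
  define F where "F s r t = indicator {0<..} t *\<^sub>R (exp ((- 3 / 2 + \<i> * of_real s) * of_real (ln t)) * complex_of_real (exp (- (t * k^2) - r^2 / (4 * t))))" for s r t :: real
  define H2 where "H2 t w = of_real (sqrt pi ^ CARD('n)) * (F s (norm w) t * C w)" for t and w :: "real^'n"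
  have H2: "(indicator {0<..} t *\<^sub>R (e t * of_real (exp (- k\<^sup>2 * t)))) * (of_real ((2 * pi) ^ CARD('n)) * (heat (of_real t) w * C w)) = H2 t w" for t w
  proof (cases "t > 0")
   case True
   have 1: "e t = exp ((- 3 / 2 + \<i> * of_real s) * of_real (ln t)) * of_real (sqrt t ^ CARD('n))"
   proof -
    have "sqrt t = exp (ln t / 2)" using True by (simp add: powr_half_sqrt[symmetric] powr_def)
    then have "sqrt t ^ CARD('n) = exp (real CARD('n) * (ln t / 2))" by (simp only: exp_of_nat_mult)
    then have 2: "complex_of_real (sqrt t ^ CARD('n)) = exp (of_real (real CARD('n) / 2) * of_real (ln t))"
     by (simp add: exp_of_real[symmetric])
    have "Z - 1 = (- 3 / 2 + \<i> * of_real s) + of_real (real CARD('n) / 2)"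
     using Z by (simp add: complex_eq_iff s_def field_simps)
    then have "e t = exp (((- 3 / 2 + \<i> * of_real s) + of_real (real CARD('n) / 2)) * of_real (ln t))"
     by (simp only: e_def)
    also have "\<dots> = exp ((- 3 / 2 + \<i> * of_real s) * of_real (ln t)) * exp (of_real (real CARD('n) / 2) * of_real (ln t))"
     by (simp only: distrib_right exp_add)
    finally show ?thesis unfolding 2 .
   qed
   have 3: "(sqrt t ^ CARD('n) * exp (- k\<^sup>2 * t)) * ((2 * pi) ^ CARD('n) * (exp (- (norm w)\<^sup>2 / (4 * t)) / ((2 * sqrt pi) ^ CARD('n) * sqrt t ^ CARD('n))))
     = sqrt pi ^ CARD('n) * exp (- (t * k^2) - (norm w)^2 / (4 * t))"
   proof -
    have a: "exp (- (t * k^2) - (norm w)^2 / (4 * t)) = exp (- k\<^sup>2 * t) * exp (- (norm w)\<^sup>2 / (4 * t))"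
     by (simp add: exp_add[symmetric] mult.commute)
    have b: "(2 * pi) ^ CARD('n) = sqrt pi ^ CARD('n) * (2 * sqrt pi) ^ CARD('n)"
    proof -
     have "2 * pi = sqrt pi * (2 * sqrt pi)" by simp
     then have "(2 * pi) ^ CARD('n) = (sqrt pi * (2 * sqrt pi)) ^ CARD('n)" by (simp only:)
     then show ?thesis by (simp only: power_mult_distrib[of "sqrt pi" "2 * sqrt pi"])
    qed
    have alg: "(X * u) * ((P * Q) * (c / (Q * X))) = P * (u * c)" if "X \<noteq> 0" "Q \<noteq> 0" for X u P Q c :: real
     using that by simp
    show ?thesis unfolding a b by (rule alg) (use True in auto)
   qed
   have "(indicator {0<..} t *\<^sub>R (e t * of_real (exp (- k\<^sup>2 * t)))) * (of_real ((2 * pi) ^ CARD('n)) * (heat (of_real t) w * C w))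
    = exp ((- 3 / 2 + \<i> * of_real s) * of_real (ln t)) * of_real ((sqrt t ^ CARD('n) * exp (- k\<^sup>2 * t)) * ((2 * pi) ^ CARD('n) * (exp (- (norm w)\<^sup>2 / (4 * t)) / ((2 * sqrt pi) ^ CARD('n) * sqrt t ^ CARD('n))))) * C w"
   proof -
    have i: "indicator {0<..} t *\<^sub>R z = z" for z :: complex using True by simp
    have alg: "(x * of_real T * of_real u) * (of_real B * (of_real G * c)) = x * of_real ((T * u) * (B * G)) * c" for x c :: complex and T u B G :: real
     by (simp only: of_real_mult mult.assoc mult.commute mult.left_commute)
    show ?thesis unfolding 1 heat_real[OF True] i by (rule alg)
   qed
   also have "\<dots> = H2 t w"
   proof -
    have i: "indicator {0<..} t *\<^sub>R z = z" for z :: complex using True by simp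
    have alg: "x * of_real (P * u) * c = of_real P * (x * of_real u * c)" for x c :: complex and P u :: real
     by (simp only: of_real_mult mult.assoc mult.commute mult.left_commute)
    show ?thesis unfolding 3 H2_def F_def i by (rule alg)
   qed
   finally show ?thesis .
  qed (simp add: H2_def F_def)
  have Fm[measurable]: "(\<lambda>p. F s (norm (snd p)) (fst p)) \<in> borel_measurable (lborel \<Otimes>\<^sub>M (lborel :: (real^'n) measure))" unfolding F_def by measurable
  have [measurable]: "F s r \<in> borel_measurable borel" for s r unfolding F_def by measurable
  have i2: "integrable lborel2 (\<lambda>(t, w). H2 t w)"
   unfolding integrable_iff_bounded
  proof
   show m[measurable]: "(\<lambda>(t, w). H2 t w) \<in> borel_measurable lborel2" unfolding H2_def case_prod_beta' by measurable
   have "(\<integral>\<^sup>+p. ennreal (norm (case p of (t, w) \<Rightarrow> H2 t w)) \<partial>lborel2) = (NN w. (NN t. ennreal (norm (H2 t w))))"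
    by (subst lborel_pair.nn_integral_snd[symmetric]) auto
   also have "\<dots> \<le> (NN w. ennreal (sqrt pi ^ CARD('n) * (4 * sqrt pi) * norm (C w / of_real (norm w))))"
   proof (rule nn_integral_mono_AE)
    show "AE w in lborel. (NN t. ennreal (norm (H2 t w))) \<le> ennreal (sqrt pi ^ CARD('n) * (4 * sqrt pi) * norm (C w / of_real (norm w)))"
     using AE_lborel_singleton[of 0]
    proof eventually_elim
     fix w :: "real^'n" assume "w \<noteq> 0"
     then have r: "norm w > 0" by simp
     \<comment> \<open>The modulus removes the imaginary power, so absolute convergence is the case
       \<open>s = 0\<close> of the kernel, bounded by \<open>4 * sqrt pi / norm w\<close>; this is
       where \<open>Cr\<close> enters.\<close>
     have nF: "complex_of_real (norm (F s (norm w) t)) = F 0 (norm w) t" for t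
     proof -
      have "norm (exp ((- 3 / 2 + \<i> * of_real s) * of_real (ln t))) = exp (- 3 / 2 * ln t)" by simp
      moreover have "exp (complex_of_real (- 3 / 2 * ln t)) = of_real (exp (- 3 / 2 * ln t))" by (rule exp_of_real)
      ultimately show ?thesis by (simp add: F_def norm_mult indicator_def)
     qed
     have iF: "integrable lborel (F s (norm w))" "integrable lborel (F 0 (norm w))" for s
      unfolding F_def by (rule line_kernel_heat(1)[OF k r])+
     have "complex_of_real (LBINT t. norm (F s (norm w) t)) = (LBINT t. F 0 (norm w) t)"
      unfolding nF[symmetric] by simp
     also have "\<dots> = line_kernel (of_real k) 0 (norm w)" unfolding F_def by (rule line_kernel_heat(2)[OF k r])
     finally have "norm (complex_of_real (LBINT t. norm (F s (norm w) t))) \<le> 4 * sqrt pi / norm w"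
      using norm_line_kernel_le[of "of_real k" "norm w" 0] k by simp
     then have F4: "(LBINT t. norm (F s (norm w) t)) \<le> 4 * sqrt pi / norm w" by (simp del: of_real_divide)
     have "(NN t. ennreal (norm (H2 t w))) = ennreal (LBINT t. norm (H2 t w))"
      unfolding H2_def by (intro nn_integral_eq_integral integrable_norm integrable_mult_right integrable_mult_left iF) auto
     also have "(LBINT t. norm (H2 t w)) = sqrt pi ^ CARD('n) * ((LBINT t. norm (F s (norm w) t)) * norm (C w))"
      unfolding H2_def norm_mult by (simp add: norm_power)
     also have "\<dots> \<le> sqrt pi ^ CARD('n) * (4 * sqrt pi / norm w * norm (C w))"
      by (intro mult_left_mono mult_right_mono F4) auto
     also have "\<dots> = sqrt pi ^ CARD('n) * (4 * sqrt pi) * norm (C w / of_real (norm w))" by (simp add: norm_divide)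
     finally show "(NN t. ennreal (norm (H2 t w))) \<le> ennreal (sqrt pi ^ CARD('n) * (4 * sqrt pi) * norm (C w / of_real (norm w)))"
      by (simp add: ennreal_leI)
    qed
   qed
   also have "\<dots> < \<infinity>"
    using integrable_mult_right[OF integrable_norm[OF Cr], of "sqrt pi ^ CARD('n) * (4 * sqrt pi)"]
    by (subst nn_integral_eq_integral) (auto simp del: norm_divide)
   finally show "(\<integral>\<^sup>+p. ennreal (norm (case p of (t, w) \<Rightarrow> H2 t w)) \<partial>lborel2) < \<infinity>" .
  qed
  have 1: "(LBINT t. (LBINT w. (indicator {0<..} t *\<^sub>R (e t * of_real (exp (- k\<^sup>2 * t)))) * (of_real ((2 * pi) ^ CARD('n)) * (heat (of_real t) w * C w))))
   = (LBINT w. (LBINT t. (indicator {0<..} t *\<^sub>R (e t * of_real (exp (- k\<^sup>2 * t)))) * (of_real ((2 * pi) ^ CARD('n)) * (heat (of_real t) w * C w))))"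
   unfolding H2 by (rule lborel_pair.Fubini_integral[OF i2, symmetric])
  have 2: "(LBINT w. (LBINT t. (indicator {0<..} t *\<^sub>R (e t * of_real (exp (- k\<^sup>2 * t)))) * (of_real ((2 * pi) ^ CARD('n)) * (heat (of_real t) w * C w))))
   = (LBINT w. of_real (sqrt pi ^ CARD('n)) * (line_kernel (of_real k) (Im Z) (norm w) * C w))"
   unfolding H2
  proof (rule integral_cong_AE)
   show "AE w in lborel. (LBINT t. H2 t w) = of_real (sqrt pi ^ CARD('n)) * (line_kernel (of_real k) (Im Z) (norm w) * C w)"
    using AE_lborel_singleton[of 0]
   proof eventually_elim
    fix w :: "real^'n" assume "w \<noteq> 0"
    then have r: "norm w > 0" by simp
    show "(LBINT t. H2 t w) = of_real (sqrt pi ^ CARD('n)) * (line_kernel (of_real k) (Im Z) (norm w) * C w)"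
     using line_kernel_heat(2)[OF k r, of s]
     unfolding H2_def F_def integral_mult_right_zero integral_mult_left_zero s_def by (simp only:)
   qed
   have "(\<lambda>p. H2 (snd p) (fst p)) \<in> borel_measurable lborel2" unfolding H2_def F_def by measurable
   from lborel.borel_measurable_lebesgue_integral[of "\<lambda>w t. H2 t w" lborel] this
   show "(\<lambda>w. \<integral>t. H2 t w \<partial>lborel) \<in> borel_measurable lborel" by (simp add: case_prod_beta')
  qed measurable
  show ?thesis unfolding 1 2 ..
 qed
 finally show ?thesis by (simp only: integral_mult_right_zero)
qed

text \<open>Analytic continuation in \<open>K\<close> at fixed \<open>s\<close>. The kernel side is
  dominated by a multiple of \<open>norm (C w) / norm w\<close> on the whole half plane, the symbol
  side by a multiple of \<open>norm (fourier C y)\<close> near each point.\<close>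

lemma line_identity:
 fixes C :: "real^'n \<Rightarrow> complex"
 assumes n: "CARD('n) \<ge> 2" and K: "Re K > 0" and s: "Re s = (real CARD('n) - 1) / 2"
  and C: "integrable lborel C" and FC: "integrable lborel (fourier C)"
  and Cr: "integrable lborel (\<lambda>w. C w / of_real (norm w))"
 shows "Gamma s * (LBINT y. power_symbol K s ((norm y)^2) * fourier C y)
  = of_real (sqrt pi ^ CARD('n)) * (LBINT w. line_kernel K (Im s) (norm w) * C w)"
proof (rule holomorphic_right_half_plane_eqI[OF _ _ _ K])
 have s0: "Re s > 0" using n s by simp
 have [measurable]: "C \<in> borel_measurable borel" "fourier C \<in> borel_measurable borel"
  using borel_measurable_integrable[OF C] by auto
 have "(\<lambda>K. \<integral>y. power_symbol K s ((norm y)^2) * fourier C y \<partial>lborel) holomorphic_on {z. 0 < Re z}"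
 proof (rule holomorphic_on_parametric_integral)
  fix y :: "real^'n"
  show "(\<lambda>K. power_symbol K s ((norm y)^2) * fourier C y) holomorphic_on {z. 0 < Re z}"
   unfolding power_symbol_def
   using shifted_square_notin_nonpos[of _ "(norm y)^2"] by (intro holomorphic_intros) auto
 next
  fix a :: complex assume "a \<in> {z. 0 < Re z}"
  then have a: "Re a > 0" by simp
  have "norm (power_symbol K s ((norm y)^2) * fourier C y) \<le> ((Re a / 2)^2) powr (- Re s) * exp (pi * \<bar>Im s\<bar>) * norm (fourier C y)"
   if "0 < Re K" "dist K a \<le> Re a / 2" for K y
  proof -
   have "\<bar>Re K - Re a\<bar> \<le> Re a / 2" using that(2) abs_Re_le_cmod[of "K - a"] by (simp add: dist_norm)
   then have "Re a / 2 \<le> Re K" by linarith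
   then show ?thesis unfolding norm_mult using that(1) a s0
    by (intro mult_right_mono norm_power_symbol_le) auto
  qed
  then show "\<exists>r>0. \<exists>g. integrable lborel g \<and> (\<forall>K\<in>{z. 0 < Re z}. dist K a \<le> r \<longrightarrow>
    (\<forall>x\<in>space lborel. cmod (power_symbol K s ((norm x)^2) * fourier C x) \<le> g x))"
   using a FC by (intro exI[of _ "Re a / 2"] conjI exI[of _ "\<lambda>y. ((Re a / 2)^2) powr (- Re s) * exp (pi * \<bar>Im s\<bar>) * norm (fourier C y)"]) auto
 qed (auto simp: open_halfspace_Re_gt)
 then show "(\<lambda>K. Gamma s * (LBINT y. power_symbol K s ((norm y)^2) * fourier C y)) holomorphic_on {z. 0 < Re z}"
  by (intro holomorphic_intros)
 have "(\<lambda>K. \<integral>w. line_kernel K (Im s) (norm w) * C w \<partial>lborel) holomorphic_on {z. 0 < Re z}"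
 proof (rule holomorphic_on_parametric_integral)
  fix w :: "real^'n"
  show "(\<lambda>K. line_kernel K (Im s) (norm w) * C w) holomorphic_on {z. 0 < Re z}"
   by (intro holomorphic_intros line_kernel_holomorphic) auto
 next
  fix a :: complex
  have "norm (line_kernel K (Im s) (norm w) * C w) \<le> 4 * sqrt pi * exp (2 * pi * \<bar>Im s\<bar>) * norm (C w / of_real (norm w))"
   if "0 < Re K" for K w
   using mult_right_mono[OF norm_line_kernel_le[OF that norm_ge_zero[of w], of "Im s"] norm_ge_zero[of "C w"]]
   by (simp add: norm_mult norm_divide)
  then show "\<exists>r>0. \<exists>g. integrable lborel g \<and> (\<forall>K\<in>{z. 0 < Re z}. dist K a \<le> r \<longrightarrow>
    (\<forall>x\<in>space lborel. cmod (line_kernel K (Im s) (norm x) * C x) \<le> g x))"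
   using Cr by (intro exI[of _ 1] conjI exI[of _ "\<lambda>w. 4 * sqrt pi * exp (2 * pi * \<bar>Im s\<bar>) * norm (C w / of_real (norm w))"]) (auto simp del: norm_divide)
 qed (auto simp: open_halfspace_Re_gt)
 then show "(\<lambda>K. of_real (sqrt pi ^ CARD('n)) * (LBINT w. line_kernel K (Im s) (norm w) * C w)) holomorphic_on {z. 0 < Re z}"
  by (intro holomorphic_intros)
qed (rule line_identity_real[OF n _ s C FC Cr])

lemma line_bound:
 fixes C :: "real^'n \<Rightarrow> complex"
 assumes n: "CARD('n) \<ge> 2" and K: "Re K > 0" and s: "Re s = (real CARD('n) - 1) / 2"
  and C: "integrable lborel C" and FC: "integrable lborel (fourier C)"
  and Cr: "integrable lborel (\<lambda>w. C w / of_real (norm w))"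
 shows "norm (Gamma s * (LBINT y. power_symbol K s ((norm y)^2) * fourier C y))
  \<le> sqrt pi ^ CARD('n) * (4 * sqrt pi * exp (2 * pi * \<bar>Im s\<bar>)) * (LBINT w. norm (C w) / norm w)"
proof -
 have [measurable]: "C \<in> borel_measurable borel" using borel_measurable_integrable[OF C] by auto
 have b: "norm (line_kernel K (Im s) (norm w) * C w) \<le> 4 * sqrt pi * exp (2 * pi * \<bar>Im s\<bar>) * (norm (C w) / norm w)" for w
  using mult_right_mono[OF norm_line_kernel_le[OF K norm_ge_zero[of w], of "Im s"] norm_ge_zero[of "C w"]]
  by (simp add: norm_mult)
 have i: "integrable lborel (\<lambda>w. 4 * sqrt pi * exp (2 * pi * \<bar>Im s\<bar>) * (norm (C w) / norm w))"
  using integrable_norm[OF Cr] by (intro integrable_mult_right) (simp add: norm_divide)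
 have j: "integrable lborel (\<lambda>w. line_kernel K (Im s) (norm w) * C w)"
  by (rule Bochner_Integration.integrable_bound[OF i]) (use b in \<open>auto intro!: AE_I2 order_trans[OF _ abs_ge_self] simp del: norm_mult\<close>)
 have "norm (LBINT w. line_kernel K (Im s) (norm w) * C w) \<le> (LBINT w. 4 * sqrt pi * exp (2 * pi * \<bar>Im s\<bar>) * (norm (C w) / norm w))"
  by (rule order_trans[OF integral_norm_bound integral_mono[OF integrable_norm[OF j] i b]])
 then have "sqrt pi ^ CARD('n) * norm (LBINT w. line_kernel K (Im s) (norm w) * C w)
  \<le> sqrt pi ^ CARD('n) * ((4 * sqrt pi * exp (2 * pi * \<bar>Im s\<bar>)) * (LBINT w. norm (C w) / norm w))"
  unfolding integral_mult_right_zero by (intro mult_left_mono) auto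
 then show ?thesis unfolding line_identity[OF assms] by (simp add: norm_mult norm_power mult.assoc)
qed

subsection \<open>Complex interpolation\<close>

lemma Re_nonpos_Ints: "z \<in> \<int>\<^sub>\<le>\<^sub>0 \<Longrightarrow> Re z \<le> 0"
 by (elim nonpos_Ints_cases) auto

text \<open>The modulus of Euler's integrand is the integrand at the real part.\<close>

lemma norm_Gamma_le:
 assumes "Re z > 0"
 shows "norm (Gamma z) \<le> Gamma (Re z)"
proof -
 define F where "F s t = indicator {0<..} t *\<^sub>R (exp ((s - 1) * of_real (ln t)) * complex_of_real (exp (- 1 * t)))" for s :: complex and t :: real
 have F: "integrable lborel (F s)" "(LBINT t. F s t) = Gamma s" if "Re s > 0" for s
  using complex_Gamma_scaled[OF that, of 1] by (simp_all add: F_def[abs_def])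
 have n: "complex_of_real (norm (F z t)) = F (of_real (Re z)) t" for t
 proof (cases "t > 0")
  case True
  have "norm (exp ((z - 1) * of_real (ln t))) = exp ((Re z - 1) * ln t)" by simp
  moreover have "exp ((complex_of_real (Re z) - 1) * of_real (ln t)) = of_real (exp ((Re z - 1) * ln t))"
   by (simp add: exp_of_real[symmetric])
  ultimately show ?thesis using True by (simp only: F_def norm_scaleR norm_mult norm_of_real) simp
 qed (simp add: F_def)
 have "norm (Gamma z) \<le> (LBINT t. norm (F z t))"
  unfolding F(2)[OF assms, symmetric] by (rule integral_norm_bound)
 moreover have "complex_of_real (LBINT t. norm (F z t)) = of_real (Gamma (Re z))"
  using F(2)[of "of_real (Re z)"] assms unfolding n[symmetric] by (simp add: Gamma_complex_of_real)
 ultimately show ?thesis by simp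
qed

text \<open>The class on which formulas are proved before passing to limits: stable under truncation
  and under multiplication by functions bounded on the support, and contained in L1 and L2.\<close>

definition nice :: "('a::euclidean_space \<Rightarrow> complex) \<Rightarrow> bool" where
 "nice f \<longleftrightarrow> f \<in> borel_measurable borel \<and> (\<exists>B. \<forall>x. norm (f x) \<le> B) \<and> (\<exists>R. \<forall>x. norm x > R \<longrightarrow> f x = 0)"

lemma nice_measurable: "nice f \<Longrightarrow> f \<in> borel_measurable borel"
 by (simp add: nice_def)

lemma nice_bounded_mult:
 assumes f: "nice f" and m: "m \<in> borel_measurable borel" and b: "\<And>x. f x \<noteq> 0 \<Longrightarrow> norm (m x) \<le> B"
 shows "nice (\<lambda>x. m x * f x)"
proof -
 from f obtain B' R where B': "\<And>x. norm (f x) \<le> B'" and R: "\<And>x. norm x > R \<Longrightarrow> f x = 0"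
  and [measurable]: "f \<in> borel_measurable borel" unfolding nice_def by blast
 note [measurable] = m
 have "norm (m x * f x) \<le> \<bar>B\<bar> * \<bar>B'\<bar>" for x
 proof (cases "f x = 0")
  case False
  then have "norm (m x) \<le> \<bar>B\<bar>" "norm (f x) \<le> \<bar>B'\<bar>" using b[of x] B'[of x] by linarith+
  then show ?thesis unfolding norm_mult by (intro mult_mono) auto
 qed simp
 then have "\<exists>B. \<forall>x. norm (m x * f x) \<le> B" by blast
 moreover have "\<exists>R. \<forall>x. norm x > R \<longrightarrow> m x * f x = 0" using R by (intro exI[of _ R]) simp
 ultimately show ?thesis unfolding nice_def by simp
qed

lemma nice_integrable:
 fixes f :: "'a::euclidean_space \<Rightarrow> complex"
 assumes "nice f"
 shows "integrable lborel f" "sq_integrable f"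
proof -
 from assms obtain B R where B: "\<And>x. norm (f x) \<le> B" and R: "\<And>x. norm x > R \<Longrightarrow> f x = 0"
  and [measurable]: "f \<in> borel_measurable borel" unfolding nice_def by blast
 have i: "integrable lborel (\<lambda>x::'a. indicator (cball 0 R) x * c)" for c :: real
  by (intro integrable_mult_left integrable_real_indicator) (use emeasure_bounded_finite[OF bounded_cball, of "0::'a" R] in auto)
 have ind: "f x = 0 \<or> x \<in> cball 0 R" for x using R[of x] by fastforce
 show "integrable lborel f"
  by (rule Bochner_Integration.integrable_bound[OF i[of B]]) (use ind B in \<open>auto simp: indicator_def intro!: AE_I2 order_trans[OF B abs_ge_self]\<close>)
 have "integrable lborel (\<lambda>x. (norm (f x))^2)"
 proof (rule Bochner_Integration.integrable_bound[OF i[of "B^2"]])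
  show "AE x in lborel. norm ((norm (f x))^2) \<le> norm (indicator (cball 0 R) x * B^2)"
  proof (rule AE_I2)
   fix x show "norm ((norm (f x))^2) \<le> norm (indicator (cball 0 R) x * B^2)"
    using ind[of x] B[of x] by (cases "x \<in> cball 0 R") (auto simp: abs_mult intro!: power_mono)
  qed
 qed measurable
 then show "sq_integrable f" by (simp add: sq_integrable_def)
qed

text \<open>The transform is a product of two functions that are square integrable by Bessel, so it
  is integrable without any smoothness. The explicit bound becomes the L2 estimate on the line Re s
  = 0.\<close>

lemma fourier_corr_integrable:
 fixes f g :: "real^'n \<Rightarrow> complex"
 assumes f: "integrable lborel f" "sq_integrable f" and g: "integrable lborel g" "sq_integrable g"
 shows "integrable lborel (fourier (corr f g))"
  "(LBINT y. norm (fourier (corr f g) y)) \<le> (2 * pi) ^ CARD('n) * (norm2 f * norm2 g)"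
proof -
 note bf = bessel_inequality[OF f] and bg = bessel_inequality[OF g]
 have bf': "sq_integrable (\<lambda>y. fourier f (- y))" "norm2 (\<lambda>y. fourier f (- y)) = norm2 (fourier f)"
  using sq_integrable_shift[OF bf(1), of 0] by auto
 have e: "fourier (corr f g) = (\<lambda>y. fourier g y * fourier f (- y))"
  by (rule ext) (rule fourier_corr[OF f(1) g(1)])
 show "integrable lborel (fourier (corr f g))" unfolding e by (rule sq_integrable_mult(1)[OF bg(1) bf'(1)])
 have "(LBINT y. norm (fourier (corr f g) y)) \<le> norm2 (fourier g) * norm2 (fourier f)"
  unfolding e using sq_integrable_mult(2)[OF bg(1) bf'(1)] by (simp add: bf'(2))
 also have "\<dots> \<le> (sqrt ((2 * pi) ^ CARD('n)) * norm2 g) * (sqrt ((2 * pi) ^ CARD('n)) * norm2 f)"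
  by (intro mult_mono bf(2) bg(2)) auto
 also have "\<dots> = (2 * pi) ^ CARD('n) * (norm2 f * norm2 g)"
 proof -
  have "sqrt ((2 * pi) ^ CARD('n)) * sqrt ((2 * pi) ^ CARD('n)) = (2 * pi) ^ CARD('n)" by simp
  then show ?thesis by (metis (no_types, lifting) mult.assoc mult.commute)
 qed
 finally show "(LBINT y. norm (fourier (corr f g) y)) \<le> (2 * pi) ^ CARD('n) * (norm2 f * norm2 g)" .
qed

text \<open>With w = x - y the weight 1 / |w| on the correlation becomes the kernel 1 / |x - y| of
  the Kerman--Sawyer form.\<close>

lemma corr_over_norm_le:
 fixes f g :: "real^'n \<Rightarrow> complex"
 assumes [measurable]: "f \<in> borel_measurable borel" "g \<in> borel_measurable borel"
 shows "(NN w. ennreal (norm (corr f g w) / norm w))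
  \<le> (NN x. (NN y. ennreal (norm (f y) * norm (g x) / dist x y)))"
proof -
 have "(NN w. ennreal (norm (corr f g w) / norm w))
  \<le> (NN w. (NN x. ennreal (norm (f (x - w)) * norm (g x) / norm w)))"
 proof (rule nn_integral_mono)
  fix w :: "real^'n"
  have e: "ennreal (a / norm w) = ennreal (1 / norm w) * ennreal a" if "a \<ge> 0" for a
   using that by (subst ennreal_mult[symmetric]) auto
  have "ennreal (norm (corr f g w) / norm w) \<le> ennreal (1 / norm w) * (NN x. ennreal (norm (f (x - w) * g x)))"
   unfolding corr_def by (subst e) (auto intro!: mult_left_mono norm_integral_le_nn_integral)
  also have "\<dots> = (NN x. ennreal (1 / norm w) * ennreal (norm (f (x - w) * g x)))"
   by (rule nn_integral_cmult[symmetric]) measurable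
  also have "\<dots> = (NN x. ennreal (norm (f (x - w)) * norm (g x) / norm w))"
   by (intro nn_integral_cong) (subst e[symmetric], auto simp: norm_mult)
  finally show "ennreal (norm (corr f g w) / norm w) \<le> (NN x. ennreal (norm (f (x - w)) * norm (g x) / norm w))" .
 qed
 also have "\<dots> = (NN x. (NN w. ennreal (norm (f (x - w)) * norm (g x) / norm w)))"
  by (rule lborel_pair.Fubini') measurable
 also have "\<dots> = (NN x. (NN y. ennreal (norm (f y) * norm (g x) / dist x y)))"
 proof (rule nn_integral_cong)
  fix x :: "real^'n"
  show "(NN w. ennreal (norm (f (x - w)) * norm (g x) / norm w)) = (NN y. ennreal (norm (f y) * norm (g x) / dist x y))"
   using nn_integral_shift(1)[of "\<lambda>w. ennreal (norm (f (x - w)) * norm (g x) / norm w)" x] by (simp add: dist_norm)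
 qed
 finally show ?thesis .
qed

lemma norm_power_symbol_le_exp:
 assumes "Re K > 0" "\<rho> \<ge> 0" "0 \<le> Re s"
 shows "norm (power_symbol K s \<rho>) \<le> exp (Re s * \<bar>ln ((Re K)^2)\<bar> + pi * \<bar>Im s\<bar>)"
proof -
 have "norm (power_symbol K s \<rho>) \<le> ((Re K)^2) powr (- Re s) * exp (pi * \<bar>Im s\<bar>)"
  using assms by (intro norm_power_symbol_le) auto
 also have "\<dots> = exp (Re s * - ln ((Re K)^2) + pi * \<bar>Im s\<bar>)"
  using assms by (simp add: powr_def exp_add[symmetric])
 also have "\<dots> \<le> exp (Re s * \<bar>ln ((Re K)^2)\<bar> + pi * \<bar>Im s\<bar>)"
 proof -
  have "Re s * - ln ((Re K)^2) \<le> Re s * \<bar>ln ((Re K)^2)\<bar>"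
   using assms(3) by (rule mult_left_mono[OF abs_ge_minus_self])
  then show ?thesis by simp
 qed
 finally show ?thesis .
qed

lemma power_symbol_integral_holomorphic:
 fixes Q :: "real^'n \<Rightarrow> complex"
 assumes K: "Re K > 0" and Q: "integrable lborel Q"
 shows "(\<lambda>s. \<integral>y. power_symbol K s ((norm y)^2) * Q y \<partial>lborel) holomorphic_on {z. 0 < Re z}"
  and "continuous_on {z. 0 \<le> Re z} (\<lambda>s. \<integral>y. power_symbol K s ((norm y)^2) * Q y \<partial>lborel)"
  and "0 \<le> Re s \<Longrightarrow> integrable lborel (\<lambda>y. power_symbol K s ((norm y)^2) * Q y)"
  and "0 \<le> Re s \<Longrightarrow> norm (LBINT y. power_symbol K s ((norm y)^2) * Q y)
   \<le> exp (Re s * \<bar>ln ((Re K)^2)\<bar> + pi * \<bar>Im s\<bar>) * (LBINT y. norm (Q y))"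
proof -
 have [measurable]: "Q \<in> borel_measurable borel" using borel_measurable_integrable[OF Q] by simp
 define L where "L = \<bar>ln ((Re K)^2)\<bar> + pi"
 have b: "norm (power_symbol K s ((norm y)^2) * Q y) \<le> exp (Re s * \<bar>ln ((Re K)^2)\<bar> + pi * \<bar>Im s\<bar>) * norm (Q y)" if "0 \<le> Re s" for s y
  unfolding norm_mult by (intro mult_right_mono norm_power_symbol_le_exp K that) auto
 have b': "norm (power_symbol K s ((norm y)^2) * Q y) \<le> exp (L * (norm a + 1)) * norm (Q y)" if "0 \<le> Re s" "dist s a \<le> 1" for s a y
 proof -
  have "norm s \<le> norm a + 1" using that(2) norm_triangle_ineq2[of s a] by (simp add: dist_norm)
  have "Re s * \<bar>ln ((Re K)^2)\<bar> + pi * \<bar>Im s\<bar> \<le> norm s * \<bar>ln ((Re K)^2)\<bar> + pi * norm s"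
   using complex_Re_le_cmod[of s] abs_Im_le_cmod[of s] by (intro add_mono mult_right_mono mult_left_mono) auto
  also have "\<dots> = L * norm s" by (simp add: L_def algebra_simps)
  also have "\<dots> \<le> L * (norm a + 1)" using \<open>norm s \<le> norm a + 1\<close> by (intro mult_left_mono) (auto simp: L_def)
  finally have "exp (Re s * \<bar>ln ((Re K)^2)\<bar> + pi * \<bar>Im s\<bar>) * norm (Q y) \<le> exp (L * (norm a + 1)) * norm (Q y)"
   by (intro mult_right_mono) auto
  with b[OF that(1), of y] show ?thesis by linarith
 qed
 have dom: "\<exists>r>0. \<exists>g. integrable lborel g \<and> (\<forall>s\<in>A. dist s a \<le> r \<longrightarrow> (\<forall>x\<in>space lborel. norm (power_symbol K s ((norm x)^2) * Q x) \<le> g x))"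
  if "A \<subseteq> {z. 0 \<le> Re z}" for a A
  using b' Q that by (intro exI[of _ 1] conjI exI[of _ "\<lambda>y. exp (L * (norm a + 1)) * norm (Q y)"]) auto
 show "(\<lambda>s. \<integral>y. power_symbol K s ((norm y)^2) * Q y \<partial>lborel) holomorphic_on {z. 0 < Re z}"
 proof (rule holomorphic_on_parametric_integral)
  show "(\<lambda>s. power_symbol K s ((norm x)^2) * Q x) holomorphic_on {z. 0 < Re z}" for x
   unfolding power_symbol_def by (intro holomorphic_intros)
  show "\<exists>r>0. \<exists>g. integrable lborel g \<and> (\<forall>s\<in>{z. 0 < Re z}. dist s a \<le> r \<longrightarrow> (\<forall>x\<in>space lborel. norm (power_symbol K s ((norm x)^2) * Q x) \<le> g x))" for a
   by (rule dom) auto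
 qed (auto simp: open_halfspace_Re_gt)
 show "continuous_on {z. 0 \<le> Re z} (\<lambda>s. \<integral>y. power_symbol K s ((norm y)^2) * Q y \<partial>lborel)"
 proof (rule continuous_on_parametric_integral)
  show "continuous_on {z. 0 \<le> Re z} (\<lambda>s. power_symbol K s ((norm x)^2) * Q x)" for x
   unfolding power_symbol_def by (intro continuous_intros)
  show "\<exists>r>0. \<exists>g. integrable lborel g \<and> (\<forall>s\<in>{z. 0 \<le> Re z}. dist s a \<le> r \<longrightarrow> (\<forall>x\<in>space lborel. norm (power_symbol K s ((norm x)^2) * Q x) \<le> g x))" for a
   by (rule dom) auto
 qed auto
 have gi: "integrable lborel (\<lambda>y. c * norm (Q y))" for c :: real using Q by simp
 show i: "integrable lborel (\<lambda>y. power_symbol K s ((norm y)^2) * Q y)" if "0 \<le> Re s"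
  by (rule Bochner_Integration.integrable_bound[OF gi[of "exp (Re s * \<bar>ln ((Re K)^2)\<bar> + pi * \<bar>Im s\<bar>)"]])
   (use b[OF that] in \<open>auto intro!: AE_I2 simp: abs_mult\<close>)
 show "norm (LBINT y. power_symbol K s ((norm y)^2) * Q y)
   \<le> exp (Re s * \<bar>ln ((Re K)^2)\<bar> + pi * \<bar>Im s\<bar>) * (LBINT y. norm (Q y))" if "0 \<le> Re s"
 proof -
  have "norm (LBINT y. power_symbol K s ((norm y)^2) * Q y) \<le> (LBINT y. exp (Re s * \<bar>ln ((Re K)^2)\<bar> + pi * \<bar>Im s\<bar>) * norm (Q y))"
   by (rule order_trans[OF integral_norm_bound integral_mono[OF integrable_norm[OF i[OF that]] gi b[OF that]]])
  then show ?thesis by simp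
 qed
qed

lemma neg_square_linear_le:
 fixes s c :: real
 assumes "c \<ge> 0"
 shows "- s\<^sup>2 + c * \<bar>s\<bar> \<le> c^2"
proof -
 have "0 \<le> (\<bar>s\<bar> - c)^2" by simp
 then have "2 * c * \<bar>s\<bar> \<le> s^2 + c^2" by (simp add: power2_diff mult_ac)
 moreover have "0 \<le> c * \<bar>s\<bar>" using assms by simp
 ultimately have "c * \<bar>s\<bar> \<le> s^2 + c^2" by linarith
 then show ?thesis by simp
qed

lemma gaussian_decay:
 fixes K e :: real
 assumes "e > 0" "K \<ge> 0"
 shows "\<exists>R. \<forall>s. \<bar>s\<bar> \<ge> R \<longrightarrow> K * exp (- s\<^sup>2 + pi * \<bar>s\<bar>) \<le> e"
proof (intro exI allI impI)
 fix s :: real assume s: "\<bar>s\<bar> \<ge> pi + 1 + \<bar>ln (e / (K + 1))\<bar>"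
 have "\<bar>s\<bar> * 1 \<le> \<bar>s\<bar> * (\<bar>s\<bar> - pi)" using s by (intro mult_left_mono) auto
 then have "- s\<^sup>2 + pi * \<bar>s\<bar> \<le> - \<bar>s\<bar>" by (simp add: algebra_simps power2_eq_square)
 also have "\<dots> \<le> ln (e / (K + 1))" using s pi_gt_zero by linarith
 finally have "exp (- s\<^sup>2 + pi * \<bar>s\<bar>) \<le> exp (ln (e / (K + 1)))" by simp
 also have "\<dots> = e / (K + 1)" using assms by simp
 finally have "K * exp (- s\<^sup>2 + pi * \<bar>s\<bar>) \<le> K * (e / (K + 1))" using assms by (intro mult_left_mono) auto
 also have "\<dots> \<le> e" using assms by (simp add: field_simps)
 finally show "K * exp (- s\<^sup>2 + pi * \<bar>s\<bar>) \<le> e" .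
qed

text \<open>Bound on Re Z = 0: (2 pi)^n comes from Bessel applied to both functions, and exp (1 +
  pi^2) bounds exp (1 - s^2 + pi |s|), the Gaussian factor times the growth of imaginary powers,
  with s = Im Z.\<close>

definition stein_const0 :: "'n::finite itself \<Rightarrow> real" where
 "stein_const0 _ = exp (1 + pi^2) * (2 * pi) ^ CARD('n)"

text \<open>Bound on Re Z = b, per unit of \<open>E\<close>. In order: the Gaussian factor at Im Z =
  0, the constant in |Z| \<le> (b + 1) exp |Im Z|, the constants of \<open>line_bound\<close>, a
  bound for the remaining factors over all Im Z, and 4 for the squared norm of |f| + |g|.\<close>

definition stein_const1 :: "'n::finite itself \<Rightarrow> real" where
 "stein_const1 _ = exp (((real CARD('n) - 1) / 2 - 1)^2) * ((real CARD('n) - 1) / 2 + 1) * sqrt pi ^ CARD('n) *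
  (4 * sqrt pi) * exp ((2 * pi + 1)^2) * 4"

text \<open>The analytic family is F Z = Gamma (1 + Z) exp ((Z - 1)^2) S Z, where S Z pairs the
  power - Z with v^Z f and v^Z g. Using Gamma (1 + Z) = Z Gamma Z removes the pole at 0 and still
  contains the factor of \<open>line_identity\<close>; both extra factors are 1 at Z = 1. The
  Gaussian yields the decay that \<open>three_lines_bound\<close> asks for, and \<theta> = 1 / b is
  the position of Z = 1 in the strip.\<close>

lemma stein_interpolation:
 fixes f g :: "real^'n \<Rightarrow> complex" and v :: "real^'n \<Rightarrow> real"
 defines "b \<equiv> (real CARD('n) - 1) / 2"
 assumes n: "CARD('n) \<ge> 3" and q: "Re q > 0"
  and f: "nice f" "norm2 f \<le> 1" and g: "nice g" "norm2 g \<le> 1"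
  and v[measurable]: "v \<in> borel_measurable borel" and A: "finite A" "\<And>a. a \<in> A \<Longrightarrow> 0 < a"
  and fA: "\<And>x. f x \<noteq> 0 \<Longrightarrow> v x \<in> A" and gA: "\<And>x. g x \<noteq> 0 \<Longrightarrow> v x \<in> A"
  and E: "E > 0"
  and KS: "\<And>h :: real^'n \<Rightarrow> real. h \<in> borel_measurable borel \<Longrightarrow> (\<And>x. 0 \<le> h x) \<Longrightarrow> (NN x. ennreal ((h x)^2)) < \<infinity> \<Longrightarrow>
   (NN x. (NN y. ennreal ((h x * v x powr b) * (h y * v y powr b) / dist x y)))
    \<le> ennreal E * (NN x. ennreal ((h x)^2))"
 shows "norm (LBINT p. power_symbol q 1 ((norm p)^2) * fourier (corr (\<lambda>x. of_real (v x) * f x) (\<lambda>x. of_real (v x) * g x)) p)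
  \<le> stein_const0 TYPE('n) powr (1 - 1 / b) * (stein_const1 TYPE('n) * E) powr (1 / b)"
proof -
 have b1: "b \<ge> 1" using n by (simp add: b_def)
 have [measurable]: "f \<in> borel_measurable borel" "g \<in> borel_measurable borel"
  using f g by (auto dest: nice_measurable)
 define tw where "tw Z h x = exp (Z * of_real (ln (v x))) * h x" for Z and h :: "real^'n \<Rightarrow> complex" and x
 \<comment> \<open>Level sets of \<open>v\<close>: as \<open>v\<close> takes finitely many values
   where \<open>f\<close> or \<open>g\<close> is nonzero, \<open>tw Z\<close> is a finite
   combination of pieces independent of \<open>Z\<close>, and \<open>Z\<close> enters through
   exponentials only.\<close>
 define pc where "pc a h x = of_bool (v x = a) * h x" for a and h :: "real^'n \<Rightarrow> complex" and x
 have lnA: "\<exists>L. \<forall>a\<in>A. \<bar>ln a\<bar> \<le> L"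
  using A(1) by (intro exI[of _ "\<Sum>a\<in>A. \<bar>ln a\<bar>"]) (auto intro: member_le_sum)
 then obtain L where L: "\<And>a. a \<in> A \<Longrightarrow> \<bar>ln a\<bar> \<le> L" by blast
 have nice_pc: "nice (pc a h)" if "nice h" for a h
  unfolding pc_def by (rule nice_bounded_mult[OF that, where B = 1]) auto
 have nice_tw: "nice (tw Z h)" if "nice h" "\<And>x. h x \<noteq> 0 \<Longrightarrow> v x \<in> A" for Z h
  unfolding tw_def
 proof (rule nice_bounded_mult[OF that(1), where B = "exp (\<bar>Re Z\<bar> * L)"])
  fix x assume "h x \<noteq> 0"
  then have "\<bar>ln (v x)\<bar> \<le> L" using L that(2) by blast
  then have "\<bar>Re Z\<bar> * \<bar>ln (v x)\<bar> \<le> \<bar>Re Z\<bar> * L" by (intro mult_left_mono) auto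
  then have "Re Z * ln (v x) \<le> \<bar>Re Z\<bar> * L" using abs_ge_self[of "Re Z * ln (v x)"] by (simp add: abs_mult)
  then show "norm (exp (Z * of_real (ln (v x)))) \<le> exp (\<bar>Re Z\<bar> * L)" by simp
 qed measurable
 have tw_sum: "tw Z h x = (\<Sum>a\<in>A. exp (Z * of_real (ln a)) * pc a h x)" if "h x \<noteq> 0 \<Longrightarrow> v x \<in> A" for Z h x
 proof (cases "h x = 0")
  case False
  then have "v x \<in> A" using that by blast
  then have "(\<Sum>a\<in>A. exp (Z * of_real (ln a)) * pc a h x) = (\<Sum>a\<in>{v x}. exp (Z * of_real (ln a)) * pc a h x)"
   using A(1) by (intro sum.mono_neutral_right) (auto simp: pc_def)
  then show ?thesis by (simp add: tw_def pc_def)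
 qed (simp add: tw_def pc_def)
 have fourier_tw: "fourier (tw Z h) p = (\<Sum>a\<in>A. exp (Z * of_real (ln a)) * fourier (pc a h) p)"
  if "nice h" "\<And>x. h x \<noteq> 0 \<Longrightarrow> v x \<in> A" for Z h p
 proof -
  have i: "integrable lborel (\<lambda>x. pc a h x * cis (- (p \<bullet> x)))" for a
   using integrable_mult_cis[OF nice_integrable(1)[OF nice_pc[OF that(1)]], of a "- p"] by simp
  have "fourier (tw Z h) p = (LBINT x. (\<Sum>a\<in>A. exp (Z * of_real (ln a)) * (pc a h x * cis (- (p \<bullet> x)))))"
   unfolding fourier_def using that(2) by (intro LBINT_cong refl) (simp add: tw_sum sum_distrib_right mult.assoc)
  also have "\<dots> = (\<Sum>a\<in>A. \<integral>x. exp (Z * of_real (ln a)) * (pc a h x * cis (- (p \<bullet> x))) \<partial>lborel)"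
   using i by (intro Bochner_Integration.integral_sum integrable_mult_right)
  also have "\<dots> = (\<Sum>a\<in>A. exp (Z * of_real (ln a)) * fourier (pc a h) p)"
   by (simp only: fourier_def integral_mult_right_zero)
  finally show ?thesis .
 qed
 define Q where "Q a a' = fourier (corr (pc a f) (pc a' g))" for a a'
 have Qi: "integrable lborel (Q a a')" for a a'
  unfolding Q_def using f g by (intro fourier_corr_integrable(1) nice_integrable nice_pc)
 define P where "P a a' Z = (LBINT p. power_symbol q Z ((norm p)^2) * Q a a' p)" for a a' Z
 \<comment> \<open>Holomorphy and continuity are read off from this finite sum; the estimates on the
   two lines use the form \<open>S_eq\<close>.\<close>
 define S where "S Z = (\<Sum>a\<in>A. \<Sum>a'\<in>A. exp (Z * of_real (ln a)) * exp (Z * of_real (ln a')) * P a a' Z)" for Z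
 define F where "F Z = Gamma (1 + Z) * exp ((Z - 1)^2) * S Z" for Z
 have S_eq: "S Z = (LBINT p. power_symbol q Z ((norm p)^2) * fourier (corr (tw Z f) (tw Z g)) p)" if "0 \<le> Re Z" for Z
 proof -
  have nf: "nice (tw Z f)" "nice (tw Z g)" using f g fA gA by (auto intro: nice_tw)
  have "power_symbol q Z ((norm p)^2) * fourier (corr (tw Z f) (tw Z g)) p
   = (\<Sum>a\<in>A. \<Sum>a'\<in>A. exp (Z * of_real (ln a)) * exp (Z * of_real (ln a')) * (power_symbol q Z ((norm p)^2) * Q a a' p))" for p
  proof -
   have "fourier (corr (tw Z f) (tw Z g)) p = fourier (tw Z f) (- p) * fourier (tw Z g) p"
    using nf by (simp add: fourier_corr nice_integrable mult.commute)
   also have "\<dots> = (\<Sum>a\<in>A. \<Sum>a'\<in>A. (exp (Z * of_real (ln a)) * fourier (pc a f) (- p)) * (exp (Z * of_real (ln a')) * fourier (pc a' g) p))"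
    using f g fA gA by (simp add: fourier_tw sum_product)
   also have "\<dots> = (\<Sum>a\<in>A. \<Sum>a'\<in>A. exp (Z * of_real (ln a)) * exp (Z * of_real (ln a')) * Q a a' p)"
    using f g by (intro sum.cong refl) (simp add: Q_def fourier_corr nice_integrable nice_pc)
   finally show ?thesis by (simp add: sum_distrib_left mult_ac)
  qed
  then have "(LBINT p. power_symbol q Z ((norm p)^2) * fourier (corr (tw Z f) (tw Z g)) p)
   = (LBINT p. (\<Sum>a\<in>A. \<Sum>a'\<in>A. exp (Z * of_real (ln a)) * exp (Z * of_real (ln a')) * (power_symbol q Z ((norm p)^2) * Q a a' p)))" by simp
  also have "\<dots> = (\<Sum>a\<in>A. \<integral>p. (\<Sum>a'\<in>A. exp (Z * of_real (ln a)) * exp (Z * of_real (ln a')) * (power_symbol q Z ((norm p)^2) * Q a a' p)) \<partial>lborel)"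
   using that by (intro Bochner_Integration.integral_sum Bochner_Integration.integrable_sum integrable_mult_right power_symbol_integral_holomorphic(3) q Qi)
  also have "\<dots> = S Z" unfolding S_def P_def
   using that by (intro sum.cong refl, subst Bochner_Integration.integral_sum)
    (auto intro!: integrable_mult_right power_symbol_integral_holomorphic(3) q Qi simp: integral_mult_right_zero simp del: integral_mult_right)
  finally show ?thesis by simp
 qed
 have Gh: "(\<lambda>Z. Gamma (1 + Z)) holomorphic_on {z. - 1 < Re z}"
  by (intro holomorphic_intros) (auto dest!: Re_nonpos_Ints)
 have Sh: "S holomorphic_on {z. 0 < Re z}" unfolding S_def P_def
  by (intro holomorphic_intros power_symbol_integral_holomorphic(1) q Qi)
 have Sc: "continuous_on {z. 0 \<le> Re z} S" unfolding S_def P_def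
  by (intro continuous_intros power_symbol_integral_holomorphic(2) q Qi)
 have hol: "F holomorphic_on {z. 0 < Re z \<and> Re z < b}" unfolding F_def
  by (intro holomorphic_intros holomorphic_on_subset[OF Gh] holomorphic_on_subset[OF Sh]) auto
 have cont: "continuous_on {z. 0 \<le> Re z \<and> Re z \<le> b} F" unfolding F_def
  by (intro continuous_intros continuous_on_subset[OF holomorphic_on_imp_continuous_on[OF Gh]] continuous_on_subset[OF Sc]) auto
 have nexp: "norm (exp ((z - 1)^2)) = exp ((Re z - 1)^2 - (Im z)^2)" for z
  by (simp add: power2_eq_square)
 have decay: "\<exists>R. \<forall>z. 0 \<le> Re z \<and> Re z \<le> b \<and> \<bar>Im z\<bar> \<ge> R \<longrightarrow> norm (F z) \<le> e" if e: "e > 0" for e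
 proof -
  have "continuous_on {1..1 + b} (Gamma :: real \<Rightarrow> real)"
   by (intro continuous_intros) (auto elim!: nonpos_Ints_cases)
  then have "compact ((Gamma :: real \<Rightarrow> real) ` {1..1 + b})" by (intro compact_continuous_image) auto
  then obtain G where "\<forall>y\<in>(Gamma :: real \<Rightarrow> real) ` {1..1 + b}. norm y \<le> G"
   using compact_imp_bounded bounded_iff by blast
  then have G: "\<bar>Gamma x\<bar> \<le> G" if "x \<in> {1..1 + b}" for x :: real
   using that by (simp only: real_norm_def image_iff Ball_def) blast
  have G0: "0 \<le> G" using G[of 1] b1 by (auto intro: order_trans[OF abs_ge_zero])
  define T where "T = (\<Sum>a\<in>A. \<Sum>a'\<in>A. exp (b * L) * exp (b * L) * (exp (b * \<bar>ln ((Re q)^2)\<bar>) * (LBINT p. norm (Q a a' p))))"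
  have T0: "0 \<le> T" unfolding T_def by (intro sum_nonneg mult_nonneg_nonneg) auto
  define K where "K = G * exp ((b + 1)^2) * T"
  have K0: "K \<ge> 0" using G0 T0 by (simp add: K_def)
  have bd: "norm (F z) \<le> K * exp (- (Im z)\<^sup>2 + pi * \<bar>Im z\<bar>)" if z: "0 \<le> Re z" "Re z \<le> b" for z
  proof -
   have 1: "norm (Gamma (1 + z)) \<le> G"
   proof -
    have "norm (Gamma (1 + z)) \<le> Gamma (1 + Re z)" using norm_Gamma_le[of "1 + z"] z by simp
    also have "\<dots> \<le> G" using G[of "1 + Re z"] z by simp
    finally show ?thesis .
   qed
   have 2: "norm (exp ((z - 1)^2)) \<le> exp ((b + 1)^2) * exp (- (Im z)\<^sup>2)"
   proof -
    have "(Re z - 1)^2 \<le> (b + 1)^2" using z by (intro power2_le_iff_abs_le[THEN iffD2]) auto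
    then show ?thesis unfolding nexp exp_add[symmetric] by simp
   qed
   have 3: "norm (S z) \<le> T * exp (pi * \<bar>Im z\<bar>)"
    unfolding S_def T_def sum_distrib_right
   proof (intro order_trans[OF norm_sum] sum_mono)
    fix a a' assume a: "a \<in> A" "a' \<in> A"
    have ea: "norm (exp (z * of_real (ln c))) \<le> exp (b * L)" if "c \<in> A" for c
    proof -
     have "Re z * ln c \<le> Re z * \<bar>ln c\<bar>" using z by (intro mult_left_mono) auto
     also have "\<dots> \<le> b * L" using z L[OF that] b1 by (intro mult_mono) auto
     finally show ?thesis by simp
    qed
    have "norm (P a a' z) \<le> exp (Re z * \<bar>ln ((Re q)^2)\<bar> + pi * \<bar>Im z\<bar>) * (LBINT p. norm (Q a a' p))"
     unfolding P_def by (rule power_symbol_integral_holomorphic(4)[OF q Qi z(1)])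
    also have "\<dots> \<le> exp (b * \<bar>ln ((Re q)^2)\<bar> + pi * \<bar>Im z\<bar>) * (LBINT p. norm (Q a a' p))"
     using z by (intro mult_right_mono) (auto intro: mult_right_mono)
    also have "\<dots> = exp (b * \<bar>ln ((Re q)^2)\<bar>) * (LBINT p. norm (Q a a' p)) * exp (pi * \<bar>Im z\<bar>)"
     by (simp add: exp_add)
    finally have "norm (exp (z * of_real (ln a)) * exp (z * of_real (ln a')) * P a a' z)
     \<le> exp (b * L) * exp (b * L) * (exp (b * \<bar>ln ((Re q)^2)\<bar>) * (LBINT p. norm (Q a a' p)) * exp (pi * \<bar>Im z\<bar>))"
     unfolding norm_mult using ea a by (intro mult_mono) auto
    then show "norm (exp (z * of_real (ln a)) * exp (z * of_real (ln a')) * P a a' z)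
     \<le> exp (b * L) * exp (b * L) * (exp (b * \<bar>ln ((Re q)^2)\<bar>) * (LBINT p. norm (Q a a' p))) * exp (pi * \<bar>Im z\<bar>)"
     by (simp only: mult.assoc)
   qed
   have "norm (F z) \<le> G * (exp ((b + 1)^2) * exp (- (Im z)\<^sup>2)) * (T * exp (pi * \<bar>Im z\<bar>))"
    unfolding F_def norm_mult using 1 2 3 G0 by (intro mult_mono) auto
   moreover have "exp (- (Im z)\<^sup>2 + pi * \<bar>Im z\<bar>) = exp (- (Im z)\<^sup>2) * exp (pi * \<bar>Im z\<bar>)" by (rule exp_add)
   ultimately show ?thesis by (simp only: K_def mult.assoc mult.commute mult.left_commute)
  qed
  obtain R where "\<And>s. \<bar>s\<bar> \<ge> R \<Longrightarrow> K * exp (- s\<^sup>2 + pi * \<bar>s\<bar>) \<le> e"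
   using gaussian_decay[OF e K0] by blast
  then show ?thesis using bd by (intro exI[of _ R]) (meson order_trans)
 qed
 have M0: "stein_const0 TYPE('n) > 0" by (simp add: stein_const0_def)
 have "b + 1 > 0" using b1 by simp
 then have M1: "stein_const1 TYPE('n) * E > 0"
  unfolding stein_const1_def using E by (intro mult_pos_pos) (auto simp: b_def)
 have bd0: "norm (F z) \<le> stein_const0 TYPE('n)" if z: "Re z = 0" for z
 proof -
  define s where "s = Im z"
  \<comment> \<open>On this line \<open>tw z\<close> multiplies by numbers of modulus 1.\<close>
  have nn: "norm2 (tw z h) = norm2 h" for h
   unfolding norm2_def tw_def norm_mult using z by simp
  have "norm (S z) \<le> exp (pi * \<bar>s\<bar>) * (LBINT p. norm (fourier (corr (tw z f) (tw z g)) p))"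
   using power_symbol_integral_holomorphic(4)[OF q fourier_corr_integrable(1), of "tw z f" "tw z g" z] f g fA gA z
   by (simp add: S_eq s_def nice_tw nice_integrable)
  also have "\<dots> \<le> exp (pi * \<bar>s\<bar>) * ((2 * pi) ^ CARD('n) * (norm2 (tw z f) * norm2 (tw z g)))"
   using f g fA gA by (intro mult_left_mono fourier_corr_integrable(2) nice_integrable nice_tw) auto
  also have "\<dots> \<le> exp (pi * \<bar>s\<bar>) * ((2 * pi) ^ CARD('n) * (1 * 1))"
   unfolding nn using f g by (intro mult_left_mono mult_mono) auto
  finally have 1: "norm (S z) \<le> exp (pi * \<bar>s\<bar>) * (2 * pi) ^ CARD('n)" by simp
  have 2: "norm (Gamma (1 + z)) \<le> 1" using norm_Gamma_le[of "1 + z"] z by simp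
  have 3: "norm (exp ((z - 1)^2)) = exp (1 - s^2)" unfolding nexp using z by (simp add: s_def)
  have "norm (F z) \<le> 1 * exp (1 - s^2) * (exp (pi * \<bar>s\<bar>) * (2 * pi) ^ CARD('n))"
   unfolding F_def norm_mult using 1 2 3 by (intro mult_mono) auto
  also have "\<dots> = exp (1 + (- s\<^sup>2 + pi * \<bar>s\<bar>)) * (2 * pi) ^ CARD('n)"
   by (simp add: exp_add[symmetric] algebra_simps)
  also have "\<dots> \<le> stein_const0 TYPE('n)"
   unfolding stein_const0_def using neg_square_linear_le[of pi s] by (intro mult_right_mono) auto
  finally show ?thesis .
 qed
 have bd1: "norm (F z) \<le> stein_const1 TYPE('n) * E" if z: "Re z = b" for z
 proof -
  define s where "s = Im z"
  define C where "C = corr (tw z f) (tw z g)"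
  \<comment> \<open>\<open>KS\<close> bounds a quadratic form; this common majorant of
    \<open>f\<close> and \<open>g\<close> turns it into a bilinear bound, at the price of a norm up
    to 2.\<close>
  define h where "h x = norm (f x) + norm (g x)" for x
  have [measurable]: "h \<in> borel_measurable borel" unfolding h_def by measurable
  have nf: "nice (tw z f)" "nice (tw z g)" using f g fA gA by (auto intro: nice_tw)
  have [measurable]: "tw z f \<in> borel_measurable borel" "tw z g \<in> borel_measurable borel"
   using nf by (auto dest: nice_measurable)
  have h2: "(NN x. ennreal ((h x)^2)) \<le> ennreal 4"
  proof -
   have a: "sq_integrable (\<lambda>x. complex_of_real (norm (k x)))" "norm2 (\<lambda>x. complex_of_real (norm (k x))) = norm2 k" if "nice k" for k :: "real^'n \<Rightarrow> complex"
    using nice_integrable(2)[OF that] by (auto simp: sq_integrable_def norm2_def)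
   note s = sq_integrable_add[OF a(1)[OF f(1)] a(1)[OF g(1)]]
   have e: "norm (complex_of_real (norm (f x)) + complex_of_real (norm (g x))) = h x" for x
    unfolding of_real_add[symmetric] norm_of_real by (simp add: h_def)
   have "(NN x. ennreal ((h x)^2)) = ennreal ((norm2 (\<lambda>x. complex_of_real (norm (f x)) + complex_of_real (norm (g x))))^2)"
    using nn_integral_sq_integrable[OF s(1)] unfolding e .
   also have "\<dots> \<le> ennreal (2^2)"
    using s(2) f(2) g(2) unfolding a(2)[OF f(1)] a(2)[OF g(1)] by (intro ennreal_leI power_mono) auto
   finally show ?thesis by simp
  qed
  have twn: "norm (tw z k x) \<le> h x * v x powr b" if "norm (k x) \<le> h x" "k x \<noteq> 0 \<Longrightarrow> v x \<in> A" for k x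
  proof (cases "k x = 0")
   case False
   then have "v x > 0" using that A(2) by blast
   then have "norm (tw z k x) = v x powr b * norm (k x)" using z by (simp add: tw_def norm_mult powr_def)
   also have "\<dots> \<le> v x powr b * h x" using that(1) by (intro mult_left_mono) auto
   finally show ?thesis by (simp add: mult.commute)
  qed (simp add: tw_def h_def)
  have "(NN w. ennreal (norm (C w) / norm w)) \<le> (NN x. (NN y. ennreal (norm (tw z f y) * norm (tw z g x) / dist x y)))"
   unfolding C_def by (rule corr_over_norm_le) measurable
  also have "\<dots> \<le> (NN x. (NN y. ennreal ((h x * v x powr b) * (h y * v y powr b) / dist x y)))"
  proof (intro nn_integral_mono ennreal_leI divide_right_mono)
   fix x y
   have "norm (tw z f y) * norm (tw z g x) \<le> (h y * v y powr b) * (h x * v x powr b)"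
    using fA gA by (intro mult_mono twn) (auto simp: h_def)
   then show "norm (tw z f y) * norm (tw z g x) \<le> (h x * v x powr b) * (h y * v y powr b)" by (simp add: mult.commute)
  qed auto
  also have "\<dots> \<le> ennreal E * (NN x. ennreal ((h x)^2))"
   using h2 by (intro KS) (auto simp: h_def intro: le_less_trans)
  also have "\<dots> \<le> ennreal E * ennreal 4" using h2 by (intro mult_left_mono) auto
  also have "\<dots> = ennreal (4 * E)" using E by (subst ennreal_mult[symmetric]) (auto simp: mult.commute)
  finally have J: "(NN w. ennreal (norm (C w) / norm w)) \<le> ennreal (4 * E)" .
  have [measurable]: "C \<in> borel_measurable borel" unfolding C_def by measurable
  have Cr: "integrable lborel (\<lambda>w. C w / of_real (norm w))"
   unfolding integrable_iff_bounded using J by (auto simp: norm_divide intro: le_less_trans)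
  have J': "(LBINT w. norm (C w) / norm w) \<le> 4 * E"
  proof -
   have "integrable lborel (\<lambda>w. norm (C w) / norm w)" using integrable_norm[OF Cr] by (simp add: norm_divide)
   then have "(NN w. ennreal (norm (C w) / norm w)) = ennreal (LBINT w. norm (C w) / norm w)"
    by (rule nn_integral_eq_integral) auto
   then show ?thesis using J E by simp
  qed
  have Ci: "integrable lborel C" "integrable lborel (fourier C)" unfolding C_def
   by (rule integrable_corr(1)[OF nice_integrable(1)[OF nf(1)] nice_integrable(1)[OF nf(2)]],
     rule fourier_corr_integrable(1)[OF nice_integrable[OF nf(1)] nice_integrable[OF nf(2)]])
  have "norm (Gamma z * S z) \<le> sqrt pi ^ CARD('n) * (4 * sqrt pi * exp (2 * pi * \<bar>s\<bar>)) * (LBINT w. norm (C w) / norm w)"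
   using line_bound[OF _ q _ Ci Cr, of z] z n b1 unfolding s_def C_def by (simp add: S_eq b_def)
  also have "\<dots> \<le> sqrt pi ^ CARD('n) * (4 * sqrt pi * exp (2 * pi * \<bar>s\<bar>)) * (4 * E)"
   by (intro mult_left_mono J') auto
  finally have 1: "norm (Gamma z * S z) \<le> sqrt pi ^ CARD('n) * (4 * sqrt pi * exp (2 * pi * \<bar>s\<bar>)) * (4 * E)" .
  have "z \<notin> \<int>\<^sub>\<le>\<^sub>0" using z b1 by (auto elim!: nonpos_Ints_cases)
  then have G: "Gamma (1 + z) = z * Gamma z" using Gamma_plus1[of z] by (simp add: add.commute)
  have nz: "norm z \<le> (b + 1) * exp \<bar>s\<bar>"
  proof -
   have "norm z \<le> b + \<bar>s\<bar>" using cmod_le[of z] z b1 by (simp add: s_def)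
   also have "\<dots> \<le> b * exp \<bar>s\<bar> + exp \<bar>s\<bar>"
   proof (intro add_mono)
    show "b \<le> b * exp \<bar>s\<bar>" using b1 by simp
    show "\<bar>s\<bar> \<le> exp \<bar>s\<bar>" using exp_ge_add_one_self[of "\<bar>s\<bar>"] by linarith
   qed
   finally show ?thesis by (simp add: algebra_simps)
  qed
  have "norm (F z) = exp ((b - 1)^2 - s^2) * norm z * norm (Gamma z * S z)"
   by (simp only: F_def G norm_mult nexp z s_def mult.assoc mult.commute mult.left_commute)
  also have "\<dots> \<le> exp ((b - 1)^2 - s^2) * ((b + 1) * exp \<bar>s\<bar>) * (sqrt pi ^ CARD('n) * (4 * sqrt pi * exp (2 * pi * \<bar>s\<bar>)) * (4 * E))"
   using 1 nz b1 E by (intro mult_mono mult_left_mono) auto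
  also have "\<dots> = exp ((b - 1)^2) * (b + 1) * sqrt pi ^ CARD('n) * (4 * sqrt pi) * exp (- s\<^sup>2 + (2 * pi + 1) * \<bar>s\<bar>) * 4 * E"
  proof -
   have "exp ((b - 1)^2 - s^2) * exp \<bar>s\<bar> * exp (2 * pi * \<bar>s\<bar>) = exp ((b - 1)^2) * exp (- s\<^sup>2 + (2 * pi + 1) * \<bar>s\<bar>)"
    unfolding exp_add[symmetric] by (simp add: algebra_simps)
   then show ?thesis by (simp add: mult_ac)
  qed
  also have "\<dots> \<le> exp ((b - 1)^2) * (b + 1) * sqrt pi ^ CARD('n) * (4 * sqrt pi) * exp ((2 * pi + 1)^2) * 4 * E"
   using neg_square_linear_le[of "2 * pi + 1" s] b1 E by (intro mult_right_mono mult_left_mono) auto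
  finally show ?thesis by (simp add: stein_const1_def b_def)
 qed
 have "norm (F (of_real (1 / b * b))) \<le> stein_const0 TYPE('n) powr (1 - 1 / b) * (stein_const1 TYPE('n) * E) powr (1 / b)"
  using b1 by (intro three_lines_bound hol cont decay M0 M1 bd0 bd1) auto
 moreover have "of_real (1 / b * b) = (1 :: complex)" using b1 by simp
 moreover have "F 1 = S 1" using Gamma_fact[of 1, where 'a = complex] by (simp add: F_def)
 moreover have "tw 1 f = (\<lambda>x. of_real (v x) * f x)" "tw 1 g = (\<lambda>x. of_real (v x) * g x)"
 proof -
  have "tw 1 k x = of_real (v x) * k x" if "k x \<noteq> 0 \<Longrightarrow> v x \<in> A" for k x
   using that A(2)[of "v x"] by (cases "k x = 0") (auto simp: tw_def exp_of_real)
  then show "tw 1 f = (\<lambda>x. of_real (v x) * f x)" "tw 1 g = (\<lambda>x. of_real (v x) * g x)" using fA gA by blast+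
 qed
 ultimately show ?thesis using S_eq[of 1] by simp
qed

subsection \<open>The resolvent kernel\<close>

text \<open>The real case is Euler's integral at exponent 1; continuation in \<open>a\<close> gives
  the rest.\<close>

lemma laplace_exp:
 assumes a: "Re a > 0"
 shows "integrable lborel (\<lambda>t. indicator {0<..} t *\<^sub>R exp (- of_real t * a))"
  and "(LBINT t. indicator {0<..} t *\<^sub>R exp (- of_real t * a)) = 1 / a"
proof -
 have r: "integrable lborel (\<lambda>t. indicator {0<..} t * exp (- c * t))"
  "(LBINT t. indicator {0<..} t *\<^sub>R exp (- of_real t * of_real c)) = 1 / complex_of_real c" if c: "c > 0" for c :: real
 proof -
  have e: "exp (- of_real t * of_real c) = exp ((1 - 1) * complex_of_real (ln t)) * of_real (exp (- c * t))" for t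
   by (simp add: exp_of_real[symmetric] mult.commute)
  have e': "indicator {0<..} t * exp (- c * t) = norm (indicator {0<..} t *\<^sub>R (exp ((1 - 1) * complex_of_real (ln t)) * of_real (exp (- c * t))))" for t
   by (auto simp: indicator_def)
  show "integrable lborel (\<lambda>t. indicator {0<..} t * exp (- c * t))"
   unfolding e' using complex_Gamma_scaled(1)[of 1 c] c by (intro integrable_norm) simp
  have "exp (- 1 * complex_of_real (ln c)) = 1 / of_real c"
  proof -
   have "exp (- 1 * complex_of_real (ln c)) = inverse (exp (of_real (ln c)))" by (simp add: exp_minus)
   also have "exp (complex_of_real (ln c)) = of_real c" using c by (simp add: exp_of_real)
   finally show ?thesis by (simp add: inverse_eq_divide)
  qed
  then show "(LBINT t. indicator {0<..} t *\<^sub>R exp (- of_real t * of_real c)) = 1 / complex_of_real c"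
   unfolding e using complex_Gamma_scaled(2)[of 1 c] c by simp
 qed
 have n: "norm (indicator {0<..} t *\<^sub>R exp (- of_real t * z)) = indicator {0<..} t * exp (- Re z * t)" for t z
  by (simp add: mult.commute)
 show "integrable lborel (\<lambda>t. indicator {0<..} t *\<^sub>R exp (- of_real t * a))"
 proof (rule Bochner_Integration.integrable_bound[OF r(1)[OF a]])
  show "AE t in lborel. norm (indicator {0<..} t *\<^sub>R exp (- of_real t * a)) \<le> norm (indicator {0<..} t * exp (- Re a * t))"
   unfolding n by simp
 qed measurable
 show "(LBINT t. indicator {0<..} t *\<^sub>R exp (- of_real t * a)) = 1 / a"
 proof (rule holomorphic_right_half_plane_eqI[OF _ _ _ a])
  show "(\<lambda>a. \<integral>t. indicator {0<..} t *\<^sub>R exp (- of_real t * a) \<partial>lborel) holomorphic_on {z. 0 < Re z}"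
  proof (rule holomorphic_on_parametric_integral)
   show "(\<lambda>a. indicator {0<..} t *\<^sub>R exp (- of_real t * a)) holomorphic_on {z. 0 < Re z}" for t :: real
    unfolding scaleR_conv_of_real by (intro holomorphic_intros)
   fix z :: complex assume "z \<in> {z. 0 < Re z}"
   then have z: "Re z > 0" by simp
   have "norm (indicator {0<..} t *\<^sub>R exp (- of_real t * w)) \<le> indicator {0<..} t * exp (- (Re z / 2) * t)"
    if "dist w z \<le> Re z / 2" for w and t :: real
   proof (cases "t > 0")
    case True
    have "\<bar>Re w - Re z\<bar> \<le> Re z / 2" using that abs_Re_le_cmod[of "w - z"] by (simp add: dist_norm)
    then have "Re z / 2 \<le> Re w" by linarith
    then have "(Re z / 2) * t \<le> Re w * t" using True by (intro mult_right_mono) auto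
    then show ?thesis unfolding n using True by simp
   qed simp
   then show "\<exists>r>0. \<exists>g. integrable lborel g \<and> (\<forall>s\<in>{z. 0 < Re z}. dist s z \<le> r \<longrightarrow>
     (\<forall>x\<in>space lborel. cmod (indicat_real {0<..} x *\<^sub>R exp (- of_real x * s)) \<le> g x))"
    using z r(1)[of "Re z / 2"] by (intro exI[of _ "Re z / 2"] conjI exI[of _ "\<lambda>t. indicator {0<..} t * exp (- (Re z / 2) * t)"]) auto
  qed (auto simp: open_halfspace_Re_gt)
  show "(\<lambda>a. 1 / a) holomorphic_on {z. 0 < Re z}" by (intro holomorphic_intros) auto
 qed (rule r(2))
qed

definition resolvent_density :: "complex \<Rightarrow> real \<Rightarrow> real^'n \<Rightarrow> complex" where
 "resolvent_density K t x = (indicator {0<..} t *\<^sub>R exp (- of_real t * K)) * (1 / K * heat (of_real t / K) x)"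

text \<open>
 Integrating \<open>exp (- \<tau> * K\<^sup>2)\<close> against the heat kernel along the ray \<open>\<tau> = t / K\<close> converges
 absolutely in \<open>L\<^sup>1\<close> for all \<open>K\<close> in the right half plane.
\<close>

definition resolvent_kernel :: "complex \<Rightarrow> real^'n \<Rightarrow> complex" where
 "resolvent_kernel K x = (LBINT t. resolvent_density K t x)"

lemma borel_measurable_vec_component [measurable (raw)]:
 fixes f :: "'a \<Rightarrow> real^'n"
 shows "f \<in> borel_measurable M \<Longrightarrow> (\<lambda>x. f x $ i) \<in> borel_measurable M"
 by (rule measurable_compose[of f M borel "\<lambda>x. x $ i"]) auto

lemma resolvent_density_measurable [measurable]:
 "(\<lambda>p. resolvent_density K (fst p) (snd p)) \<in> borel_measurable lborel2"
 unfolding resolvent_density_def heat_def gauss1_def by measurable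

lemma Re_ray: "Re K > 0 \<Longrightarrow> t > 0 \<Longrightarrow> Re (of_real t / K) > 0"
 by (simp add: Re_divide add_pos_nonneg)

text \<open>The L1 norm of the heat kernel at time \<tau> is (|\<tau>| / Re \<tau>)^(n / 2),
  constant along the ray \<tau> = t / K, while exp (- \<tau> K^2) = exp (- t K) decays there. Along
  the positive axis the exponential would grow whenever Re (K^2) < 0.\<close>

lemma resolvent_density_integrable:
 assumes K: "Re K > 0"
 shows "integrable lborel2 (\<lambda>(t, x :: real^'n). resolvent_density K t x)"
 unfolding integrable_iff_bounded
proof
 show "(\<lambda>(t, x :: real^'n). resolvent_density K t x) \<in> borel_measurable lborel2"
  unfolding case_prod_beta' by (rule resolvent_density_measurable)
 define c where "c = norm (1 / K) * sqrt (norm K / Re K) ^ CARD('n)"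
 have K0: "K \<noteq> 0" using K by auto
 have "(\<integral>\<^sup>+p. ennreal (norm (case p of (t, x :: real^'n) \<Rightarrow> resolvent_density K t x)) \<partial>lborel2)
  = (NN t. (NN x. ennreal (norm (resolvent_density K t (x :: real^'n)))))"
  by (subst lborel.nn_integral_fst[symmetric]) (auto simp: case_prod_beta')
 also have "\<dots> = (NN t. ennreal c * ennreal (norm (indicator {0<..} t *\<^sub>R exp (- of_real t * K))))"
 proof (rule nn_integral_cong)
  fix t :: real
  show "(NN x. ennreal (norm (resolvent_density K t (x :: real^'n)))) = ennreal c * ennreal (norm (indicator {0<..} t *\<^sub>R exp (- of_real t * K)))"
  proof (cases "t > 0")
   case True
   note R = Re_ray[OF K True]
   have ratio: "norm (of_real t / K) / Re (of_real t / K) = norm K / Re K"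
   proof -
    have "Re (of_real t / K) = t * Re K / (norm K)^2" by (simp add: Re_divide cmod_power2)
    then show ?thesis unfolding norm_divide using True K0 K by (simp add: power2_eq_square)
   qed
   have "(NN x. ennreal (norm (resolvent_density K t (x :: real^'n))))
    = (NN x. ennreal (norm (exp (- of_real t * K)) * norm (1 / K)) * ennreal (norm (heat (of_real t / K) (x :: real^'n))))"
    using True by (intro nn_integral_cong) (simp add: resolvent_density_def norm_mult norm_divide ennreal_mult[symmetric] mult.assoc)
   also have "\<dots> = ennreal (norm (exp (- of_real t * K)) * norm (1 / K)) * (NN x. ennreal (norm (heat (of_real t / K) (x :: real^'n))))"
    by (rule nn_integral_cmult) measurable
   also have "(NN x. ennreal (norm (heat (of_real t / K) (x :: real^'n)))) = ennreal (sqrt (norm K / Re K) ^ CARD('n))"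
    using heat_integrable[OF R, where 'n = 'n] by (subst nn_integral_eq_integral) (auto simp: ratio)
   also have "ennreal (norm (exp (- of_real t * K)) * norm (1 / K)) * \<dots> = ennreal (c * norm (exp (- of_real t * K)))"
    using K by (subst ennreal_mult[symmetric]) (auto simp: c_def mult_ac)
   also have "\<dots> = ennreal c * ennreal (norm (indicator {0<..} t *\<^sub>R exp (- of_real t * K)))"
    using True K by (subst ennreal_mult) (auto simp: c_def)
   finally show ?thesis .
  qed (simp add: resolvent_density_def)
 qed
 also have "\<dots> = ennreal c * (NN t. ennreal (norm (indicator {0<..} t *\<^sub>R exp (- of_real t * K))))"
  by (rule nn_integral_cmult) measurable
 also have "\<dots> < \<infinity>" using laplace_exp(1)[OF K] by (auto simp: integrable_iff_bounded ennreal_mult_less_top)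
 finally show "(\<integral>\<^sup>+p. ennreal (norm (case p of (t, x :: real^'n) \<Rightarrow> resolvent_density K t x)) \<partial>lborel2) < \<infinity>" .
qed

lemma resolvent_kernel_integrable:
 assumes "Re K > 0"
 shows "integrable lborel (resolvent_kernel K :: real^'n \<Rightarrow> complex)"
 using lborel_pair.integrable_snd[OF resolvent_density_integrable[OF assms]]
 by (simp add: resolvent_kernel_def[abs_def])

lemma power_symbol_1:
 assumes "Re K > 0" "\<rho> \<ge> 0"
 shows "power_symbol K 1 \<rho> = 1 / (of_real \<rho> + K^2)"
proof -
 have "of_real \<rho> + K^2 \<noteq> 0" using shifted_square_notin_nonpos[OF assms] by auto
 then show ?thesis by (simp add: power_symbol_def exp_minus inverse_eq_divide)
qed

lemma resolvent_kernel_pairing: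
 fixes C :: "real^'n \<Rightarrow> complex"
 assumes K: "Re K > 0" and C: "integrable lborel C" and B: "\<And>w. norm (C w) \<le> B"
  and FC: "integrable lborel (fourier C)"
 shows "of_real ((2 * pi) ^ CARD('n)) * (LBINT w. resolvent_kernel K w * C w)
  = (LBINT y. power_symbol K 1 ((norm y)^2) * fourier C y)"
proof -
 have K0: "K \<noteq> 0" using K by auto
 have [measurable]: "C \<in> borel_measurable borel" "fourier C \<in> borel_measurable borel"
  using borel_measurable_integrable[OF C] by auto
 note rd = resolvent_density_measurable[measurable]
 have i1: "integrable lborel2 (\<lambda>(t, w). resolvent_density K t w * C w)"
 proof (rule Bochner_Integration.integrable_bound)
  show "integrable lborel2 (\<lambda>p. (case p of (t, w :: real^'n) \<Rightarrow> resolvent_density K t w) * of_real B)"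
   by (intro integrable_mult_left resolvent_density_integrable K)
  have "norm (resolvent_density K t w * C w) \<le> norm (resolvent_density K t w * of_real B)" for t w
   unfolding norm_mult using B[of w] by (intro mult_left_mono) auto
  then show "AE p in lborel \<Otimes>\<^sub>M lborel. norm (case p of (t, w) \<Rightarrow> resolvent_density K t w * C w) \<le> norm ((case p of (t, w :: real^'n) \<Rightarrow> resolvent_density K t w) * of_real B)"
   by (intro AE_I2) (auto split: prod.split)
 qed (simp add: case_prod_beta')
 have "(LBINT w. resolvent_kernel K w * C w) = (LBINT w. (LBINT t. resolvent_density K t w * C w))"
  by (simp add: resolvent_kernel_def)
 also have "\<dots> = (LBINT t. (LBINT w. resolvent_density K t w * C w))"
  by (rule lborel_pair.Fubini_integral[OF i1])
 finally have "of_real ((2 * pi) ^ CARD('n)) * (LBINT w. resolvent_kernel K w * C w)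
  = (LBINT t. of_real ((2 * pi) ^ CARD('n)) * (LBINT w. resolvent_density K t w * C w))"
  by (simp only: integral_mult_right_zero)
 \<comment> \<open>Along the ray the two exponents combine to \<open>- t * a y\<close>, with
   \<open>Re (a y) \<ge> Re K\<close>. The Laplace integral gives \<open>1 / a y\<close>, and
   \<open>K * a y\<close> is the base of the symbol.\<close>
 define a where "a y = K + of_real ((norm y)^2) / K" for y :: "real^'n"
 define H where "H t y = (indicator {0<..} t *\<^sub>R exp (- of_real t * a y)) * (1 / K * fourier C y)" for t and y :: "real^'n"
 have Re_a: "Re (a y) \<ge> Re K" for y
 proof -
  have "Re (of_real ((norm y)^2) / K) \<ge> 0" using K by (simp add: Re_divide)
  then show ?thesis unfolding a_def by simp
 qed
 have [measurable]: "(\<lambda>p. H (fst p) (snd p)) \<in> borel_measurable lborel2" unfolding H_def a_def by measurable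
 have "of_real ((2 * pi) ^ CARD('n)) * (LBINT w. resolvent_density K t w * C w) = (LBINT y. H t y)" for t
 proof (cases "t > 0")
  case True
  note R = Re_ray[OF K True]
  define m where "m = exp (- of_real t * K) * (1 / K)"
  have "of_real ((2 * pi) ^ CARD('n)) * (LBINT w. resolvent_density K t w * C w)
   = of_real ((2 * pi) ^ CARD('n)) * (LBINT w. m * (heat (of_real t / K) w * C w))"
   using True by (simp add: resolvent_density_def m_def mult.assoc)
  also have "\<dots> = m * (of_real ((2 * pi) ^ CARD('n)) * (LBINT w. heat (of_real t / K) w * C w))"
   unfolding integral_mult_right_zero by (rule mult.left_commute)
  also have "\<dots> = (LBINT y. m * (exp (- (of_real t / K) * of_real ((norm y)^2)) * fourier C y))"
   unfolding heat_pairing[OF R C] by (rule integral_mult_right_zero[symmetric])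
  also have "\<dots> = (LBINT y. H t y)"
  proof (intro LBINT_cong refl)
   fix y :: "real^'n"
   have "- of_real t * a y = - of_real t * K + - (of_real t / K) * of_real ((norm y)^2)"
    by (simp add: a_def algebra_simps)
   then have "exp (- of_real t * a y) = exp (- of_real t * K) * exp (- (of_real t / K) * of_real ((norm y)^2))"
    by (simp only: exp_add)
   then show "m * (exp (- (of_real t / K) * of_real ((norm y)^2)) * fourier C y) = H t y"
    using True by (simp add: H_def m_def)
  qed
  finally show ?thesis .
 qed (simp add: resolvent_density_def H_def)
 note step = this
 have i2: "integrable lborel2 (\<lambda>(t, y). H t y)"
 proof (rule Bochner_Integration.integrable_bound)
  show "integrable lborel2 (\<lambda>(t, y). (indicator {0<..} t *\<^sub>R exp (- of_real t * K)) * (1 / K * fourier C y))"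
   by (intro integrable_pair_mult laplace_exp K integrable_mult_right FC)
  have "norm (H t y) \<le> norm ((indicator {0<..} t *\<^sub>R exp (- of_real t * K)) * (1 / K * fourier C y))" for t y
  proof (cases "t > 0")
   case True
   then have "norm (exp (- of_real t * a y)) \<le> norm (exp (- of_real t * K))" using Re_a[of y] by simp
   then show ?thesis unfolding H_def norm_mult norm_scaleR by (intro mult_right_mono mult_left_mono) auto
  qed (simp add: H_def)
  then show "AE p in lborel \<Otimes>\<^sub>M lborel. norm (case p of (t, y) \<Rightarrow> H t y) \<le> norm (case p of (t, y) \<Rightarrow> (indicator {0<..} t *\<^sub>R exp (- of_real t * K)) * (1 / K * fourier C y))"
   by (intro AE_I2) (auto split: prod.split simp del: norm_mult)
 qed (simp add: case_prod_beta')
 have "of_real ((2 * pi) ^ CARD('n)) * (LBINT w. resolvent_kernel K w * C w) = (LBINT t. (LBINT y. H t y))"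
  unfolding step[symmetric] by fact
 also have "\<dots> = (LBINT y. (LBINT t. H t y))"
  by (rule lborel_pair.Fubini_integral[OF i2, symmetric])
 also have "\<dots> = (LBINT y. power_symbol K 1 ((norm y)^2) * fourier C y)"
 proof (rule LBINT_cong[OF refl])
  fix y :: "real^'n"
  have ra: "Re (a y) > 0" using Re_a[of y] K by linarith
  have "K * a y = of_real ((norm y)^2) + K^2" using K0 by (simp add: a_def field_simps power2_eq_square)
  then have "1 / a y * (1 / K) = power_symbol K 1 ((norm y)^2)"
   using K by (simp add: power_symbol_1 mult.commute)
  then show "(LBINT t. H t y) = power_symbol K 1 ((norm y)^2) * fourier C y"
   unfolding H_def integral_mult_left_zero laplace_exp(2)[OF ra] by (simp only: mult.assoc[symmetric])
 qed
 finally show ?thesis .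
qed

subsection \<open>Approximate identity and inversion at the origin\<close>

lemma heat_scaled_integral:
 fixes C :: "real^'n \<Rightarrow> complex"
 assumes [measurable]: "C \<in> borel_measurable borel" and c: "c > 0"
 shows "(LBINT w. heat (of_real (c^2)) w * C w) = (LBINT v. heat 1 v * C (c *\<^sub>R v))"
proof -
 have "(LBINT w. heat (of_real (c^2)) w * C w)
  = (\<integral>w. heat (of_real (c^2)) w * C w \<partial>density (distr lborel borel (\<lambda>x. 0 + c *\<^sub>R x)) (\<lambda>_. ennreal (\<bar>c\<bar> ^ DIM(real^'n))))"
  using lborel_affine[of c "0 :: real^'n"] c by simp
 also have "\<dots> = (\<integral>w. (c ^ CARD('n)) *\<^sub>R (heat (of_real (c^2)) w * C w) \<partial>distr lborel borel (\<lambda>x. 0 + c *\<^sub>R x))"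
  using c by (subst integral_density) auto
 also have "\<dots> = (LBINT v. (c ^ CARD('n)) *\<^sub>R (heat (of_real (c^2)) (c *\<^sub>R v) * C (c *\<^sub>R v)))"
  by (subst integral_distr) auto
 also have "\<dots> = (LBINT v. heat 1 v * C (c *\<^sub>R v))"
 proof (intro LBINT_cong refl)
  fix v :: "real^'n"
  have "c ^ CARD('n) * (exp (- (norm (c *\<^sub>R v))\<^sup>2 / (4 * c^2)) / ((2 * sqrt pi) ^ CARD('n) * sqrt (c^2) ^ CARD('n)))
   = exp (- (norm v)\<^sup>2 / (4 * 1)) / ((2 * sqrt pi) ^ CARD('n) * sqrt 1 ^ CARD('n))"
   using c by (simp add: power_mult_distrib)
  then have "(c ^ CARD('n)) *\<^sub>R heat (of_real (c^2)) (c *\<^sub>R v) = heat (of_real 1) v"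
   unfolding heat_real[OF zero_less_power[OF c, of 2]] heat_real[OF zero_less_one]
   by (simp only: scaleR_conv_of_real[where 'a = complex] of_real_mult[symmetric])
  then show "(c ^ CARD('n)) *\<^sub>R (heat (of_real (c^2)) (c *\<^sub>R v) * C (c *\<^sub>R v)) = heat 1 v * C (c *\<^sub>R v)"
   by (metis mult_scaleR_left of_real_1)
 qed
 finally show ?thesis .
qed

lemma heat_1_integral: "(LBINT v. heat 1 (v :: real^'n)) = 1"
proof -
 have "heat 1 v = of_real (norm (heat 1 v))" for v :: "real^'n"
 proof -
  have "heat (of_real 1) v = of_real (exp (- (norm v)\<^sup>2 / (4 * 1)) / ((2 * sqrt pi) ^ CARD('n) * sqrt 1 ^ CARD('n)))"
   by (rule heat_real) simp
  moreover have "0 \<le> exp (- (norm v)\<^sup>2 / (4 * 1)) / ((2 * sqrt pi) ^ CARD('n) * sqrt 1 ^ CARD('n))" by simp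
  ultimately show ?thesis by (metis abs_of_nonneg norm_of_real of_real_1)
 qed
 then have "(LBINT v. heat 1 (v :: real^'n)) = of_real (LBINT v. norm (heat 1 (v :: real^'n)))"
  by (metis (no_types, lifting) LBINT_cong integral_complex_of_real)
 then show ?thesis using heat_integrable(2)[of 1, where 'n = 'n] by simp
qed

text \<open>Rescaling fixes the kernel at time 1 and moves the parameter into \<open>C\<close>, so
  boundedness and continuity at the origin suffice.\<close>

lemma heat_approximate_identity:
 fixes C :: "real^'n \<Rightarrow> complex"
 assumes [measurable]: "C \<in> borel_measurable borel" and B: "\<And>w. norm (C w) \<le> B" and cont: "isCont C 0"
 shows "(\<lambda>k. \<integral>w. heat (of_real ((1 / real (Suc k))^2)) w * C w \<partial>lborel) \<longlonglongrightarrow> C 0"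
proof -
 have "(\<lambda>k. \<integral>v. heat 1 v * C ((1 / real (Suc k)) *\<^sub>R v) \<partial>lborel) \<longlonglongrightarrow> (LBINT v. heat 1 (v :: real^'n) * C 0)"
 proof (rule integral_dominated_convergence[where w = "\<lambda>v. norm (heat 1 v) * B"])
  show "integrable lborel (\<lambda>v :: real^'n. norm (heat 1 v) * B)"
   using heat_integrable(1)[of 1] by (intro integrable_mult_left integrable_norm) auto
  show "AE v in lborel. (\<lambda>k. heat 1 (v :: real^'n) * C ((1 / real (Suc k)) *\<^sub>R v)) \<longlonglongrightarrow> heat 1 v * C 0"
  proof (intro AE_I2 tendsto_intros)
   fix v :: "real^'n"
   have "(\<lambda>k. (1 / real (Suc k)) *\<^sub>R v) \<longlonglongrightarrow> 0 *\<^sub>R v"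
    using LIMSEQ_inverse_real_of_nat by (intro tendsto_intros) (simp add: inverse_eq_divide)
   then have "(\<lambda>k. (1 / real (Suc k)) *\<^sub>R v) \<longlonglongrightarrow> 0" by simp
   then show "(\<lambda>k. C ((1 / real (Suc k)) *\<^sub>R v)) \<longlonglongrightarrow> C 0" by (rule isCont_tendsto_compose[OF cont])
  qed
  show "AE v in lborel. norm (heat 1 (v :: real^'n) * C ((1 / real (Suc k)) *\<^sub>R v)) \<le> norm (heat 1 v) * B" for k
   unfolding norm_mult by (intro AE_I2 mult_left_mono B) auto
 qed measurable
 moreover have "(LBINT v. heat 1 (v :: real^'n) * C 0) = C 0" by (simp add: heat_1_integral)
 moreover have "(LBINT v. heat 1 v * C ((1 / real (Suc k)) *\<^sub>R v)) = (LBINT w. heat (of_real ((1 / real (Suc k))^2)) w * C w)" for k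
  by (rule heat_scaled_integral[symmetric]) auto
 ultimately show ?thesis by (simp only:)
qed

text \<open>The two sides are the limits of the two sides of \<open>heat_pairing\<close> as the time
  tends to 0. The value at the origin is the one of interest because \<open>corr h \<phi> 0\<close>
  is the pairing of \<open>h\<close> with \<open>\<phi>\<close>.\<close>

lemma fourier_inversion_0:
 fixes C :: "real^'n \<Rightarrow> complex"
 assumes C: "integrable lborel C" and B: "\<And>w. norm (C w) \<le> B" and cont: "isCont C 0"
  and FC: "integrable lborel (fourier C)"
 shows "(LBINT y. fourier C y) = of_real ((2 * pi) ^ CARD('n)) * C 0"
proof (rule LIMSEQ_unique)
 have [measurable]: "C \<in> borel_measurable borel" using borel_measurable_integrable[OF C] by simp
 let ?t = "\<lambda>k. (1 / real (Suc k))^2"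
 show "(\<lambda>k. of_real ((2 * pi) ^ CARD('n)) * (LBINT w. heat (of_real (?t k)) w * C w)) \<longlonglongrightarrow> of_real ((2 * pi) ^ CARD('n)) * C 0"
  by (intro tendsto_intros heat_approximate_identity[where B = B, OF _ B cont]) measurable
 have "(\<lambda>k. \<integral>y. exp (- of_real (?t k) * of_real ((norm y)^2)) * fourier C y \<partial>lborel) \<longlonglongrightarrow> (LBINT y. fourier C y)"
 proof (rule integral_dominated_convergence[where w = "\<lambda>y. norm (fourier C y)"])
  show "AE y in lborel. (\<lambda>k. exp (- of_real (?t k) * of_real ((norm y)^2)) * fourier C y) \<longlonglongrightarrow> fourier C y"
  proof (rule AE_I2)
   fix y :: "real^'n"
   have "(\<lambda>k. exp (- of_real (?t k) * of_real ((norm y)^2)) * fourier C y) \<longlonglongrightarrow> exp (- of_real (0^2) * of_real ((norm y)^2)) * fourier C y"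
    using LIMSEQ_inverse_real_of_nat by (intro tendsto_intros) (simp add: inverse_eq_divide)
   then show "(\<lambda>k. exp (- of_real (?t k) * of_real ((norm y)^2)) * fourier C y) \<longlonglongrightarrow> fourier C y" by simp
  qed
  show "AE y in lborel. norm (exp (- of_real (?t k) * of_real ((norm y)^2)) * fourier C y) \<le> norm (fourier C y)" for k
   unfolding norm_mult by (intro AE_I2 mult_left_le_one_le) auto
 qed (use FC in \<open>auto intro: integrable_norm\<close>)
 then show "(\<lambda>k. of_real ((2 * pi) ^ CARD('n)) * (LBINT w. heat (of_real (?t k)) w * C w)) \<longlonglongrightarrow> (LBINT y. fourier C y)"
  using C by (subst heat_pairing) auto
qed

subsection \<open>Existence of the resolvent\<close>

lemma has_vector_derivative_line:
 fixes \<phi> :: "real^'n \<Rightarrow> complex"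
 assumes "\<phi> differentiable (at (x + h *\<^sub>R axis i 1))"
 shows "((\<lambda>h. \<phi> (x + h *\<^sub>R axis i 1)) has_vector_derivative partial_deriv i \<phi> (x + h *\<^sub>R axis i 1)) (at h)"
proof -
 let ?y = "x + h *\<^sub>R axis i 1"
 have D: "(\<phi> has_derivative frechet_derivative \<phi> (at ?y)) (at ?y)"
  using assms by (simp add: frechet_derivative_works)
 have "((\<lambda>h. x + h *\<^sub>R axis i (1::real)) has_derivative (\<lambda>t. t *\<^sub>R axis i 1)) (at h)"
  by (auto intro!: derivative_eq_intros)
 from has_derivative_compose[OF this D]
 have "((\<lambda>h. \<phi> (x + h *\<^sub>R axis i 1)) has_derivative (\<lambda>t. frechet_derivative \<phi> (at ?y) (t *\<^sub>R axis i 1))) (at h)" .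
 moreover have "frechet_derivative \<phi> (at ?y) (t *\<^sub>R axis i 1) = t *\<^sub>R partial_deriv i \<phi> ?y" for t
  unfolding partial_deriv_def using has_derivative_linear[OF D] by (rule linear_cmul)
 ultimately show ?thesis by (simp add: has_vector_derivative_def)
qed

lemma partial_deriv_zero_outside:
 fixes \<phi> :: "real^'n \<Rightarrow> complex"
 assumes "\<And>x. norm x > R \<Longrightarrow> \<phi> x = 0" "norm x > R"
 shows "partial_deriv i \<phi> x = 0"
proof -
 have "open {x :: real^'n. norm x > R}" by (intro open_Collect_less continuous_intros)
 then have "(\<phi> has_derivative (\<lambda>_. 0)) (at x)"
  by (rule has_derivative_transform_within_open[OF has_derivative_const[of 0]]) (use assms in auto)
 then show ?thesis by (simp add: partial_deriv_def frechet_derivative_at[symmetric])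
qed

lemma nice_continuous:
 fixes \<phi> :: "real^'n \<Rightarrow> complex"
 assumes c: "continuous_on UNIV \<phi>" and R: "\<And>x. norm x > R \<Longrightarrow> \<phi> x = 0"
 shows "nice \<phi>"
proof -
 have "compact (\<phi> ` cball 0 R)" by (intro compact_continuous_image continuous_on_subset[OF c]) auto
 then obtain B where B: "\<forall>y\<in>\<phi> ` cball 0 R. norm y \<le> B" using compact_imp_bounded bounded_iff by blast
 have "norm (\<phi> x) \<le> max B 0" for x
  using B R[of x] by (cases "norm x > R") (auto simp: le_max_iff_disj)
 moreover have "\<phi> \<in> borel_measurable borel" by (rule borel_measurable_continuous_onI[OF c])
 ultimately show ?thesis unfolding nice_def using R by blast
qed

text \<open>A difference quotient has an explicit transform by translation invariance, so the
  formula follows by letting the increment tend to 0 on both sides, in place of an integration by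
  parts.\<close>

lemma fourier_partial_deriv:
 fixes \<phi> :: "real^'n \<Rightarrow> complex"
 assumes d: "\<phi> differentiable_on UNIV" and c: "continuous_on UNIV (partial_deriv i \<phi>)"
  and R: "\<And>x. norm x > R \<Longrightarrow> \<phi> x = 0"
 shows "fourier (partial_deriv i \<phi>) y = \<i> * of_real (y $ i) * fourier \<phi> y"
proof (rule LIMSEQ_unique)
 have cont: "continuous_on UNIV \<phi>" using d by (rule differentiable_imp_continuous_on)
 have n\<phi>: "nice \<phi>" using cont R by (rule nice_continuous)
 have nd: "nice (partial_deriv i \<phi>)" using c partial_deriv_zero_outside[OF R] by (rule nice_continuous)
 then obtain B where B: "\<And>x. norm (partial_deriv i \<phi> x) \<le> B" unfolding nice_def by blast
 have B0: "0 \<le> B" using B[of 0] by (rule order_trans[OF norm_ge_zero])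
 have [measurable]: "\<phi> \<in> borel_measurable borel" "partial_deriv i \<phi> \<in> borel_measurable borel"
  using n\<phi> nd by (auto dest: nice_measurable)
 define e where "e = (axis i 1 :: real^'n)"
 define h where "h k = 1 / real (Suc k)" for k
 have h: "h k > 0" "h k \<le> 1" for k by (auto simp: h_def)
 have h0: "h \<longlonglongrightarrow> 0" unfolding h_def using LIMSEQ_inverse_real_of_nat by (simp add: inverse_eq_divide)
 define q where "q k x = (\<phi> (x + h k *\<^sub>R e) - \<phi> x) / of_real (h k)" for k x
 have vd: "((\<lambda>h. \<phi> (x + h *\<^sub>R e)) has_vector_derivative partial_deriv i \<phi> (x + t *\<^sub>R e)) (at t)" for x t
  unfolding e_def using d by (intro has_vector_derivative_line) (auto simp: differentiable_on_def)
 have qlim: "(\<lambda>k. q k x) \<longlonglongrightarrow> partial_deriv i \<phi> x" for x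
 proof -
  have "((\<lambda>t. (\<phi> (x + t *\<^sub>R e) - \<phi> x) /\<^sub>R t) \<longlongrightarrow> partial_deriv i \<phi> x) (at 0)"
  proof -
   have "((\<lambda>t. norm (((\<phi> (x + t *\<^sub>R e)) - \<phi> x) - t *\<^sub>R partial_deriv i \<phi> x) / norm t) \<longlongrightarrow> 0) (at 0)"
    using vd[of x 0] unfolding has_vector_derivative_def has_derivative_at by simp
   then have "((\<lambda>t. norm ((\<phi> (x + t *\<^sub>R e) - \<phi> x) /\<^sub>R t - partial_deriv i \<phi> x)) \<longlongrightarrow> 0) (at 0)"
   proof (rule Lim_transform_eventually)
    show "\<forall>\<^sub>F t in at 0. norm (((\<phi> (x + t *\<^sub>R e)) - \<phi> x) - t *\<^sub>R partial_deriv i \<phi> x) / norm t = norm ((\<phi> (x + t *\<^sub>R e) - \<phi> x) /\<^sub>R t - partial_deriv i \<phi> x)"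
     unfolding eventually_at
    proof (intro exI[of _ 1] conjI ballI impI)
     fix t :: real assume "t \<noteq> 0 \<and> dist t 0 < 1"
     then have "(\<phi> (x + t *\<^sub>R e) - \<phi> x) /\<^sub>R t - partial_deriv i \<phi> x = inverse t *\<^sub>R (((\<phi> (x + t *\<^sub>R e)) - \<phi> x) - t *\<^sub>R partial_deriv i \<phi> x)"
      by (simp add: scaleR_diff_right)
     then show "norm (((\<phi> (x + t *\<^sub>R e)) - \<phi> x) - t *\<^sub>R partial_deriv i \<phi> x) / norm t = norm ((\<phi> (x + t *\<^sub>R e) - \<phi> x) /\<^sub>R t - partial_deriv i \<phi> x)"
      by (simp add: divide_inverse mult.commute)
    qed auto
   qed
   then show ?thesis by (simp only: tendsto_norm_zero_iff Lim_null[symmetric])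
  qed
  moreover have "filterlim h (at 0) sequentially"
   using h0 h(1) by (simp add: filterlim_at eventually_sequentially less_imp_neq[symmetric])
  ultimately have "(\<lambda>k. (\<phi> (x + h k *\<^sub>R e) - \<phi> x) /\<^sub>R h k) \<longlonglongrightarrow> partial_deriv i \<phi> x"
   by (rule filterlim_compose)
  then show ?thesis by (simp add: q_def scaleR_conv_of_real divide_inverse mult.commute)
 qed
 \<comment> \<open>Increments at most 1 keep the supports inside the ball of radius
   \<open>R + 1\<close>; together with the mean value inequality this gives an integrable
   majorant.\<close>
 have qbound: "norm (q k x) \<le> B * indicator (cball 0 (R + 1)) x" for k x
 proof (cases "norm x \<le> R + 1")
  case True
  have "\<exists>t\<in>{0<..<h k}. norm (\<phi> (x + h k *\<^sub>R e) - \<phi> (x + 0 *\<^sub>R e)) \<le> norm ((h k - 0) *\<^sub>R partial_deriv i \<phi> (x + t *\<^sub>R e))"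
  proof (rule mvt_general)
   show "continuous_on {0..h k} (\<lambda>t. \<phi> (x + t *\<^sub>R e))"
    by (intro continuous_on_compose2[OF cont] continuous_intros) auto
   show "((\<lambda>t. \<phi> (x + t *\<^sub>R e)) has_derivative (\<lambda>s. s *\<^sub>R partial_deriv i \<phi> (x + t *\<^sub>R e))) (at t)" for t
    using vd[of x t] by (simp add: has_vector_derivative_def)
  qed (use h in auto)
  then obtain t where "norm (\<phi> (x + h k *\<^sub>R e) - \<phi> x) \<le> h k * norm (partial_deriv i \<phi> (x + t *\<^sub>R e))" using h(1)[of k] by auto
  also have "\<dots> \<le> h k * B" using h(1)[of k] by (intro mult_left_mono B) auto
  finally have "norm (q k x) \<le> B" using h(1)[of k] by (simp add: q_def norm_divide divide_le_eq mult.commute)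
  then show ?thesis using True by simp
 next
  case False
  have "norm (x + h k *\<^sub>R e) \<ge> norm x - norm (h k *\<^sub>R e)" using norm_triangle_ineq2[of x "- (h k *\<^sub>R e)"] by simp
  moreover have "norm (h k *\<^sub>R e) \<le> 1" using h[of k] by (simp add: e_def norm_axis_1)
  ultimately have "norm (x + h k *\<^sub>R e) > R" using False by linarith
  then show ?thesis using False R[of x] R[of "x + h k *\<^sub>R e"] by (simp add: q_def)
 qed
 have [measurable]: "q k \<in> borel_measurable borel" for k unfolding q_def by measurable
 show "(\<lambda>k. fourier (q k) y) \<longlonglongrightarrow> fourier (partial_deriv i \<phi>) y"
  unfolding fourier_def
 proof (rule integral_dominated_convergence[where w = "\<lambda>x. B * indicator (cball 0 (R + 1)) x"])
  show "integrable lborel (\<lambda>x :: real^'n. B * indicator (cball 0 (R + 1)) x)"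
   using emeasure_bounded_finite[OF bounded_cball, of "0 :: real^'n" "R + 1"]
   by (intro integrable_mult_right integrable_real_indicator) auto
  show "AE x in lborel. (\<lambda>k. q k x * cis (- (y \<bullet> x))) \<longlonglongrightarrow> partial_deriv i \<phi> x * cis (- (y \<bullet> x))"
   by (intro AE_I2 tendsto_intros qlim)
  show "AE x in lborel. norm (q k x * cis (- (y \<bullet> x))) \<le> B * indicator (cball 0 (R + 1)) x" for k
   using qbound by (intro AE_I2) (simp add: norm_mult)
 qed measurable
 have fq: "fourier (q k) y = (cis (h k * (y $ i)) - 1) / of_real (h k) * fourier \<phi> y" for k
 proof -
  have i: "integrable lborel (\<lambda>x. \<phi> x * cis (- (y \<bullet> x)))"
   using integrable_mult_cis[OF nice_integrable(1)[OF n\<phi>], of "- y"] by simp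
  define F where "F x = \<phi> x * (cis (- (y \<bullet> x)) * cis (h k * (y $ i)))" for x
  have [measurable]: "F \<in> borel_measurable borel" unfolding F_def by measurable
  have sh: "\<phi> (x + h k *\<^sub>R e) * cis (- (y \<bullet> x)) = F (x - (- (h k *\<^sub>R e)))" for x
  proof -
   have "y \<bullet> e = y $ i" by (simp add: e_def inner_axis)
   then have "cis (- (y \<bullet> x)) = cis (- (y \<bullet> (x + h k *\<^sub>R e))) * cis (h k * (y $ i))"
    by (simp add: cis_mult inner_add_right)
   then show ?thesis by (simp add: F_def)
  qed
  have Fi: "integrable lborel F" using integrable_mult_left[OF i, of "cis (h k * (y $ i))"] by (simp add: F_def[abs_def] mult.assoc)
  have i2: "integrable lborel (\<lambda>x. \<phi> (x + h k *\<^sub>R e) * cis (- (y \<bullet> x)))"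
   unfolding sh using Fi by (subst integral_shift(4)) auto
  have I2: "(LBINT x. \<phi> (x + h k *\<^sub>R e) * cis (- (y \<bullet> x))) = cis (h k * (y $ i)) * fourier \<phi> y"
  proof -
   have "(LBINT x. \<phi> (x + h k *\<^sub>R e) * cis (- (y \<bullet> x))) = (LBINT x. F x)"
    unfolding sh by (rule integral_shift(2)) measurable
   also have "\<dots> = (LBINT x. cis (h k * (y $ i)) * (\<phi> x * cis (- (y \<bullet> x))))" by (simp add: F_def mult_ac)
   finally show ?thesis unfolding integral_mult_right_zero fourier_def .
  qed
  have "fourier (q k) y = (LBINT x. (\<phi> (x + h k *\<^sub>R e) * cis (- (y \<bullet> x)) - \<phi> x * cis (- (y \<bullet> x))) / of_real (h k))"
   unfolding fourier_def q_def by (simp add: left_diff_distrib)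
  also have "\<dots> = (LBINT x. (\<phi> (x + h k *\<^sub>R e) * cis (- (y \<bullet> x)) - \<phi> x * cis (- (y \<bullet> x)))) / of_real (h k)"
   by (rule integral_divide_zero)
  also have "(LBINT x. (\<phi> (x + h k *\<^sub>R e) * cis (- (y \<bullet> x)) - \<phi> x * cis (- (y \<bullet> x)))) = cis (h k * (y $ i)) * fourier \<phi> y - fourier \<phi> y"
   unfolding Bochner_Integration.integral_diff[OF i2 i] I2 by (simp add: fourier_def)
  finally show ?thesis by (simp add: left_diff_distrib)
 qed
 have "(\<lambda>k. (cis (h k * (y $ i)) - 1) / of_real (h k)) \<longlonglongrightarrow> \<i> * of_real (y $ i)"
 proof -
  have "((\<lambda>z. exp (\<i> * of_real (y $ i) * z)) has_field_derivative (\<i> * of_real (y $ i))) (at 0)"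
   by (auto intro!: derivative_eq_intros)
  then have "(\<lambda>z. (exp (\<i> * of_real (y $ i) * z) - 1) / z) \<midarrow>0\<rightarrow> \<i> * of_real (y $ i)"
   by (simp add: DERIV_def)
  moreover have "filterlim (\<lambda>k. complex_of_real (h k)) (at 0) sequentially"
   using tendsto_of_real[OF h0, where 'a = complex] h(1) by (simp add: filterlim_at eventually_sequentially less_imp_neq[symmetric])
  ultimately have "(\<lambda>k. (exp (\<i> * of_real (y $ i) * of_real (h k)) - 1) / of_real (h k)) \<longlonglongrightarrow> \<i> * of_real (y $ i)"
   by (rule filterlim_compose)
  then show ?thesis by (simp add: cis_conv_exp mult_ac)
 qed
 then show "(\<lambda>k. fourier (q k) y) \<longlonglongrightarrow> \<i> * of_real (y $ i) * fourier \<phi> y"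
  unfolding fq by (intro tendsto_intros)
qed

lemma test_function_support:
 assumes "test_function \<phi>"
 obtains R where "\<And>x. norm x > R \<Longrightarrow> \<phi> x = 0"
proof -
 have "bounded (closure {x. \<phi> x \<noteq> 0})" using assms by (simp add: test_function_def compact_imp_bounded)
 then obtain R where "\<forall>x\<in>closure {x. \<phi> x \<noteq> 0}. norm x \<le> R" by (auto simp: bounded_iff)
 then have "norm x \<le> R" if "\<phi> x \<noteq> 0" for x using that closure_subset[of "{x. \<phi> x \<noteq> 0}"] by blast
 then show ?thesis by (intro that[of R]) (metis not_le)
qed

lemma test_function_laplacian:
 fixes \<phi> :: "real^'n \<Rightarrow> complex"
 assumes "test_function \<phi>"
 shows "nice \<phi>" "continuous_on UNIV \<phi>" "nice (laplacian \<phi>)" "continuous_on UNIV (laplacian \<phi>)"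
  "fourier (laplacian \<phi>) y = - of_real ((norm y)^2) * fourier \<phi> y"
proof -
 have "Ck (Suc (Suc 0)) \<phi>" using assms unfolding test_function_def by blast
 then have d: "\<phi> differentiable_on UNIV" "\<And>i. partial_deriv i \<phi> differentiable_on UNIV"
  and c: "\<And>i j. continuous_on UNIV (partial_deriv j (partial_deriv i \<phi>))" by auto
 obtain R where R: "\<And>x. norm x > R \<Longrightarrow> \<phi> x = 0" using test_function_support[OF assms] by blast
 have R1: "partial_deriv i \<phi> x = 0" if "norm x > R" for i x by (rule partial_deriv_zero_outside[OF R that])
 have R2: "partial_deriv j (partial_deriv i \<phi>) x = 0" if "norm x > R" for i j x
  by (rule partial_deriv_zero_outside[OF R1 that])
 show c0: "continuous_on UNIV \<phi>" using d(1) by (rule differentiable_imp_continuous_on)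
 show "nice \<phi>" using c0 R by (rule nice_continuous)
 show lc: "continuous_on UNIV (laplacian \<phi>)" unfolding laplacian_def[abs_def] by (intro continuous_intros c)
 show "nice (laplacian \<phi>)" using lc by (rule nice_continuous[where R = R]) (simp add: laplacian_def R2)
 have F1: "fourier (partial_deriv i \<phi>) y = \<i> * of_real (y $ i) * fourier \<phi> y" for i
  by (rule fourier_partial_deriv[OF d(1) differentiable_imp_continuous_on[OF d(2)] R])
 have F2: "fourier (partial_deriv i (partial_deriv i \<phi>)) y = \<i> * of_real (y $ i) * (\<i> * of_real (y $ i) * fourier \<phi> y)" for i
  unfolding F1[symmetric] by (rule fourier_partial_deriv[OF d(2) c R1])
 have n2: "nice (partial_deriv i (partial_deriv i \<phi>))" for i by (rule nice_continuous[OF c R2])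
 have i2: "integrable lborel (\<lambda>x. partial_deriv i (partial_deriv i \<phi>) x * cis (- (y \<bullet> x)))" for i
  using integrable_mult_cis[OF nice_integrable(1)[OF n2], of i "- y"] by simp
 have "fourier (laplacian \<phi>) y = (\<Sum>i\<in>UNIV. fourier (partial_deriv i (partial_deriv i \<phi>)) y)"
  unfolding fourier_def laplacian_def sum_distrib_right by (rule Bochner_Integration.integral_sum[OF i2])
 also have "\<dots> = (\<Sum>i\<in>UNIV. - of_real ((y $ i)^2) * fourier \<phi> y)"
 proof (rule sum.cong[OF refl])
  fix i
  have "\<i> * of_real (y $ i) * (\<i> * of_real (y $ i) * z) = (\<i> * \<i>) * of_real ((y $ i)^2) * z" for z
   by (simp only: of_real_power of_real_mult power2_eq_square mult.assoc mult.left_commute mult.commute)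
  then show "fourier (partial_deriv i (partial_deriv i \<phi>)) y = - of_real ((y $ i)^2) * fourier \<phi> y"
   unfolding F2 by simp
 qed
 also have "\<dots> = - of_real ((norm y)^2) * fourier \<phi> y"
  unfolding norm_sq_vec of_real_sum sum_negf[symmetric] sum_distrib_right ..
 finally show "fourier (laplacian \<phi>) y = - of_real ((norm y)^2) * fourier \<phi> y" .
qed

text \<open>The translation is moved to \<open>g\<close>, which is continuous and bounded, while the
  integrable \<open>f\<close> serves as majorant.\<close>

lemma isCont_corr_0:
 fixes f g :: "real^'n \<Rightarrow> complex"
 assumes f: "integrable lborel f" and g: "nice g" "continuous_on UNIV g"
 shows "isCont (corr f g) 0"
 unfolding continuous_at_sequentially
proof (intro allI impI)
 fix w :: "nat \<Rightarrow> real^'n" assume w: "w \<longlonglongrightarrow> 0"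
 have [measurable]: "f \<in> borel_measurable borel" "g \<in> borel_measurable borel"
  using borel_measurable_integrable[OF f] g by (auto dest: nice_measurable)
 obtain B where B: "\<And>x. norm (g x) \<le> B" using g(1) unfolding nice_def by blast
 have e: "corr f g v = (LBINT y. f y * g (y + v))" for v
  unfolding corr_def using integral_shift(2)[of "\<lambda>y. f y * g (y + v)" v] by simp
 have "(\<lambda>k. \<integral>y. f y * g (y + w k) \<partial>lborel) \<longlonglongrightarrow> (LBINT y. f y * g (y + 0))"
 proof (rule integral_dominated_convergence[where w = "\<lambda>y. norm (f y) * B"])
  show "integrable lborel (\<lambda>y. norm (f y) * B)" using f by simp
  show "AE y in lborel. (\<lambda>k. f y * g (y + w k)) \<longlonglongrightarrow> f y * g (y + 0)"
   by (intro AE_I2 tendsto_intros continuous_on_tendsto_compose[OF g(2)] w) auto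
  show "AE y in lborel. norm (f y * g (y + w k)) \<le> norm (f y) * B" for k
   unfolding norm_mult by (intro AE_I2 mult_left_mono B) auto
 qed measurable
 then show "(corr f g \<circ> w) \<longlonglongrightarrow> corr f g 0" by (simp add: e o_def)
qed

lemma sq_integrable_approx:
 fixes f :: "'a::euclidean_space \<Rightarrow> complex"
 assumes f: "sq_integrable f"
 shows "\<exists>F. (\<forall>k. nice (F k)) \<and> (\<forall>k x. F k x = f x \<or> F k x = 0) \<and> (\<lambda>k. norm2 (\<lambda>x. f x - F k x)) \<longlonglongrightarrow> 0"
proof -
 have [measurable]: "f \<in> borel_measurable borel" using f by (simp add: sq_integrable_def)
 define F where "F k x = of_bool (norm x \<le> real k \<and> norm (f x) \<le> real k) * f x" for k x
 have "nice (F k)" for k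
  unfolding nice_def
 proof (intro conjI exI allI)
  show "F k \<in> borel_measurable borel" unfolding F_def by measurable
  show "norm (F k x) \<le> real k" for x by (auto simp: F_def)
  show "real k < norm x \<longrightarrow> F k x = 0" for x by (auto simp: F_def)
 qed
 moreover have "F k x = f x \<or> F k x = 0" for k x by (auto simp: F_def)
 moreover have "(\<lambda>k. norm2 (\<lambda>x. f x - F k x)) \<longlonglongrightarrow> 0"
 proof -
  have "(\<lambda>k. \<integral>x. (norm (f x - F k x))^2 \<partial>lborel) \<longlonglongrightarrow> (\<integral>x. 0 \<partial>(lborel :: 'a measure))"
  proof (rule integral_dominated_convergence[where w = "\<lambda>x. (norm (f x))^2"])
   show "AE x in lborel. (\<lambda>k. (norm (f x - F k x))^2) \<longlonglongrightarrow> 0"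
   proof (rule AE_I2)
    fix x
    obtain N :: nat where N: "max (norm x) (norm (f x)) \<le> real N" using real_arch_simple by blast
    have "\<forall>\<^sub>F k in sequentially. (norm (f x - F k x))^2 = 0"
     using eventually_ge_at_top[of N] by eventually_elim (use N in \<open>auto simp: F_def\<close>)
    then show "(\<lambda>k. (norm (f x - F k x))^2) \<longlonglongrightarrow> 0" by (rule tendsto_eventually)
   qed
   show "AE x in lborel. norm ((norm (f x - F k x))^2) \<le> (norm (f x))^2" for k
    by (intro AE_I2) (auto simp: F_def)
  qed (use f in \<open>auto simp: sq_integrable_def F_def\<close>)
  then have "(\<lambda>k. sqrt (LBINT x. (norm (f x - F k x))^2)) \<longlonglongrightarrow> sqrt 0"
   by (intro tendsto_real_sqrt) simp
  then show ?thesis by (simp add: norm2_def)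
 qed
 ultimately show ?thesis by blast
qed

lemma corr_diff_left:
 assumes "sq_integrable f" "sq_integrable f'" "sq_integrable g"
 shows "corr (\<lambda>x. f x - f' x) g w = corr f g w - corr f' g w"
 unfolding corr_def left_diff_distrib
 by (rule Bochner_Integration.integral_diff[OF
   sq_integrable_mult(1)[OF sq_integrable_shift(2)[OF assms(1)] assms(3)]
   sq_integrable_mult(1)[OF sq_integrable_shift(2)[OF assms(2)] assms(3)]])

lemma integrable_L1_bounded:
 fixes K C :: "'a::euclidean_space \<Rightarrow> complex"
 assumes K: "integrable lborel K" and [measurable]: "C \<in> borel_measurable borel" and B: "\<And>w. norm (C w) \<le> B"
 shows "integrable lborel (\<lambda>w. K w * C w)" "norm (LBINT w. K w * C w) \<le> (LBINT w. norm (K w)) * B"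
proof -
 have [measurable]: "K \<in> borel_measurable borel" using borel_measurable_integrable[OF K] by simp
 have i: "integrable lborel (\<lambda>w. norm (K w) * B)" using K by simp
 have b: "norm (K w * C w) \<le> norm (K w) * B" for w unfolding norm_mult by (intro mult_left_mono B) auto
 show j: "integrable lborel (\<lambda>w. K w * C w)"
  by (rule Bochner_Integration.integrable_bound[OF i]) (use b in \<open>auto intro!: AE_I2 order_trans[OF _ abs_ge_self] simp del: norm_mult\<close>)
 have "norm (LBINT w. K w * C w) \<le> (LBINT w. norm (K w) * B)"
  by (rule order_trans[OF integral_norm_bound integral_mono[OF integrable_norm[OF j] i b]])
 then show "norm (LBINT w. K w * C w) \<le> (LBINT w. norm (K w)) * B" by simp
qed

text \<open>On the Fourier side the factor |y|^2 + Q^2 coming from the operator cancels the symbol,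
  and inversion at the origin finishes the case of nice \<open>f\<close>. Since the kernel is in L1,
  both sides are continuous in \<open>f\<close> for the L2 norm, which gives the general
  case.\<close>

lemma resolvent_weak_equation:
 fixes f \<phi> :: "real^'n \<Rightarrow> complex"
 assumes Q: "Re Q > 0" and f: "sq_integrable f" and \<phi>: "test_function \<phi>"
 defines "u \<equiv> conv (resolvent_kernel Q) f"
 shows "(LBINT x. u x * laplacian \<phi> x) = (LBINT x. - (f x - Q^2 * u x) * \<phi> x)"
proof -
 note T = test_function_laplacian[OF \<phi>]
 define g where "g x = laplacian \<phi> x - Q^2 * \<phi> x" for x
 have gc: "continuous_on UNIV g" unfolding g_def by (intro continuous_intros T)
 obtain R where R: "\<And>x. norm x > R \<Longrightarrow> \<phi> x = 0" using test_function_support[OF \<phi>] by blast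
 obtain R' where R': "\<And>x. norm x > R' \<Longrightarrow> laplacian \<phi> x = 0" using T(3) unfolding nice_def by blast
 have ng: "nice g" by (rule nice_continuous[OF gc, of "max R R'"]) (auto simp: g_def R R')
 note K = resolvent_kernel_integrable[OF Q, where 'n = 'n]
 \<comment> \<open>\<open>\<Phi> h = 0\<close> is the weak equation with right-hand side
   \<open>h\<close>, written with correlations by \<open>conv_pairing\<close>.\<close>
 define \<Phi> where "\<Phi> h = (LBINT w. resolvent_kernel Q w * corr h g w) + corr h \<phi> 0" for h
 note s\<phi> = nice_integrable[OF T(1)] and sg = nice_integrable[OF ng]
 have nice0: "\<Phi> h = 0" if h: "nice h" for h
 proof -
  note sh = nice_integrable[OF h]
  have Fg: "fourier g y = - (of_real ((norm y)^2) + Q^2) * fourier \<phi> y" for y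
  proof -
   have i1: "integrable lborel (\<lambda>x. laplacian \<phi> x * cis (- (y \<bullet> x)))"
    using integrable_mult_cis[OF nice_integrable(1)[OF T(3)], of "- y"] by simp
   have i2: "integrable lborel (\<lambda>x. Q^2 * (\<phi> x * cis (- (y \<bullet> x))))"
    using integrable_mult_cis[OF s\<phi>(1), of "- y"] by simp
   have "fourier g y = (LBINT x. laplacian \<phi> x * cis (- (y \<bullet> x)) - Q^2 * (\<phi> x * cis (- (y \<bullet> x))))"
    unfolding fourier_def g_def by (simp add: left_diff_distrib mult.assoc)
   also have "\<dots> = fourier (laplacian \<phi>) y - Q^2 * fourier \<phi> y"
    unfolding Bochner_Integration.integral_diff[OF i1 i2] integral_mult_right_zero fourier_def ..
   finally show ?thesis unfolding T(5) by (rule trans) (simp add: algebra_simps)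
  qed
  define P where "P = complex_of_real ((2 * pi) ^ CARD('n))"
  have P: "P \<noteq> 0" by (simp add: P_def)
  have "P * (LBINT w. resolvent_kernel Q w * corr h g w) = (LBINT y. power_symbol Q 1 ((norm y)^2) * fourier (corr h g) y)"
   unfolding P_def by (rule resolvent_kernel_pairing[OF Q integrable_corr(1)[OF sh(1) sg(1)] norm_corr_le[OF sh(2) sg(2)] fourier_corr_integrable(1)[OF sh sg]])
  also have "\<dots> = (LBINT y. - fourier (corr h \<phi>) y)"
  proof (rule LBINT_cong[OF refl])
   fix y :: "real^'n"
   have nz: "of_real ((norm y)^2) + Q^2 \<noteq> 0" using shifted_square_notin_nonpos[OF Q, of "(norm y)^2"] by auto
   have alg: "1 / A * (- A * p * q) = - (p * q)" if "A \<noteq> 0" for A p q :: complex using that by simp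
   show "power_symbol Q 1 ((norm y)^2) * fourier (corr h g) y = - fourier (corr h \<phi>) y"
    unfolding fourier_corr[OF sh(1) sg(1)] fourier_corr[OF sh(1) s\<phi>(1)] Fg power_symbol_1[OF Q zero_le_power2]
    by (rule alg[OF nz])
  qed
  also have "\<dots> = - (LBINT y. fourier (corr h \<phi>) y)" by (rule Bochner_Integration.integral_minus)
  also have "(LBINT y. fourier (corr h \<phi>) y) = P * corr h \<phi> 0"
   unfolding P_def
   by (rule fourier_inversion_0[OF integrable_corr(1)[OF sh(1) s\<phi>(1)] norm_corr_le[OF sh(2) s\<phi>(2)] isCont_corr_0[OF sh(1) T(1,2)] fourier_corr_integrable(1)[OF sh s\<phi>]])
  finally have "P * \<Phi> h = 0" by (simp add: \<Phi>_def distrib_left)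
  then show ?thesis using P by simp
 qed
 obtain F where F: "\<And>k. nice (F k)" "\<And>k x. F k x = f x \<or> F k x = 0" "(\<lambda>k. norm2 (\<lambda>x. f x - F k x)) \<longlonglongrightarrow> 0"
  using sq_integrable_approx[OF f] by metis
 define c where "c = (LBINT w. norm (resolvent_kernel Q (w :: real^'n))) * norm2 g + norm2 \<phi>"
 have "norm (\<Phi> f) \<le> c * norm2 (\<lambda>x. f x - F k x)" for k
 proof -
  note sF = nice_integrable(2)[OF F(1), of k]
  note sd = sq_integrable_diff[OF f sF]
  have m: "corr h g \<in> borel_measurable borel" if "sq_integrable h" for h
   using that sg(2) by (auto simp: sq_integrable_def)
  have iK: "integrable lborel (\<lambda>w. resolvent_kernel Q w * corr h g w)" if "sq_integrable h" for h
   by (rule integrable_L1_bounded(1)[OF K m[OF that] norm_corr_le[OF that sg(2)]])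
  have "\<Phi> (\<lambda>x. f x - F k x) = \<Phi> f - \<Phi> (F k)"
   unfolding \<Phi>_def corr_diff_left[OF f sF sg(2)] corr_diff_left[OF f sF s\<phi>(2)] right_diff_distrib
    Bochner_Integration.integral_diff[OF iK[OF f] iK[OF sF]] by simp
  then have "\<Phi> f = \<Phi> (\<lambda>x. f x - F k x)" using nice0[OF F(1)] by simp
  also have "norm \<dots> \<le> (LBINT w. norm (resolvent_kernel Q (w :: real^'n))) * (norm2 (\<lambda>x. f x - F k x) * norm2 g) + norm2 (\<lambda>x. f x - F k x) * norm2 \<phi>"
   unfolding \<Phi>_def
   by (intro norm_triangle_mono integrable_L1_bounded(2)[OF K m[OF sd]] norm_corr_le sd sg s\<phi>)
  also have "\<dots> = c * norm2 (\<lambda>x. f x - F k x)" by (simp add: c_def algebra_simps)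
  finally show ?thesis .
 qed
 moreover have "(\<lambda>k. c * norm2 (\<lambda>x. f x - F k x)) \<longlonglongrightarrow> c * 0" by (intro tendsto_intros F)
 ultimately have "norm (\<Phi> f) \<le> c * 0" by (intro LIMSEQ_le_const) auto
 then have \<Phi>0: "\<Phi> f = 0" by simp
 note su = conv_sq_integrable(1)[OF K f, folded u_def]
 have "(LBINT x. u x * g x) = - (LBINT x. f x * \<phi> x)"
  using \<Phi>0 unfolding \<Phi>_def u_def conv_pairing[OF K f sg(2)] by (simp add: corr_def eq_neg_iff_add_eq_0)
 moreover have "(LBINT x. u x * laplacian \<phi> x) = (LBINT x. u x * g x) + (LBINT x. Q^2 * u x * \<phi> x)"
 proof -
  have "u x * laplacian \<phi> x = u x * g x + Q^2 * u x * \<phi> x" for x by (simp add: g_def algebra_simps)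
  then show ?thesis
   using sq_integrable_mult(1)[OF su sg(2)] sq_integrable_mult(1)[OF sq_integrable_cmult(1)[OF su] s\<phi>(2), of "Q^2"]
   by (simp add: Bochner_Integration.integral_add)
 qed
 moreover have "(LBINT x. - (f x - Q^2 * u x) * \<phi> x) = (LBINT x. Q^2 * u x * \<phi> x) - (LBINT x. f x * \<phi> x)"
 proof -
  have "- (f x - Q^2 * u x) * \<phi> x = Q^2 * u x * \<phi> x - f x * \<phi> x" for x by (simp add: algebra_simps)
  then show ?thesis
   using sq_integrable_mult(1)[OF f s\<phi>(2)] sq_integrable_mult(1)[OF sq_integrable_cmult(1)[OF su] s\<phi>(2), of "Q^2"]
   by (simp add: Bochner_Integration.integral_diff)
 qed
 ultimately show ?thesis by (simp only: add.commute diff_conv_add_uminus)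
qed

subsection \<open>Smooth functions of one variable\<close>

text \<open>The derivative is an existential witness, which makes closure under sums, products and
  scaling a plain induction. One variable is enough because the test functions to be built are
  tensor products.\<close>

fun C1k :: "nat \<Rightarrow> (real \<Rightarrow> complex) \<Rightarrow> bool" where
 "C1k 0 f = continuous_on UNIV f"
| "C1k (Suc k) f = (\<exists>f'. (\<forall>x. (f has_vector_derivative f' x) (at x)) \<and> C1k k f')"

lemma C1k_SucI: "(\<And>x. (f has_vector_derivative f' x) (at x)) \<Longrightarrow> C1k k f' \<Longrightarrow> C1k (Suc k) f"
 by auto

lemma C1k_Suc_imp: "C1k (Suc k) f \<Longrightarrow> C1k k f"
proof (induction k arbitrary: f)
 case 0
 then obtain f' where "\<forall>x. (f has_vector_derivative f' x) (at x)" by auto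
 then show ?case
  by (auto intro!: continuous_at_imp_continuous_on has_vector_derivative_continuous)
next
 case (Suc k)
 then obtain f' where "\<forall>x. (f has_vector_derivative f' x) (at x)" "C1k (Suc k) f'" by (auto simp del: C1k.simps(1) elim: C1k.elims)
 with Suc.IH[of f'] show ?case by auto
qed

lemma C1k_add: "C1k k f \<Longrightarrow> C1k k g \<Longrightarrow> C1k k (\<lambda>x. f x + g x)"
proof (induction k arbitrary: f g)
 case (Suc k)
 then obtain f' g' where "\<forall>x. (f has_vector_derivative f' x) (at x)" "C1k k f'"
  "\<forall>x. (g has_vector_derivative g' x) (at x)" "C1k k g'" by auto
 then show ?case using Suc.IH[of f' g'] by (auto intro!: exI[of _ "\<lambda>x. f' x + g' x"] has_vector_derivative_add)
qed (auto intro: continuous_on_add)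

lemma C1k_mult: "C1k k f \<Longrightarrow> C1k k g \<Longrightarrow> C1k k (\<lambda>x. f x * g x)"
proof (induction k arbitrary: f g)
 case (Suc k)
 then obtain f' g' where *: "\<forall>x. (f has_vector_derivative f' x) (at x)" "C1k k f'"
  "\<forall>x. (g has_vector_derivative g' x) (at x)" "C1k k g'" by auto
 have "C1k k f" "C1k k g" using Suc.prems by (auto simp only: intro: C1k_Suc_imp)
 then have "C1k k (\<lambda>x. f x * g' x + f' x * g x)" using * by (intro C1k_add Suc.IH)
 then show ?case using * by (auto intro!: exI[of _ "\<lambda>x. f x * g' x + f' x * g x"] has_vector_derivative_mult)
qed (auto intro: continuous_on_mult)

lemma C1k_const: "C1k k (\<lambda>_. c)"
 by (induction k arbitrary: c) (auto intro!: exI[of _ "\<lambda>_. 0"])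

lemma C1k_scale: "C1k k f \<Longrightarrow> C1k k (\<lambda>x. f (a * x + b))"
proof (induction k arbitrary: f)
 case 0
 then show ?case by (auto intro!: continuous_on_compose2[of UNIV f] continuous_intros)
next
 case (Suc k)
 then obtain f' where f': "\<forall>x. (f has_vector_derivative f' x) (at x)" "C1k k f'" by auto
 have "((\<lambda>x. f (a * x + b)) has_vector_derivative (of_real a * f' (a * x + b))) (at x)" for x
 proof -
  have "((\<lambda>x. a * x + b) has_real_derivative a) (at x)" by (auto intro!: derivative_eq_intros)
  from vector_diff_chain_at[OF this[unfolded has_real_derivative_iff_has_vector_derivative], of f] f'(1)
  show ?thesis by (simp add: o_def scaleR_conv_of_real)
 qed
 moreover have "C1k k (\<lambda>x. of_real a * f' (a * x + b))" by (intro C1k_mult C1k_const Suc.IH f')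
 ultimately show ?case by (rule C1k_SucI)
qed

definition smooth1 :: "(real \<Rightarrow> complex) \<Rightarrow> bool" where "smooth1 f \<longleftrightarrow> (\<forall>k. C1k k f)"

text \<open>Each order supplies its own witness for the derivative; uniqueness of the derivative
  identifies them all.\<close>

lemma smooth1_derivative:
 assumes "smooth1 f" "\<And>x. (f has_vector_derivative f' x) (at x)"
 shows "smooth1 f'"
 unfolding smooth1_def
proof
 fix k
 from assms(1) obtain g where g: "\<forall>x. (f has_vector_derivative g x) (at x)" "C1k k g"
  unfolding smooth1_def using C1k.simps(2)[of k f] by blast
 have "f' = g" using assms(2) g(1) by (auto intro: vector_derivative_unique_at)
 with g show "C1k k f'" by simp
qed

lemma smooth1_mult: "smooth1 f \<Longrightarrow> smooth1 g \<Longrightarrow> smooth1 (\<lambda>x. f x * g x)"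
 by (simp add: smooth1_def C1k_mult)

lemma smooth1_scale: "smooth1 f \<Longrightarrow> smooth1 (\<lambda>x. f (a * x + b))"
 by (simp add: smooth1_def C1k_scale)

lemma smooth1_has_derivative:
 assumes "smooth1 f"
 shows "\<exists>f'. (\<forall>x. (f has_vector_derivative f' x) (at x)) \<and> smooth1 f'"
proof -
 from assms obtain f' where f': "\<forall>x. (f has_vector_derivative f' x) (at x)"
  unfolding smooth1_def using C1k.simps(2)[of 0 f] by blast
 then show ?thesis using smooth1_derivative[OF assms] by blast
qed

lemma smooth1_continuous: "smooth1 f \<Longrightarrow> continuous_on UNIV f"
 unfolding smooth1_def by (metis C1k.simps(1))

text \<open>Polynomial multiples of the Gaussian are closed under differentiation, so the induction
  runs over all powers \<open>m\<close> at once; for \<open>m = 0\<close> the index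
  \<open>m - 1\<close> carries the coefficient 0.\<close>

lemma smooth1_gauss:
 fixes c :: complex and y :: real
 shows "smooth1 (\<lambda>s. exp (c * of_real ((s - y)^2)))"
proof -
 let ?g = "\<lambda>m s. of_real ((s - y) ^ m) * exp (c * of_real ((s - y)^2))"
 have "C1k k (?g m)" for k m
 proof (induction k arbitrary: m)
  case 0
  then show ?case by (auto intro!: continuous_intros)
 next
  case (Suc k)
  have "(?g m has_vector_derivative (of_nat m * ?g (m - 1) x + 2 * c * ?g (Suc m) x)) (at x)" for x
  proof -
   have "((\<lambda>z. (z - of_real y) ^ m * exp (c * (z - of_real y)^2)) has_field_derivative
    (of_nat m * ((of_real x - of_real y) ^ (m - 1)) * exp (c * (of_real x - of_real y)^2) + 2 * c * ((of_real x - of_real y) ^ Suc m * exp (c * (of_real x - of_real y)^2)))) (at (of_real x))"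
    by (auto intro!: derivative_eq_intros simp: algebra_simps)
   from has_vector_derivative_real_field[OF this] show ?thesis by (simp add: mult.assoc)
  qed
  moreover have "C1k k (\<lambda>x. of_nat m * ?g (m - 1) x + 2 * c * ?g (Suc m) x)"
   by (intro C1k_add C1k_mult[of k "\<lambda>_. of_nat m"] C1k_mult[of k "\<lambda>_. 2 * c"] C1k_const Suc)
  ultimately show ?case by (rule C1k_SucI)
 qed
 from this[of _ 0] show ?thesis by (simp add: smooth1_def)
qed

text \<open>\<open>flat 0\<close> is the classical smooth function all of whose derivatives vanish
  at the origin; with the powers of 1 / t the family is closed under differentiation.\<close>

definition flat :: "nat \<Rightarrow> real \<Rightarrow> real" where
 "flat m t = (if t > 0 then (1 / t) ^ m * exp (- (1 / t)) else 0)"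

lemma flat_tendsto_0: "((\<lambda>t. flat m t) \<longlongrightarrow> 0) (at 0)"
proof -
 have "((\<lambda>t. (inverse t) ^ m / exp (inverse t)) \<longlongrightarrow> 0) (at_right (0::real))"
  by (rule filterlim_compose[OF tendsto_power_div_exp_0 filterlim_inverse_at_top_right])
 then have r: "((\<lambda>t. flat m t) \<longlongrightarrow> 0) (at_right 0)"
  by (rule Lim_transform_eventually)
   (auto simp: eventually_at_filter flat_def exp_minus divide_inverse intro!: always_eventually)
 have l: "((\<lambda>t. flat m t) \<longlongrightarrow> 0) (at_left 0)"
  by (rule Lim_transform_eventually[OF tendsto_const])
   (auto simp: eventually_at_filter flat_def intro!: always_eventually)
 show ?thesis using l r by (simp add: filterlim_split_at)
qed

lemma flat_derivative: "(flat m has_real_derivative (flat (m + 2) t - of_nat m * flat (m + 1) t)) (at t)"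
proof (cases t "0::real" rule: linorder_cases)
 case less
 have "((\<lambda>_. 0) has_real_derivative 0) (at t)" by simp
 then have "(flat m has_real_derivative 0) (at t)"
  by (rule has_field_derivative_transform_within_open[where S = "{..<0}"]) (use less in \<open>auto simp: flat_def\<close>)
 then show ?thesis using less by (simp add: flat_def)
next
 case equal
 \<comment> \<open>At the origin the difference quotient of \<open>flat m\<close> is
   \<open>flat (Suc m)\<close>, which tends to 0.\<close>
 have "((\<lambda>h. (flat m (0 + h) - flat m 0) / h) \<longlongrightarrow> 0) (at 0)"
  by (rule Lim_transform_eventually[OF flat_tendsto_0[of "Suc m"]])
   (auto simp: eventually_at_filter flat_def intro!: always_eventually)
 then show ?thesis using equal by (simp add: DERIV_def flat_def)
next
 case greater
 have "((\<lambda>t. (1 / t) ^ m * exp (- (1 / t))) has_real_derivative (flat (m + 2) t - of_nat m * flat (m + 1) t)) (at t)"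
 proof -
  have u: "((\<lambda>t. 1 / t) has_real_derivative (- (1 / t^2))) (at t)"
   using greater by (auto intro!: derivative_eq_intros simp: power2_eq_square)
  have e: "((\<lambda>t. exp (- (1 / t))) has_real_derivative (1 / t^2 * exp (- (1 / t)))) (at t)"
   by (rule DERIV_cong[OF DERIV_chain2[OF DERIV_exp DERIV_minus[OF u]]]) simp
  have D: "((\<lambda>t. (1 / t) ^ m * exp (- (1 / t))) has_real_derivative
   (of_nat m * (- (1 / t^2)) * (1 / t) ^ (m - 1)) * exp (- (1 / t)) + (1 / t) ^ m * (1 / t^2 * exp (- (1 / t)))) (at t)"
   by (rule DERIV_cong[OF DERIV_mult[OF DERIV_power[OF u, of m] e]]) (simp add: mult_ac)
  have 1: "of_nat m * (- (1 / t^2)) * (1 / t) ^ (m - 1) = - of_nat m * (1 / t) ^ (m + 1)"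
   using greater by (cases m) (auto simp: field_simps power2_eq_square)
  have 2: "(1 / t) ^ m * (1 / t^2 * exp (- (1 / t))) = (1 / t) ^ (m + 2) * exp (- (1 / t))"
   by (simp add: power_add power_one_over power2_eq_square)
  show ?thesis using D unfolding 1 2 using greater by (simp add: flat_def mult.assoc)
 qed
 then show ?thesis
  by (rule has_field_derivative_transform_within_open[where S = "{0<..}"]) (use greater in \<open>auto simp: flat_def\<close>)
qed

lemma smooth1_flat: "smooth1 (\<lambda>t. of_real (flat m t))"
 unfolding smooth1_def
proof
 fix k show "C1k k (\<lambda>t. of_real (flat m t))"
 proof (induction k arbitrary: m)
  case 0
  have "isCont (flat m) t" for t using DERIV_isCont[OF flat_derivative] .
  then show ?case by (auto intro!: continuous_intros continuous_at_imp_continuous_on)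
 next
  case (Suc k)
  have "((\<lambda>t. complex_of_real (flat m t)) has_vector_derivative (of_real (flat (m + 2) t) + (- of_nat m) * of_real (flat (m + 1) t))) (at t)" for t
   using has_vector_derivative_of_real[OF flat_derivative[of m t], where 'a = complex] by simp
  moreover have "C1k k (\<lambda>t. complex_of_real (flat (m + 2) t) + (- of_nat m) * of_real (flat (m + 1) t))"
   by (intro C1k_add C1k_mult[of k "\<lambda>_. - of_nat m"] C1k_const Suc)
  ultimately show ?case by (rule C1k_SucI)
 qed
qed

text \<open>Supported in [- 1, 1]; the arguments are written in the shape of
  \<open>smooth1_scale\<close>. Its use as a cutoff rests on \<open>bump 0\<close> being nonzero:
  powers of that value are divided out in the limit.\<close>

definition bump :: "real \<Rightarrow> complex" where
 "bump s = of_real (flat 0 (1 * s + 1)) * of_real (flat 0 (- 1 * s + 1))"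

lemma smooth1_bump: "smooth1 bump"
 unfolding bump_def[abs_def]
 by (intro smooth1_mult smooth1_scale[of "\<lambda>t. of_real (flat 0 t)"] smooth1_flat)

lemma bump_0: "bump 0 \<noteq> 0" by (simp add: bump_def flat_def)

lemma bump_outside: "\<bar>s\<bar> \<ge> 1 \<Longrightarrow> bump s = 0"
 by (auto simp: bump_def flat_def)

lemma bounded_of_outside_zero:
 fixes f :: "real \<Rightarrow> complex"
 assumes "continuous_on UNIV f" "\<And>s. \<bar>s\<bar> > R \<Longrightarrow> f s = 0"
 obtains B where "\<And>s. norm (f s) \<le> B" "B \<ge> 0"
proof -
 have "compact (f ` cball 0 R)" by (intro compact_continuous_image continuous_on_subset[OF assms(1)]) auto
 then obtain B where B: "\<forall>y\<in>f ` cball 0 R. norm y \<le> B" using compact_imp_bounded bounded_iff by blast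
 have "norm (f s) \<le> max B 0" for s
  using B assms(2)[of s] by (cases "\<bar>s\<bar> > R") (auto simp: le_max_iff_disj)
 then show ?thesis by (intro that[of "max B 0"]) auto
qed

lemma vector_derivative_outside_zero:
 fixes f :: "real \<Rightarrow> complex"
 assumes "\<And>s. \<bar>s\<bar> > R \<Longrightarrow> f s = 0" "(f has_vector_derivative d) (at s)" "\<bar>s\<bar> > R"
 shows "d = 0"
proof -
 have "open {s :: real. \<bar>s\<bar> > R}" by (intro open_Collect_less continuous_intros)
 then have "(f has_vector_derivative 0) (at s)"
  by (rule has_vector_derivative_transform_within_open[OF has_vector_derivative_const[of 0]]) (use assms in auto)
 then show ?thesis using assms(2) by (rule vector_derivative_unique_at[symmetric])
qed

subsection \<open>Test functions in product form\<close>

lemma has_derivative_tensor: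
 fixes q :: "'n::finite \<Rightarrow> real \<Rightarrow> complex"
 assumes "\<And>i x. (q i has_vector_derivative q' i x) (at x)"
 shows "((\<lambda>x::real^'n. \<Prod>i\<in>UNIV. q i (x $ i)) has_derivative
  (\<lambda>y. \<Sum>i\<in>UNIV. (y $ i *\<^sub>R q' i (x $ i)) * (\<Prod>j\<in>UNIV - {i}. q j (x $ j)))) (at x)"
proof (rule has_derivative_prod)
 fix i
 have "((\<lambda>x::real^'n. x $ i) has_derivative (\<lambda>y. y $ i)) (at x)"
  by (intro bounded_linear_imp_has_derivative bounded_linear_vec_nth)
 from has_derivative_compose[OF this assms[of i "x $ i", unfolded has_vector_derivative_def]]
 show "((\<lambda>x::real^'n. q i (x $ i)) has_derivative (\<lambda>y. y $ i *\<^sub>R q' i (x $ i))) (at x)" .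
qed

lemma partial_deriv_tensor:
 fixes q :: "'n::finite \<Rightarrow> real \<Rightarrow> complex"
 assumes "\<And>i x. (q i has_vector_derivative q' i x) (at x)"
 shows "partial_deriv j (\<lambda>x::real^'n. \<Prod>i\<in>UNIV. q i (x $ i)) = (\<lambda>x. \<Prod>i\<in>UNIV. (q(j := q' j)) i (x $ i))"
proof
 fix x :: "real^'n"
 have "partial_deriv j (\<lambda>x::real^'n. \<Prod>i\<in>UNIV. q i (x $ i)) x
  = (\<Sum>i\<in>UNIV. (axis j 1 $ i *\<^sub>R q' i (x $ i)) * (\<Prod>k\<in>UNIV - {i}. q k (x $ k)))"
  unfolding partial_deriv_def frechet_derivative_at[OF has_derivative_tensor[of q q' x, OF assms], symmetric] ..
 also have "\<dots> = (\<Sum>i\<in>{j}. (axis j 1 $ i *\<^sub>R q' i (x $ i)) * (\<Prod>k\<in>UNIV - {i}. q k (x $ k)))"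
  by (intro sum.mono_neutral_right) (auto simp: axis_def)
 also have "\<dots> = q' j (x $ j) * (\<Prod>k\<in>UNIV - {j}. q k (x $ k))" by (simp add: axis_def)
 also have "\<dots> = (\<Prod>i\<in>UNIV. (q(j := q' j)) i (x $ i))"
  by (subst (2) prod.remove[of _ j]) (auto intro!: arg_cong2[where f = "(*)"] prod.cong)
 finally show "partial_deriv j (\<lambda>x::real^'n. \<Prod>i\<in>UNIV. q i (x $ i)) x = (\<Prod>i\<in>UNIV. (q(j := q' j)) i (x $ i))" .
qed

text \<open>A partial derivative of a tensor product is a tensor product with one factor replaced by
  its derivative, so the induction stays inside this class.\<close>

lemma Ck_tensor:
 fixes q :: "'n::finite \<Rightarrow> real \<Rightarrow> complex"
 assumes "\<And>i. smooth1 (q i)"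
 shows "Ck k (\<lambda>x::real^'n. \<Prod>i\<in>UNIV. q i (x $ i))"
 using assms
proof (induction k arbitrary: q)
 case 0
 have "continuous_on UNIV (\<lambda>x::real^'n. q i (x $ i))" for i
  by (rule continuous_on_compose2[OF smooth1_continuous[OF 0]]) (auto intro: continuous_intros)
 then show ?case by (auto intro!: continuous_on_prod)
next
 case (Suc k)
 have "\<exists>q'. \<forall>i. (\<forall>x. (q i has_vector_derivative q' i x) (at x)) \<and> smooth1 (q' i)"
  using smooth1_has_derivative[OF Suc.prems] by (intro choice) blast
 then obtain q' where q': "\<And>i x. (q i has_vector_derivative q' i x) (at x)" "\<And>i. smooth1 (q' i)" by blast
 have "(\<lambda>x::real^'n. \<Prod>i\<in>UNIV. q i (x $ i)) differentiable_on UNIV"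
  using has_derivative_tensor[of q q', OF q'(1)] by (auto simp: differentiable_on_def differentiable_def)
 moreover have "Ck k (\<lambda>x::real^'n. \<Prod>i\<in>UNIV. (q(j := q' j)) i (x $ i))" for j
  by (rule Suc.IH) (use q' Suc.prems in auto)
 ultimately show ?case by (simp add: partial_deriv_tensor[of q q', OF q'(1)])
qed

lemma test_function_tensor:
 fixes q :: "'n::finite \<Rightarrow> real \<Rightarrow> complex"
 assumes "\<And>i. smooth1 (q i)" "\<And>i s. \<bar>s\<bar> > R \<Longrightarrow> q i s = 0"
 shows "test_function (\<lambda>x::real^'n. \<Prod>i\<in>UNIV. q i (x $ i))"
 unfolding test_function_def
proof (intro conjI allI Ck_tensor assms)
 have "{x::real^'n. (\<Prod>i\<in>UNIV. q i (x $ i)) \<noteq> 0} \<subseteq> cbox (\<chi> i. - R) (\<chi> i. R)"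
 proof
  fix x :: "real^'n" assume "x \<in> {x. (\<Prod>i\<in>UNIV. q i (x $ i)) \<noteq> 0}"
  then have "\<bar>x $ i\<bar> \<le> R" for i using assms(2)[of "x $ i" i] by (auto simp: not_less[symmetric])
  then show "x \<in> cbox (\<chi> i. - R) (\<chi> i. R)" by (auto simp: mem_box_cart abs_le_iff minus_le_iff)
 qed
 then have "bounded {x::real^'n. (\<Prod>i\<in>UNIV. q i (x $ i)) \<noteq> 0}" using bounded_cbox bounded_subset by blast
 then show "compact (closure {x::real^'n. (\<Prod>i\<in>UNIV. q i (x $ i)) \<noteq> 0})" by (simp add: compact_closure)
qed

lemma laplacian_tensor:
 fixes q :: "'n::finite \<Rightarrow> real \<Rightarrow> complex"
 assumes "\<And>i x. (q i has_vector_derivative q' i x) (at x)" "\<And>i x. (q' i has_vector_derivative q'' i x) (at x)"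
 shows "laplacian (\<lambda>x::real^'n. \<Prod>i\<in>UNIV. q i (x $ i)) x = (\<Sum>j\<in>UNIV. \<Prod>i\<in>UNIV. (q(j := q'' j)) i (x $ i))"
 unfolding laplacian_def
proof (rule sum.cong[OF refl])
 fix j
 have "((q(j := q' j)) i has_vector_derivative (q'(j := q'' j)) i x) (at x)" for i x using assms by auto
 from partial_deriv_tensor[of "q(j := q' j)" "q'(j := q'' j)" j, OF this]
 show "partial_deriv j (partial_deriv j (\<lambda>x::real^'n. \<Prod>i\<in>UNIV. q i (x $ i))) x = (\<Prod>i\<in>UNIV. (q(j := q'' j)) i (x $ i))"
  unfolding partial_deriv_tensor[of q q', OF assms(1)] by simp
qed

subsection \<open>Uniqueness of the resolvent\<close>

definition gauss1_d1 :: "complex \<Rightarrow> real \<Rightarrow> complex" where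
 "gauss1_d1 t s = - (of_real s / (2 * t)) * gauss1 t s"

text \<open>The second derivative in space; by the heat equation it is also the derivative in
  complex time (\<open>gauss1_dtau\<close>), so that \<open>heat_dt\<close> is both the Laplacian
  and the time derivative of \<open>heat\<close>.\<close>

definition gauss1_d2 :: "complex \<Rightarrow> real \<Rightarrow> complex" where
 "gauss1_d2 t s = (of_real (s^2) / (4 * t^2) - 1 / (2 * t)) * gauss1 t s"

lemma gauss1_derivatives:
 assumes "t \<noteq> 0"
 shows "((\<lambda>s. gauss1 t (s - y)) has_vector_derivative gauss1_d1 t (s - y)) (at s)"
  "((\<lambda>s. gauss1_d1 t (s - y)) has_vector_derivative gauss1_d2 t (s - y)) (at s)"
proof -
 define r where "r = csqrt (4 * of_real pi * t)"
 have "((\<lambda>z. exp (- (z - of_real y)\<^sup>2 / (4 * t)) / r) has_field_derivative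
  (- ((of_real s - of_real y) / (2 * t)) * (exp (- (of_real s - of_real y)\<^sup>2 / (4 * t)) / r))) (at (of_real s))"
  using assms by (auto intro!: derivative_eq_intros simp: field_simps r_def)
 from has_vector_derivative_real_field[OF this]
 show "((\<lambda>s. gauss1 t (s - y)) has_vector_derivative gauss1_d1 t (s - y)) (at s)"
  by (simp add: gauss1_def gauss1_d1_def r_def)
 have "((\<lambda>z. - ((z - of_real y) / (2 * t)) * (exp (- (z - of_real y)\<^sup>2 / (4 * t)) / r)) has_field_derivative
  (((of_real s - of_real y)^2 / (4 * t^2) - 1 / (2 * t)) * (exp (- (of_real s - of_real y)\<^sup>2 / (4 * t)) / r))) (at (of_real s))"
  using assms by (auto intro!: derivative_eq_intros simp: field_simps r_def power2_eq_square)
 from has_vector_derivative_real_field[OF this]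
 show "((\<lambda>s. gauss1_d1 t (s - y)) has_vector_derivative gauss1_d2 t (s - y)) (at s)"
  by (simp add: gauss1_def gauss1_d1_def gauss1_d2_def r_def)
qed

lemma smooth1_gauss1: "smooth1 (\<lambda>s. gauss1 t (s - y))"
proof -
 have "smooth1 (\<lambda>s. exp (- (1 / (4 * t)) * of_real ((s - y)^2)) * (1 / csqrt (4 * of_real pi * t)))"
  by (intro smooth1_mult smooth1_gauss) (simp add: smooth1_def C1k_const)
 then show ?thesis by (simp add: gauss1_def)
qed

text \<open>Half of the Gaussian exponent is spent on absorbing the factors s and s^2 of the
  derivatives.\<close>

lemma gauss1_bounds:
 assumes t: "Re t > 0"
 shows "\<exists>M c. c > 0 \<and> M \<ge> 0 \<and> (\<forall>s. norm (gauss1 t s) \<le> M * exp (- c * s^2) \<and>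
  norm (gauss1_d1 t s) \<le> M * exp (- c * s^2) \<and> norm (gauss1_d2 t s) \<le> M * exp (- c * s^2))"
proof -
 define \<alpha> where "\<alpha> = Re t / (4 * (norm t)^2)"
 have n0: "norm t > 0" using t by auto
 have \<alpha>: "\<alpha> > 0" using t n0 by (simp add: \<alpha>_def)
 define N where "N = 1 / (2 * sqrt pi * sqrt (norm t))"
 have N: "N > 0" using n0 by (simp add: N_def)
 have g: "norm (gauss1 t s) = N * exp (- \<alpha> * s^2)" for s
  using norm_gauss1[OF t, of s] by (simp add: N_def \<alpha>_def)
 define c where "c = \<alpha> / 2"
 have c: "c > 0" using \<alpha> by (simp add: c_def)
 have e: "exp (- \<alpha> * s^2) = exp (- c * s^2) * exp (- c * s^2)" for s
  by (simp add: exp_add[symmetric] c_def)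
 have e1: "exp (- c * s^2) \<le> 1" for s using c by simp
 have s2: "s^2 * exp (- c * s^2) \<le> 1 / c" for s
 proof -
  have "c * s^2 \<le> exp (c * s^2)" using exp_ge_add_one_self[of "c * s^2"] by linarith
  then have "c * s^2 * exp (- c * s^2) \<le> exp (c * s^2) * exp (- c * s^2)" by (intro mult_right_mono) auto
  then show ?thesis using c by (simp add: exp_minus field_simps)
 qed
 have s1: "\<bar>s\<bar> * exp (- c * s^2) \<le> 1 + 1 / c" for s
 proof -
  have "2 * \<bar>s\<bar> * 1 \<le> \<bar>s\<bar>^2 + 1^2" by (rule sum_squares_bound)
  moreover have "0 \<le> \<bar>s\<bar>" by simp
  ultimately have "\<bar>s\<bar> \<le> 1 + s^2" by simp
  then have "\<bar>s\<bar> * exp (- c * s^2) \<le> (1 + s^2) * exp (- c * s^2)" by (intro mult_right_mono) auto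
  also have "\<dots> = exp (- c * s^2) + s^2 * exp (- c * s^2)" by (simp add: distrib_right)
  also have "\<dots> \<le> 1 + 1 / c" using e1 s2 by (intro add_mono)
  finally show ?thesis .
 qed
 define M1 where "M1 = (1 + 1 / c) / (2 * norm t)"
 define M2 where "M2 = (1 / c) / (4 * (norm t)^2) + 1 / (2 * norm t)"
 define M where "M = N * (1 + M1 + M2)"
 have MM: "M1 \<ge> 0" "M2 \<ge> 0" using c n0 by (auto simp: M1_def M2_def)
 have 0: "norm (gauss1 t s) \<le> M * exp (- c * s^2)" for s
 proof -
  have "N * (exp (- c * s^2) * exp (- c * s^2)) \<le> M * (1 * exp (- c * s^2))"
   unfolding M_def using N MM e1[of s] by (intro mult_mono) auto
  then show ?thesis unfolding g e by simp
 qed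
 have 1: "norm (gauss1_d1 t s) \<le> M * exp (- c * s^2)" for s
 proof -
  have "norm (gauss1_d1 t s) = N * ((\<bar>s\<bar> * exp (- c * s^2)) / (2 * norm t)) * exp (- c * s^2)"
   unfolding gauss1_d1_def norm_mult norm_minus_cancel g e by (simp add: norm_divide norm_mult mult_ac)
  also have "\<dots> \<le> N * M1 * exp (- c * s^2)"
   unfolding M1_def using N n0 s1[of s] by (intro mult_right_mono mult_left_mono divide_right_mono) auto
  also have "\<dots> \<le> M * exp (- c * s^2)" unfolding M_def using N MM by (intro mult_right_mono mult_left_mono) auto
  finally show ?thesis .
 qed
 have 2: "norm (gauss1_d2 t s) \<le> M * exp (- c * s^2)" for s
 proof -
  have "norm (of_real (s^2) / (4 * t^2) - 1 / (2 * t)) \<le> s^2 / (4 * (norm t)^2) + 1 / (2 * norm t)"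
   by (rule order_trans[OF norm_triangle_ineq4]) (simp add: norm_divide norm_mult norm_power)
  then have "norm (gauss1_d2 t s) \<le> (s^2 / (4 * (norm t)^2) + 1 / (2 * norm t)) * (N * (exp (- c * s^2) * exp (- c * s^2)))"
   unfolding gauss1_d2_def norm_mult g e using N by (intro mult_right_mono) auto
  also have "\<dots> = N * ((s^2 * exp (- c * s^2)) / (4 * (norm t)^2) + exp (- c * s^2) / (2 * norm t)) * exp (- c * s^2)"
   by (simp add: algebra_simps add_divide_distrib)
  also have "\<dots> \<le> N * M2 * exp (- c * s^2)"
   unfolding M2_def using N n0 s2[of s] e1[of s] by (intro mult_right_mono mult_left_mono add_mono divide_right_mono) auto
  also have "\<dots> \<le> M * exp (- c * s^2)" unfolding M_def using N MM by (intro mult_right_mono mult_left_mono) auto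
  finally show ?thesis .
 qed
 show ?thesis using 0 1 2 c N MM by (intro exI[of _ M] exI[of _ c]) (auto simp: M_def)
qed

definition heat_dt :: "complex \<Rightarrow> real^'n \<Rightarrow> complex" where
 "heat_dt t x = (\<Sum>j\<in>UNIV. \<Prod>i\<in>UNIV. if i = j then gauss1_d2 t (x $ i) else gauss1 t (x $ i))"

text \<open>The heat kernel is not compactly supported, so it is multiplied in each coordinate by
  \<open>bump (h k * s)\<close> with \<open>h k\<close> tending to 0. Derivatives that fall on the
  cutoff carry powers of \<open>h k\<close> and vanish in the limit; \<open>u\<close> times a square
  integrable tensor Gaussian is the majorant, and the factor \<open>bump 0 ^ CARD('n)\<close>
  cancels.\<close>

lemma weak_solution_heat:
 fixes u :: "real^'n \<Rightarrow> complex"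
 assumes u: "sq_integrable u" and t: "Re t > 0"
  and weak: "\<And>\<phi>. test_function \<phi> \<Longrightarrow> (LBINT x. u x * (laplacian \<phi> x - K^2 * \<phi> x)) = 0"
 shows "(LBINT x. u x * (heat_dt t (x - y) - K^2 * heat t (x - y))) = 0"
proof -
 have [measurable]: "u \<in> borel_measurable borel" using u by (simp add: sq_integrable_def)
 have t0: "t \<noteq> 0" using t by auto
 obtain b1 where b1: "\<And>x. (bump has_vector_derivative b1 x) (at x)" "smooth1 b1"
  using smooth1_has_derivative[OF smooth1_bump] by blast
 obtain b2 where b2: "\<And>x. (b1 has_vector_derivative b2 x) (at x)" "smooth1 b2"
  using smooth1_has_derivative[OF b1(2)] by blast
 have z0: "bump s = 0" if "\<bar>s\<bar> > 1" for s using bump_outside[of s] that by simp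
 have z1: "b1 s = 0" if "\<bar>s\<bar> > 1" for s by (rule vector_derivative_outside_zero[OF z0 b1(1) that])
 have z2: "b2 s = 0" if "\<bar>s\<bar> > 1" for s by (rule vector_derivative_outside_zero[OF z1 b2(1) that])
 obtain X0 where X0: "\<And>s. norm (bump s) \<le> X0" "X0 \<ge> 0" using bounded_of_outside_zero[OF smooth1_continuous[OF smooth1_bump] z0] by blast
 obtain X1 where X1: "\<And>s. norm (b1 s) \<le> X1" "X1 \<ge> 0" using bounded_of_outside_zero[OF smooth1_continuous[OF b1(2)] z1] by blast
 obtain X2 where X2: "\<And>s. norm (b2 s) \<le> X2" "X2 \<ge> 0" using bounded_of_outside_zero[OF smooth1_continuous[OF b2(2)] z2] by blast
 define X where "X = X0 + X1 + X2"
 have X: "norm (bump s) \<le> X" "norm (b1 s) \<le> X" "norm (b2 s) \<le> X" "X \<ge> 0" for s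
  using X0(1)[of s] X1(1)[of s] X2(1)[of s] X0(2) X1(2) X2(2) by (auto simp: X_def)
 obtain M c where c: "c > 0" and M: "M \<ge> 0" and G: "\<And>s. norm (gauss1 t s) \<le> M * exp (- c * s^2)"
  "\<And>s. norm (gauss1_d1 t s) \<le> M * exp (- c * s^2)" "\<And>s. norm (gauss1_d2 t s) \<le> M * exp (- c * s^2)"
  using gauss1_bounds[OF t] by blast
 define h where "h k = 1 / real (Suc k)" for k
 have h: "h k > 0" "h k \<le> 1" for k by (auto simp: h_def)
 have h0: "h \<longlonglongrightarrow> 0" unfolding h_def using LIMSEQ_inverse_real_of_nat by (simp add: inverse_eq_divide)
 define p where "p k i s = gauss1 t (s - y $ i) * bump (h k * s + 0)" for k i s
 define p' where "p' k i s = gauss1 t (s - y $ i) * (of_real (h k) * b1 (h k * s + 0)) + gauss1_d1 t (s - y $ i) * bump (h k * s + 0)" for k i s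
 define p'' where "p'' k i s = (gauss1 t (s - y $ i) * (of_real (h k) * (of_real (h k) * b2 (h k * s + 0))) + gauss1_d1 t (s - y $ i) * (of_real (h k) * b1 (h k * s + 0)))
  + (gauss1_d1 t (s - y $ i) * (of_real (h k) * b1 (h k * s + 0)) + gauss1_d2 t (s - y $ i) * bump (h k * s + 0))" for k i s
 have ch: "((\<lambda>s. f (h k * s + 0)) has_vector_derivative (of_real (h k) * f' (h k * s + 0))) (at s)"
  if "\<And>x. (f has_vector_derivative f' x) (at x)" for f f' :: "real \<Rightarrow> complex" and k s
 proof -
  have "((\<lambda>x. h k * x + 0) has_real_derivative h k) (at s)" by (auto intro!: derivative_eq_intros)
  from vector_diff_chain_at[OF this[unfolded has_real_derivative_iff_has_vector_derivative], of f] that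
  show ?thesis by (simp add: o_def scaleR_conv_of_real)
 qed
 have pd: "(p k i has_vector_derivative p' k i s) (at s)" for k i s
  unfolding p_def[abs_def] p'_def
  by (intro has_vector_derivative_mult gauss1_derivatives t0 ch[OF b1(1)])
 have pd': "(p' k i has_vector_derivative p'' k i s) (at s)" for k i s
  unfolding p'_def[abs_def] p''_def
  by (intro has_vector_derivative_mult has_vector_derivative_add has_vector_derivative_mult_right gauss1_derivatives t0 ch[OF b1(1)] ch[OF b2(1)])
 have sp: "smooth1 (p k i)" for k i
  unfolding p_def[abs_def] by (intro smooth1_mult smooth1_gauss1 smooth1_scale smooth1_bump)
 have zp: "p k i s = 0" if "\<bar>s\<bar> > real (Suc k)" for k i s
 proof -
  have "\<bar>h k * s\<bar> > 1" using that by (simp add: h_def abs_mult field_simps del: of_nat_Suc)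
  then show ?thesis using z0 by (simp add: p_def)
 qed
 define \<psi> where "\<psi> k = (\<lambda>x::real^'n. \<Prod>i\<in>UNIV. p k i (x $ i))" for k
 have tf: "test_function (\<psi> k)" for k unfolding \<psi>_def by (rule test_function_tensor[OF sp zp])
 have lap: "laplacian (\<psi> k) x = (\<Sum>j\<in>UNIV. \<Prod>i\<in>UNIV. (if i = j then p'' k i (x $ i) else p k i (x $ i)))" for k x
  unfolding \<psi>_def laplacian_tensor[of "p k" "p' k" "p'' k", OF pd pd'] by (intro sum.cong prod.cong refl) auto
 \<comment> \<open>The 4 counts the four products that make up \<open>p''\<close>.\<close>
 define E where "E i s = 4 * X * M * exp (- c * (s - y $ i)^2)" for i s
 have E0: "0 \<le> E i s" for i s using X(4) M by (simp add: E_def)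
 have bh: "norm (of_real (h k) * z) \<le> B" if "norm z \<le> B" for k B and z :: complex
 proof -
  have "norm (of_real (h k) * z) \<le> 1 * norm z" unfolding norm_mult using h[of k] by (intro mult_right_mono) auto
  with that show ?thesis by simp
 qed
 have pm: "norm (a * b) \<le> X * M * exp (- c * (s - y $ i)^2)" if "norm a \<le> M * exp (- c * (s - y $ i)^2)" "norm b \<le> X" for a b :: complex and s i
 proof -
  have "norm a * norm b \<le> (M * exp (- c * (s - y $ i)^2)) * X" using that M by (intro mult_mono) auto
  then show ?thesis by (simp add: norm_mult mult_ac)
 qed
 have pE: "norm (p k i s) \<le> E i s" for k i s
 proof -
  have "norm (p k i s) \<le> X * M * exp (- c * (s - y $ i)^2)" unfolding p_def by (intro pm G X)
  moreover have "0 \<le> X * M * exp (- c * (s - y $ i)^2)" using X(4) M by simp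
  ultimately show ?thesis unfolding E_def by linarith
 qed
 have pE'': "norm (p'' k i s) \<le> E i s" for k i s
 proof -
  have "norm (p'' k i s) \<le> (X * M * exp (- c * (s - y $ i)^2) + X * M * exp (- c * (s - y $ i)^2)) + (X * M * exp (- c * (s - y $ i)^2) + X * M * exp (- c * (s - y $ i)^2))"
   unfolding p''_def by (intro norm_triangle_mono pm G bh X)
  also have "\<dots> = E i s" by (simp add: E_def)
  finally show ?thesis .
 qed
 define D where "D x = (\<Prod>i\<in>UNIV. complex_of_real (E i (x $ i)))" for x :: "real^'n"
 have nD: "norm (D x) = (\<Prod>i\<in>UNIV. E i (x $ i))" for x
  using E0 by (simp add: D_def prod_norm[symmetric])
 have D: "sq_integrable D"
 proof -
  have e: "complex_of_real ((E i s)^2) = of_real ((4 * X * M)^2) * of_real (exp (- (2 * c) * (s - y $ i)^2))" for i s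
   by (simp add: E_def power_mult_distrib exp_double[symmetric])
  have "integrable lborel (\<lambda>s. exp (- (2 * c) * (s - y $ i)^2))" for i
   using gaussian_real_integral(1)[of "2 * c"] c by (subst integral_shift(4)) auto
  then have i: "integrable lborel (\<lambda>s. complex_of_real ((E i s)^2))" for i
   unfolding e by (intro integrable_mult_right integrable_of_real)
  have eq: "(norm (D x))^2 = norm (\<Prod>i\<in>UNIV. complex_of_real ((E i (x $ i))^2))" for x
   unfolding nD using E0 by (simp add: prod_norm[symmetric] prod_power_distrib norm_power)
  have "integrable lborel (\<lambda>x. (norm (D x))^2)"
   unfolding eq using integral_prod_components(1)[OF i] by (rule integrable_norm)
  moreover have "D \<in> borel_measurable borel" unfolding D_def E_def by measurable
  ultimately show ?thesis by (simp add: sq_integrable_def)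
 qed
 have tensor_le: "norm (\<Prod>i\<in>UNIV. a i) \<le> norm (D x)" if "\<And>i. norm (a i) \<le> E i (x $ i)" for a :: "'n \<Rightarrow> complex" and x :: "real^'n"
 proof -
  have "(\<Prod>i\<in>UNIV. norm (a i)) \<le> (\<Prod>i\<in>UNIV. E i (x $ i))" using that by (intro prod_mono) auto
  then show ?thesis unfolding nD by (simp only: prod_norm)
 qed
 define L where "L k x = laplacian (\<psi> k) x - K^2 * \<psi> k x" for k x
 define C where "C = real CARD('n) + norm (K^2)"
 have LD: "norm (L k x) \<le> C * norm (D x)" for k x
 proof -
  have "norm (laplacian (\<psi> k) x) \<le> (\<Sum>j\<in>(UNIV :: 'n set). norm (D x))"
   unfolding lap by (rule order_trans[OF norm_sum]) (intro sum_mono tensor_le, auto simp: pE pE'')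
  moreover have "norm (K^2 * \<psi> k x) \<le> norm (K^2) * norm (D x)"
   unfolding norm_mult \<psi>_def by (intro mult_left_mono tensor_le pE) auto
  ultimately show ?thesis unfolding L_def C_def
   using norm_triangle_ineq4[of "laplacian (\<psi> k) x" "K^2 * \<psi> k x"] by (simp add: distrib_right)
 qed
 have bc: "(\<lambda>k. f (h k * s + 0)) \<longlonglongrightarrow> f 0" if "smooth1 f" for f and s
 proof -
  have "(\<lambda>k. h k * s + 0) \<longlonglongrightarrow> 0 * s + 0" by (intro tendsto_intros h0)
  then have "(\<lambda>k. h k * s + 0) \<longlonglongrightarrow> 0" by simp
  from continuous_on_tendsto_compose[OF smooth1_continuous[OF that] this] show ?thesis by simp
 qed
 have hc: "(\<lambda>k. complex_of_real (h k)) \<longlonglongrightarrow> 0" using tendsto_of_real[OF h0, where 'a = complex] by simp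
 have pl: "(\<lambda>k. p k i s) \<longlonglongrightarrow> gauss1 t (s - y $ i) * bump 0" for i s
  unfolding p_def by (intro tendsto_intros bc smooth1_bump)
 have pl'': "(\<lambda>k. p'' k i s) \<longlonglongrightarrow> gauss1_d2 t (s - y $ i) * bump 0" for i s
 proof -
  have "(\<lambda>k. p'' k i s) \<longlonglongrightarrow> (gauss1 t (s - y $ i) * (0 * (0 * b2 0)) + gauss1_d1 t (s - y $ i) * (0 * b1 0))
  + (gauss1_d1 t (s - y $ i) * (0 * b1 0) + gauss1_d2 t (s - y $ i) * bump 0)"
   unfolding p''_def by (intro tendsto_intros bc smooth1_bump b1 b2 hc)
  then show ?thesis by simp
 qed
 have Ll: "(\<lambda>k. L k x) \<longlonglongrightarrow> bump 0 ^ CARD('n) * (heat_dt t (x - y) - K^2 * heat t (x - y))" for x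
 proof -
  have "(\<lambda>k. L k x) \<longlonglongrightarrow> (\<Sum>j\<in>UNIV. \<Prod>i\<in>UNIV. (if i = j then gauss1_d2 t (x $ i - y $ i) * bump 0 else gauss1 t (x $ i - y $ i) * bump 0))
   - K^2 * (\<Prod>i\<in>UNIV. gauss1 t (x $ i - y $ i) * bump 0)"
   unfolding L_def lap unfolding \<psi>_def
  proof (intro tendsto_diff tendsto_sum tendsto_prod tendsto_mult tendsto_const pl)
   show "(\<lambda>k. if i = j then p'' k i (x $ i) else p k i (x $ i)) \<longlonglongrightarrow> (if i = j then gauss1_d2 t (x $ i - y $ i) * bump 0 else gauss1 t (x $ i - y $ i) * bump 0)" for i j
    using pl pl'' by (cases "i = j") simp_all
  qed
  also have "(\<Sum>j\<in>UNIV. \<Prod>i\<in>UNIV. (if i = j then gauss1_d2 t (x $ i - y $ i) * bump 0 else gauss1 t (x $ i - y $ i) * bump 0))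
   = (\<Sum>j\<in>UNIV. \<Prod>i\<in>UNIV. (if i = j then gauss1_d2 t (x $ i - y $ i) else gauss1 t (x $ i - y $ i)) * bump 0)"
   by (intro sum.cong prod.cong refl) auto
  also have "\<dots> = bump 0 ^ CARD('n) * heat_dt t (x - y)"
   by (simp add: heat_dt_def prod.distrib sum_distrib_left mult.commute cong: if_cong)
  also have "(\<Prod>i\<in>UNIV. gauss1 t (x $ i - y $ i) * bump 0) = bump 0 ^ CARD('n) * heat t (x - y)"
   by (simp add: heat_def prod.distrib mult.commute)
  finally show ?thesis by (simp add: right_diff_distrib mult_ac)
 qed
 have Lm[measurable]: "L k \<in> borel_measurable borel" for k
  using test_function_laplacian(2,4)[OF tf] unfolding L_def[abs_def]
  by (intro borel_measurable_continuous_onI continuous_intros)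
 define Lim where "Lim x = bump 0 ^ CARD('n) * (heat_dt t (x - y) - K^2 * heat t (x - y))" for x
 have [measurable]: "Lim \<in> borel_measurable borel"
  by (rule borel_measurable_LIMSEQ_metric[OF Lm Ll[folded Lim_def]])
 have "(\<lambda>k. \<integral>x. u x * L k x \<partial>lborel) \<longlonglongrightarrow> (LBINT x. u x * Lim x)"
 proof (rule integral_dominated_convergence[where w = "\<lambda>x. C * norm (u x * D x)"])
  show "integrable lborel (\<lambda>x. C * norm (u x * D x))"
   using sq_integrable_mult(1)[OF u D] by (intro integrable_mult_right integrable_norm)
  show "AE x in lborel. (\<lambda>k. u x * L k x) \<longlonglongrightarrow> u x * Lim x"
   unfolding Lim_def by (intro AE_I2 tendsto_intros Ll)
  show "AE x in lborel. norm (u x * L k x) \<le> C * norm (u x * D x)" for k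
  proof (rule AE_I2)
   fix x
   have "norm (u x) * norm (L k x) \<le> norm (u x) * (C * norm (D x))" by (intro mult_left_mono LD) auto
   then show "norm (u x * L k x) \<le> C * norm (u x * D x)" by (simp add: norm_mult mult_ac)
  qed
 qed measurable
 moreover have "(LBINT x. u x * L k x) = 0" for k unfolding L_def by (rule weak[OF tf])
 ultimately have "(\<lambda>k::nat. 0) \<longlonglongrightarrow> (LBINT x. u x * Lim x)" by simp
 then have "0 = (LBINT x. u x * Lim x)" by (rule LIMSEQ_unique[OF tendsto_const])
 also have "\<dots> = (LBINT x. bump 0 ^ CARD('n) * (u x * (heat_dt t (x - y) - K^2 * heat t (x - y))))"
  by (simp add: Lim_def mult_ac)
 also have "\<dots> = bump 0 ^ CARD('n) * (LBINT x. u x * (heat_dt t (x - y) - K^2 * heat t (x - y)))"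
  by (rule integral_mult_right_zero)
 finally show ?thesis using bump_0 by simp
qed

section \<open>The heat flow of a homogeneous solution\<close>

lemma gauss1_dtau:
 assumes t: "Re t > 0"
 shows "((\<lambda>t. gauss1 t s) has_field_derivative gauss1_d2 t s) (at t)"
proof -
 define r where "r = csqrt (4 * of_real pi * t)"
 define E where "E = exp (- of_real (s^2) / (4 * t))"
 have t0: "t \<noteq> 0" using t by auto
 have nn: "4 * of_real pi * t \<notin> \<real>\<^sub>\<le>\<^sub>0" using t by (auto simp: complex_nonpos_Reals_iff mult_le_0_iff not_le)
 have r2: "r * r = 4 * of_real pi * t" using power2_csqrt[of "4 * of_real pi * t"] by (simp add: r_def power2_eq_square)
 then have r0: "r \<noteq> 0" using t0 by auto
 have dE: "((\<lambda>t. exp (- of_real (s^2) / (4 * t))) has_field_derivative (of_real (s^2) / (4 * t^2) * E)) (at t)"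
  using t0 by (auto intro!: derivative_eq_intros simp: E_def field_simps power2_eq_square)
 have dr: "((\<lambda>t. csqrt (4 * of_real pi * t)) has_field_derivative (4 * of_real pi / (2 * r))) (at t)"
  using nn by (auto intro!: derivative_eq_intros simp: r_def)
 have "((\<lambda>t. gauss1 t s) has_field_derivative ((of_real (s^2) / (4 * t^2) * E) * r - E * (4 * of_real pi / (2 * r))) / (r * r)) (at t)"
  unfolding gauss1_def using DERIV_divide[OF dE dr] r0 by (simp add: E_def r_def)
 also have "((of_real (s^2) / (4 * t^2) * E) * r - E * (4 * of_real pi / (2 * r))) / (r * r) = gauss1_d2 t s"
 proof -
  have "E * (4 * of_real pi / (2 * r)) / (r * r) = E / r * (4 * of_real pi / (2 * (r * r)))" by simp
  also have "\<dots> = E / r * (1 / (2 * t))" unfolding r2 using t0 by simp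
  finally have 1: "E * (4 * of_real pi / (2 * r)) / (r * r) = E / r * (1 / (2 * t))" .
  have 2: "(of_real (s^2) / (4 * t^2) * E) * r / (r * r) = of_real (s^2) / (4 * t^2) * (E / r)" using r0 by simp
  have g: "gauss1 t s = E / r" by (simp add: gauss1_def E_def r_def)
  have "a * x - x * c = (a - c) * x" for a x c :: complex by (simp add: algebra_simps)
  then show ?thesis unfolding diff_divide_distrib 1 2 gauss1_d2_def g .
 qed
 finally show ?thesis .
qed

lemma heat_dtau:
 fixes x :: "real^'n"
 assumes t: "Re t > 0"
 shows "((\<lambda>t. heat t x) has_field_derivative heat_dt t x) (at t)"
proof -
 have "((\<lambda>t. \<Prod>i\<in>UNIV. gauss1 t (x $ i)) has_derivative (\<lambda>h. \<Sum>i\<in>UNIV. (gauss1_d2 t (x $ i) * h) * (\<Prod>j\<in>UNIV - {i}. gauss1 t (x $ j)))) (at t)"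
  by (intro has_derivative_prod gauss1_dtau[OF t, unfolded has_field_derivative_def])
 moreover have "(\<lambda>h. \<Sum>i\<in>UNIV. (gauss1_d2 t (x $ i) * h) * (\<Prod>j\<in>UNIV - {i}. gauss1 t (x $ j))) = (*) (heat_dt t x)"
 proof
  fix h
  have "heat_dt t x = (\<Sum>i\<in>UNIV. gauss1_d2 t (x $ i) * (\<Prod>j\<in>UNIV - {i}. gauss1 t (x $ j)))"
   unfolding heat_dt_def
  proof (intro sum.cong refl)
   fix i :: 'n
   have "(\<Prod>k\<in>UNIV. if k = i then gauss1_d2 t (x $ k) else gauss1 t (x $ k)) = gauss1_d2 t (x $ i) * (\<Prod>k\<in>UNIV - {i}. if k = i then gauss1_d2 t (x $ k) else gauss1 t (x $ k))"
    by (subst prod.remove[of _ i]) auto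
   also have "(\<Prod>k\<in>UNIV - {i}. if k = i then gauss1_d2 t (x $ k) else gauss1 t (x $ k)) = (\<Prod>j\<in>UNIV - {i}. gauss1 t (x $ j))"
    by (intro prod.cong) auto
   finally show "(\<Prod>k\<in>UNIV. if k = i then gauss1_d2 t (x $ k) else gauss1 t (x $ k)) = gauss1_d2 t (x $ i) * (\<Prod>j\<in>UNIV - {i}. gauss1 t (x $ j))" .
  qed
  note e = this
  show "(\<Sum>i\<in>UNIV. (gauss1_d2 t (x $ i) * h) * (\<Prod>j\<in>UNIV - {i}. gauss1 t (x $ j))) = heat_dt t x * h"
   unfolding e sum_distrib_right by (intro sum.cong) (simp_all add: mult_ac)
 qed
 ultimately show ?thesis by (simp add: has_field_derivative_def heat_def)
qed

lemma nice_indicator: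
 assumes [measurable]: "A \<in> sets borel" and "bounded A"
 shows "nice (indicator A :: 'a::euclidean_space \<Rightarrow> complex)"
proof -
 obtain R where R: "\<And>x. x \<in> A \<Longrightarrow> norm x \<le> R" using assms(2) unfolding bounded_iff by auto
 have "norm (indicator A x :: complex) \<le> 1" for x by (simp add: indicator_def)
 moreover have "indicator A x = (0 :: complex)" if "norm x > R" for x using R[of x] that by (auto simp: indicator_def)
 ultimately show ?thesis unfolding nice_def by (intro conjI exI[of _ 1] exI[of _ R] allI impI) auto
qed

text \<open>The square of the L2 norm is at most the supremum times the L1 norm, both of which are
  explicit at complex time.\<close>

lemma heat_bounds:
 fixes x :: "real^'n"
 assumes t: "Re t > 0"
 shows "norm (heat t x) \<le> (1 / (2 * sqrt pi * sqrt (norm t))) ^ CARD('n)"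
  and "sq_integrable (heat t :: real^'n \<Rightarrow> complex)"
  and "(norm2 (heat t :: real^'n \<Rightarrow> complex))^2
   \<le> (1 / (2 * sqrt pi * sqrt (norm t))) ^ CARD('n) * sqrt (norm t / Re t) ^ CARD('n)"
proof -
 define B where "B = 1 / (2 * sqrt pi * sqrt (norm t))"
 have B0: "B \<ge> 0" by (simp add: B_def)
 have g: "norm (gauss1 t s) \<le> B" for s
  unfolding norm_gauss1[OF t] B_def using t by (intro divide_right_mono) auto
 show h: "norm (heat t x) \<le> (1 / (2 * sqrt pi * sqrt (norm t))) ^ CARD('n)" for x :: "real^'n"
 proof -
  have "(\<Prod>i\<in>UNIV. norm (gauss1 t (x $ i))) \<le> (\<Prod>i\<in>(UNIV :: 'n set). B)" using g by (intro prod_mono) auto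
  then show ?thesis unfolding heat_def B_def by (simp add: prod_norm)
 qed
 have le: "(norm (heat t x))^2 \<le> B ^ CARD('n) * norm (heat t x)" for x :: "real^'n"
  unfolding power2_eq_square B_def using h by (intro mult_right_mono) auto
 have i: "integrable lborel (\<lambda>x :: real^'n. B ^ CARD('n) * norm (heat t x))"
  using heat_integrable(1)[OF t] by (intro integrable_mult_right integrable_norm)
 have i2: "integrable lborel (\<lambda>x :: real^'n. (norm (heat t x))^2)"
  by (rule Bochner_Integration.integrable_bound[OF i]) (use le B0 in \<open>auto intro!: AE_I2\<close>)
 then show "sq_integrable (heat t :: real^'n \<Rightarrow> complex)" by (simp add: sq_integrable_def)
 have "(norm2 (heat t :: real^'n \<Rightarrow> complex))^2 \<le> (LBINT x. B ^ CARD('n) * norm (heat t (x :: real^'n)))"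
  unfolding norm2_sq using i2 i le by (intro integral_mono)
 then show "(norm2 (heat t :: real^'n \<Rightarrow> complex))^2
   \<le> (1 / (2 * sqrt pi * sqrt (norm t))) ^ CARD('n) * sqrt (norm t / Re t) ^ CARD('n)"
  by (simp add: heat_integrable(2)[OF t] B_def)
qed

text \<open>For times near \<open>a\<close> all Gaussians are dominated by one with a common smaller
  exponent \<open>c\<close>. That Gaussian is again a heat kernel, at the real time \<sigma>, so its
  square integrability is known from \<open>heat_bounds\<close>.\<close>

lemma heat_locally_dominated:
 assumes a: "Re a > 0"
 shows "\<exists>M \<sigma>. 0 \<le> M \<and> Re \<sigma> > 0 \<and> (\<forall>w x. w \<in> cball a (Re a / 2) \<longrightarrow> norm (heat w (x :: real^'n)) \<le> M * norm (heat \<sigma> x))"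
proof -
 define c where "c = (Re a / 2) / (4 * (2 * norm a)^2)"
 define N where "N = 1 / (2 * sqrt pi * sqrt (Re a / 2))"
 \<comment> \<open>The time at which the heat kernel has Gaussian exponent \<open>c\<close>.\<close>
 define \<sigma> where "\<sigma> = complex_of_real (1 / (4 * c))"
 define m where "m = 2 * sqrt pi * sqrt (norm \<sigma>)"
 have na: "Re a \<le> norm a" by (rule complex_Re_le_cmod)
 have c: "c > 0" unfolding c_def using a na by (intro divide_pos_pos mult_pos_pos zero_less_power) auto
 have Re\<sigma>: "Re \<sigma> = 1 / (4 * c)" by (simp only: \<sigma>_def Re_complex_of_real)
 then have s: "Re \<sigma> > 0" using c by simp
 have "\<sigma> \<noteq> 0" using s by auto
 then have m: "m > 0" unfolding m_def by (intro mult_pos_pos) auto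
 have N0: "N \<ge> 0" using a by (simp add: N_def)
 have n\<sigma>: "norm \<sigma> = 1 / (4 * c)" using c by (simp only: \<sigma>_def norm_of_real) simp
 have e\<sigma>: "Re \<sigma> / (4 * (norm \<sigma>)^2) = c" unfolding n\<sigma> Re\<sigma> using c by (simp add: power2_eq_square)
 have g: "norm (gauss1 w s) \<le> (N * m) * norm (gauss1 \<sigma> s)" if z: "w \<in> cball a (Re a / 2)" for w s
 proof -
  have d: "norm (a - w) \<le> Re a / 2" using z by (simp add: dist_norm)
  have "Re (a - w) \<le> Re a / 2" using complex_Re_le_cmod[of "a - w"] d by linarith
  then have r: "Re a / 2 \<le> Re w" by simp
  have n1: "Re a / 2 \<le> norm w" using r complex_Re_le_cmod[of w] by linarith
  have n2: "norm w \<le> 2 * norm a" using norm_triangle_ineq2[of w a] d na a by (simp add: norm_minus_commute)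
  have z0: "Re w > 0" using r a by linarith
  have "c \<le> Re w / (4 * (norm w)^2)" unfolding c_def
  proof (rule frac_le)
   show "4 * (norm w)^2 \<le> 4 * (2 * norm a)^2" using n2 by (intro mult_left_mono power_mono) auto
  qed (use r a z0 n1 in auto)
  then have "c * s^2 \<le> Re w / (4 * (norm w)^2) * s^2" by (rule mult_right_mono) simp
  then have e: "exp (- (Re w / (4 * (norm w)^2)) * s^2) \<le> exp (- c * s^2)" by simp
  have "norm (gauss1 w s) \<le> exp (- c * s^2) / (2 * sqrt pi * sqrt (Re a / 2))"
   unfolding norm_gauss1[OF z0] by (rule frac_le) (use e n1 a in auto)
  also have "\<dots> = (N * m) * norm (gauss1 \<sigma> s)"
   unfolding norm_gauss1[OF s] e\<sigma> m_def[symmetric] N_def using m by simp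
  finally show ?thesis .
 qed
 have "norm (heat w x) \<le> (N * m) ^ CARD('n) * norm (heat \<sigma> x)" if z: "w \<in> cball a (Re a / 2)" for w and x :: "real^'n"
 proof -
  have "(\<Prod>i\<in>UNIV. norm (gauss1 w (x $ i))) \<le> (\<Prod>i\<in>UNIV. (N * m) * norm (gauss1 \<sigma> (x $ i)))" using g[OF z] by (intro prod_mono) auto
  then show ?thesis unfolding heat_def by (simp add: prod_norm[symmetric] prod.distrib)
 qed
 then show ?thesis using s N0 m by (intro exI[of _ "(N * m) ^ CARD('n)"] exI[of _ \<sigma>]) auto
qed

text \<open>Holomorphy in time spares a bound on \<open>heat_dt\<close>: domination of the heat
  kernels themselves yields both the derivative and the integrability.\<close>

lemma heat_pairing_derivative:
 fixes u :: "real^'n \<Rightarrow> complex"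
 assumes u: "sq_integrable u" and a: "Re a > 0"
 shows "((\<lambda>t. \<integral>x. u x * heat t (x - y) \<partial>lborel) has_field_derivative (LBINT x. u x * heat_dt a (x - y))) (at a)"
  and "integrable lborel (\<lambda>x. u x * heat_dt a (x - y))"
proof -
 have [measurable]: "u \<in> borel_measurable borel" using u by (simp add: sq_integrable_def)
 obtain M \<sigma> where M: "0 \<le> M" and \<sigma>: "Re \<sigma> > 0"
  and le: "\<And>s x :: real^'n. s \<in> cball a (Re a / 2) \<Longrightarrow> norm (heat s x) \<le> M * norm (heat \<sigma> x)"
  using heat_locally_dominated[OF a, where 'n='n] by blast
 have re: "Re s > 0" if "s \<in> cball a (Re a / 2)" for s
 proof -
  have "norm (a - s) \<le> Re a / 2" using that by (simp add: dist_norm)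
  then have "Re (a - s) \<le> Re a / 2" using complex_Re_le_cmod[of "a - s"] by linarith
  then show ?thesis using a by simp
 qed
 have i: "integrable lborel (\<lambda>x. M * norm (u x * heat \<sigma> (x - y)))"
  using sq_integrable_mult(1)[OF u sq_integrable_shift(2)[OF heat_bounds(2)[OF \<sigma>]]] by (intro integrable_mult_right integrable_norm)
 have d: "((\<lambda>s. u x * heat s (x - y)) has_field_derivative u x * heat_dt s (x - y)) (at s)" if "Re s > 0" for s x
  using DERIV_cmult[OF heat_dtau[OF that, of "x - y"]] .
 have dd: "deriv (\<lambda>s. u x * heat s (x - y)) a = u x * heat_dt a (x - y)" for x
  by (rule DERIV_imp_deriv[OF d[OF a]])
 have hol: "(\<lambda>s. u x * heat s (x - y)) holomorphic_on cball a (Re a / 2)" for x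
  unfolding holomorphic_on_def field_differentiable_def using d[OF re] has_field_derivative_at_within by blast
 have dom: "norm (u x * heat s (x - y)) \<le> M * norm (u x * heat \<sigma> (x - y))" if "s \<in> cball a (Re a / 2)" for s x
 proof -
  have "norm (u x) * norm (heat s (x - y)) \<le> norm (u x) * (M * norm (heat \<sigma> (x - y)))" by (intro mult_left_mono le that) auto
  then show ?thesis by (simp add: norm_mult mult_ac)
 qed
 have r: "Re a / 2 > 0" using a by simp
 note D = has_field_derivative_parametric_integral[where f = "\<lambda>s x. u x * heat s (x - y)" and M = lborel, OF r _ hol i dom]
 show "((\<lambda>t. \<integral>x. u x * heat t (x - y) \<partial>lborel) has_field_derivative (LBINT x. u x * heat_dt a (x - y))) (at a)"
  using D(1) unfolding dd by simp
 show "integrable lborel (\<lambda>x. u x * heat_dt a (x - y))"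
  using D(2) unfolding dd by simp
qed

text \<open>\<open>U s * exp (- K\<^sup>2 * s)\<close> is constant on the half plane. On the
  positive axis the exponential need not decay, since \<open>Re (K^2)\<close> may be negative; on
  the ray s = t / K it is exp (- t K), and the norm of the heat kernel stays bounded there for t
  \<ge> 1 because |s| / Re s is constant.\<close>

lemma heat_flow_vanishes:
 fixes u :: "real^'n \<Rightarrow> complex"
 assumes u: "sq_integrable u" and K: "Re K > 0" and r: "Re r > 0"
  and weak: "\<And>\<phi>. test_function \<phi> \<Longrightarrow> (LBINT x. u x * (laplacian \<phi> x - K^2 * \<phi> x)) = 0"
 shows "(LBINT x. u x * heat r (x - y)) = 0"
proof -
 define U where "U r = (LBINT x. u x * heat r (x - y))" for r
 have ui: "integrable lborel (\<lambda>x. u x * heat s (x - y))" if "Re s > 0" for s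
  by (rule sq_integrable_mult(1)[OF u sq_integrable_shift(2)[OF heat_bounds(2)[OF that]]])
 have dU: "(U has_field_derivative K^2 * U s) (at s)" if z: "Re s > 0" for s
 proof -
  have "(LBINT x. u x * heat_dt s (x - y) - K^2 * (u x * heat s (x - y))) = 0"
   using weak_solution_heat[OF u z weak, of y] by (simp add: right_diff_distrib mult_ac)
  then have "(LBINT x. u x * heat_dt s (x - y)) = K^2 * U s"
   using heat_pairing_derivative(2)[OF u z] ui[OF z] by (simp add: U_def)
  then show ?thesis using heat_pairing_derivative(1)[OF u z, of y] unfolding U_def by simp
 qed
 have "((\<lambda>s. U s * exp (- K\<^sup>2 * s)) has_field_derivative 0) (at s within {s. Re s > 0})" if "s \<in> {s. Re s > 0}" for s
  using that by (auto intro!: derivative_eq_intros dU[THEN has_field_derivative_at_within] simp: algebra_simps)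
 from has_field_derivative_zero_constant[OF convex_halfspace_Re_gt this]
 obtain C where C: "\<And>s. Re s > 0 \<Longrightarrow> U s * exp (- K\<^sup>2 * s) = C" by auto
 have K0: "K \<noteq> 0" using K by auto
 have ik: "Re (inverse K) > 0" using K K0 by (simp add: complex_eq_iff sum_power2_gt_zero_iff)
 define P where "P = sqrt ((1 / (2 * sqrt pi * sqrt (norm (inverse K)))) ^ CARD('n) * sqrt (norm (inverse K) / Re (inverse K)) ^ CARD('n))"
 have "norm C \<le> norm2 u * P * exp (- t * Re K)" if t: "t \<ge> 1" for t :: real
 proof -
  define s where "s = of_real t * inverse K"
  have Rz: "Re s = t * Re (inverse K)" by (simp add: s_def)
  have z: "Re s > 0" unfolding Rz by (rule mult_pos_pos) (use ik t in auto)
  have nz: "norm s = t * norm (inverse K)" using t by (simp add: s_def norm_mult)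
  have q: "norm s / Re s = norm (inverse K) / Re (inverse K)" unfolding nz Rz using t by simp
  have "norm (inverse K) \<le> norm s" unfolding nz using t by (simp add: mult_le_cancel_right1)
  then have "1 / (2 * sqrt pi * sqrt (norm s)) \<le> 1 / (2 * sqrt pi * sqrt (norm (inverse K)))"
   using K0 by (intro divide_left_mono mult_left_mono mult_pos_pos) auto
  then have "(norm2 (heat s :: real^'n \<Rightarrow> complex))^2 \<le> (1 / (2 * sqrt pi * sqrt (norm (inverse K)))) ^ CARD('n) * sqrt (norm (inverse K) / Re (inverse K)) ^ CARD('n)"
   using heat_bounds(3)[OF z, where 'n='n] unfolding q
   by (elim order_trans) (intro mult_right_mono power_mono zero_le_power real_sqrt_ge_zero divide_nonneg_nonneg less_imp_le[OF ik], auto)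
  then have h: "norm2 (heat s :: real^'n \<Rightarrow> complex) \<le> P" unfolding P_def by (rule real_le_rsqrt)
  have "norm (U s) \<le> norm2 u * norm2 (\<lambda>x. heat s (x - y))"
   unfolding U_def by (rule sq_integrable_mult(3)[OF u sq_integrable_shift(2)[OF heat_bounds(2)[OF z]]])
  also have "\<dots> = norm2 u * norm2 (heat s :: real^'n \<Rightarrow> complex)" by (simp add: sq_integrable_shift(4)[OF heat_bounds(2)[OF z]])
  also have "\<dots> \<le> norm2 u * P" using h by (intro mult_left_mono) (auto simp: norm2_def)
  finally have 1: "norm (U s) \<le> norm2 u * P" .
  have "K^2 * s = of_real t * K" using K0 by (simp add: s_def power2_eq_square)
  then have "norm C = norm (U s) * exp (- t * Re K)" unfolding C[OF z, symmetric] norm_mult by simp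
  also have "\<dots> \<le> norm2 u * P * exp (- t * Re K)" using 1 by (intro mult_right_mono) auto
  finally show ?thesis .
 qed
 then have "\<forall>\<^sub>F t in at_top. norm C \<le> norm2 u * P * exp (- t * Re K)" using eventually_ge_at_top[of 1] by (rule eventually_mono[rotated])
 moreover have "((\<lambda>t. norm2 u * P * exp (- t * Re K)) \<longlongrightarrow> norm2 u * P * 0) at_top"
 proof (intro tendsto_mult tendsto_const filterlim_compose[OF exp_at_bot])
  have "LIM t at_top. Re K * t :> at_top" using K by (intro filterlim_tendsto_pos_mult_at_top[OF tendsto_const] filterlim_ident)
  then show "LIM t at_top. - t * Re K :> at_bot" unfolding filterlim_uminus_at_bot by (simp add: mult.commute)
 qed
 ultimately have "norm C \<le> norm2 u * P * 0" by (intro tendsto_lowerbound) auto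
 then have "C = 0" by simp
 then show ?thesis using C[OF r] by (simp add: U_def)
qed

text \<open>The heat kernel being even, the hypothesis says that its convolution with
  \<open>u\<close> vanishes; as the time tends to 0, the pairing of this convolution with
  \<open>h\<close> tends to the pairing of \<open>u\<close> with \<open>h\<close>.\<close>

lemma heat_flow_zero_imp_orthogonal:
 fixes u h :: "real^'n \<Rightarrow> complex"
 assumes u: "sq_integrable u" and h: "nice h" "continuous_on UNIV h"
  and zero: "\<And>t y. 0 < t \<Longrightarrow> (LBINT x. u x * heat (of_real t) (x - y)) = 0"
 shows "(LBINT x. u x * h x) = 0"
proof -
 have [measurable]: "u \<in> borel_measurable borel" "h \<in> borel_measurable borel" using u nice_measurable[OF h(1)] by (auto simp: sq_integrable_def)
 note hs = nice_integrable(2)[OF h(1)]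
 obtain R where R: "\<And>x. norm x > R \<Longrightarrow> h x = 0" using h(1) unfolding nice_def by auto
 \<comment> \<open>\<open>isCont_corr_0\<close> asks for an integrable function. Cutting
   \<open>u\<close> off at radius \<open>R + 1\<close> leaves the correlation unchanged for shifts
   of norm below 1.\<close>
 define i where "i = (\<lambda>x :: real^'n. indicator (cball 0 (R + 1)) x :: complex)"
 have "nice i" unfolding i_def by (rule nice_indicator) auto
 then have "integrable lborel (\<lambda>x. u x * i x)" by (intro sq_integrable_mult(1) u nice_integrable)
 then have "isCont (corr (\<lambda>x. u x * i x) h) 0" by (rule isCont_corr_0[OF _ h])
 moreover have "\<forall>\<^sub>F w in nhds 0. corr (\<lambda>x. u x * i x) h w = corr u h w"
 proof -
  have "\<forall>\<^sub>F w in nhds 0. w \<in> ball (0 :: real^'n) 1" by (intro eventually_nhds_in_open) auto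
  then show ?thesis
  proof eventually_elim
   case (elim w)
   have "u (x - w) * i (x - w) * h x = u (x - w) * h x" for x
   proof (cases "norm x > R")
    case False
    then have "norm (x - w) \<le> R + 1" using norm_triangle_ineq4[of x w] elim by simp
    then show ?thesis by (simp add: i_def)
   qed (use R in auto)
   then show ?case unfolding corr_def by (intro LBINT_cong refl)
  qed
 qed
 ultimately have c: "isCont (corr u h) 0" using isCont_cong by blast
 have m: "corr u h \<in> borel_measurable borel" unfolding corr_def by measurable
 have even: "heat r (x - y) = heat r (y - x)" for r and x y :: "real^'n"
  by (simp add: heat_def gauss1_def power2_commute)
 have "(LBINT w. heat (of_real ((1 / real (Suc k))^2)) w * corr u h w) = 0" for k
 proof -
  have p: "Re (complex_of_real ((1 / real (Suc k))^2)) > 0" by simp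
  have "conv (heat (of_real ((1 / real (Suc k))^2))) u y = 0" for y
   using zero[of "(1 / real (Suc k))^2" y] unfolding conv_def even[of _ _ y] by (simp add: mult.commute)
  then show ?thesis using conv_pairing[OF heat_integrable(1)[OF p] u hs] by simp
 qed
 then have "(\<lambda>k. 0) \<longlonglongrightarrow> corr u h 0" using heat_approximate_identity[OF m norm_corr_le[OF u hs] c] by simp
 then have "corr u h 0 = 0" using LIMSEQ_unique tendsto_const by blast
 then show ?thesis by (simp add: corr_def)
qed

lemma orthogonal_imp_open_integral_zero:
 fixes u :: "real^'n \<Rightarrow> complex"
 assumes u: "sq_integrable u" and S: "open S" "bounded S"
  and zero: "\<And>h. nice h \<Longrightarrow> continuous_on UNIV h \<Longrightarrow> (LBINT x. u x * h x) = 0"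
 shows "(LBINT x. u x * indicator S x) = 0"
proof -
 have [measurable]: "u \<in> borel_measurable borel" "S \<in> sets borel" using u S by (auto simp: sq_integrable_def)
 obtain R where R: "\<And>x. x \<in> S \<Longrightarrow> norm x \<le> R" using S(2) unfolding bounded_iff by auto
 have ne: "- S \<noteq> {}" using S(2) not_bounded_UNIV[where 'a="real^'n"] by (metis Compl_UNIV_eq double_complement)
 \<comment> \<open>Continuous functions that increase to the indicator of the open set
   \<open>S\<close>.\<close>
 define h where "h k x = complex_of_real (min 1 (real k * infdist x (- S)))" for k and x :: "real^'n"
 have h0: "h k x = 0" if "x \<notin> S" for k x using that by (simp add: h_def)
 have hc: "continuous_on UNIV (h k)" for k unfolding h_def by (intro continuous_intros)
 have hn: "nice (h k)" for k using hc by (rule nice_continuous[of _ R]) (use R h0 in fastforce)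
 have h1: "norm (h k x) \<le> indicator S x" for k x
  using h0[of x k] infdist_nonneg[of x "- S"] by (cases "x \<in> S") (auto simp: h_def)
 have "nice (indicator S :: real^'n \<Rightarrow> complex)" by (rule nice_indicator) (use S in auto)
 then have i: "integrable lborel (\<lambda>x. norm (u x * indicator S x))" by (intro integrable_norm sq_integrable_mult(1) u nice_integrable)
 have lim: "(\<lambda>k. h k x) \<longlonglongrightarrow> indicator S x" for x
 proof (cases "x \<in> S")
  case True
  have "infdist x (- S) \<noteq> 0" using in_closed_iff_infdist_zero[of "- S" x] S(1) ne True by (simp add: closed_Compl)
  then have p: "infdist x (- S) > 0" using infdist_nonneg[of x "- S"] by linarith
  obtain N :: nat where N: "1 < real N * infdist x (- S)" using ex_less_of_nat_mult[OF p] by blast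
  have "h k x = 1" if "k \<ge> N" for k
  proof -
   have "real N * infdist x (- S) \<le> real k * infdist x (- S)" using that p by (intro mult_right_mono) auto
   then show ?thesis using N by (simp add: h_def min_def)
  qed
  then show ?thesis using True by (intro tendsto_eventually) (auto simp: eventually_sequentially)
 qed (simp add: h0)
 have "(\<lambda>k. \<integral>x. u x * h k x \<partial>lborel) \<longlonglongrightarrow> (LBINT x. u x * indicator S x)"
 proof (rule integral_dominated_convergence[OF _ _ i])
  have [measurable]: "h k \<in> borel_measurable borel" for k using hn by (rule nice_measurable)
  show "(\<lambda>x. u x * h k x) \<in> borel_measurable lborel" for k by simp
  show "AE x in lborel. norm (u x * h k x) \<le> norm (u x * indicator S x)" for k
  proof (rule AE_I2)
   fix x
   have "norm (u x) * norm (h k x) \<le> norm (u x) * indicator S x" using h1 by (intro mult_left_mono) auto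
   then show "norm (u x * h k x) \<le> norm (u x * indicator S x)" by (cases "x \<in> S") (simp_all add: norm_mult)
  qed
 qed (use lim in \<open>auto intro!: AE_I2 tendsto_mult\<close>)
 then show ?thesis unfolding zero[OF hn hc] by (simp add: LIMSEQ_const_iff)
qed

text \<open>Outer regularity passes from open sets to bounded Borel sets, the error being an L2
  pairing with the indicator of a set of small measure. Testing on the part of a ball where
  \<open>Re (c * u x)\<close> is positive, for c equal to 1, - 1, \<i> and - \<i>, then gives the
  claim.\<close>

lemma open_integral_zero_imp_AE_zero:
 fixes u :: "'a::euclidean_space \<Rightarrow> complex"
 assumes u: "sq_integrable u"
  and zero: "\<And>S. open S \<Longrightarrow> bounded S \<Longrightarrow> (LBINT x. u x * indicator S x) = 0"
 shows "AE x in lborel. u x = 0"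
proof -
 have [measurable]: "u \<in> borel_measurable borel" using u by (auto simp: sq_integrable_def)
 have nice_ind: "nice (indicator A :: 'a \<Rightarrow> complex)" if "A \<in> sets borel" "A \<subseteq> ball 0 R" for A R
  using that(1) bounded_subset[OF bounded_ball that(2)] by (rule nice_indicator)
 have bnd: "(LBINT x. u x * indicator A x) = 0" if A[measurable]: "A \<in> sets borel" and sub: "A \<subseteq> ball 0 R" for A R
 proof -
  have "norm (LBINT x. u x * indicator A x) \<le> norm2 u * e" if e: "e > 0" for e
  proof -
   obtain S where S: "open S" "A \<subseteq> S" "emeasure lborel (S - A) < ennreal (e^2)"
    using outer_regular_lborel[OF A, of "e^2"] e by auto
   define T where "T = S \<inter> ball 0 R"
   have T: "open T" "bounded T" "A \<subseteq> T" "T - A \<subseteq> ball 0 R" using S sub by (auto simp: T_def)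
   have [measurable]: "T \<in> sets borel" "S \<in> sets borel" using T S by auto
   have iT: "integrable lborel (\<lambda>x. u x * indicator (T - A) x)" and iA: "integrable lborel (\<lambda>x. u x * indicator A x)"
    by (intro sq_integrable_mult(1) u nice_integrable nice_ind[of _ R] T sub; measurable)+
   have "(LBINT x. u x * indicator (T - A) x + u x * indicator A x) = (LBINT x. u x * indicator T x)"
    by (rule LBINT_cong) (use T(3) in \<open>auto simp: indicator_def\<close>)
   then have "(LBINT x. u x * indicator A x) = - (LBINT x. u x * indicator (T - A) x)"
    using zero[OF T(1,2)] iT iA by (simp add: eq_neg_iff_add_eq_0 add.commute)
   then have "norm (LBINT x. u x * indicator A x) \<le> norm2 u * norm2 (indicator (T - A) :: 'a \<Rightarrow> complex)"
    using sq_integrable_mult(3)[OF u nice_integrable(2)[OF nice_ind[of "T - A" R]]] T(4) by simp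
   also have "norm2 (indicator (T - A) :: 'a \<Rightarrow> complex) \<le> e"
   proof (rule norm2_leI(2))
    have "(NN x. ennreal ((norm (indicator (T - A) x :: complex))^2)) = (NN x. indicator (T - A) x)"
     by (intro nn_integral_cong) (auto simp: indicator_def)
    also have "\<dots> = emeasure lborel (T - A)" by simp
    also have "\<dots> \<le> emeasure lborel (S - A)" by (intro emeasure_mono) (auto simp: T_def)
    finally show "(NN x. ennreal ((norm (indicator (T - A) x :: complex))^2)) \<le> ennreal (e^2)" using S(3) by auto
   qed (use e in auto)
   finally show ?thesis by (simp add: mult_left_mono norm2_def)
  qed
  note le = this
  have "norm (LBINT x. u x * indicator A x) \<le> 0"
  proof (rule field_le_epsilon)
   fix e :: real assume e: "e > 0"
   define n where "n = norm2 u"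
   have n: "n \<ge> 0" by (simp add: n_def norm2_def)
   have "norm (LBINT x. u x * indicator A x) \<le> n * (e / (n + 1))" using le[OF divide_pos_pos[OF e, of "n + 1"]] n by (simp only: n_def)
   also have "\<dots> \<le> e" using mult_left_mono[of n "n + 1" e] e n by (simp add: pos_divide_le_eq mult.commute)
   finally show "norm (LBINT x. u x * indicator A x) \<le> 0 + e" by simp
  qed
  then show ?thesis by simp
 qed
 have neg: "AE x in lborel. Re (c * u x) \<le> 0" for c
 proof -
  have "AE x in lborel. norm x < real R \<longrightarrow> Re (c * u x) \<le> 0" for R :: nat
  proof -
   define A where "A = {x. Re (c * u x) > 0} \<inter> ball 0 (real R)"
   have A[measurable]: "A \<in> sets borel" unfolding A_def by measurable
   have i: "integrable lborel (\<lambda>x. u x * indicator A x)"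
    by (intro sq_integrable_mult(1) u nice_integrable nice_ind[of _ "real R"] A) (auto simp: A_def)
   have "(LBINT x. c * (u x * indicator A x)) = 0"
    using bnd[OF A, of "real R"] by (simp add: A_def)
   then have z: "(LBINT x. Re (c * (u x * indicator A x))) = 0"
    unfolding integral_Re[OF integrable_mult_right[OF i, of c]] by (simp only: zero_complex.sel)
   have "0 \<le> Re (c * (u x * indicator A x))" for x
    by (cases "x \<in> A") (auto simp: A_def simp del: times_complex.sel)
   then have "AE x in lborel. Re (c * (u x * indicator A x)) = 0"
    using integral_nonneg_eq_0_iff_AE[OF integrable_Re[OF integrable_mult_right[OF i, of c]]] z by blast
   then show ?thesis
   proof eventually_elim
    case (elim x)
    then show ?case by (cases "x \<in> A") (auto simp add: A_def not_less simp del: times_complex.sel)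
   qed
  qed
  then have "AE x in lborel. \<forall>R::nat. norm x < real R \<longrightarrow> Re (c * u x) \<le> 0" by (subst AE_all_countable) blast
  then show ?thesis
  proof eventually_elim
   case (elim x)
   obtain R :: nat where "norm x < real R" using reals_Archimedean2 by blast
   then show ?case using elim by blast
  qed
 qed
 show ?thesis using neg[of 1] neg[of "-1"] neg[of \<i>] neg[of "-\<i>"]
  by eventually_elim (simp add: complex_eq_iff)
qed

lemma resolvent_unique:
 fixes u :: "real^'n \<Rightarrow> complex"
 assumes u: "sq_integrable u" and K: "Re K > 0"
  and weak: "\<And>\<phi>. test_function \<phi> \<Longrightarrow> (LBINT x. u x * (laplacian \<phi> x - K^2 * \<phi> x)) = 0"
 shows "AE x in lborel. u x = 0"
proof (rule open_integral_zero_imp_AE_zero[OF u])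
 fix S :: "(real^'n) set" assume S: "open S" "bounded S"
 have h: "(LBINT x. u x * heat (of_real t) (x - y)) = 0" if "0 < t" for t y
  by (rule heat_flow_vanishes[OF u K _ weak]) (use that in auto)
 show "(LBINT x. u x * indicator S x) = 0"
  by (rule orthogonal_imp_open_integral_zero[OF u S heat_flow_zero_imp_orthogonal[OF u _ _ h]])
qed

subsection \<open>The weighted estimate\<close>

text \<open>Within a factor 2 below the root, and with finitely many values on each interval
  [1 / N, N].\<close>

definition dyadic_sqrt :: "real \<Rightarrow> real" where
 "dyadic_sqrt a = (if a \<le> 0 then 0 else 2 powr of_int \<lfloor>log 2 (sqrt a)\<rfloor>)"

lemma dyadic_sqrt_bounds:
 assumes "0 \<le> a"
 shows "0 \<le> dyadic_sqrt a" "dyadic_sqrt a \<le> sqrt a" "sqrt a \<le> 2 * dyadic_sqrt a"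
proof -
 have "dyadic_sqrt a \<le> sqrt a \<and> sqrt a \<le> 2 * dyadic_sqrt a"
 proof (cases "a = 0")
  case False
  define L where "L = log 2 (sqrt a)"
  have e: "sqrt a = 2 powr L" using False assms by (simp add: L_def)
  have "(2::real) powr L \<le> 2 powr (of_int \<lfloor>L\<rfloor> + 1)" by (rule powr_mono) linarith+
  then have "2 powr L \<le> 2 * 2 powr of_int \<lfloor>L\<rfloor>" by (simp add: powr_add)
  moreover have "(2::real) powr of_int \<lfloor>L\<rfloor> \<le> 2 powr L" by (rule powr_mono) auto
  ultimately show ?thesis using False assms unfolding dyadic_sqrt_def L_def[symmetric] e by simp
 qed (simp add: dyadic_sqrt_def)
 then show "dyadic_sqrt a \<le> sqrt a" "sqrt a \<le> 2 * dyadic_sqrt a" by auto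
qed (simp add: dyadic_sqrt_def)

lemma dyadic_sqrt_measurable [measurable]: "dyadic_sqrt \<in> borel_measurable borel"
 unfolding dyadic_sqrt_def by measurable

lemma dyadic_sqrt_finite_range:
 assumes "0 < N"
 shows "\<exists>A. finite A \<and> (\<forall>a\<in>A. 0 < a) \<and> (\<forall>a. 1 / N \<le> a \<longrightarrow> a \<le> N \<longrightarrow> dyadic_sqrt a \<in> A)"
proof (intro exI conjI)
 define A where "A = (\<lambda>j. 2 powr real_of_int j) ` {\<lfloor>log 2 (sqrt (1 / N))\<rfloor>..\<lfloor>log 2 (sqrt N)\<rfloor>}"
 show "finite A" "\<forall>a\<in>A. 0 < a" by (auto simp: A_def)
 show "\<forall>a. 1 / N \<le> a \<longrightarrow> a \<le> N \<longrightarrow> dyadic_sqrt a \<in> A"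
 proof (intro allI impI)
  fix a assume a: "1 / N \<le> a" "a \<le> N"
  have a0: "0 < a" using assms a(1) by (auto intro: less_le_trans[of _ "1 / N"])
  have "\<lfloor>log 2 (sqrt (1 / N))\<rfloor> \<le> \<lfloor>log 2 (sqrt a)\<rfloor>" by (intro floor_mono) (use assms a0 a in \<open>simp del: real_sqrt_divide\<close>)
  moreover have "\<lfloor>log 2 (sqrt a)\<rfloor> \<le> \<lfloor>log 2 (sqrt N)\<rfloor>" by (intro floor_mono) (use assms a0 a in simp)
  ultimately show "dyadic_sqrt a \<in> A" using a0 by (simp add: dyadic_sqrt_def A_def)
 qed
qed

text \<open>The 4 is a rounding factor 2 for each of the two functions, (2 pi)^n is the
  normalisation in \<open>resolvent_kernel_pairing\<close>, and the rest is Stein's bound with the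
  constant of \<open>kerman_sawyer_bound\<close>, from which the power D^(1 / b) is split
  off.\<close>

definition resolvent_const :: "'n::finite itself \<Rightarrow> real" where
 "resolvent_const T = (let b = (real CARD('n) - 1) / 2 in
  4 * (stein_const0 T powr (1 - 1 / b) * (stein_const1 T * (32 * real (neighbour_count T) * real CARD('n))) powr (1 / b))
   / (2 * pi) ^ CARD('n))"

lemma resolvent_const_nonneg: "0 \<le> resolvent_const T"
 by (simp add: resolvent_const_def Let_def)

lemma neighbour_count_pos: "0 < neighbour_count TYPE('n::finite)"
proof -
 have "{m :: int^'n. \<forall>i. \<bar>m $ i\<bar> \<le> 1} \<subseteq> (\<lambda>f. \<chi> i. f i) ` (UNIV \<rightarrow>\<^sub>E {-1..1})"
 proof
  fix m :: "int^'n" assume "m \<in> {m. \<forall>i. \<bar>m $ i\<bar> \<le> 1}"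
  then have "($) m \<in> UNIV \<rightarrow>\<^sub>E {-1..1}" by (auto simp: abs_le_iff minus_le_iff)
  then show "m \<in> (\<lambda>f. \<chi> i. f i) ` (UNIV \<rightarrow>\<^sub>E {-1..1})" by (intro image_eqI[of _ _ "($) m"]) auto
 qed
 then have "finite {m :: int^'n. \<forall>i. \<bar>m $ i\<bar> \<le> 1}" by (rule finite_subset) (intro finite_imageI finite_PiE; simp)
 then show ?thesis unfolding neighbour_count_def by (subst card_gt_0_iff) (auto intro!: exI[of _ 0])
qed

text \<open>\<open>a\<close> stands for a Borel version of |V| and \<open>D\<close> for any number
  above the Kerman--Sawyer norm; it has to be positive even when that norm is 0.\<close>

locale kerman_sawyer_weight =
 fixes a :: "real^'n::finite \<Rightarrow> real" and b D :: real
 assumes meas [measurable]: "a \<in> borel_measurable borel" and nonneg: "\<And>x. 0 \<le> a x"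
  and b: "b = (real CARD('n) - 1) / 2" and dim: "CARD('n) \<ge> 3" and D: "0 < D"
  and fin: "\<And>k m. (\<integral>\<^sup>+x\<in>dyadic_cube k m. ennreal (a x powr b) \<partial>lborel) < \<infinity>"
  and test: "\<And>k m. (\<integral>\<^sup>+x\<in>dyadic_cube k m. (\<integral>\<^sup>+y\<in>dyadic_cube k m. ennreal (a x powr b * a y powr b) / ennreal (dist x y) \<partial>lborel) \<partial>lborel)
    \<le> ennreal D * (\<integral>\<^sup>+x\<in>dyadic_cube k m. ennreal (a x powr b) \<partial>lborel)"
begin

lemma b_ge_1: "1 \<le> b" using dim unfolding b by simp

text \<open>Stein interpolation bounds the form with symbol of power - 1, and
  \<open>resolvent_kernel_pairing\<close> identifies that form with the one of the resolvent kernel.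
  The bounds by \<open>N\<close> make the rounded root finitely valued on the supports.\<close>

lemma bilinear_bound_normalised:
 fixes f g :: "real^'n \<Rightarrow> complex"
 assumes K: "Re K > 0" and f: "nice f" "norm2 f \<le> 1" and g: "nice g" "norm2 g \<le> 1"
  and N: "0 < N" "\<And>x. f x \<noteq> 0 \<or> g x \<noteq> 0 \<Longrightarrow> 1 / N \<le> a x \<and> a x \<le> N"
 shows "norm (LBINT w. resolvent_kernel K w * corr (\<lambda>x. of_real (dyadic_sqrt (a x)) * f x) (\<lambda>x. of_real (dyadic_sqrt (a x)) * g x) w)
  \<le> resolvent_const TYPE('n) / 4 * D powr (1 / b)"
proof -
 define v where "v = (\<lambda>x. dyadic_sqrt (a x))"
 define E where "E = 32 * real (neighbour_count TYPE('n)) * real CARD('n) * D"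
 define C where "C = corr (\<lambda>x. of_real (v x) * f x) (\<lambda>x. of_real (v x) * g x)"
 define s where "s = stein_const0 TYPE('n) powr (1 - 1 / b) * (stein_const1 TYPE('n) * E) powr (1 / b)"
 have v[measurable]: "v \<in> borel_measurable borel" unfolding v_def by measurable
 obtain A where A: "finite A" "\<And>t. t \<in> A \<Longrightarrow> 0 < t" "\<And>t. 1 / N \<le> t \<Longrightarrow> t \<le> N \<Longrightarrow> dyadic_sqrt t \<in> A"
  using dyadic_sqrt_finite_range[OF N(1)] by blast
 have fA: "f x \<noteq> 0 \<Longrightarrow> v x \<in> A" and gA: "g x \<noteq> 0 \<Longrightarrow> v x \<in> A" for x
  unfolding v_def using A(3) N(2) by auto
 have E0: "E > 0" unfolding E_def using D neighbour_count_pos[where 'n='n] by simp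
 \<comment> \<open>Rounding down only decreases the weight: \<open>v x powr b\<close> is at most
   \<open>sqrt (a x powr b)\<close>, so the bound for the true weight is inherited.\<close>
 have KS: "(NN x. (NN y. ennreal ((h x * v x powr b) * (h y * v y powr b) / dist x y)))
    \<le> ennreal E * (NN x. ennreal ((h x)^2))"
  if h: "h \<in> borel_measurable borel" "\<And>x. 0 \<le> h x" "(NN x. ennreal ((h x)^2)) < \<infinity>" for h :: "real^'n \<Rightarrow> real"
 proof -
  have le: "h x * v x powr b \<le> h x * sqrt (a x powr b)" for x
  proof (rule mult_left_mono)
   have "v x powr b \<le> sqrt (a x) powr b" unfolding v_def using dyadic_sqrt_bounds[OF nonneg] b_ge_1 by (intro powr_mono2) auto
   also have "\<dots> = sqrt (a x powr b)" using nonneg by (simp add: powr_half_sqrt[symmetric] powr_powr mult.commute)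
   finally show "v x powr b \<le> sqrt (a x powr b)" .
  qed (use h in simp)
  have "(NN x. (NN y. ennreal ((h x * v x powr b) * (h y * v y powr b) / dist x y)))
   \<le> (NN x. (NN y. ennreal ((h x * sqrt (a x powr b)) * (h y * sqrt (a y powr b)) / dist x y)))"
   by (intro nn_integral_mono ennreal_leI divide_right_mono mult_mono le) (use h in auto)
  also have "\<dots> \<le> ennreal E * (NN x. ennreal ((h x)^2))"
   unfolding E_def by (rule kerman_sawyer_bound[OF _ _ fin test D h]) auto
  finally show ?thesis .
 qed
 have "norm (LBINT p. power_symbol K 1 ((norm p)^2) * fourier C p) \<le> s"
  unfolding s_def C_def b by (rule stein_interpolation[OF dim K f g v A(1,2) fA gA E0 KS[unfolded b]])
 moreover have "\<exists>B. \<forall>a\<in>A. a \<le> B" using A(1) by (meson Max_ge)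
 then obtain B where B: "\<And>a. a \<in> A \<Longrightarrow> a \<le> B" by blast
 have nb: "nice (\<lambda>x. of_real (v x) * h x)" if "nice h" "\<And>x. h x \<noteq> 0 \<Longrightarrow> v x \<in> A" for h :: "real^'n \<Rightarrow> complex"
  by (rule nice_bounded_mult[OF that(1), of _ B]) (use B A(2) that(2) in \<open>force+\<close>)
 note nf = nb[OF f(1) fA] and ng = nb[OF g(1) gA]
 have "of_real ((2 * pi) ^ CARD('n)) * (LBINT w. resolvent_kernel K w * C w) = (LBINT p. power_symbol K 1 ((norm p)^2) * fourier C p)"
  unfolding C_def
  by (rule resolvent_kernel_pairing[OF K integrable_corr(1) norm_corr_le fourier_corr_integrable(1)]; intro nice_integrable nf ng)
 moreover have "norm (of_real ((2 * pi) ^ CARD('n)) * z) = (2 * pi) ^ CARD('n) * norm z" for z :: complex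
  unfolding norm_mult norm_of_real by simp
 ultimately have "(2 * pi) ^ CARD('n) * norm (LBINT w. resolvent_kernel K w * C w) \<le> s"
  by metis
 then have "norm (LBINT w. resolvent_kernel K w * C w) \<le> s / (2 * pi) ^ CARD('n)"
  by (simp add: pos_le_divide_eq mult.commute)
 also have "s = stein_const0 TYPE('n) powr (1 - 1 / b) * ((stein_const1 TYPE('n) * (32 * real (neighbour_count TYPE('n)) * real CARD('n))) powr (1 / b) * D powr (1 / b))"
 proof -
  define k where "k = stein_const1 TYPE('n) * (32 * real (neighbour_count TYPE('n)) * real CARD('n))"
  have "stein_const1 TYPE('n) * E = k * D" by (simp add: E_def k_def)
  moreover have "0 \<le> k" using dim by (simp add: k_def stein_const1_def)
  ultimately show ?thesis unfolding s_def k_def[symmetric] using D by (simp add: powr_mult)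
 qed
 also have "\<dots> / (2 * pi) ^ CARD('n) = resolvent_const TYPE('n) / 4 * D powr (1 / b)"
  unfolding resolvent_const_def Let_def b[symmetric] by simp
 finally show ?thesis unfolding C_def v_def .
qed

text \<open>Dividing \<open>F\<close> and \<open>G\<close> by the rounded root \<open>v\<close>
  reduces to the normalised bound; \<open>J\<close> bounds the L2 norms of the quotients, its factor
  2 undoing the rounding.\<close>

lemma bilinear_bound:
 fixes F G :: "real^'n \<Rightarrow> complex"
 assumes k: "Re k > 0" and F: "nice F" and G: "nice G"
  and N: "0 < N" "\<And>x. F x \<noteq> 0 \<or> G x \<noteq> 0 \<Longrightarrow> 1 / N \<le> a x \<and> a x \<le> N"
 shows "norm (LBINT w. resolvent_kernel k w * corr F G w)
  \<le> resolvent_const TYPE('n) * D powr (1 / b) *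
   (sqrt (LBINT x. (norm (F x))^2 / a x) * sqrt (LBINT x. (norm (G x))^2 / a x))"
proof -
 define K where "K = resolvent_const TYPE('n) / 4 * D powr (1 / b)"
 define J where "J H = 2 * sqrt (LBINT x. (norm (H x))^2 / a x)" for H :: "real^'n \<Rightarrow> complex"
 define v where "v = (\<lambda>x. dyadic_sqrt (a x))"
 define q where "q H = (\<lambda>x. of_real (1 / v x) * H x)" for H :: "real^'n \<Rightarrow> complex"
 have v[measurable]: "v \<in> borel_measurable borel" unfolding v_def by measurable
 have vb: "v x > 0 \<and> 1 / v x \<le> 2 * sqrt N \<and> (1 / v x)^2 \<le> 4 / a x" if "1 / N \<le> a x" for x
 proof -
  have a0: "0 < a x" using N(1) that by (auto intro: less_le_trans[of _ "1 / N"])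
  have s: "sqrt (a x) \<le> 2 * v x" unfolding v_def by (rule dyadic_sqrt_bounds(3)[OF nonneg])
  have sp: "0 < sqrt (a x)" using a0 by simp
  have v0: "v x > 0" using s sp by linarith
  have l: "1 / v x \<le> 2 / sqrt (a x)" using divide_left_mono[OF s, of 2] v0 sp by simp
  have "2 / sqrt (a x) \<le> 2 / sqrt (1 / N)" using that a0 N(1) by (intro divide_left_mono mult_pos_pos) (simp_all del: real_sqrt_divide)
  also have "\<dots> = 2 * sqrt N" by (simp add: real_sqrt_divide)
  finally have "1 / v x \<le> 2 * sqrt N" using l by linarith
  moreover have "(1 / v x)^2 \<le> (2 / sqrt (a x))^2" using l v0 by (intro power_mono) auto
  then have "(1 / v x)^2 \<le> 4 / a x" using a0 by (simp add: power_divide)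
  ultimately show ?thesis using v0 by blast
 qed
 have Q: "nice (q H) \<and> norm2 (q H) \<le> J H \<and> (\<lambda>x. of_real (v x) * q H x) = H" if H: "nice H" "\<And>x. H x \<noteq> 0 \<Longrightarrow> 1 / N \<le> a x" for H
 proof (intro conjI ext)
  have [measurable]: "H \<in> borel_measurable borel" using H(1) by (rule nice_measurable)
  show "nice (q H)" unfolding q_def
  proof (rule nice_bounded_mult[OF H(1)])
   show "norm (complex_of_real (1 / v x)) \<le> 2 * sqrt N" if "H x \<noteq> 0" for x using vb[OF H(2)[OF that]] by (simp add: norm_divide)
  qed simp
  have le: "(norm (q H x))^2 \<le> 4 * ((norm (H x))^2 / a x)" for x
  proof (cases "H x = 0")
   case False
   have "(norm (q H x))^2 = (1 / v x)^2 * (norm (H x))^2" by (simp add: q_def norm_mult norm_divide power_mult_distrib power_divide)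
   also have "\<dots> \<le> 4 / a x * (norm (H x))^2" using vb[OF H(2)[OF False]] by (intro mult_right_mono) auto
   finally show ?thesis by simp
  qed (simp add: q_def)
  have i: "integrable lborel (\<lambda>x. (norm (H x))^2 / a x)"
  proof (rule Bochner_Integration.integrable_bound)
   show "integrable lborel (\<lambda>x. N * (norm (H x))^2)" using nice_integrable(2)[OF H(1)] by (auto simp: sq_integrable_def)
   have "(norm (H x))^2 / a x \<le> N * (norm (H x))^2" for x
   proof (cases "H x = 0")
    case False
    then have "1 / N \<le> a x" by (rule H(2))
    then have "1 / a x \<le> N" using N(1) nonneg[of x] by (cases "a x = 0") (auto simp: field_simps)
    then have "1 / a x * (norm (H x))^2 \<le> N * (norm (H x))^2" by (rule mult_right_mono) simp
    then show ?thesis by simp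
   qed simp
   then show "AE x in lborel. norm ((norm (H x))^2 / a x) \<le> norm (N * (norm (H x))^2)" using nonneg N(1) by (auto intro!: AE_I2)
  qed simp
  have "(norm2 (q H))^2 \<le> (LBINT x. 4 * ((norm (H x))^2 / a x))"
   unfolding norm2_sq using nice_integrable(2)[OF \<open>nice (q H)\<close>] by (intro integral_mono le integrable_mult_right i) (simp add: sq_integrable_def)
  then have "(norm2 (q H))^2 \<le> 4 * (LBINT x. (norm (H x))^2 / a x)" unfolding integral_mult_right_zero .
  then have "norm2 (q H) \<le> sqrt (4 * (LBINT x. (norm (H x))^2 / a x))" by (rule real_le_rsqrt)
  then show "norm2 (q H) \<le> J H" unfolding J_def real_sqrt_mult by simp
  show "of_real (v x) * q H x = H x" for x
   using vb[OF H(2), of x] by (cases "H x = 0") (auto simp: q_def)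
 qed
 note QF = Q[OF F] and QG = Q[OF G]
 have F1: "1 / N \<le> a x" if "F x \<noteq> 0" for x using N(2)[of x] that by blast
 have G1: "1 / N \<le> a x" if "G x \<noteq> 0" for x using N(2)[of x] that by blast
 have J0: "0 \<le> J H" for H unfolding J_def using nonneg by (intro mult_nonneg_nonneg real_sqrt_ge_zero integral_nonneg_AE AE_I2) auto
 \<comment> \<open>The norms may vanish, so the division is by \<open>J F + e\<close> and
   \<open>J G + e\<close>, and \<open>e\<close> tends to 0 at the end.\<close>
 have main: "norm (LBINT w. resolvent_kernel k w * corr F G w) \<le> K * ((J F + e) * (J G + e))" if e: "e > 0" for e
 proof -
  define s t where "s = J F + e" and "t = J G + e"
  have st: "s > 0" "t > 0" using J0[of F] J0[of G] e by (auto simp: s_def t_def)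
  have sc: "nice (\<lambda>x. of_real (1 / r) * h x) \<and> norm2 (\<lambda>x. of_real (1 / r) * h x) \<le> 1"
   if "nice h" "norm2 h \<le> r" "r > 0" for r and h :: "real^'n \<Rightarrow> complex"
  proof
   show "nice (\<lambda>x. of_real (1 / r) * h x)" by (rule nice_bounded_mult[OF that(1), of _ "norm (complex_of_real (1 / r))"]) auto
   show "norm2 (\<lambda>x. of_real (1 / r) * h x) \<le> 1"
    using that unfolding sq_integrable_cmult(2) by (simp add: norm_divide)
  qed
  have f: "nice (\<lambda>x. of_real (1 / s) * q F x)" "norm2 (\<lambda>x. of_real (1 / s) * q F x) \<le> 1"
   using sc[of "q F" s] QF[OF F1] st e by (auto simp: s_def)
  have g: "nice (\<lambda>x. of_real (1 / t) * q G x)" "norm2 (\<lambda>x. of_real (1 / t) * q G x) \<le> 1"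
   using sc[of "q G" t] QG[OF G1] st e by (auto simp: t_def)
  have eF: "of_real (dyadic_sqrt (a x)) * (of_real (1 / s) * q F x) = of_real (1 / s) * F x" for x
   using fun_cong[OF conjunct2[OF conjunct2[OF QF[OF F1]]], of x] by (simp add: v_def)
  have eG: "of_real (dyadic_sqrt (a x)) * (of_real (1 / t) * q G x) = of_real (1 / t) * G x" for x
   using fun_cong[OF conjunct2[OF conjunct2[OF QG[OF G1]]], of x] by (simp add: v_def)
  have c: "corr (\<lambda>x. of_real (1 / s) * F x) (\<lambda>x. of_real (1 / t) * G x) w = of_real (1 / (s * t)) * corr F G w" for w
   unfolding corr_def integral_mult_right_zero[symmetric] by (intro LBINT_cong refl) simp
  have "norm (LBINT w. resolvent_kernel k w * corr (\<lambda>x. of_real (dyadic_sqrt (a x)) * (of_real (1 / s) * q F x)) (\<lambda>x. of_real (dyadic_sqrt (a x)) * (of_real (1 / t) * q G x)) w) \<le> K"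
   unfolding K_def by (rule bilinear_bound_normalised[OF k f g N(1)]) (use N(2) in \<open>auto simp: q_def\<close>)
  then have "norm (LBINT w. of_real (1 / (s * t)) * (resolvent_kernel k w * corr F G w)) \<le> K"
   unfolding eF eG c by (simp add: mult.left_commute)
  then have "1 / (s * t) * norm (LBINT w. resolvent_kernel k w * corr F G w) \<le> K"
   unfolding integral_mult_right_zero norm_mult using st by (simp add: norm_divide norm_mult)
  then show ?thesis using st unfolding s_def[symmetric] t_def[symmetric] by (simp add: pos_divide_le_eq mult_ac)
 qed
 have "\<forall>\<^sub>F e in at_right 0. norm (LBINT w. resolvent_kernel k w * corr F G w) \<le> K * ((J F + e) * (J G + e))"
  using main by (auto simp: eventually_at_right_less eventually_at_filter)
 moreover have "((\<lambda>e. K * ((J F + e) * (J G + e))) \<longlongrightarrow> K * ((J F + 0) * (J G + 0))) (at_right 0)"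
  by (intro tendsto_intros)
 ultimately have "norm (LBINT w. resolvent_kernel k w * corr F G w) \<le> K * ((J F + 0) * (J G + 0))"
  by (intro tendsto_lowerbound) auto
 then show ?thesis by (simp add: K_def J_def mult_ac)
qed

text \<open>On this set everything is bounded and the weight lies in [1 / N, N] with N = k + 1, as
  \<open>bilinear_bound\<close> demands; a point with \<open>a x > 0\<close> belongs to it for all
  large \<open>k\<close>.\<close>

definition good :: "(real^'n \<Rightarrow> complex) \<Rightarrow> nat \<Rightarrow> real^'n \<Rightarrow> bool" where
 "good h k x \<longleftrightarrow> norm x \<le> real (Suc k) \<and> 1 / real (Suc k) \<le> a x \<and> a x \<le> real (Suc k) \<and> norm (h x) \<le> real (Suc k)"

lemma good_measurable [measurable]: "h \<in> borel_measurable borel \<Longrightarrow> Measurable.pred borel (good h k)"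
 unfolding good_def by measurable

lemma eventually_good:
 assumes "0 < a x"
 shows "\<forall>\<^sub>F k in sequentially. good h k x"
proof -
 obtain m :: nat where m: "max (max (norm x) (1 / a x)) (max (a x) (norm (h x))) \<le> real m" using real_arch_simple by blast
 have "good h k x" if "k \<ge> m" for k
 proof -
  have k: "real m \<le> real (Suc k)" using that by simp
  have "1 / a x \<le> real (Suc k)" using m k by linarith
  then have "1 / real (Suc k) \<le> a x" using assms by (simp add: divide_le_eq mult.commute)
  then show ?thesis unfolding good_def using m k by auto
 qed
 then show ?thesis by (auto simp: eventually_sequentially)
qed

lemma nice_good:
 assumes [measurable]: "h \<in> borel_measurable borel" "H \<in> borel_measurable borel" and B: "\<And>x. good h k x \<Longrightarrow> norm (H x) \<le> B"
 shows "nice (\<lambda>x. if good h k x then H x else 0)"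
 unfolding nice_def
proof (intro conjI exI allI impI)
 show "norm (if good h k x then H x else 0) \<le> max B 0" for x using B[of x] by auto
 show "(if good h k x then H x else 0) = 0" if "norm x > real (Suc k)" for x using that by (simp add: good_def)
qed measurable

lemma integral_div_weight_le:
 fixes F :: "real^'n \<Rightarrow> complex"
 assumes F[measurable]: "F \<in> borel_measurable borel"
  and I: "(NN x. ennreal ((norm (F x))^2) * inverse (ennreal (a x))) = ennreal I" "0 \<le> I"
 shows "(LBINT x. (norm (if good F k x then F x else 0))^2 / a x) \<le> I"
proof (rule integral_real_bounded)
 have "ennreal ((norm (if good F k x then F x else 0))^2 / a x) \<le> ennreal ((norm (F x))^2) * inverse (ennreal (a x))" for x
 proof (cases "good F k x")
  case True
  then have "0 < a x" by (auto simp: good_def intro: less_le_trans[of _ "1 / real (Suc k)"])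
  then show ?thesis using True by (simp add: divide_inverse ennreal_mult inverse_ennreal)
 qed simp
 then show "(NN x. ennreal ((norm (if good F k x then F x else 0))^2 / a x)) \<le> ennreal I"
  unfolding I(1)[symmetric] by (rule nn_integral_mono)
qed (rule I)

text \<open>Where \<open>a x = 0\<close> no truncation reaches the point, but there the inverse
  weight is infinite, so finiteness of the integral forces \<open>F x = 0\<close> almost
  everywhere.\<close>

lemma good_truncation_tendsto:
 fixes F :: "real^'n \<Rightarrow> complex"
 assumes F: "sq_integrable F"
  and I: "(NN x. ennreal ((norm (F x))^2) * inverse (ennreal (a x))) < \<infinity>"
 shows "(\<lambda>k. norm2 (\<lambda>x. F x - (if good F k x then F x else 0))) \<longlonglongrightarrow> 0"
proof -
 have [measurable]: "F \<in> borel_measurable borel" and i: "integrable lborel (\<lambda>x. (norm (F x))^2)" using F by (auto simp: sq_integrable_def)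
 have "AE x in lborel. ennreal ((norm (F x))^2) * inverse (ennreal (a x)) \<noteq> \<infinity>"
  using I by (intro nn_integral_noteq_infinite) auto
 then have ae: "AE x in lborel. (\<lambda>k. (norm (F x - (if good F k x then F x else 0)))^2) \<longlonglongrightarrow> 0"
 proof eventually_elim
  case (elim x)
  show ?case
  proof (cases "a x = 0")
   case True
   then have "F x = 0" using elim by (auto simp: ennreal_mult_eq_top_iff)
   then show ?thesis by (simp cong: if_cong)
  next
   case False
   then have "0 < a x" using nonneg[of x] by simp
   show ?thesis
    by (rule tendsto_eventually, rule eventually_mono[OF eventually_good[OF \<open>0 < a x\<close>, of F]]) simp
  qed
 qed
 have "(\<lambda>k. \<integral>x. (norm (F x - (if good F k x then F x else 0)))^2 \<partial>lborel) \<longlonglongrightarrow> (\<integral>x. 0 \<partial>(lborel :: (real^'n) measure))"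
  by (rule integral_dominated_convergence[OF _ _ i ae]) auto
 then have "(\<lambda>k. sqrt (LBINT x. (norm (F x - (if good F k x then F x else 0)))^2)) \<longlonglongrightarrow> sqrt 0"
  by (intro tendsto_real_sqrt) simp
 then show ?thesis by (simp add: norm2_def)
qed

text \<open>\<open>F\<close> is replaced by its truncations. The error is measured by the L1 norm of
  the resolvent kernel, which is not uniform in \<open>K\<close>, but it disappears in the limit and
  leaves the uniform constant.\<close>

lemma pairing_bound:
 fixes F G :: "real^'n \<Rightarrow> complex"
 assumes K: "Re K > 0" and F: "sq_integrable F" and G: "nice G"
  and N: "0 < N" "\<And>x. G x \<noteq> 0 \<Longrightarrow> 1 / N \<le> a x \<and> a x \<le> N"
  and I: "(NN x. ennreal ((norm (F x))^2) * inverse (ennreal (a x))) = ennreal I" "0 \<le> I"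
 shows "norm (LBINT x. conv (resolvent_kernel K) F x * G x)
  \<le> resolvent_const TYPE('n) * D powr (1 / b) * (sqrt I * sqrt (LBINT x. (norm (G x))^2 / a x))"
proof -
 define c where "c = resolvent_const TYPE('n) * D powr (1 / b)"
 define J where "J = sqrt (LBINT x. (norm (G x))^2 / a x)"
 define R where "R = (resolvent_kernel K :: real^'n \<Rightarrow> complex)"
 define Fk where "Fk k = (\<lambda>x. if good F k x then F x else 0)" for k
 have Fm[measurable]: "F \<in> borel_measurable borel" and Gm[measurable]: "G \<in> borel_measurable borel"
  using F nice_measurable[OF G] by (auto simp: sq_integrable_def)
 have R: "integrable lborel R" unfolding R_def by (rule resolvent_kernel_integrable[OF K])
 have nF: "nice (Fk k)" for k unfolding Fk_def by (rule nice_good[of _ _ _ "real (Suc k)"]) (auto simp: good_def)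
 note sG = nice_integrable(2)[OF G]
 note sF = nice_integrable(2)[OF nF]
 have c0: "0 \<le> c" by (simp add: c_def resolvent_const_nonneg)
 have J0: "0 \<le> J" unfolding J_def using nonneg by (intro real_sqrt_ge_zero integral_nonneg_AE AE_I2) auto
 have cm: "corr H G \<in> borel_measurable borel" if [measurable]: "H \<in> borel_measurable borel" for H unfolding corr_def by measurable
 have le: "norm (LBINT x. conv R F x * G x) \<le> c * (sqrt I * J) + (LBINT x. norm (R x)) * (norm2 (\<lambda>x. F x - Fk k x) * norm2 G)" for k
 proof -
  have sD: "sq_integrable (\<lambda>x. F x - Fk k x)" by (rule sq_integrable_diff[OF F sF])
  have i1: "integrable lborel (\<lambda>w. R w * corr (Fk k) G w)"
   by (rule integrable_L1_bounded(1)[OF R cm norm_corr_le[OF sF sG]]) (rule nice_measurable[OF nF])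
  have i2: "integrable lborel (\<lambda>w. R w * corr (\<lambda>x. F x - Fk k x) G w)"
   by (rule integrable_L1_bounded(1)[OF R cm norm_corr_le[OF sD sG]]) (use sD in \<open>simp add: sq_integrable_def\<close>)
  have "(LBINT x. conv R F x * G x) = (LBINT w. R w * corr F G w)" by (rule conv_pairing[OF R F sG])
  also have "\<dots> = (LBINT w. R w * corr (Fk k) G w + R w * corr (\<lambda>x. F x - Fk k x) G w)"
   unfolding corr_diff_left[OF F sF sG] by (intro LBINT_cong refl) (simp add: algebra_simps)
  also have "\<dots> = (LBINT w. R w * corr (Fk k) G w) + (LBINT w. R w * corr (\<lambda>x. F x - Fk k x) G w)"
   using i1 i2 by (rule Bochner_Integration.integral_add)
  also have "norm \<dots> \<le> c * (sqrt I * J) + (LBINT x. norm (R x)) * (norm2 (\<lambda>x. F x - Fk k x) * norm2 G)"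
  proof (rule norm_triangle_mono)
   define M where "M = max (real (Suc k)) N"
   have M: "M > 0" "1 / M \<le> 1 / real (Suc k)" "1 / M \<le> 1 / N" "real (Suc k) \<le> M" "N \<le> M"
    using N(1) by (auto simp: M_def intro!: divide_left_mono)
   have "1 / M \<le> a x \<and> a x \<le> M" if "Fk k x \<noteq> 0 \<or> G x \<noteq> 0" for x
    using that
   proof
    assume "Fk k x \<noteq> 0"
    then show ?thesis using M by (auto simp: Fk_def good_def split: if_splits)
   next
    assume "G x \<noteq> 0"
    then show ?thesis using M N(2)[of x] by linarith
   qed
   then have "norm (LBINT w. R w * corr (Fk k) G w) \<le> c * (sqrt (LBINT x. (norm (Fk k x))^2 / a x) * J)"
    unfolding R_def c_def J_def by (intro bilinear_bound[OF K nF G M(1)])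
   also have "\<dots> \<le> c * (sqrt I * J)"
    unfolding Fk_def using integral_div_weight_le[OF Fm I, of k] c0 J0 by (intro mult_left_mono mult_right_mono) auto
   finally show "norm (LBINT w. R w * corr (Fk k) G w) \<le> c * (sqrt I * J)" .
   show "norm (LBINT w. R w * corr (\<lambda>x. F x - Fk k x) G w) \<le> (LBINT x. norm (R x)) * (norm2 (\<lambda>x. F x - Fk k x) * norm2 G)"
    by (rule integrable_L1_bounded(2)[OF R cm norm_corr_le[OF sD sG]]) (use sD in \<open>simp add: sq_integrable_def\<close>)
  qed
  finally show ?thesis .
 qed
 have "(\<lambda>k. norm2 (\<lambda>x. F x - Fk k x)) \<longlonglongrightarrow> 0" unfolding Fk_def by (rule good_truncation_tendsto[OF F]) (simp add: I)
 then have "(\<lambda>k. c * (sqrt I * J) + (LBINT x. norm (R x)) * (norm2 (\<lambda>x. F x - Fk k x) * norm2 G))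
  \<longlonglongrightarrow> c * (sqrt I * J) + (LBINT x. norm (R x)) * (0 * norm2 G)"
  by (intro tendsto_intros)
 then have "norm (LBINT x. conv R F x * G x) \<le> c * (sqrt I * J) + (LBINT x. norm (R x)) * (0 * norm2 G)"
  by (rule tendsto_lowerbound) (use le in auto)
 then show ?thesis by (simp add: R_def c_def J_def)
qed

text \<open>Duality: testing with \<open>a\<close> times the conjugate of \<open>u\<close> on a
  truncation gives J \<le> c sqrt I sqrt J for the truncated integral J. The truncation makes J
  finite, so sqrt J can be divided out; Fatou then removes the truncation.\<close>

lemma weighted_bound:
 fixes F :: "real^'n \<Rightarrow> complex"
 assumes K: "Re K > 0" and F: "sq_integrable F"
  and fin: "(NN x. ennreal ((norm (F x))^2) * inverse (ennreal (a x))) < \<infinity>"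
 shows "(NN x. ennreal ((norm (conv (resolvent_kernel K) F x))^2) * ennreal (a x))
  \<le> ennreal ((resolvent_const TYPE('n) * D powr (1 / b))^2) * (NN x. ennreal ((norm (F x))^2) * inverse (ennreal (a x)))"
proof -
 define c where "c = resolvent_const TYPE('n) * D powr (1 / b)"
 define u where "u = conv (resolvent_kernel K) F"
 obtain I where I: "(NN x. ennreal ((norm (F x))^2) * inverse (ennreal (a x))) = ennreal I" "0 \<le> I"
  using fin by (cases "\<integral>\<^sup>+x. ennreal ((norm (F x))^2) * inverse (ennreal (a x)) \<partial>lborel") auto
 have su: "sq_integrable u" unfolding u_def by (rule conv_sq_integrable(1)[OF resolvent_kernel_integrable[OF K] F])
 then have [measurable]: "u \<in> borel_measurable borel" by (simp add: sq_integrable_def)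
 have c0: "0 \<le> c" by (simp add: c_def resolvent_const_nonneg)
 define e where "e k x = (if good u k x then a x * (norm (u x))^2 else 0)" for k x
 have e0: "0 \<le> e k x" for k x by (simp add: e_def nonneg)
 have bound: "(NN x. ennreal (e k x)) \<le> ennreal (c^2 * I)" for k
 proof -
  define G where "G x = (if good u k x then of_real (a x) * cnj (u x) else 0)" for x
  define J where "J = (LBINT x. e k x)"
  have G: "nice G" unfolding G_def
  proof (rule nice_good)
   show "norm (of_real (a x) * cnj (u x)) \<le> real (Suc k) * real (Suc k)" if "good u k x" for x
    using that nonneg[of x] unfolding norm_mult good_def by (intro mult_mono) auto
  qed measurable
  have uG: "u x * G x = of_real (e k x)" for x using complex_norm_square[of "u x"] by (simp add: G_def e_def)
  have Ga: "(norm (G x))^2 / a x = e k x" for x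
  proof (cases "good u k x")
   case True
   then have "0 < a x" by (auto simp: good_def intro: less_le_trans[of _ "1 / real (Suc k)"])
   then show ?thesis using True by (simp add: G_def e_def norm_mult power_mult_distrib power2_eq_square)
  qed (simp add: G_def e_def)
  have "norm (LBINT x. u x * G x) \<le> c * (sqrt I * sqrt (LBINT x. (norm (G x))^2 / a x))"
   unfolding u_def c_def by (rule pairing_bound[OF K F G, of "real (Suc k)"]) (auto simp: G_def good_def I split: if_splits)
  then have le: "\<bar>J\<bar> \<le> c * (sqrt I * sqrt J)" unfolding uG Ga J_def by simp
  have i: "integrable lborel (e k)"
   using integrable_norm[OF sq_integrable_mult(1)[OF su nice_integrable(2)[OF G]]] e0 by (simp add: uG)
  have J0: "0 \<le> J" unfolding J_def using e0 by (intro integral_nonneg_AE AE_I2) auto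
  have "J \<le> c^2 * I"
  proof (cases "J = 0")
   case False
   then have "sqrt J > 0" using J0 by simp
   moreover have "sqrt J * sqrt J \<le> (c * sqrt I) * sqrt J" using le J0 by (simp add: mult_ac)
   ultimately have "sqrt J \<le> c * sqrt I" by (rule mult_right_le_imp_le[rotated])
   then have "(sqrt J)^2 \<le> (c * sqrt I)^2" using J0 by (intro power_mono) auto
   then show ?thesis using J0 I(2) by (simp add: power_mult_distrib)
  qed (use I in simp)
  then show ?thesis using e0 by (subst nn_integral_eq_integral[OF i]) (auto simp: J_def intro: ennreal_leI)
 qed
 have lim: "ennreal ((norm (u x))^2) * ennreal (a x) = liminf (\<lambda>k. ennreal (e k x))" for x
 proof (cases "a x = 0")
  case True
  have "e k x = 0" for k using True by (simp add: e_def)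
  then show ?thesis using True by (simp add: Liminf_const)
 next
  case False
  then have "0 < a x" using nonneg[of x] by simp
  have "\<forall>\<^sub>F k in sequentially. ennreal (e k x) = ennreal ((norm (u x))^2) * ennreal (a x)"
   by (rule eventually_mono[OF eventually_good[OF \<open>0 < a x\<close>, of u]])
    (simp add: e_def ennreal_mult' nonneg mult.commute)
  then have "(\<lambda>k. ennreal (e k x)) \<longlonglongrightarrow> ennreal ((norm (u x))^2) * ennreal (a x)" by (rule tendsto_eventually)
  then show ?thesis by (metis lim_imp_Liminf trivial_limit_sequentially)
 qed
 have "(NN x. ennreal ((norm (u x))^2) * ennreal (a x)) \<le> liminf (\<lambda>k. \<integral>\<^sup>+x. ennreal (e k x) \<partial>lborel)"
  unfolding lim by (rule nn_integral_liminf) (simp add: e_def)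
 also have "\<dots> \<le> ennreal (c^2 * I)"
  by (rule order_trans[OF Liminf_le_Limsup Limsup_bounded]) (auto simp: bound)
 also have "\<dots> = ennreal (c^2) * ennreal I" using I by (simp add: ennreal_mult)
 finally show ?thesis unfolding I(1) u_def c_def .
qed

end

subsection \<open>Passage to Lebesgue measurable functions\<close>

lemma lebesgue_borel_version:
 fixes f :: "'a::euclidean_space \<Rightarrow> complex"
 assumes [measurable]: "f \<in> borel_measurable lebesgue"
 shows "\<exists>f'\<in>borel_measurable borel. AE x in lborel. f x = f' x"
proof -
 have "(\<lambda>x. Re (f x)) \<in> borel_measurable lebesgue" "(\<lambda>x. Im (f x)) \<in> borel_measurable lebesgue" by measurable
 from this[THEN completion_ex_borel_measurable_real]
 obtain p q where [measurable]: "p \<in> borel_measurable lborel" "q \<in> borel_measurable lborel"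
  and ae: "AE x in lborel. Re (f x) = p x" "AE x in lborel. Im (f x) = q x" by blast
 show ?thesis
 proof (rule bexI[of _ "\<lambda>x. Complex (p x) (q x)"])
  show "AE x in lborel. f x = Complex (p x) (q x)" using ae by eventually_elim (simp add: complex_eq_iff)
  have "(\<lambda>x. Complex (p x) (q x)) = (\<lambda>x. of_real (p x) + \<i> * of_real (q x))" by (simp add: complex_eq_iff fun_eq_iff)
  then show "(\<lambda>x. Complex (p x) (q x)) \<in> borel_measurable borel" by simp
 qed
qed

lemma integral_lebesgue_eq_lborel:
 fixes F F' :: "'a::euclidean_space \<Rightarrow> complex"
 assumes "F \<in> borel_measurable lebesgue" and F': "F' \<in> borel_measurable borel" and "AE x in lborel. F x = F' x"
 shows "(\<integral>x. F x \<partial>lebesgue) = (LBINT x. F' x)"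
proof -
 have "F' \<in> borel_measurable lborel" using F' by simp
 then have "(\<integral>x. F x \<partial>lebesgue) = (\<integral>x. F' x \<partial>lebesgue)"
  by (intro integral_cong_AE assms(1) measurable_completion AE_completion assms(3))
 then show ?thesis using F' by (simp add: integral_completion)
qed

lemma L2_sq_lborel: "L2_sq w f = (NN x. ennreal ((cmod (f x))^2) * w x)"
 by (simp add: L2_sq_def nn_integral_completion)

lemma L2_sq_cong_AE:
 "AE x in lborel. f x = g x \<Longrightarrow> L2_sq w f = L2_sq w g"
 unfolding L2_sq_lborel by (rule nn_integral_cong_AE) auto

lemma L2_one_borel_version:
 fixes f :: "real^'n \<Rightarrow> complex"
 assumes "f \<in> L2 (\<lambda>_. 1)"
 shows "\<exists>f'. sq_integrable f' \<and> (AE x in lborel. f x = f' x)"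
proof -
 obtain f' where f': "f' \<in> borel_measurable borel" "AE x in lborel. f x = f' x"
  using lebesgue_borel_version[of f] assms by (auto simp: L2_def)
 have "L2_sq (\<lambda>_. 1) f' < \<infinity>" using assms L2_sq_cong_AE[OF f'(2)] by (simp add: L2_def)
 then have "sq_integrable f'" using f'(1) by (simp add: sq_integrable_iff_nn L2_sq_lborel)
 then show ?thesis using f'(2) by blast
qed

lemma sq_integrable_L2_one: "sq_integrable f \<Longrightarrow> f \<in> L2 (\<lambda>_. 1)"
 by (auto simp: L2_def L2_sq_lborel sq_integrable_iff_nn intro: measurable_completion)

lemma S_class_measurable: "V \<in> S_class \<Longrightarrow> V \<in> borel_measurable lebesgue"
 by (simp add: S_class_def)

lemma dyadic_cube_subset_cbox: "dyadic_cube k m \<subseteq> cbox (\<chi> i. of_int (m $ i) * 2 powi k) (\<chi> i. (of_int (m $ i) + 1) * 2 powi k)"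
 by (auto simp: dyadic_cube_def mem_box_cart less_imp_le)

text \<open>Cubes of mass zero are left out of the supremum, and for them both sides vanish. For the
  others the quotient can be multiplied out, as local integrability on the closed cube makes the
  mass finite.\<close>

lemma KS_class_test:
 fixes W w :: "real^'n \<Rightarrow> real" and k :: int and m :: "int^'n"
 assumes W: "W \<in> KS_class (real CARD('n) - 1)" and W0: "\<And>x. 0 \<le> W x"
  and w[measurable]: "w \<in> borel_measurable borel" and ae: "AE x in lborel. W x = w x"
 defines "Q \<equiv> dyadic_cube k m"
 shows "(\<integral>\<^sup>+x\<in>Q. ennreal (w x) \<partial>lborel) < \<infinity>"
  and "(\<integral>\<^sup>+x\<in>Q. (\<integral>\<^sup>+y\<in>Q. ennreal (w x * w y) / ennreal (dist x y) \<partial>lborel) \<partial>lborel)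
   \<le> KS_norm (real CARD('n) - 1) W * (\<integral>\<^sup>+x\<in>Q. ennreal (w x) \<partial>lborel)"
proof -
 have [measurable]: "Q \<in> sets borel" by (simp add: Q_def)
 define B where "B = (\<integral>\<^sup>+x\<in>Q. ennreal (w x) \<partial>lborel)"
 define A where "A = (\<integral>\<^sup>+x\<in>Q. (\<integral>\<^sup>+y\<in>Q. ennreal (w x * w y) / ennreal (dist x y) \<partial>lborel) \<partial>lborel)"
 have BW: "(\<integral>\<^sup>+x\<in>Q. ennreal \<bar>W x\<bar> \<partial>lebesgue) = B"
  unfolding nn_integral_completion B_def using ae W0 by (intro nn_integral_cong_AE) (auto elim: eventually_mono)
 \<comment> \<open>The Borel version replaces \<open>W\<close> in the inner variable first and in
   the outer one afterwards, so that each time the exceptional set is a null set of a single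
   variable; the exponent of the distance is 1.\<close>
 have in1: "(\<integral>\<^sup>+y\<in>Q. ennreal \<bar>W x * W y\<bar> / ennreal (dist x y powr (real CARD('n) - (real CARD('n) - 1))) \<partial>lebesgue)
   = (\<integral>\<^sup>+y\<in>Q. ennreal (W x * w y) / ennreal (dist x y) \<partial>lborel)" for x
 proof -
  have "ennreal \<bar>W x * W y\<bar> / ennreal (dist x y powr (real CARD('n) - (real CARD('n) - 1))) = ennreal (W x * W y) / ennreal (dist x y)" for y
   using W0[of x] W0[of y] by simp
  then show ?thesis unfolding nn_integral_completion using ae by (intro nn_integral_cong_AE) (auto elim: eventually_mono)
 qed
 have AW: "(\<integral>\<^sup>+x\<in>Q. (\<integral>\<^sup>+y\<in>Q. ennreal \<bar>W x * W y\<bar> / ennreal (dist x y powr (real CARD('n) - (real CARD('n) - 1))) \<partial>lebesgue) \<partial>lebesgue) = A"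
  unfolding in1 unfolding nn_integral_completion A_def using ae by (intro nn_integral_cong_AE) (auto elim: eventually_mono)
 define K :: "(real^'n) set" where "K = cbox (\<chi> i. of_int (m $ i) * 2 powi k) (\<chi> i. (of_int (m $ i) + 1) * 2 powi k)"
 have QK: "Q \<subseteq> K" unfolding Q_def K_def by (rule dyadic_cube_subset_cbox)
 have "set_integrable lebesgue K W" using W by (simp add: KS_class_def K_def compact_cbox)
 then have "(\<integral>\<^sup>+x. ennreal (norm (indicat_real K x *\<^sub>R W x)) \<partial>lebesgue) < \<infinity>"
  unfolding set_integrable_def integrable_iff_bounded by simp
 then have K: "(\<integral>\<^sup>+x\<in>K. ennreal \<bar>W x\<bar> \<partial>lebesgue) < \<infinity>"
  by (elim le_less_trans[rotated]) (auto intro!: nn_integral_mono simp: indicator_def)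
 have "B \<le> (\<integral>\<^sup>+x\<in>K. ennreal \<bar>W x\<bar> \<partial>lebesgue)"
  unfolding BW[symmetric] using QK by (intro nn_integral_mono) (auto simp: indicator_def)
 with K have Bf: "B < \<infinity>" by (rule le_less_trans[rotated])
 then show "(\<integral>\<^sup>+x\<in>Q. ennreal (w x) \<partial>lborel) < \<infinity>" by (simp add: B_def)
 have "A \<le> KS_norm (real CARD('n) - 1) W * B"
 proof (cases "B = 0")
  case True
  have "AE x in lborel. ennreal (w x) * indicator Q x = 0"
   using True unfolding B_def by (subst nn_integral_0_iff_AE[symmetric]) auto
  with ae have "AE x in lborel. (\<integral>\<^sup>+y\<in>Q. ennreal (w x * w y) / ennreal (dist x y) \<partial>lborel) * indicator Q x = 0"
  proof eventually_elim
   case (elim x)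
   show ?case
   proof (cases "x \<in> Q")
    case True
    then have "w x = 0" using elim W0[of x] by (auto simp: ennreal_eq_0_iff)
    then show ?thesis by simp
   qed simp
  qed
  then have "A = (\<integral>\<^sup>+x. 0 \<partial>(lborel :: (real^'n) measure))" unfolding A_def by (rule nn_integral_cong_AE)
  then show ?thesis by simp
 next
  case False
  have Q: "Q \<in> {Q \<in> dyadic_cubes. (\<integral>\<^sup>+x\<in>Q. ennreal \<bar>W x\<bar> \<partial>lebesgue) \<noteq> 0}"
   using False unfolding BW[symmetric] by (auto simp: dyadic_cubes_def Q_def)
  have "A / B \<le> KS_norm (real CARD('n) - 1) W"
   unfolding KS_norm_def by (rule SUP_upper2[OF Q]) (simp only: BW AW order_refl)
  then have "B * (A / B) \<le> B * KS_norm (real CARD('n) - 1) W" by (intro mult_left_mono) auto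
  moreover have "B * (A / B) = A" using False Bf by (simp add: ennreal_times_divide mult.commute[of B] ennreal_mult_divide_eq)
  ultimately show ?thesis by (simp add: mult.commute)
 qed
 then show "(\<integral>\<^sup>+x\<in>Q. (\<integral>\<^sup>+y\<in>Q. ennreal (w x * w y) / ennreal (dist x y) \<partial>lborel) \<partial>lborel)
   \<le> KS_norm (real CARD('n) - 1) W * (\<integral>\<^sup>+x\<in>Q. ennreal (w x) \<partial>lborel)"
  by (simp add: A_def B_def)
qed

lemma S_class_weight:
 fixes V :: "real^'n \<Rightarrow> complex"
 assumes n: "CARD('n) \<ge> 3" and V: "V \<in> S_class"
 shows "\<exists>a. (AE x in lborel. cmod (V x) = a x) \<and>
  (\<forall>D > enn2real (KS_norm (real CARD('n) - 1) (abs_power V)). kerman_sawyer_weight a ((real CARD('n) - 1) / 2) D)"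
proof -
 obtain V' where [measurable]: "V' \<in> borel_measurable borel" and ae: "AE x in lborel. V x = V' x"
  using lebesgue_borel_version[OF S_class_measurable[OF V]] by blast
 define b where "b = (real CARD('n) - 1) / 2"
 define N where "N = KS_norm (real CARD('n) - 1) (abs_power V)"
 have W: "abs_power V \<in> KS_class (real CARD('n) - 1)" using V by (simp add: S_class_def)
 have N: "N < \<infinity>" using W by (simp add: KS_class_def N_def)
 have aew: "AE x in lborel. abs_power V x = cmod (V' x) powr b" using ae by eventually_elim (simp add: abs_power_def b_def)
 have W0: "0 \<le> abs_power V x" for x by (simp add: abs_power_def)
 note T = KS_class_test[OF W W0 _ aew]
 have "kerman_sawyer_weight (\<lambda>x. cmod (V' x)) b D" if D: "D > enn2real N" for D
 proof
  show "0 < D" using D enn2real_nonneg[of N] by linarith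
  have ND: "N \<le> ennreal D" using N D by (metis ennreal_enn2real ennreal_leI infinity_ennreal_def less_imp_le)
  show "(\<integral>\<^sup>+x\<in>dyadic_cube k m. ennreal (cmod (V' x) powr b) \<partial>lborel) < \<infinity>" for k m by (rule T(1)) simp
  show "(\<integral>\<^sup>+x\<in>dyadic_cube k m. (\<integral>\<^sup>+y\<in>dyadic_cube k m. ennreal (cmod (V' x) powr b * cmod (V' y) powr b) / ennreal (dist x y) \<partial>lborel) \<partial>lborel)
    \<le> ennreal D * (\<integral>\<^sup>+x\<in>dyadic_cube k m. ennreal (cmod (V' x) powr b) \<partial>lborel)" for k m
   by (rule order_trans[OF T(2)]) (use ND in \<open>auto simp: N_def intro!: mult_right_mono\<close>)
 qed (use n in \<open>auto simp: b_def\<close>)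
 moreover have "AE x in lborel. cmod (V x) = cmod (V' x)" using ae by eventually_elim simp
 ultimately show ?thesis unfolding b_def N_def by (intro exI[of _ "\<lambda>x. cmod (V' x)"]) simp
qed

text \<open>The weighted bound is available for each \<open>D\<close> above the Kerman--Sawyer norm
  \<open>N\<close>; letting \<open>D\<close> decrease to \<open>N\<close> gives N^(1 / b), which is
  \<open>S_norm V\<close> as 1 / b = 2 / (n - 1).\<close>

lemma S_class_bound:
 fixes V h h' u :: "real^'n \<Rightarrow> complex"
 assumes n: "CARD('n) \<ge> 3" and V: "V \<in> S_class" and K: "Re K > 0"
  and h': "sq_integrable h'" "AE x in lborel. h x = h' x" and u: "AE x in lborel. u x = conv (resolvent_kernel K) h' x"
  and fin: "L2_sq (inv_abs_weight V) h < \<infinity>"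
 shows "L2_sq (abs_weight V) u \<le> ennreal ((resolvent_const TYPE('n) * S_norm V)^2) * L2_sq (inv_abs_weight V) h"
proof -
 define b where "b = (real CARD('n) - 1) / 2"
 define N where "N = enn2real (KS_norm (real CARD('n) - 1) (abs_power V))"
 obtain a where a: "AE x in lborel. cmod (V x) = a x" and ks: "\<And>D. D > N \<Longrightarrow> kerman_sawyer_weight a b D"
  using S_class_weight[OF n V] unfolding b_def N_def by blast
 have b: "b > 0" using n by (simp add: b_def)
 have L: "L2_sq (inv_abs_weight V) h = (NN x. ennreal ((cmod (h' x))^2) * inverse (ennreal (a x)))"
  unfolding L2_sq_lborel inv_abs_weight_def using a h'(2) by (intro nn_integral_cong_AE) (auto elim!: eventually_elim2)
 have U: "L2_sq (abs_weight V) u = (NN x. ennreal ((cmod (conv (resolvent_kernel K) h' x))^2) * ennreal (a x))"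
  unfolding L2_sq_lborel abs_weight_def using a u by (intro nn_integral_cong_AE) (auto elim!: eventually_elim2)
 obtain I where I: "L2_sq (inv_abs_weight V) h = ennreal I" "0 \<le> I" using fin by (cases "L2_sq (inv_abs_weight V) h") auto
 define c where "c D = resolvent_const TYPE('n) * D powr (1 / b)" for D
 have le: "L2_sq (abs_weight V) u \<le> ennreal ((c D)^2 * I)" if "D > N" for D
 proof -
  interpret kerman_sawyer_weight a b D by (rule ks[OF that])
  show ?thesis using weighted_bound[OF K h'(1)] fin I(2) unfolding U L I(1)[unfolded L] c_def by (simp add: ennreal_mult)
 qed
 have "((\<lambda>D. (c D)^2 * I) \<longlongrightarrow> (c N)^2 * I) (at_right N)"
  unfolding c_def using b
  by (intro tendsto_intros tendsto_powr'[OF tendsto_ident_at tendsto_const])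
   (auto simp: N_def eventually_at_filter intro!: always_eventually order_trans[OF enn2real_nonneg less_imp_le])
 then have "((\<lambda>D. ennreal ((c D)^2 * I)) \<longlongrightarrow> ennreal ((c N)^2 * I)) (at_right N)" by (rule tendsto_ennrealI)
 moreover have "\<forall>\<^sub>F D in at_right N. L2_sq (abs_weight V) u \<le> ennreal ((c D)^2 * I)"
  using le by (auto simp: eventually_at_filter)
 ultimately have "L2_sq (abs_weight V) u \<le> ennreal ((c N)^2 * I)" by (intro tendsto_lowerbound) auto
 moreover have "c N = resolvent_const TYPE('n) * S_norm V" by (simp add: c_def S_norm_def N_def b_def)
 ultimately show ?thesis using I by (simp add: ennreal_mult)
qed

section \<open>The resolvent as a convolution\<close>

lemma resolvent_exists:
 fixes f f' :: "real^'n \<Rightarrow> complex"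
 assumes K: "Re K > 0" and f: "f \<in> borel_measurable lebesgue" "sq_integrable f'" "AE x in lborel. f x = f' x"
 defines "u \<equiv> conv (resolvent_kernel K) f'"
 shows "sq_integrable u" "has_distr_laplacian u (\<lambda>x. - (f x + - (K^2) * u x))"
proof -
 show su: "sq_integrable u" unfolding u_def by (rule conv_sq_integrable(1)[OF resolvent_kernel_integrable[OF K] f(2)])
 then have um: "u \<in> borel_measurable borel" by (simp add: sq_integrable_def)
 then have uL[measurable]: "u \<in> borel_measurable lebesgue" by (intro measurable_completion) simp
 have f'm: "f' \<in> borel_measurable borel" using f(2) by (simp add: sq_integrable_def)
 note [measurable] = f(1)
 show "has_distr_laplacian u (\<lambda>x. - (f x + - (K^2) * u x))"
  unfolding has_distr_laplacian_def
 proof (intro allI impI)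
  fix \<phi> :: "real^'n \<Rightarrow> complex" assume \<phi>: "test_function \<phi>"
  have pm: "\<phi> \<in> borel_measurable borel" "laplacian \<phi> \<in> borel_measurable borel"
   using test_function_laplacian(1,3)[OF \<phi>] by (auto intro: nice_measurable)
  then have [measurable]: "\<phi> \<in> borel_measurable lebesgue" "laplacian \<phi> \<in> borel_measurable lebesgue"
   by (auto intro: measurable_completion)
  have "(\<integral>x. u x * laplacian \<phi> x \<partial>lebesgue) = (LBINT x. u x * laplacian \<phi> x)"
   by (rule integral_lebesgue_eq_lborel) (use um pm in auto)
  also have "\<dots> = (LBINT x. - (f' x - K^2 * u x) * \<phi> x)"
   unfolding u_def by (rule resolvent_weak_equation[OF K f(2) \<phi>])
  also have "\<dots> = (\<integral>x. - (f x + - (K^2) * u x) * \<phi> x \<partial>lebesgue)"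
  proof (rule integral_lebesgue_eq_lborel[symmetric])
   show "(\<lambda>x. - (f' x - K^2 * u x) * \<phi> x) \<in> borel_measurable borel" using f'm um pm by measurable
   show "AE x in lborel. - (f x + - (K^2) * u x) * \<phi> x = - (f' x - K^2 * u x) * \<phi> x"
    using f(3) by eventually_elim simp
  qed measurable
  finally show "(\<integral>x. u x * laplacian \<phi> x \<partial>lebesgue) = (\<integral>x. - (f x + - (K^2) * u x) * \<phi> x \<partial>lebesgue)" .
 qed
qed

text \<open>The difference of two solutions solves the homogeneous equation. Each solution comes
  with a Borel version, to which \<open>resolvent_unique\<close> applies.\<close>

lemma distr_solution_unique:
 fixes f u v :: "real^'n \<Rightarrow> complex"
 assumes K: "Re K > 0" and f: "f \<in> L2 (\<lambda>_. 1)" and u: "sq_integrable u" "AE x in lborel. v x = u x" "v \<in> L2 (\<lambda>_. 1)"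
  and u': "sq_integrable u'" "AE x in lborel. v' x = u' x" "v' \<in> L2 (\<lambda>_. 1)"
  and dv: "has_distr_laplacian v (\<lambda>x. - (f x + - (K^2) * v x))"
  and dv': "has_distr_laplacian v' (\<lambda>x. - (f x + - (K^2) * v' x))"
 shows "AE x in lborel. v x = v' x"
proof -
 obtain f' where f': "sq_integrable f'" "AE x in lborel. f x = f' x" using L2_one_borel_version[OF f] by blast
 have weak: "(LBINT x. w x * (laplacian \<phi> x - K^2 * \<phi> x)) = - (LBINT x. f' x * \<phi> x)"
  if w: "sq_integrable w" "AE x in lborel. y x = w x" "y \<in> L2 (\<lambda>_. 1)"
   and dy: "has_distr_laplacian y (\<lambda>x. - (f x + - (K^2) * y x))" and \<phi>: "test_function \<phi>" for w y \<phi>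
 proof -
  have n: "nice \<phi>" "nice (laplacian \<phi>)" using test_function_laplacian(1,3)[OF \<phi>] by auto
  note pm = n[THEN nice_measurable] and ps = n[THEN nice_integrable(2)]
  have pL[measurable]: "\<phi> \<in> borel_measurable lebesgue" "laplacian \<phi> \<in> borel_measurable lebesgue"
   using pm by (auto intro: measurable_completion)
  have fL[measurable]: "f \<in> borel_measurable lebesgue" "y \<in> borel_measurable lebesgue" using f w(3) by (auto simp: L2_def)
  have m: "w \<in> borel_measurable borel" "f' \<in> borel_measurable borel" using w(1) f'(1) by (auto simp: sq_integrable_def)
  have "(LBINT x. w x * laplacian \<phi> x) = (\<integral>x. y x * laplacian \<phi> x \<partial>lebesgue)"
   by (rule integral_lebesgue_eq_lborel[symmetric]) (use m pm w(2) in \<open>auto elim: eventually_mono\<close>)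
  also have "\<dots> = (\<integral>x. - (f x + - (K^2) * y x) * \<phi> x \<partial>lebesgue)" using dy \<phi> by (simp add: has_distr_laplacian_def)
  also have "\<dots> = (LBINT x. K^2 * (w x * \<phi> x) - f' x * \<phi> x)"
  proof (rule integral_lebesgue_eq_lborel)
   show "(\<lambda>x. K^2 * (w x * \<phi> x) - f' x * \<phi> x) \<in> borel_measurable borel" using m pm by measurable
   show "AE x in lborel. - (f x + - (K^2) * y x) * \<phi> x = K^2 * (w x * \<phi> x) - f' x * \<phi> x"
    using f'(2) w(2) by eventually_elim (simp add: algebra_simps)
  qed measurable
  also have "\<dots> = K^2 * (LBINT x. w x * \<phi> x) - (LBINT x. f' x * \<phi> x)"
   using sq_integrable_mult(1)[OF w(1) ps(1)] sq_integrable_mult(1)[OF f'(1) ps(1)] by simp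
  finally have e: "(LBINT x. w x * laplacian \<phi> x) = K^2 * (LBINT x. w x * \<phi> x) - (LBINT x. f' x * \<phi> x)" .
  have "(LBINT x. w x * (laplacian \<phi> x - K^2 * \<phi> x)) = (LBINT x. w x * laplacian \<phi> x - K^2 * (w x * \<phi> x))"
   by (intro LBINT_cong refl) (simp add: algebra_simps)
  also have "\<dots> = (LBINT x. w x * laplacian \<phi> x) - K^2 * (LBINT x. w x * \<phi> x)"
   using sq_integrable_mult(1)[OF w(1) ps(1)] sq_integrable_mult(1)[OF w(1) ps(2)] by simp
  finally show ?thesis using e by simp
 qed
 have "AE x in lborel. u x - u' x = 0"
 proof (rule resolvent_unique[OF sq_integrable_diff[OF u(1) u'(1)] K])
  fix \<phi> :: "real^'n \<Rightarrow> complex" assume \<phi>: "test_function \<phi>"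
  have n: "nice \<phi>" "nice (laplacian \<phi>)" using test_function_laplacian(1,3)[OF \<phi>] by auto
  have s: "sq_integrable (\<lambda>x. laplacian \<phi> x - K^2 * \<phi> x)"
   by (intro sq_integrable_diff sq_integrable_cmult(1) nice_integrable(2) n)
  have "(LBINT x. (u x - u' x) * (laplacian \<phi> x - K^2 * \<phi> x))
   = (LBINT x. u x * (laplacian \<phi> x - K^2 * \<phi> x) - u' x * (laplacian \<phi> x - K^2 * \<phi> x))"
   by (intro LBINT_cong refl) (rule left_diff_distrib)
  also have "\<dots> = 0"
   by (simp add: Bochner_Integration.integral_diff[OF sq_integrable_mult(1)[OF u(1) s] sq_integrable_mult(1)[OF u'(1) s]] weak[OF u dv \<phi>] weak[OF u' dv' \<phi>])
  finally show "(LBINT x. (u x - u' x) * (laplacian \<phi> x - K^2 * \<phi> x)) = 0" .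
 qed
 then show ?thesis using u(2) u'(2) by eventually_elim simp
qed

text \<open>For nonreal \<open>z\<close> the number \<open>- z\<close> is off the cut, so the
  principal root is the \<open>K\<close> in the open right half plane with z = - K^2.\<close>

lemma csqrt_resolvent:
 assumes "z \<notin> \<real>"
 shows "Re (csqrt (- z)) > 0" "- ((csqrt (- z))^2) = z"
proof -
 have "Im z \<noteq> 0" using assms by (auto simp: complex_is_Real_iff)
 then have "\<bar>Re z\<bar> < cmod z" by (simp add: cmod_def real_less_rsqrt)
 then show "Re (csqrt (- z)) > 0" by simp
qed simp

text \<open>Existence makes the choice in \<open>resolvent\<close> take an actual solution, and
  uniqueness identifies it up to a null set with the convolution, whatever representative was
  chosen.\<close>

lemma resolvent_eq_conv:
 fixes f f' :: "real^'n \<Rightarrow> complex"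
 assumes z: "z \<notin> \<real>" and f: "f \<in> L2 (\<lambda>_. 1)" "sq_integrable f'" "AE x in lborel. f x = f' x"
 shows "AE x in lborel. resolvent z f x = conv (resolvent_kernel (csqrt (- z))) f' x" "resolvent z f \<in> L2 (\<lambda>_. 1)"
proof -
 define K where "K = csqrt (- z)"
 define u where "u = conv (resolvent_kernel K) f'"
 have K: "Re K > 0" and z2: "- (K^2) = z" unfolding K_def using csqrt_resolvent[OF z] by auto
 have fm: "f \<in> borel_measurable lebesgue" using f(1) by (simp add: L2_def)
 note u = resolvent_exists[OF K fm f(2,3), folded u_def]
 have "resolvent z f \<in> L2 (\<lambda>_. 1) \<and> has_distr_laplacian (resolvent z f) (\<lambda>x. - (f x + z * resolvent z f x))"
  unfolding resolvent_def
  by (rule someI[of "\<lambda>u. u \<in> L2 (\<lambda>_. 1) \<and> has_distr_laplacian u (\<lambda>x. - (f x + z * u x))" u])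
   (use u sq_integrable_L2_one[OF u(1)] in \<open>simp add: z2\<close>)
 then have r: "resolvent z f \<in> L2 (\<lambda>_. 1)" "has_distr_laplacian (resolvent z f) (\<lambda>x. - (f x + - (K^2) * resolvent z f x))"
  unfolding z2 by auto
 then show "resolvent z f \<in> L2 (\<lambda>_. 1)" by simp
 obtain v where v: "sq_integrable v" "AE x in lborel. resolvent z f x = v x" using L2_one_borel_version[OF r(1)] by blast
 have "AE x in lborel. resolvent z f x = u x"
  by (rule distr_solution_unique[OF K f(1) v r(1) u(1) _ sq_integrable_L2_one[OF u(1)] r(2) u(2)]) simp
 then show "AE x in lborel. resolvent z f x = conv (resolvent_kernel (csqrt (- z))) f' x" by (simp add: u_def K_def)
qed

lemma resolvent_bound:
 fixes V f :: "real^'n \<Rightarrow> complex"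
 assumes n: "CARD('n) \<ge> 3" and V: "V \<in> S_class" and z: "z \<notin> \<real>"
  and f: "f \<in> L2 (\<lambda>_. 1)" and fin: "L2_sq (inv_abs_weight V) f < \<infinity>"
 shows "L2_sq (abs_weight V) (resolvent z f) \<le> ennreal ((resolvent_const TYPE('n) * S_norm V)^2) * L2_sq (inv_abs_weight V) f"
proof -
 obtain f' where f': "sq_integrable f'" "AE x in lborel. f x = f' x" using L2_one_borel_version[OF f] by blast
 show ?thesis by (rule S_class_bound[OF n V csqrt_resolvent(1)[OF z] f' resolvent_eq_conv(1)[OF z f f'] fin])
qed

text \<open>\<open>resolvent z\<close> picks a representative for each function separately, so it is
  linear only almost everywhere; the difference is therefore identified through
  convolutions.\<close>

lemma resolvent_diff_bound:
 fixes V f g :: "real^'n \<Rightarrow> complex"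
 assumes n: "CARD('n) \<ge> 3" and V: "V \<in> S_class" and z: "z \<notin> \<real>"
  and f: "f \<in> L2 (\<lambda>_. 1)" and g: "g \<in> L2 (\<lambda>_. 1)" and fin: "L2_sq (inv_abs_weight V) (\<lambda>x. f x - g x) < \<infinity>"
 shows "L2_sq (abs_weight V) (\<lambda>x. resolvent z f x - resolvent z g x)
  \<le> ennreal ((resolvent_const TYPE('n) * S_norm V)^2) * L2_sq (inv_abs_weight V) (\<lambda>x. f x - g x)"
proof -
 define R where "R = (resolvent_kernel (csqrt (- z)) :: real^'n \<Rightarrow> complex)"
 have R: "integrable lborel R" unfolding R_def by (rule resolvent_kernel_integrable[OF csqrt_resolvent(1)[OF z]])
 obtain f' where f': "sq_integrable f'" "AE x in lborel. f x = f' x" using L2_one_borel_version[OF f] by blast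
 obtain g' where g': "sq_integrable g'" "AE x in lborel. g x = g' x" using L2_one_borel_version[OF g] by blast
 have ae: "AE x in lborel. f x - g x = f' x - g' x" using f'(2) g'(2) by eventually_elim simp
 have u: "AE x in lborel. resolvent z f x - resolvent z g x = conv R (\<lambda>x. f' x - g' x) x"
  using resolvent_eq_conv(1)[OF z f f'] resolvent_eq_conv(1)[OF z g g'] conv_sq_integrable(3)[OF R f'(1)] conv_sq_integrable(3)[OF R g'(1)]
  by eventually_elim (simp add: R_def conv_def right_diff_distrib)
 show ?thesis
  by (rule S_class_bound[OF n V csqrt_resolvent(1)[OF z] sq_integrable_diff[OF f'(1) g'(1)] ae u[unfolded R_def] fin])
qed

subsection \<open>Completeness and extension by continuity\<close>

lemma
 assumes [measurable]: "V \<in> borel_measurable lebesgue"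
 shows abs_weight_measurable: "abs_weight V \<in> borel_measurable lebesgue"
  and inv_abs_weight_measurable: "inv_abs_weight V \<in> borel_measurable lebesgue"
 unfolding abs_weight_def[abs_def] inv_abs_weight_def[abs_def] by measurable

lemma norm_add_sq_le: "(norm (x + y))^2 \<le> 2 * (norm x)^2 + 2 * (norm y)^2"
 for x y :: "'a::real_normed_vector"
proof -
 have "(norm (x + y))^2 \<le> (norm x + norm y)^2" by (intro power_mono norm_triangle_ineq norm_ge_zero)
 also have "\<dots> \<le> 2 * (norm x)^2 + 2 * (norm y)^2"
  using zero_le_power2[of "norm x - norm y"] by (simp add: power2_eq_square algebra_simps)
 finally show ?thesis .
qed

text \<open>Squared norms in \<open>ennreal\<close> keep infinite values visible. The price is the
  factor 2, which reappears as \<open>sqrt 2\<close> in the final constant.\<close>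

lemma L2_sq_triangle:
 fixes f g h :: "real^'n \<Rightarrow> complex"
 assumes [measurable]: "f \<in> borel_measurable lebesgue" "g \<in> borel_measurable lebesgue" "h \<in> borel_measurable lebesgue" "w \<in> borel_measurable lebesgue"
 shows "L2_sq w (\<lambda>x. f x - g x) \<le> 2 * L2_sq w (\<lambda>x. f x - h x) + 2 * L2_sq w (\<lambda>x. h x - g x)"
proof -
 have "ennreal ((cmod (f x - g x))^2) * w x \<le> 2 * (ennreal ((cmod (f x - h x))^2) * w x) + 2 * (ennreal ((cmod (h x - g x))^2) * w x)" for x
 proof -
  have "ennreal ((cmod (f x - g x))^2) \<le> ennreal (2 * (cmod (f x - h x))^2 + 2 * (cmod (h x - g x))^2)"
   using norm_add_sq_le[of "f x - h x" "h x - g x"] by (intro ennreal_leI) simp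
  also have "\<dots> = 2 * ennreal ((cmod (f x - h x))^2) + 2 * ennreal ((cmod (h x - g x))^2)"
   by (simp add: ennreal_plus ennreal_mult)
  finally have "ennreal ((cmod (f x - g x))^2) * w x \<le> (2 * ennreal ((cmod (f x - h x))^2) + 2 * ennreal ((cmod (h x - g x))^2)) * w x"
   by (rule mult_right_mono) simp
  then show ?thesis by (simp add: distrib_right mult.assoc)
 qed
 then have "L2_sq w (\<lambda>x. f x - g x) \<le> (\<integral>\<^sup>+x. 2 * (ennreal ((cmod (f x - h x))^2) * w x) + 2 * (ennreal ((cmod (h x - g x))^2) * w x) \<partial>lebesgue)"
  unfolding L2_sq_def by (intro nn_integral_mono)
 also have "\<dots> = 2 * L2_sq w (\<lambda>x. f x - h x) + 2 * L2_sq w (\<lambda>x. h x - g x)"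
  unfolding L2_sq_def by (subst nn_integral_add) (auto simp: nn_integral_cmult)
 finally show ?thesis .
qed

lemma L2_sq_minus_commute: "L2_sq w (\<lambda>x. f x - g x) = L2_sq w (\<lambda>x. g x - f x)"
 by (simp add: L2_sq_def norm_minus_commute)

lemma L2_sq_diff_finite:
 assumes "f \<in> L2 w" "g \<in> L2 w" "w \<in> borel_measurable lebesgue"
 shows "L2_sq w (\<lambda>x. f x - g x) < \<infinity>"
proof -
 have "L2_sq w (\<lambda>x. f x - g x) \<le> 2 * L2_sq w (\<lambda>x. f x - 0) + 2 * L2_sq w (\<lambda>x. 0 - g x)"
  using assms by (intro L2_sq_triangle) (auto simp: L2_def)
 also have "\<dots> = 2 * L2_sq w f + 2 * L2_sq w g" by (simp add: L2_sq_def)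
 also have "\<dots> < \<infinity>" using assms by (simp add: L2_def ennreal_mult_less_top)
 finally show ?thesis .
qed

text \<open>Finiteness is essential: \<open>L2_norm\<close> is 0 on functions of infinite
  norm.\<close>

lemma L2_norm_tendsto_0_iff:
 assumes "\<And>k. L2_sq w (h k) < \<infinity>"
 shows "(\<lambda>k. L2_norm w (h k)) \<longlonglongrightarrow> 0 \<longleftrightarrow> (\<lambda>k. L2_sq w (h k)) \<longlonglongrightarrow> 0"
proof
 assume "(\<lambda>k. L2_norm w (h k)) \<longlonglongrightarrow> 0"
 then have "(\<lambda>k. ennreal ((L2_norm w (h k))^2)) \<longlonglongrightarrow> ennreal (0^2)" by (intro tendsto_ennrealI tendsto_power)
 moreover have "ennreal ((L2_norm w (h k))^2) = L2_sq w (h k)" for k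
  using assms[of k] by (simp add: L2_norm_def)
 ultimately show "(\<lambda>k. L2_sq w (h k)) \<longlonglongrightarrow> 0" by simp
next
 assume "(\<lambda>k. L2_sq w (h k)) \<longlonglongrightarrow> 0"
 then have "(\<lambda>k. sqrt (enn2real (L2_sq w (h k)))) \<longlonglongrightarrow> sqrt (enn2real 0)"
  by (intro tendsto_real_sqrt tendsto_enn2real) auto
 then show "(\<lambda>k. L2_norm w (h k)) \<longlonglongrightarrow> 0" by (simp add: L2_norm_def)
qed

text \<open>Riesz--Fischer: a rapidly convergent subsequence converges almost everywhere, and Fatou's
 lemma gives the bound on the distance to its limit.\<close>

lemma L2_complete:
 fixes v :: "nat \<Rightarrow> real^'n \<Rightarrow> complex" and \<omega> :: "real^'n \<Rightarrow> real"
 assumes v[measurable]: "\<And>k. v k \<in> borel_measurable lebesgue" and w[measurable]: "\<omega> \<in> borel_measurable lebesgue" and w0: "\<And>x. 0 \<le> \<omega> x"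
  and c: "c \<longlonglongrightarrow> 0" and cauchy: "\<And>k l. L2_sq (\<lambda>x. ennreal (\<omega> x)) (\<lambda>x. v k x - v l x) \<le> c k + c l"
 shows "\<exists>u\<in>borel_measurable lebesgue. \<forall>k. L2_sq (\<lambda>x. ennreal (\<omega> x)) (\<lambda>x. v k x - u x) \<le> c k"
proof -
 \<comment> \<open>The rate (1 / 16)^k still leaves (1 / 4)^k after multiplication by 4^k, so the
   series \<open>s\<close> below has finite integral, and where it is finite the increments are of
   order (1 / 2)^k.\<close>
 have "\<exists>j\<ge>k. c j \<le> ennreal ((1 / 16) ^ k)" for k
 proof -
  have "\<forall>\<^sub>F j in sequentially. c j < ennreal ((1 / 16) ^ k)" using c by (rule order_tendstoD(2)) simp
  then obtain N where "\<And>j. j \<ge> N \<Longrightarrow> c j < ennreal ((1 / 16) ^ k)" by (auto simp: eventually_sequentially)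
  then show ?thesis by (intro exI[of _ "max k N"]) (auto intro: less_imp_le)
 qed
 then obtain r where r: "\<And>k. k \<le> r k" "\<And>k. c (r k) \<le> ennreal ((1 / 16) ^ k)" by metis
 define d where "d k x = v (r (Suc k)) x - v (r k) x" for k x
 define s where "s x = (\<Sum>k. ennreal (4 ^ k) * (ennreal ((cmod (d k x))^2) * ennreal (\<omega> x)))" for x
 have [measurable]: "d k \<in> borel_measurable lebesgue" for k unfolding d_def by measurable
 have "(\<integral>\<^sup>+x. s x \<partial>lebesgue) = (\<Sum>k. ennreal (4 ^ k) * L2_sq (\<lambda>x. ennreal (\<omega> x)) (d k))"
  unfolding s_def L2_sq_def by (subst nn_integral_suminf) (auto simp: nn_integral_cmult)
 also have "\<dots> \<le> (\<Sum>k. ennreal (2 * (1 / 4) ^ k))"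
 proof (intro suminf_le summableI)
  fix k
  have "L2_sq (\<lambda>x. ennreal (\<omega> x)) (d k) \<le> c (r (Suc k)) + c (r k)" unfolding d_def by (rule cauchy)
  also have "\<dots> \<le> ennreal ((1 / 16) ^ Suc k) + ennreal ((1 / 16) ^ k)" by (intro add_mono r)
  also have "\<dots> \<le> ennreal (2 * (1 / 16) ^ k)" by (subst ennreal_plus[symmetric]) (auto intro!: ennreal_leI)
  finally have "ennreal (4 ^ k) * L2_sq (\<lambda>x. ennreal (\<omega> x)) (d k) \<le> ennreal (4 ^ k) * ennreal (2 * (1 / 16) ^ k)" by (rule mult_left_mono) simp
  also have "\<dots> = ennreal (2 * (1 / 4) ^ k)"
  proof -
   have "(16::real) ^ k = 4 ^ k * 4 ^ k" by (simp add: power_mult_distrib[symmetric])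
   then show ?thesis by (simp add: ennreal_mult[symmetric] power_divide)
  qed
  finally show "ennreal (4 ^ k) * L2_sq (\<lambda>x. ennreal (\<omega> x)) (d k) \<le> ennreal (2 * (1 / 4) ^ k)" .
 qed
 also have "\<dots> = ennreal (\<Sum>k. 2 * (1 / 4) ^ k)" by (intro suminf_ennreal2 summable_mult summable_geometric) auto
 finally have "(\<integral>\<^sup>+x. s x \<partial>lebesgue) \<noteq> \<infinity>" by (auto simp: top_unique)
 moreover have "s \<in> borel_measurable lebesgue" unfolding s_def by measurable
 ultimately have ae: "AE x in lebesgue. s x \<noteq> \<infinity>" by (intro nn_integral_noteq_infinite)
 define u where "u x = lim (\<lambda>k. v (r k) x)" for x
 have [measurable]: "u \<in> borel_measurable lebesgue" unfolding u_def by measurable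
 \<comment> \<open>No convergence is claimed where the weight vanishes; such points contribute
   nothing to the weighted norms.\<close>
 have conv: "AE x in lebesgue. \<omega> x = 0 \<or> (\<lambda>k. v (r k) x) \<longlonglongrightarrow> u x"
  using ae
 proof eventually_elim
  case (elim x)
  show ?case
  proof (cases "\<omega> x = 0")
   case False
   then have wx: "0 < \<omega> x" using w0[of x] by simp
   obtain S where S: "s x = ennreal S" "0 \<le> S" using elim by (cases "s x") auto
   have dk: "norm (d k x) \<le> sqrt (S / \<omega> x) * (1 / 2) ^ k" for k
   proof (rule power2_le_imp_le)
    have "ennreal (4 ^ k) * (ennreal ((cmod (d k x))^2) * ennreal (\<omega> x)) \<le> s x"
     unfolding s_def using sum_le_suminf[OF summableI, of "{k}" "\<lambda>k. ennreal (4 ^ k) * (ennreal ((cmod (d k x))^2) * ennreal (\<omega> x))"] by simp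
    then have "ennreal (4 ^ k * ((cmod (d k x))^2 * \<omega> x)) \<le> ennreal S" using wx by (simp add: S(1) ennreal_mult)
    then have "4 ^ k * ((cmod (d k x))^2 * \<omega> x) \<le> S" using S(2) by simp
    then have "(cmod (d k x))^2 * (4 ^ k * \<omega> x) \<le> S" by (simp add: mult_ac)
    then have "(cmod (d k x))^2 \<le> S / (4 ^ k * \<omega> x)" using wx by (subst pos_le_divide_eq) auto
    also have "\<dots> = (sqrt (S / \<omega> x) * (1 / 2) ^ k)^2"
    proof -
     have "(4::real) ^ k = (2 ^ k)^2" by (simp add: power2_eq_square power_mult_distrib[symmetric])
     then show ?thesis using S(2) wx by (simp add: power_mult_distrib power_divide)
    qed
    finally show "(norm (d k x))^2 \<le> (sqrt (S / \<omega> x) * (1 / 2) ^ k)^2" .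
   qed (use S wx in simp)
   have "summable (\<lambda>k. d k x)"
    by (rule summable_comparison_test'[of "\<lambda>k. sqrt (S / \<omega> x) * (1 / 2) ^ k" 0]) (use dk in \<open>auto intro!: summable_mult summable_geometric\<close>)
   then have "(\<lambda>n. \<Sum>k<n. d k x) \<longlonglongrightarrow> (\<Sum>k. d k x)" by (rule summable_LIMSEQ)
   moreover have "(\<Sum>k<n. d k x) = v (r n) x - v (r 0) x" for n
    unfolding d_def by (rule sum_lessThan_telescope)
   ultimately have "(\<lambda>n. v (r n) x - v (r 0) x + v (r 0) x) \<longlonglongrightarrow> (\<Sum>k. d k x) + v (r 0) x" by (intro tendsto_add) auto
   then show ?thesis unfolding u_def by (simp add: convergentI convergent_LIMSEQ_iff[symmetric])
  qed simp
 qed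
 have "L2_sq (\<lambda>x. ennreal (\<omega> x)) (\<lambda>x. v j x - u x) \<le> c j" for j
 proof -
  have "AE x in lebesgue. ennreal ((cmod (v j x - u x))^2) * ennreal (\<omega> x) = liminf (\<lambda>k. ennreal ((cmod (v j x - v (r k) x))^2) * ennreal (\<omega> x))"
   using conv
  proof eventually_elim
   case (elim x)
   have "(\<lambda>k. ennreal ((cmod (v j x - v (r k) x))^2 * \<omega> x)) \<longlonglongrightarrow> ennreal ((cmod (v j x - u x))^2 * \<omega> x)"
    by (cases "\<omega> x = 0", simp, rule tendsto_ennrealI, intro tendsto_intros, use elim in simp)
   from lim_imp_Liminf[OF _ this] show ?case using w0 by (simp add: ennreal_mult)
  qed
  then have "L2_sq (\<lambda>x. ennreal (\<omega> x)) (\<lambda>x. v j x - u x) = (\<integral>\<^sup>+x. liminf (\<lambda>k. ennreal ((cmod (v j x - v (r k) x))^2) * ennreal (\<omega> x)) \<partial>lebesgue)"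
   unfolding L2_sq_def by (rule nn_integral_cong_AE)
  also have "\<dots> \<le> liminf (\<lambda>k. L2_sq (\<lambda>x. ennreal (\<omega> x)) (\<lambda>x. v j x - v (r k) x))"
   unfolding L2_sq_def by (rule nn_integral_liminf) measurable
  also have "\<dots> \<le> liminf (\<lambda>k. c j + c (r k))" by (intro Liminf_mono always_eventually allI cauchy)
  also have "\<dots> = c j + 0"
  proof (rule lim_imp_Liminf)
   have "filterlim r at_top sequentially" by (rule filterlim_at_top_mono[OF filterlim_ident]) (use r in auto)
   then show "(\<lambda>k. c j + c (r k)) \<longlonglongrightarrow> c j + 0" by (intro tendsto_add tendsto_const filterlim_compose[OF c])
  qed simp
  finally show ?thesis by simp
 qed
 then show ?thesis by (intro bexI[of _ u]) auto
qed

text \<open>\<open>f\<close> is cut off where |V| > k. Elsewhere |f|^2 \<le> k |f|^2 / |V|, with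
  \<open>f\<close> zero almost everywhere on the zero set of \<open>V\<close>, so the truncations
  lie in L2. Their weighted norms do not exceed that of \<open>f\<close>, which the final bound
  uses.\<close>

lemma approximates_exists:
 fixes V f :: "real^'n \<Rightarrow> complex"
 assumes V[measurable]: "V \<in> borel_measurable lebesgue" and f: "f \<in> L2 (inv_abs_weight V)"
 shows "\<exists>g. approximates V g f \<and> (\<forall>k. L2_sq (inv_abs_weight V) (g k) \<le> L2_sq (inv_abs_weight V) f)"
proof -
 define g where "g k x = (if cmod (V x) \<le> real k then f x else 0)" for k x
 have fm[measurable]: "f \<in> borel_measurable lebesgue" and fin: "L2_sq (inv_abs_weight V) f < \<infinity>" using f by (auto simp: L2_def)
 have [measurable]: "inv_abs_weight V \<in> borel_measurable lebesgue" by (rule inv_abs_weight_measurable[OF V])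
 have gm[measurable]: "g k \<in> borel_measurable lebesgue" for k unfolding g_def by measurable
 have le: "L2_sq (inv_abs_weight V) (g k) \<le> L2_sq (inv_abs_weight V) f" for k
  unfolding L2_sq_def by (intro nn_integral_mono) (simp add: g_def)
 have ae: "AE x in lebesgue. ennreal ((cmod (f x))^2) * inv_abs_weight V x \<noteq> \<infinity>"
  using fin unfolding L2_sq_def by (intro nn_integral_noteq_infinite) auto
 have "L2_sq (\<lambda>_. 1) (g k) < \<infinity>" for k
 proof -
  have "AE x in lebesgue. ennreal ((cmod (g k x))^2) * 1 \<le> ennreal (real k) * (ennreal ((cmod (f x))^2) * inv_abs_weight V x)"
   using ae
  proof eventually_elim
   case (elim x)
   show ?case
   proof (cases "V x = 0 \<or> \<not> cmod (V x) \<le> real k")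
    case True
    then have "g k x = 0" using elim by (auto simp: g_def inv_abs_weight_def ennreal_mult_eq_top_iff)
    then show ?thesis by simp
   next
    case False
    then have V0: "cmod (V x) > 0" "cmod (V x) \<le> real k" by auto
    have "(cmod (f x))^2 * cmod (V x) \<le> (cmod (f x))^2 * real k" by (intro mult_left_mono V0) simp
    then have "(cmod (f x))^2 \<le> real k * ((cmod (f x))^2 * inverse (cmod (V x)))"
     using pos_le_divide_eq[OF V0(1), of "(cmod (f x))^2" "(cmod (f x))^2 * real k"] by (simp add: divide_inverse mult_ac)
    then have "ennreal ((cmod (f x))^2) \<le> ennreal (real k * ((cmod (f x))^2 * inverse (cmod (V x))))" by (rule ennreal_leI)
    also have "\<dots> = ennreal (real k) * (ennreal ((cmod (f x))^2) * inv_abs_weight V x)"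
     using V0 by (simp add: ennreal_mult inv_abs_weight_def inverse_ennreal)
    finally show ?thesis using V0 by (simp add: g_def)
   qed
  qed
  then have "L2_sq (\<lambda>_. 1) (g k) \<le> (\<integral>\<^sup>+x. ennreal (real k) * (ennreal ((cmod (f x))^2) * inv_abs_weight V x) \<partial>lebesgue)"
   unfolding L2_sq_def by (rule nn_integral_mono_AE)
  also have "\<dots> = ennreal (real k) * L2_sq (inv_abs_weight V) f" unfolding L2_sq_def by (intro nn_integral_cmult) auto
  also have "\<dots> < \<infinity>" using fin by (simp add: ennreal_mult_less_top)
  finally show ?thesis .
 qed
 then have g: "g k \<in> L2 (\<lambda>_. 1) \<inter> L2 (inv_abs_weight V)" for k
  using le_less_trans[OF le fin] by (simp add: L2_def)
 have "(\<lambda>k. L2_sq (inv_abs_weight V) (\<lambda>x. g k x - f x)) \<longlonglongrightarrow> (\<integral>\<^sup>+x. 0 \<partial>(lebesgue :: (real^'n) measure))"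
  unfolding L2_sq_def
 proof (rule nn_integral_dominated_convergence)
  show "(\<integral>\<^sup>+x. ennreal ((cmod (f x))^2) * inv_abs_weight V x \<partial>lebesgue) < \<infinity>" using fin by (simp add: L2_sq_def)
  show "AE x in lebesgue. ennreal ((cmod (g k x - f x))^2) * inv_abs_weight V x \<le> ennreal ((cmod (f x))^2) * inv_abs_weight V x" for k
   by (simp add: g_def)
  have "(\<lambda>k. ennreal ((cmod (g k x - f x))^2) * inv_abs_weight V x) \<longlonglongrightarrow> 0" for x
  proof (rule tendsto_eventually)
   obtain m :: nat where "cmod (V x) \<le> real m" using real_arch_simple by blast
   then have "g k x = f x" if "k \<ge> m" for k using that by (simp add: g_def)
   then show "\<forall>\<^sub>F k in sequentially. ennreal ((cmod (g k x - f x))^2) * inv_abs_weight V x = 0"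
    unfolding eventually_sequentially by auto
  qed
  then show "AE x in lebesgue. (\<lambda>k. ennreal ((cmod (g k x - f x))^2) * inv_abs_weight V x) \<longlonglongrightarrow> 0" by simp
 qed auto
 then have "(\<lambda>k. L2_sq (inv_abs_weight V) (\<lambda>x. g k x - f x)) \<longlonglongrightarrow> 0" by simp
 then have "(\<lambda>k. L2_norm (inv_abs_weight V) (\<lambda>x. g k x - f x)) \<longlonglongrightarrow> 0"
  using g f by (subst L2_norm_tendsto_0_iff) (auto intro!: L2_sq_diff_finite[unfolded infinity_ennreal_def])
 then show ?thesis using g le unfolding approximates_def by blast
qed

context
 fixes V :: "real^'n \<Rightarrow> complex" and z :: complex and C :: ennreal
 assumes n: "CARD('n) \<ge> 3" and V: "V \<in> S_class" and z: "z \<notin> \<real>"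
  and C_def: "C = ennreal ((resolvent_const TYPE('n) * S_norm V)^2)"
begin

lemma weights_measurable: "abs_weight V \<in> borel_measurable lebesgue" "inv_abs_weight V \<in> borel_measurable lebesgue"
 using S_class_measurable[OF V] by (simp_all add: abs_weight_measurable inv_abs_weight_measurable)

lemma resolvent_measurable: "f \<in> L2 (\<lambda>_. 1) \<Longrightarrow> resolvent z f \<in> borel_measurable lebesgue"
 using L2_one_borel_version[of f] resolvent_eq_conv(2)[OF z, of f] by (auto simp: L2_def)

lemma approximatesD:
 assumes "approximates V g f" and f: "f \<in> L2 (inv_abs_weight V)"
 shows "g k \<in> L2 (\<lambda>_. 1)" "g k \<in> L2 (inv_abs_weight V)" "(\<lambda>k. L2_sq (inv_abs_weight V) (\<lambda>x. g k x - f x)) \<longlonglongrightarrow> 0"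
proof -
 have g: "g k \<in> L2 (\<lambda>_. 1) \<inter> L2 (inv_abs_weight V)" for k using assms(1) by (simp add: approximates_def)
 then show "g k \<in> L2 (\<lambda>_. 1)" "g k \<in> L2 (inv_abs_weight V)" by auto
 show "(\<lambda>k. L2_sq (inv_abs_weight V) (\<lambda>x. g k x - f x)) \<longlonglongrightarrow> 0"
  using assms(1) g f weights_measurable(2) by (subst L2_norm_tendsto_0_iff[symmetric]) (auto simp: approximates_def intro: L2_sq_diff_finite[unfolded infinity_ennreal_def])
qed

lemma C_cmult_tendsto_0: "x \<longlonglongrightarrow> 0 \<Longrightarrow> (\<lambda>k. C * x k) \<longlonglongrightarrow> 0"
 using ennreal_tendsto_cmult[of C x 0] by (simp add: C_def)

lemma two_cmult_tendsto_0: "x \<longlonglongrightarrow> 0 \<Longrightarrow> (\<lambda>k. 2 * x k :: ennreal) \<longlonglongrightarrow> 0"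
 using ennreal_tendsto_cmult[of 2 x 0] by simp

text \<open>\<open>resolvent_limit\<close> quantifies over all approximating sequences, but one
  decides: the difference of two such sequences tends to 0 in the inverse weight, and
  \<open>resolvent_diff_bound\<close> carries this over to the resolvents.\<close>

lemma resolvent_limitI:
 fixes f u :: "real^'n \<Rightarrow> complex"
 assumes f: "f \<in> L2 (inv_abs_weight V)" and u: "u \<in> borel_measurable lebesgue" and g0: "approximates V g0 f"
  and lim: "(\<lambda>k. L2_sq (abs_weight V) (\<lambda>x. resolvent z (g0 k) x - u x)) \<longlonglongrightarrow> 0"
 shows "resolvent_limit V z f u"
proof -
 note [measurable] = weights_measurable u
 have fm[measurable]: "f \<in> borel_measurable lebesgue" using f by (simp add: L2_def)
 have RL: "resolvent z h \<in> L2 (abs_weight V)" if "h \<in> L2 (\<lambda>_. 1)" "h \<in> L2 (inv_abs_weight V)" for h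
 proof -
  have "L2_sq (abs_weight V) (resolvent z h) \<le> C * L2_sq (inv_abs_weight V) h"
   unfolding C_def by (rule resolvent_bound[OF n V z that(1)]) (use that(2) in \<open>simp add: L2_def\<close>)
  also have "\<dots> < \<infinity>" using that(2) by (simp add: L2_def C_def ennreal_mult_less_top)
  finally show ?thesis using resolvent_measurable[OF that(1)] by (simp add: L2_def)
 qed
 note g0D = approximatesD[OF g0 f]
 have uL: "u \<in> L2 (abs_weight V)"
 proof -
  have "\<forall>\<^sub>F k in sequentially. L2_sq (abs_weight V) (\<lambda>x. resolvent z (g0 k) x - u x) < 1"
   using lim by (rule order_tendstoD(2)) simp
  then obtain k where k: "L2_sq (abs_weight V) (\<lambda>x. resolvent z (g0 k) x - u x) < 1"
   by (auto simp: eventually_sequentially)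
  have "L2_sq (abs_weight V) (\<lambda>x. u x - 0) \<le> 2 * L2_sq (abs_weight V) (\<lambda>x. u x - resolvent z (g0 k) x) + 2 * L2_sq (abs_weight V) (\<lambda>x. resolvent z (g0 k) x - 0)"
   using resolvent_measurable[OF g0D(1)] by (intro L2_sq_triangle) auto
  also have "\<dots> < \<infinity>"
   using less_trans[OF k, of \<infinity>] RL[OF g0D(1,2), of k]
   by (simp add: L2_sq_minus_commute[of _ u] ennreal_mult_less_top L2_def)
  finally show ?thesis using u by (simp add: L2_def)
 qed
 have "(\<forall>k. resolvent z (g k) \<in> L2 (abs_weight V)) \<and> (\<lambda>k. L2_norm (abs_weight V) (\<lambda>x. resolvent z (g k) x - u x)) \<longlonglongrightarrow> 0"
  if g: "approximates V g f" for g
 proof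
  note gD = approximatesD[OF g f]
  show R: "\<forall>k. resolvent z (g k) \<in> L2 (abs_weight V)" using RL gD by blast
  have mg[measurable]: "g k \<in> borel_measurable lebesgue" "g0 k \<in> borel_measurable lebesgue" for k
   using gD(1) g0D(1) by (auto simp: L2_def)
  have "L2_sq (abs_weight V) (\<lambda>x. resolvent z (g k) x - u x) \<le>
   2 * (C * (2 * L2_sq (inv_abs_weight V) (\<lambda>x. g k x - f x) + 2 * L2_sq (inv_abs_weight V) (\<lambda>x. g0 k x - f x)))
   + 2 * L2_sq (abs_weight V) (\<lambda>x. resolvent z (g0 k) x - u x)" for k
  proof -
   have "L2_sq (abs_weight V) (\<lambda>x. resolvent z (g k) x - u x) \<le> 2 * L2_sq (abs_weight V) (\<lambda>x. resolvent z (g k) x - resolvent z (g0 k) x)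
     + 2 * L2_sq (abs_weight V) (\<lambda>x. resolvent z (g0 k) x - u x)"
    using resolvent_measurable[OF g0D(1)] resolvent_measurable[OF gD(1)] by (intro L2_sq_triangle) auto
   also have "L2_sq (abs_weight V) (\<lambda>x. resolvent z (g k) x - resolvent z (g0 k) x) \<le> C * L2_sq (inv_abs_weight V) (\<lambda>x. g k x - g0 k x)"
    unfolding C_def by (intro resolvent_diff_bound[OF n V z] gD g0D L2_sq_diff_finite weights_measurable)
   also have "L2_sq (inv_abs_weight V) (\<lambda>x. g k x - g0 k x) \<le> 2 * L2_sq (inv_abs_weight V) (\<lambda>x. g k x - f x) + 2 * L2_sq (inv_abs_weight V) (\<lambda>x. g0 k x - f x)"
    unfolding L2_sq_minus_commute[of _ "g0 k"] by (intro L2_sq_triangle) auto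
   finally show ?thesis by (simp add: mult_left_mono add_mono)
  qed
  moreover have "(\<lambda>k. 2 * (C * (2 * L2_sq (inv_abs_weight V) (\<lambda>x. g k x - f x) + 2 * L2_sq (inv_abs_weight V) (\<lambda>x. g0 k x - f x)))
   + 2 * L2_sq (abs_weight V) (\<lambda>x. resolvent z (g0 k) x - u x)) \<longlonglongrightarrow> 0"
   using tendsto_add[OF two_cmult_tendsto_0[OF C_cmult_tendsto_0[OF tendsto_add[OF two_cmult_tendsto_0[OF gD(3)] two_cmult_tendsto_0[OF g0D(3)], simplified]]] two_cmult_tendsto_0[OF lim]] by simp
  ultimately have "(\<lambda>k. L2_sq (abs_weight V) (\<lambda>x. resolvent z (g k) x - u x)) \<longlonglongrightarrow> 0"
   by (rule tendsto_sandwich[OF _ _ tendsto_const, rotated 1, OF always_eventually[OF allI]]) auto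
  then show "(\<lambda>k. L2_norm (abs_weight V) (\<lambda>x. resolvent z (g k) x - u x)) \<longlonglongrightarrow> 0"
   using R uL weights_measurable by (subst L2_norm_tendsto_0_iff) (auto intro: L2_sq_diff_finite[unfolded infinity_ennreal_def])
 qed
 then show ?thesis using uL g0 unfolding resolvent_limit_def by blast
qed

text \<open>Through \<open>resolvent_diff_bound\<close> the resolvents of an approximating sequence
  satisfy the Cauchy condition of \<open>L2_complete\<close>, with \<open>c k\<close> proportional
  to the distance of \<open>g k\<close> from \<open>f\<close>.\<close>

lemma resolvent_limit_exists:
 assumes f: "f \<in> L2 (inv_abs_weight V)"
 shows "\<exists>u. resolvent_limit V z f u"
proof -
 obtain g where g: "approximates V g f" using approximates_exists[OF S_class_measurable[OF V] f] by blast
 note gD = approximatesD[OF g f]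
 note [measurable] = weights_measurable
 have mg[measurable]: "g k \<in> borel_measurable lebesgue" "f \<in> borel_measurable lebesgue" for k
  using gD(1) f by (auto simp: L2_def)
 define c where "c k = C * (2 * L2_sq (inv_abs_weight V) (\<lambda>x. g k x - f x))" for k
 have c: "c \<longlonglongrightarrow> 0" unfolding c_def by (intro C_cmult_tendsto_0 two_cmult_tendsto_0 gD)
 have w: "abs_weight V = (\<lambda>x. ennreal (cmod (V x)))" by (simp add: abs_weight_def fun_eq_iff)
 have "L2_sq (\<lambda>x. ennreal (cmod (V x))) (\<lambda>x. resolvent z (g k) x - resolvent z (g l) x) \<le> c k + c l" for k l
 proof -
  have "L2_sq (abs_weight V) (\<lambda>x. resolvent z (g k) x - resolvent z (g l) x) \<le> C * L2_sq (inv_abs_weight V) (\<lambda>x. g k x - g l x)"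
   unfolding C_def by (intro resolvent_diff_bound[OF n V z] gD L2_sq_diff_finite weights_measurable)
  also have "\<dots> \<le> C * (2 * L2_sq (inv_abs_weight V) (\<lambda>x. g k x - f x) + 2 * L2_sq (inv_abs_weight V) (\<lambda>x. f x - g l x))"
   by (intro mult_left_mono L2_sq_triangle) auto
  finally show ?thesis by (simp add: w c_def distrib_left L2_sq_minus_commute[of _ f])
 qed
 then obtain u where u: "u \<in> borel_measurable lebesgue" "\<And>k. L2_sq (\<lambda>x. ennreal (cmod (V x))) (\<lambda>x. resolvent z (g k) x - u x) \<le> c k"
  using L2_complete[of "\<lambda>k. resolvent z (g k)" "\<lambda>x. cmod (V x)" c] c resolvent_measurable[OF gD(1)] S_class_measurable[OF V] by auto
 have "(\<lambda>k. L2_sq (abs_weight V) (\<lambda>x. resolvent z (g k) x - u x)) \<longlonglongrightarrow> 0"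
  using u(2) c by (intro tendsto_sandwich[OF _ _ tendsto_const c]) (auto simp: w)
 from resolvent_limitI[OF f u(1) g this] show ?thesis by blast
qed

text \<open>Consistency of the extension with the resolvent on L2, as the first branch of
  \<open>extended_resolvent\<close> requires.\<close>

lemma resolvent_limit_resolvent:
 assumes f: "f \<in> L2 (inv_abs_weight V)" "f \<in> L2 (\<lambda>_. 1)"
 shows "resolvent_limit V z f (resolvent z f)"
proof -
 obtain g where g: "approximates V g f" using approximates_exists[OF S_class_measurable[OF V] f(1)] by blast
 note gD = approximatesD[OF g f(1)]
 have "L2_sq (abs_weight V) (\<lambda>x. resolvent z (g k) x - resolvent z f x) \<le> C * L2_sq (inv_abs_weight V) (\<lambda>x. g k x - f x)" for k
  unfolding C_def by (intro resolvent_diff_bound[OF n V z] gD f L2_sq_diff_finite weights_measurable)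
 then have "(\<lambda>k. L2_sq (abs_weight V) (\<lambda>x. resolvent z (g k) x - resolvent z f x)) \<longlonglongrightarrow> 0"
  by (intro tendsto_sandwich[OF _ _ tendsto_const C_cmult_tendsto_0[OF gD(3)]]) auto
 from resolvent_limitI[OF f(1) resolvent_measurable[OF f(2)] g this] show ?thesis .
qed

lemma extended_resolvent_limit:
 "f \<in> L2 (inv_abs_weight V) \<Longrightarrow> resolvent_limit V z f (extended_resolvent V z f)"
 unfolding extended_resolvent_def using resolvent_limit_resolvent someI_ex[OF resolvent_limit_exists] by auto

text \<open>The truncations of \<open>approximates_exists\<close> have no larger norm than
  \<open>f\<close>, so the bound passes to the limit; \<open>sqrt 2\<close> stems from
  \<open>L2_sq_triangle\<close>.\<close>

lemma resolvent_limit_bound: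
 assumes f: "f \<in> L2 (inv_abs_weight V)" and u: "resolvent_limit V z f u"
 shows "L2_norm (abs_weight V) u \<le> sqrt 2 * resolvent_const TYPE('n) * S_norm V * L2_norm (inv_abs_weight V) f"
proof -
 define K where "K = resolvent_const TYPE('n) * S_norm V"
 have K: "0 \<le> K" by (simp add: K_def S_norm_def resolvent_const_nonneg)
 obtain g where g: "approximates V g f" and gle: "\<And>k. L2_sq (inv_abs_weight V) (g k) \<le> L2_sq (inv_abs_weight V) f"
  using approximates_exists[OF S_class_measurable[OF V] f] by blast
 note gD = approximatesD[OF g f]
 have R: "\<And>k. resolvent z (g k) \<in> L2 (abs_weight V)" and l: "(\<lambda>k. L2_norm (abs_weight V) (\<lambda>x. resolvent z (g k) x - u x)) \<longlonglongrightarrow> 0" and uL: "u \<in> L2 (abs_weight V)"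
  using u g unfolding resolvent_limit_def by auto
 have lim: "(\<lambda>k. L2_sq (abs_weight V) (\<lambda>x. resolvent z (g k) x - u x)) \<longlonglongrightarrow> 0"
  using l R uL weights_measurable by (subst L2_norm_tendsto_0_iff[symmetric]) (auto intro: L2_sq_diff_finite[unfolded infinity_ennreal_def])
 have le: "L2_sq (abs_weight V) u \<le> 2 * L2_sq (abs_weight V) (\<lambda>x. resolvent z (g k) x - u x) + 2 * (C * L2_sq (inv_abs_weight V) f)" for k
 proof -
  have "L2_sq (abs_weight V) (\<lambda>x. u x - 0) \<le> 2 * L2_sq (abs_weight V) (\<lambda>x. u x - resolvent z (g k) x) + 2 * L2_sq (abs_weight V) (\<lambda>x. resolvent z (g k) x - 0)"
   using uL weights_measurable resolvent_measurable[OF gD(1)] by (intro L2_sq_triangle) (auto simp: L2_def)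
  also have "L2_sq (abs_weight V) (\<lambda>x. resolvent z (g k) x - 0) \<le> C * L2_sq (inv_abs_weight V) (g k)"
   using resolvent_bound[OF n V z gD(1)] gD(2) by (simp add: C_def L2_def)
  also have "\<dots> \<le> C * L2_sq (inv_abs_weight V) f" by (intro mult_left_mono gle) simp
  finally show ?thesis by (simp add: mult_left_mono add_mono L2_sq_minus_commute[of _ u])
 qed
 have "(\<lambda>k. 2 * L2_sq (abs_weight V) (\<lambda>x. resolvent z (g k) x - u x) + 2 * (C * L2_sq (inv_abs_weight V) f)) \<longlonglongrightarrow> 0 + 2 * (C * L2_sq (inv_abs_weight V) f)"
  by (intro tendsto_add two_cmult_tendsto_0 lim tendsto_const)
 then have "L2_sq (abs_weight V) u \<le> 0 + 2 * (C * L2_sq (inv_abs_weight V) f)"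
  by (rule tendsto_lowerbound) (use le in auto)
 then have sq: "L2_sq (abs_weight V) u \<le> 2 * (C * L2_sq (inv_abs_weight V) f)" by simp
 obtain I where I: "L2_sq (inv_abs_weight V) f = ennreal I" "0 \<le> I" using f by (cases "L2_sq (inv_abs_weight V) f") (auto simp: L2_def)
 have "L2_sq (abs_weight V) u \<le> ennreal (2 * (K^2 * I))" using sq I by (simp add: C_def K_def[symmetric] ennreal_mult)
 then have "enn2real (L2_sq (abs_weight V) u) \<le> 2 * (K^2 * I)" using I by (intro enn2real_leI) auto
 then have "L2_norm (abs_weight V) u \<le> sqrt (2 * (K^2 * I))" unfolding L2_norm_def by (rule real_sqrt_le_mono)
 also have "\<dots> = sqrt 2 * (K * sqrt I)" using K by (simp add: real_sqrt_mult)
 finally show ?thesis using I by (simp add: K_def L2_norm_def mult_ac)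
qed

end

theorem theorem2p2:
  assumes "CARD('n::finite) \<ge> 3"
  shows "\<exists>C::real. \<forall>V \<in> (S_class :: (real^'n \<Rightarrow> complex) set). \<forall>z. z \<notin> \<real> \<longrightarrow>
           (\<forall>f \<in> L2 (inv_abs_weight V).
              resolvent_limit V z f (extended_resolvent V z f) \<and>
              L2_norm (abs_weight V) (extended_resolvent V z f)
                \<le> C * S_norm V * L2_norm (inv_abs_weight V) f)"
  using extended_resolvent_limit[OF assms _ _ refl] resolvent_limit_bound[OF assms _ _ refl]
  by (intro exI[of _ "sqrt 2 * resolvent_const TYPE('n)"] ballI allI impI conjI) auto

end
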